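(* Let $n\ge 1$ be an integer, let $A$ be the minimal symmetric operator generated in $L^2(0,\infty)$ by the differential expression $l(y)=(-1)^n y^{(2n)}$, and let $A_F$ be its Friedrichs extension. Put $\alpha=\frac{\pi}{2n}$, $C_0:=1$, $C_k:=\prod_{p=1}^{k}\cot(p\alpha)$ for $k\in\{1,\dots,n-1\}$, and for $\lambda=re^{i\varphi}$ with $r>0$, $0<\varphi<\pi$, put $\sqrt[2n]{-\lambda}:=\sqrt[2n]{r}\, e^{\frac{i(\varphi-\pi)}{2n}}$. Let $\Gamma_0,\Gamma_1:\mathrm{dom}(A^* )\to\mathbb{C}^n$ be $$\Gamma_0 y:=\big(y^{(n-1)}(0),\dots,y'(0),y(0)\big)^{T},\qquad \Gamma_1 y:=\big(y^{(n)}(0),-y^{(n+1)}(0),\dots,(-1)^{n-1}y^{(2n-1)}(0)\big)^{T}.$$ Then the characteristic matrix $M_F(\lambda)$ of $A_F$, i.e. the Weyl function of $A$ corresponding to the boundary triplet $\{\mathbb{C}^n,\Gamma_0,\Gamma_1\}$, is $$M_F(\lambda)=\left(\frac{-C_j C_k}{\sin((j+k+1)\alpha)}\left(\sqrt[2n]{-\lambda}\right)^{j+k+1}\right)_{j,k=0}^{n-1},\qquad \mathrm{Im}\,\lambda>0,$$ and the corresponding spectral function (the spectral function of $M_F$) is $$\sigma_F(t)=\frac{2n}{\pi}\left(\frac{C_jC_k}{2n+1+j+k}\,t^{\frac{2n+1+j+k}{2n}}\right)_{j,k=0}^{n-1}\ \text{ for } t\ge 0,\qquad \sigma_F(t)=0\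 \text{ for } t<0.$$
   Context: Minimal operator. $A$ is the closure in $L^2(0,\infty)$ of the operator $y\mapsto(-1)^n y^{(2n)}$ defined on $C_c^\infty(0,\infty)$. It is a closed, densely defined, nonnegative symmetric operator with deficiency indices $(n,n)$. Its adjoint $A^*$ is given by $A^*y=(-1)^n y^{(2n)}$ on $\mathrm{dom}(A^* )=W^{2n,2}(0,\infty)$. Friedrichs extension. $A_F$ is the Friedrichs ("hard") extension of the nonnegative operator $A$; it is well known that it is the restriction of $A^*$ to the functions $y\in\mathrm{dom}(A^* )$ with $y(0)=y'(0)=\dots=y^{(n-1)}(0)=0$. Boundary triplet. A triplet $\{\mathcal H,\Gamma_0,\Gamma_1\}$, with $\mathcal H$ a Hilbert space and $\Gamma_0,\Gamma_1:\mathrm{dom}(A^* )\to\mathcal H$ linear, is a boundary triplet for $A^*$ if (i) $(A^*f,g)-(f,A^*g)=(\Gamma_1f,\Gamma_0g)-(\Gamma_0f,\Gamma_1g)$ for all $f,g\in\mathrm{dom}(A^* )$, and (ii) $f\mapsto\{\Gamma_0f,\Gamma_1f\}$ maps $\mathrm{dom}(A^* )$ onto $\mathcal H\oplus\mathcal H$. It corresponds to a self-adjoint extension $\widetilde A$ of $A$ if $\mathrm{dom}(\widetilde A)=\ker\Gamma_0$. The triplet $\{\mathbb{C}^n,\Gamma_0,\Gamma_1\}$ with $\Gamma_0 y=\big(y^{(n-1)}(0),\dots,y'(0),y(0)\big)^{T}$ and $\Gamma_1 y=\big(y^{(n)}(0),-y^{(n+1)}(0),\dots,(-1)^{n-1}y^{(2n-1)}(0)\big)^{T}$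 is a boundary triplet for $A^*$ (a known fact) and corresponds to $A_F$. Weyl function. With $A_0:=A^*\upharpoonright\ker\Gamma_0$, the Weyl function is the unique map $M:\rho(A_0)\to[\mathcal H]$ (bounded operators on $\mathcal H$) such that $\Gamma_1f_z=M(z)\Gamma_0f_z$ for all $f_z\in\ker(A^*-zI)$, $z\in\rho(A_0)$. The characteristic matrix of $A_F$ is identified with the Weyl function of the boundary triplet $\{\mathbb{C}^n,\Gamma_0,\Gamma_1\}$ with $\Gamma_0 y=\big(y^{(n-1)}(0),\dots,y'(0),y(0)\big)^{T}$ and $\Gamma_1 y=\big(y^{(n)}(0),-y^{(n+1)}(0),\dots,(-1)^{n-1}y^{(2n-1)}(0)\big)^{T}$. Spectral function. An $n\times n$ matrix function $F$ holomorphic in $\mathbb{C}_+=\{\mathrm{Im}\,z>0\}$ with $\mathrm{Im}\,F(z):=\frac{1}{2i}(F(z)-F(z)^* )\ge0$ (an $R$-function) admits a representation $$F(z)=P+zQ+\int_{-\infty}^{+\infty}\Big(\frac1{t-z}-\frac{t}{1+t^2}\Big)d\sigma(t),\quad z\in\mathbb{C}_+,$$ with self-adjoint matrices $P,Q\in\mathbb{C}^{n\times n}$, $Q\ge0$, and a non-decreasing left-continuous self-adjoint $n\times n$ matrix function $\sigma$ such that $\int_{-\infty}^{+\infty}\frac{d\sigma(t)}{1+t^2}$ converges. $\sigma$ is called the spectral function of $F$; it is determined up to an additive constant matrix, and is normalized here by $\sigma(0)=0$. The Weyl function is an $R$-function. Matrix rows and columns are indexed by $j,k\in\{0,\dots,n-1\}$.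 *)

theory Defs
  imports "HOL-Analysis.Analysis" "Jordan_Normal_Form.Schur_Decomposition"
begin

section \<open>The space of square-integrable functions on the half-line\<close>

text \<open>
  Elements of the Hilbert space are represented by functions \<open>real \<Rightarrow> complex\<close>; only their values
  on \<open>{0<..}\<close> matter, and functions that agree almost everywhere there represent the same element.
\<close>

abbreviation halfline :: "real measure" where
  "halfline \<equiv> lebesgue_on {0<..}"

definition L2_halfline :: "(real \<Rightarrow> complex) set" where
  "L2_halfline = {f. f \<in> borel_measurable halfline \<and> integrable halfline (\<lambda>x. (cmod (f x))\<^sup>2)}"

definition L2_inner :: "(real \<Rightarrow> complex) \<Rightarrow> (real \<Rightarrow> complex) \<Rightarrow> complex" where
  "L2_inner f g = (LINT x|halfline. f x * cnj (g x))"

definition L2_norm :: "(real \<Rightarrow> complex) \<Rightarrow> real" where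
  "L2_norm f = sqrt (LINT x|halfline. (cmod (f x))\<^sup>2)"

definition L2_tendsto :: "(nat \<Rightarrow> real \<Rightarrow> complex) \<Rightarrow> (real \<Rightarrow> complex) \<Rightarrow> bool" where
  "L2_tendsto F f \<longleftrightarrow> (\<lambda>m. L2_norm (\<lambda>x. F m x - f x)) \<longlonglongrightarrow> 0"


section \<open>Unbounded operators, given by their graphs\<close>

type_synonym operator = "((real \<Rightarrow> complex) \<times> (real \<Rightarrow> complex)) set"

definition op_closure :: "operator \<Rightarrow> operator" where
  "op_closure T = {(f, g). f \<in> L2_halfline \<and> g \<in> L2_halfline \<and>
     (\<exists>F G. (\<forall>m. (F m, G m) \<in> T) \<and> L2_tendsto F f \<and> L2_tendsto G g)}"

definition op_adjoint :: "operator \<Rightarrow> operator" where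
  "op_adjoint T = {(g, h). g \<in> L2_halfline \<and> h \<in> L2_halfline \<and>
     (\<forall>(f, f') \<in> T. L2_inner f' g = L2_inner f h)}"

definition op_restrict :: "operator \<Rightarrow> (real \<Rightarrow> complex) set \<Rightarrow> operator" where
  "op_restrict T X = {(f, g) \<in> T. f \<in> X}"

text \<open>
  \<open>T - z\<close> maps the domain of \<open>T\<close> onto the whole space, and its inverse is bounded; injectivity
  modulo null sets is contained in the estimate.
\<close>

definition resolvent_set :: "operator \<Rightarrow> complex set" where
  "resolvent_set T = {z.
     (\<forall>h \<in> L2_halfline. \<exists>(f, g) \<in> T. AE x in halfline. g x - z * f x = h x) \<and>
     (\<exists>c. \<forall>(f, g) \<in> T. L2_norm f \<le> c * L2_norm (\<lambda>x. g x - z * f x))}"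

text \<open>
  The Friedrichs extension of a nonnegative symmetric operator: the restriction of the adjoint to
  those \<open>f\<close> that are limits of sequences in the domain of \<open>T\<close> that are Cauchy sequences with
  respect to the quadratic form \<open>(Tf, f)\<close>.
\<close>

definition friedrichs_extension :: "operator \<Rightarrow> operator" where
  "friedrichs_extension T = op_restrict (op_adjoint T)
     {f. \<exists>F G. (\<forall>m. (F m, G m) \<in> T) \<and> L2_tendsto F f \<and>
        (\<forall>\<epsilon>>0. \<exists>N. \<forall>m\<ge>N. \<forall>k\<ge>N.
           cmod (L2_inner (\<lambda>x. G m x - G k x) (\<lambda>x. F m x - F k x)) < \<epsilon>)}"


section \<open>The minimal operator\<close>

definition vderiv :: "(real \<Rightarrow> complex) \<Rightarrow> real \<Rightarrow> complex" where
  "vderiv f = (\<lambda>x. vector_derivative f (at x))"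

text \<open>Smooth functions with compact support in \<open>(0, \<infinity>)\<close>, extended by zero to the real line.\<close>

definition test_functions :: "(real \<Rightarrow> complex) set" where
  "test_functions = {\<phi>. (\<forall>k x. (vderiv ^^ k) \<phi> differentiable at x) \<and>
     (\<exists>a b. 0 < a \<and> (\<forall>x. x \<notin> {a..b} \<longrightarrow> \<phi> x = 0))}"

definition minimal_operator :: "nat \<Rightarrow> operator" where
  "minimal_operator n = op_closure
     {(\<phi>, \<lambda>x. (-1) ^ n * (vderiv ^^ (2 * n)) \<phi> x) | \<phi>. \<phi> \<in> test_functions}"

text \<open>
  The boundary value \<open>y\<^sup>(\<^sup>k\<^sup>)(0)\<close> of a class of functions is the one of its representative \<open>u 0\<close> that
  is \<open>k\<close> times continuously differentiable on \<open>[0, \<infinity>)\<close>, with derivatives \<open>u 1, \<dots>, u k\<close>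
  (one-sided at \<open>0\<close>).
\<close>

definition derivs_of_repr :: "nat \<Rightarrow> (real \<Rightarrow> complex) \<Rightarrow> (nat \<Rightarrow> real \<Rightarrow> complex) \<Rightarrow> bool" where
  "derivs_of_repr k y u \<longleftrightarrow>
     (AE x in halfline. y x = u 0 x) \<and>
     (\<forall>i<k. \<forall>x\<ge>0. (u i has_vector_derivative u (Suc i) x) (at x within {0..})) \<and>
     continuous_on {0..} (u k)"

definition deriv_at_0 :: "nat \<Rightarrow> (real \<Rightarrow> complex) \<Rightarrow> complex" where
  "deriv_at_0 k y = (THE c. \<exists>u. derivs_of_repr k y u \<and> u k 0 = c)"

definition Gamma0 :: "nat \<Rightarrow> (real \<Rightarrow> complex) \<Rightarrow> complex vec" where
  "Gamma0 n y = vec n (\<lambda>j. deriv_at_0 (n - 1 - j) y)"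

definition Gamma1 :: "nat \<Rightarrow> (real \<Rightarrow> complex) \<Rightarrow> complex vec" where
  "Gamma1 n y = vec n (\<lambda>j. (-1) ^ j * deriv_at_0 (n + j) y)"


section \<open>Boundary triplets and Weyl functions\<close>

text \<open>
  Boundary triplets with boundary space \<open>\<complex>\<^sup>n\<close> for the adjoint of a symmetric operator \<open>T\<close>.
\<close>

definition boundary_triplet ::
  "operator \<Rightarrow> nat \<Rightarrow> ((real \<Rightarrow> complex) \<Rightarrow> complex vec) \<Rightarrow> ((real \<Rightarrow> complex) \<Rightarrow> complex vec) \<Rightarrow> bool"
where
  "boundary_triplet T n \<Gamma>0 \<Gamma>1 \<longleftrightarrow>
     (\<forall>\<Gamma> \<in> {\<Gamma>0, \<Gamma>1}.
        (\<forall>f \<in> Domain (op_adjoint T). \<Gamma> f \<in> carrier_vec n) \<and>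
        (\<forall>f \<in> Domain (op_adjoint T). \<forall>g \<in> Domain (op_adjoint T). \<forall>a b.
           \<Gamma> (\<lambda>x. a * f x + b * g x) = a \<cdot>\<^sub>v \<Gamma> f + b \<cdot>\<^sub>v \<Gamma> g)) \<and>
     (\<forall>(f, f') \<in> op_adjoint T. \<forall>(g, g') \<in> op_adjoint T.
        L2_inner f' g - L2_inner f g' = \<Gamma>1 f \<bullet>c \<Gamma>0 g - \<Gamma>0 f \<bullet>c \<Gamma>1 g) \<and>
     (\<forall>u \<in> carrier_vec n. \<forall>v \<in> carrier_vec n.
        \<exists>f \<in> Domain (op_adjoint T). \<Gamma>0 f = u \<and> \<Gamma>1 f = v)"

text \<open>The triplet with first map \<open>\<Gamma>0\<close> corresponds to the self-adjoint extension \<open>B\<close> of \<open>T\<close>.\<close>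

definition corresponds_to ::
  "operator \<Rightarrow> nat \<Rightarrow> ((real \<Rightarrow> complex) \<Rightarrow> complex vec) \<Rightarrow> operator \<Rightarrow> bool"
where
  "corresponds_to T n \<Gamma>0 B \<longleftrightarrow> op_adjoint B = B \<and> T \<subseteq> B \<and>
     Domain B = {f \<in> Domain (op_adjoint T). \<Gamma>0 f = 0\<^sub>v n}"

text \<open>
  Outside the resolvent set the value is left unspecified, so any concrete equation for
  \<open>weyl_function T n \<Gamma>0 \<Gamma>1 z\<close> includes that \<open>z\<close> belongs to the resolvent set.
\<close>

definition weyl_function ::
  "operator \<Rightarrow> nat \<Rightarrow> ((real \<Rightarrow> complex) \<Rightarrow> complex vec) \<Rightarrow> ((real \<Rightarrow> complex) \<Rightarrow> complex vec) \<Rightarrow>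
   complex \<Rightarrow> complex mat"
where
  "weyl_function T n \<Gamma>0 \<Gamma>1 =
     (\<lambda>z \<in> resolvent_set (op_restrict (op_adjoint T) {f. \<Gamma>0 f = 0\<^sub>v n}).
        THE M. M \<in> carrier_mat n n \<and>
          (\<forall>f. (f, \<lambda>x. z * f x) \<in> op_adjoint T \<longrightarrow> \<Gamma>1 f = M *\<^sub>v \<Gamma>0 f))"


section \<open>Matrix-valued R-functions and spectral functions\<close>

text \<open>
  In \<open>complex\<close>, \<open>0 \<le> c\<close> means that \<open>c\<close> is real and nonnegative.
\<close>

definition nonneg_mat :: "nat \<Rightarrow> complex mat \<Rightarrow> bool" where
  "nonneg_mat n A \<longleftrightarrow> A \<in> carrier_mat n n \<and> (\<forall>v \<in> carrier_vec n. 0 \<le> (A *\<^sub>v v) \<bullet>c v)"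

definition R_function :: "nat \<Rightarrow> (complex \<Rightarrow> complex mat) \<Rightarrow> bool" where
  "R_function n F \<longleftrightarrow>
     (\<forall>z. Im z > 0 \<longrightarrow> F z \<in> carrier_mat n n \<and>
        nonneg_mat n ((1 / (2 * \<i>)) \<cdot>\<^sub>m (F z - mat_adjoint (F z)))) \<and>
     (\<forall>j<n. \<forall>k<n. (\<lambda>z. F z $$ (j, k)) holomorphic_on {z. Im z > 0})"

text \<open>
  Riemann--Stieltjes integrals: Riemann--Stieltjes sums over tagged divisions whose mesh
  tends to zero.
\<close>

definition has_RS_integral ::
  "(real \<Rightarrow> complex) \<Rightarrow> (real \<Rightarrow> complex) \<Rightarrow> complex \<Rightarrow> real \<Rightarrow> real \<Rightarrow> bool"
where
  "has_RS_integral f s I a b \<longleftrightarrow>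
     (\<forall>\<epsilon>>0. \<exists>\<delta>>0. \<forall>p. p tagged_division_of {a..b} \<and> (\<lambda>x. ball x \<delta>) fine p \<longrightarrow>
        cmod ((\<Sum>(x, K) \<in> p. f x * (s (Sup K) - s (Inf K))) - I) < \<epsilon>)"

definition has_RS_integral_real_line ::
  "(real \<Rightarrow> complex) \<Rightarrow> (real \<Rightarrow> complex) \<Rightarrow> complex \<Rightarrow> bool"
where
  "has_RS_integral_real_line f s I \<longleftrightarrow>
     (\<exists>J. (\<forall>a b. a \<le> b \<longrightarrow> has_RS_integral f s (J a b) a b) \<and>
        ((\<lambda>(a, b). J a b) \<longlongrightarrow> I) (at_bot \<times>\<^sub>F at_top))"

definition has_mat_RS_integral ::
  "nat \<Rightarrow> (real \<Rightarrow> complex) \<Rightarrow> (real \<Rightarrow> complex mat) \<Rightarrow> complex mat \<Rightarrow> bool"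
where
  "has_mat_RS_integral n f \<sigma> S \<longleftrightarrow> S \<in> carrier_mat n n \<and>
     (\<forall>j<n. \<forall>k<n. has_RS_integral_real_line f (\<lambda>t. \<sigma> t $$ (j, k)) (S $$ (j, k)))"

definition spectral_function ::
  "nat \<Rightarrow> (complex \<Rightarrow> complex mat) \<Rightarrow> (real \<Rightarrow> complex mat) \<Rightarrow> bool"
where
  "spectral_function n F \<sigma> \<longleftrightarrow> R_function n F \<and>
     (\<forall>t. \<sigma> t \<in> carrier_mat n n \<and> mat_adjoint (\<sigma> t) = \<sigma> t) \<and>
     (\<forall>s t. s \<le> t \<longrightarrow> nonneg_mat n (\<sigma> t - \<sigma> s)) \<and>
     (\<forall>t. \<forall>j<n. \<forall>k<n. continuous (at_left t) (\<lambda>s. \<sigma> s $$ (j, k))) \<and>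
     \<sigma> 0 = 0\<^sub>m n n \<and>
     (\<exists>S. has_mat_RS_integral n (\<lambda>t. 1 / (1 + complex_of_real t ^ 2)) \<sigma> S) \<and>
     (\<exists>P Q. P \<in> carrier_mat n n \<and> mat_adjoint P = P \<and>
        Q \<in> carrier_mat n n \<and> mat_adjoint Q = Q \<and> nonneg_mat n Q \<and>
        (\<forall>z. Im z > 0 \<longrightarrow>
           (\<exists>S. has_mat_RS_integral n
                  (\<lambda>t. 1 / (complex_of_real t - z) - complex_of_real t / (1 + complex_of_real t ^ 2)) \<sigma> S \<and>
                F z = P + z \<cdot>\<^sub>m Q + S)))"


section \<open>The constants\<close>

definition alpha :: "nat \<Rightarrow> real" where
  "alpha n = pi / (2 * real n)"

definition cot_prod :: "nat \<Rightarrow> nat \<Rightarrow> real" where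
  "cot_prod n k = (\<Prod>p = 1..k. cot (real p * alpha n))"

end

theory Submission
  imports Defs
begin

text \<open>
  A pair \<open>(g, h)\<close> in the graph of the adjoint has a weak derivative of order \<open>2 n\<close>, hence a representative
  with a chain of locally absolutely continuous derivatives; these derivatives are square-integrable
  and tend to zero, which gives Green's formula and the boundary triplet. The form of the minimal
  operator is the squared norm of the \<open>n\<close>-th derivative. Convergence in it preserves the vanishing of
  the first \<open>n\<close> boundary values, and every function with these boundary values is approximated by test
  functions, so that the Friedrichs extension is the Dirichlet realisation.

  For nonreal \<open>z\<close> the solutions of \<open>(-1)\<^sup>n y\<^sup>(\<^sup>2\<^sup>n\<^sup>) = z y\<close> in the half-line space are spanned by the decaying exponentials
  \<open>exp (\<rho> x)\<close>, and the sum over all \<open>2 n\<close> roots of the solutions of \<open>g' = \<rho> g + h\<close>, corrected by these exponentials, is the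
  resolvent. The formula for the Weyl function becomes an identity for products of cotangents, equivalent
  to the vanishing at \<open>q, \<dots>, q\<^sup>n\<close> of a \<open>q\<close>-binomial polynomial with \<open>q = cis (2 \<alpha>)\<close>. The spectral
  function is read off from the Stieltjes transform of \<open>t powr (\<gamma> - 1)\<close>, where \<open>\<gamma> = (j + k + 1) / (2 n)\<close>.
\<close>

section \<open>Square-integrable functions\<close>

text \<open>The adjoint is given abstractly, by testing against \<open>test_functions\<close>, so
  its domain has to be reconstructed before any boundary value exists. One device recurs: pairing a
  chain of derivatives with a smooth function that has a single nonzero derivative at the end point
  isolates one boundary value. On unit intervals this bounds the intermediate derivatives by the
  first and the last one; on intervals of length \<epsilon> it forces the boundary values of form
  limits to vanish.

  Why cotangents: on \<open>exp (\<rho> x)\<close> both boundary maps give vectors of powers of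
  \<rho>, so the Weyl function is fixed by n linear equations for each of its rows, one per root in
  the left half-plane. Instead of inverting a Vandermonde matrix, the claimed matrix is inserted;
  all powers of \<rho> cancel and a root survives only through its angle. A cotangent is, up to the
  factor i, a quotient (1 + q^p) / (1 - q^p).

  The density of the spectral function is a power of t times a rank one matrix, whence its
  monotonicity; the Weyl function grows more slowly than z, whence Q = 0.\<close>

lemma integrable_halfline_iff:
  "integrable halfline f \<longleftrightarrow> f absolutely_integrable_on {0<..}"
  by (simp add: set_integrable_def integrable_restrict_space)

lemma AE_halfline_iff: "(AE x in halfline. P x) \<longleftrightarrow> (AE x in lebesgue. 0 < x \<longrightarrow> P x)"
  by (simp add: AE_restrict_space_iff)

lemma AE_halflineI: "(\<And>x. 0 < x \<Longrightarrow> P x) \<Longrightarrow> AE x in halfline. P x"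
  by (simp add: AE_halfline_iff)

lemma borel_measurable_cnj [measurable]:
  "f \<in> borel_measurable M \<Longrightarrow> (\<lambda>x. cnj (f x)) \<in> borel_measurable M"
  by (rule measurable_compose[OF _ borel_measurable_continuous_onI]) (auto intro: continuous_intros)

lemma integrable_mult_of_square_integrable:
  fixes f g :: "'a \<Rightarrow> complex"
  assumes [measurable]: "f \<in> borel_measurable M" "g \<in> borel_measurable M"
    and f: "integrable M (\<lambda>x. (cmod (f x))\<^sup>2)" and g: "integrable M (\<lambda>x. (cmod (g x))\<^sup>2)"
  shows "integrable M (\<lambda>x. f x * g x)"
proof (rule Bochner_Integration.integrable_bound)
  show "integrable M (\<lambda>x. (cmod (f x))\<^sup>2 + (cmod (g x))\<^sup>2)"
    using f g by simp
  have "cmod (f x) * cmod (g x) \<le> (cmod (f x))\<^sup>2 + (cmod (g x))\<^sup>2" for x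
  proof -
    have "0 \<le> (cmod (f x) - cmod (g x))\<^sup>2" "0 \<le> cmod (f x) * cmod (g x)" by auto
    then show ?thesis unfolding power2_diff by linarith
  qed
  then show "AE x in M. norm (f x * g x) \<le> norm ((cmod (f x))\<^sup>2 + (cmod (g x))\<^sup>2)"
    by (simp add: norm_mult)
qed simp

lemma Cauchy_Schwarz_integral:
  fixes f g :: "'a \<Rightarrow> complex"
  assumes [measurable]: "f \<in> borel_measurable M" "g \<in> borel_measurable M"
    and f: "integrable M (\<lambda>x. (cmod (f x))\<^sup>2)" and g: "integrable M (\<lambda>x. (cmod (g x))\<^sup>2)"
  shows "(LINT x|M. cmod (f x) * cmod (g x)) \<le>
    sqrt (LINT x|M. (cmod (f x))\<^sup>2) * sqrt (LINT x|M. (cmod (g x))\<^sup>2)"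
proof -
  define a where "a = sqrt (LINT x|M. (cmod (f x))\<^sup>2)"
  define b where "b = sqrt (LINT x|M. (cmod (g x))\<^sup>2)"
  have a: "a \<ge> 0" "(LINT x|M. (cmod (f x))\<^sup>2) = a\<^sup>2" and b: "b \<ge> 0" "(LINT x|M. (cmod (g x))\<^sup>2) = b\<^sup>2"
    by (simp_all add: a_def b_def)
  have int: "integrable M (\<lambda>x. cmod (f x) * cmod (g x))"
    using integrable_norm[OF integrable_mult_of_square_integrable[OF assms]] by (simp add: norm_mult)
  have *: "(LINT x|M. cmod (f x) * cmod (g x)) \<le> (a + e) * (b + e)" if e: "e > 0" for e
  proof -
    \<comment> \<open>The weight that makes \<open>a b <= s/2 a^2 + b^2/(2 s)\<close> sharp is the
      ratio of the two norms; adding \<open>e > 0\<close> to both keeps it defined when a norm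
      vanishes, and e tends to 0 at the end.\<close>
    define s where "s = (b + e) / (a + e)"
    have s: "s > 0" using a b e by (simp add: s_def)
    have "(LINT x|M. cmod (f x) * cmod (g x)) \<le>
        (LINT x|M. s / 2 * (cmod (f x))\<^sup>2 + 1 / (2 * s) * (cmod (g x))\<^sup>2)"
    proof (intro Bochner_Integration.integral_mono)
      fix x
      have "0 \<le> (s * cmod (f x) - cmod (g x))\<^sup>2 / (2 * s)"
        using s by simp
      also have "\<dots> = s / 2 * (cmod (f x))\<^sup>2 + 1 / (2 * s) * (cmod (g x))\<^sup>2 - cmod (f x) * cmod (g x)"
        using s by (simp add: power2_diff field_simps power2_eq_square)
      finally show "cmod (f x) * cmod (g x) \<le> s / 2 * (cmod (f x))\<^sup>2 + 1 / (2 * s) * (cmod (g x))\<^sup>2"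
        by simp
    qed (use int f g in auto)
    also have "\<dots> = s / 2 * a\<^sup>2 + 1 / (2 * s) * b\<^sup>2"
      using f g a b by simp
    also have "\<dots> \<le> s / 2 * (a + e)\<^sup>2 + 1 / (2 * s) * (b + e)\<^sup>2"
      using a b e s by (intro add_mono mult_left_mono power_mono) auto
    also have "\<dots> = (a + e) * (b + e)"
    proof -
      have "a + e \<noteq> 0" "b + e \<noteq> 0" using a b e by auto
      then show ?thesis unfolding s_def power2_eq_square by (simp add: divide_simps) (simp add: algebra_simps)
    qed
    finally show ?thesis .
  qed
  have "((\<lambda>e. (a + e) * (b + e)) \<longlongrightarrow> (a + 0) * (b + 0)) (at_right 0)"
    by (intro tendsto_intros)
  then have "(LINT x|M. cmod (f x) * cmod (g x)) \<le> (a + 0) * (b + 0)"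
    by (rule tendsto_lowerbound) (auto simp: eventually_at_right_less intro!: eventually_mono[OF eventually_at_right_less] *)
  then show ?thesis
    by (simp add: a_def b_def)
qed

section \<open>The space \<open>L2_halfline\<close>: linear structure, inner product and
  norm\<close>

lemma L2_halflineD:
  assumes "f \<in> L2_halfline"
  shows "f \<in> borel_measurable halfline" "integrable halfline (\<lambda>x. (cmod (f x))\<^sup>2)"
  using assms by (auto simp: L2_halfline_def)

lemma L2_mult_integrable:
  assumes "f \<in> L2_halfline" "g \<in> L2_halfline"
  shows "integrable halfline (\<lambda>x. f x * g x)"
  by (rule integrable_mult_of_square_integrable) (use assms in \<open>simp_all add: L2_halflineD\<close>)

lemma L2_cnj: "f \<in> L2_halfline \<Longrightarrow> (\<lambda>x. cnj (f x)) \<in> L2_halfline"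
  by (auto simp: L2_halfline_def)

lemma L2_inner_integrable:
  assumes "f \<in> L2_halfline" "g \<in> L2_halfline"
  shows "integrable halfline (\<lambda>x. f x * cnj (g x))"
  by (rule L2_mult_integrable) (simp_all add: assms L2_cnj)

lemma L2_cmult: "f \<in> L2_halfline \<Longrightarrow> (\<lambda>x. c * f x) \<in> L2_halfline"
  by (auto simp: L2_halfline_def norm_mult power_mult_distrib)

lemma L2_add:
  assumes "f \<in> L2_halfline" "g \<in> L2_halfline"
  shows "(\<lambda>x. f x + g x) \<in> L2_halfline"
proof -
  have [measurable]: "f \<in> borel_measurable halfline" "g \<in> borel_measurable halfline"
    using assms by (simp_all add: L2_halflineD)
  have "(cmod (f x + g x))\<^sup>2 \<le> 2 * (cmod (f x))\<^sup>2 + 2 * (cmod (g x))\<^sup>2" for x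
  proof -
    have "(cmod (f x + g x))\<^sup>2 \<le> (cmod (f x) + cmod (g x))\<^sup>2"
      by (intro power_mono norm_triangle_ineq) auto
    moreover have "0 \<le> (cmod (f x) - cmod (g x))\<^sup>2" by simp
    ultimately show ?thesis by (simp add: power2_sum power2_diff)
  qed
  then have bd: "AE x in halfline. norm ((cmod (f x + g x))\<^sup>2) \<le> norm (2 * (cmod (f x))\<^sup>2 + 2 * (cmod (g x))\<^sup>2)"
    by (intro AE_I2) simp
  have "integrable halfline (\<lambda>x. (cmod (f x + g x))\<^sup>2)"
  proof (rule Bochner_Integration.integrable_bound[OF _ _ bd])
    show "integrable halfline (\<lambda>x. 2 * (cmod (f x))\<^sup>2 + 2 * (cmod (g x))\<^sup>2)"
      using L2_halflineD(2)[OF assms(1)] L2_halflineD(2)[OF assms(2)] by simp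
    show "(\<lambda>x. (cmod (f x + g x))\<^sup>2) \<in> borel_measurable halfline"
      by measurable
  qed
  moreover have "(\<lambda>x. f x + g x) \<in> borel_measurable halfline" by measurable
  ultimately show ?thesis unfolding L2_halfline_def by blast
qed

lemma L2_diff: "f \<in> L2_halfline \<Longrightarrow> g \<in> L2_halfline \<Longrightarrow> (\<lambda>x. f x - g x) \<in> L2_halfline"
  using L2_add[of f "\<lambda>x. (-1) * g x"] L2_cmult[of g "-1"] by simp

lemma L2_zero: "(\<lambda>x. 0) \<in> L2_halfline"
  by (simp add: L2_halfline_def)

lemma L2_sum: "(\<And>i. i \<in> I \<Longrightarrow> f i \<in> L2_halfline) \<Longrightarrow> (\<lambda>x. \<Sum>i\<in>I. f i x) \<in> L2_halfline"
  by (induction I rule: infinite_finite_induct) (auto intro: L2_zero L2_add)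

text \<open>Lebesgue measure is complete, so measurability survives a change on a null set. This is
  what allows a class to be replaced by its regular representative.\<close>

lemma L2_AE_cong:
  assumes "f \<in> L2_halfline" "AE x in halfline. f x = g x"
  shows "g \<in> L2_halfline"
proof -
  have "g \<in> borel_measurable halfline"
  proof -
    have "f \<in> borel_measurable halfline" using assms by (simp add: L2_halflineD)
    then have "(\<lambda>x. indicator {0<..} x *\<^sub>R f x) \<in> borel_measurable lebesgue"
      by (simp add: borel_measurable_restrict_space_iff)
    moreover have "AE x in lebesgue. indicator {0<..} x *\<^sub>R f x = indicator {0<..} x *\<^sub>R g x"
      using assms(2) unfolding AE_halfline_iff by eventually_elim (auto simp: indicator_def)
    ultimately have "(\<lambda>x. indicator {0<..} x *\<^sub>R g x) \<in> borel_measurable lebesgue"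
      by (rule borel_measurable_AE)
    then show ?thesis
      by (simp add: borel_measurable_restrict_space_iff)
  qed
  moreover have "integrable halfline (\<lambda>x. (cmod (g x))\<^sup>2)"
    using assms \<open>g \<in> borel_measurable halfline\<close>
    by (intro integrable_cong_AE_imp[OF L2_halflineD(2)[OF assms(1)]]) auto
  ultimately show ?thesis by (simp add: L2_halfline_def)
qed

lemma L2_inner_cong_AE:
  assumes "f \<in> L2_halfline" "AE x in halfline. f x = f' x"
    and "g \<in> L2_halfline" "AE x in halfline. g x = g' x"
  shows "L2_inner f g = L2_inner f' g'"
proof -
  have [measurable]: "f \<in> borel_measurable halfline" "g \<in> borel_measurable halfline"
    "f' \<in> borel_measurable halfline" "g' \<in> borel_measurable halfline"
    using assms L2_AE_cong L2_halflineD by blast+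
  show ?thesis unfolding L2_inner_def
    by (rule integral_cong_AE) (use assms(2,4) in auto)
qed

lemma L2_norm_cong_AE:
  assumes "f \<in> L2_halfline" "AE x in halfline. f x = g x"
  shows "L2_norm f = L2_norm g"
proof -
  have [measurable]: "f \<in> borel_measurable halfline" "g \<in> borel_measurable halfline"
    using assms L2_AE_cong L2_halflineD by blast+
  have "(LINT x|halfline. (cmod (f x))\<^sup>2) = (LINT x|halfline. (cmod (g x))\<^sup>2)"
    by (rule integral_cong_AE) (use assms(2) in auto)
  then show ?thesis by (simp add: L2_norm_def)
qed

lemma L2_norm_nonneg: "L2_norm f \<ge> 0"
  by (simp add: L2_norm_def)

lemma L2_norm_square: "(L2_norm f)\<^sup>2 = (LINT x|halfline. (cmod (f x))\<^sup>2)"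
  by (simp add: L2_norm_def)

lemma L2_inner_self: "L2_inner f f = of_real ((L2_norm f)\<^sup>2)"
  unfolding L2_inner_def L2_norm_square complex_norm_square[symmetric] by (rule integral_complex_of_real)

lemma L2_inner_diff_left:
  assumes "f \<in> L2_halfline" "g \<in> L2_halfline" "h \<in> L2_halfline"
  shows "L2_inner (\<lambda>x. f x - g x) h = L2_inner f h - L2_inner g h"
  using assms by (simp add: L2_inner_def algebra_simps L2_inner_integrable)

lemma L2_inner_cmult_left: "L2_inner (\<lambda>x. c * f x) g = c * L2_inner f g"
  by (simp add: L2_inner_def mult.assoc)

lemma L2_inner_commute: "L2_inner f g = cnj (L2_inner g f)"
proof -
  have "L2_inner f g = (LINT x|halfline. cnj (g x * cnj (f x)))"
    by (simp add: L2_inner_def mult.commute)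
  then show ?thesis unfolding L2_inner_def by (simp only: Bochner_Integration.integral_cnj)
qed

lemma L2_inner_cmult_right: "L2_inner f (\<lambda>x. c * g x) = cnj c * L2_inner f g"
  by (metis L2_inner_cmult_left L2_inner_commute complex_cnj_mult)

lemma L2_Cauchy_Schwarz:
  assumes "f \<in> L2_halfline" "g \<in> L2_halfline"
  shows "cmod (L2_inner f g) \<le> L2_norm f * L2_norm g"
proof -
  have "cmod (L2_inner f g) \<le> (LINT x|halfline. cmod (f x) * cmod (g x))"
    unfolding L2_inner_def by (rule order_trans[OF integral_norm_bound]) (simp add: norm_mult)
  also have "\<dots> \<le> L2_norm f * L2_norm g"
    unfolding L2_norm_def by (rule Cauchy_Schwarz_integral) (use assms in \<open>simp_all add: L2_halflineD\<close>)
  finally show ?thesis .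
qed

lemma L2_norm_triangle:
  assumes "f \<in> L2_halfline" "g \<in> L2_halfline"
  shows "L2_norm (\<lambda>x. f x + g x) \<le> L2_norm f + L2_norm g"
proof (rule power2_le_imp_le)
  have [simp]: "(\<lambda>x. f x + g x) \<in> L2_halfline" by (rule L2_add[OF assms])
  have "of_real ((L2_norm (\<lambda>x. f x + g x))\<^sup>2) =
      L2_inner f f + L2_inner f g + (L2_inner g f + L2_inner g g)"
    unfolding L2_inner_self[symmetric] L2_inner_def
    using assms by (simp add: algebra_simps L2_inner_integrable L2_add)
  then have "(L2_norm (\<lambda>x. f x + g x))\<^sup>2 = Re (L2_inner f f + L2_inner f g + (L2_inner g f + L2_inner g g))"
    by (metis Re_complex_of_real)
  also have "\<dots> \<le> (L2_norm f)\<^sup>2 + (L2_norm g)\<^sup>2 + cmod (L2_inner f g) + cmod (L2_inner g f)"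
    using complex_Re_le_cmod[of "L2_inner f g"] complex_Re_le_cmod[of "L2_inner g f"] by (simp add: L2_inner_self)
  also have "\<dots> \<le> (L2_norm f + L2_norm g)\<^sup>2"
    using L2_Cauchy_Schwarz[OF assms] L2_Cauchy_Schwarz[OF assms(2,1)]
    by (simp add: power2_sum mult.commute[of "L2_norm g"] mult.assoc)
  finally show "(L2_norm (\<lambda>x. f x + g x))\<^sup>2 \<le> (L2_norm f + L2_norm g)\<^sup>2" .
qed (simp add: L2_norm_nonneg)

lemma L2_norm_minus_commute: "L2_norm (\<lambda>x. f x - g x) = L2_norm (\<lambda>x. g x - f x)"
  by (simp add: L2_norm_def norm_minus_commute)

lemma L2_norm_eq_0_imp_AE:
  assumes "f \<in> L2_halfline" "L2_norm f = 0"
  shows "AE x in halfline. f x = 0"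
  using assms integral_nonneg_eq_0_iff_AE[of halfline "\<lambda>x. (cmod (f x))\<^sup>2"]
  by (simp add: L2_norm_def L2_halflineD)

lemma L2_inner_tendsto_left:
  assumes "L2_tendsto F f" "\<And>m. F m \<in> L2_halfline" "f \<in> L2_halfline" "g \<in> L2_halfline"
  shows "(\<lambda>m. L2_inner (F m) g) \<longlonglongrightarrow> L2_inner f g"
proof (rule Lim_transform_bound[where g = "\<lambda>m. L2_norm (\<lambda>x. F m x - f x) * L2_norm g", THEN LIM_zero_cancel])
  show "\<forall>\<^sub>F m in sequentially. norm (L2_inner (F m) g - L2_inner f g) \<le> 
      norm (L2_norm (\<lambda>x. F m x - f x) * L2_norm g)"
    using L2_Cauchy_Schwarz[OF L2_diff[OF assms(2,3)] assms(4)] assms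
    by (intro always_eventually) (simp add: L2_inner_diff_left L2_norm_nonneg)
  show "(\<lambda>m. L2_norm (\<lambda>x. F m x - f x) * L2_norm g) \<longlonglongrightarrow> 0"
    using assms(1) by (intro tendsto_mult_left_zero) (simp add: L2_tendsto_def)
qed

lemma L2_inner_tendsto_right:
  assumes "L2_tendsto F f" "\<And>m. F m \<in> L2_halfline" "f \<in> L2_halfline" "g \<in> L2_halfline"
  shows "(\<lambda>m. L2_inner g (F m)) \<longlonglongrightarrow> L2_inner g f"
  using tendsto_cnj[OF L2_inner_tendsto_left[OF assms]] by (simp add: L2_inner_commute[symmetric])

section \<open>Passage between the half-line and compact intervals\<close>

lemma L2_absolutely_integrable:
  assumes "f \<in> L2_halfline" "0 \<le> a"
  shows "f absolutely_integrable_on {a..b}"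
proof -
  have meas: "f \<in> borel_measurable halfline" using assms by (simp add: L2_halflineD)
  have "{a<..<b} \<subseteq> {0<..}" using assms by auto
  have "integrable (lebesgue_on {a<..<b}) f"
  proof (rule Bochner_Integration.integrable_bound)
    have "(\<lambda>x. (cmod (f x))\<^sup>2) absolutely_integrable_on {a<..<b}"
      using L2_halflineD(2)[OF assms(1)] \<open>{a<..<b} \<subseteq> {0<..}\<close> unfolding integrable_halfline_iff
      by (intro set_integrable_subset[of lebesgue "{0<..}" _ "{a<..<b}"]) auto
    moreover have "(\<lambda>x. (1 :: real)) absolutely_integrable_on {a<..<b}"
      using lmeasurable_box[of a b] by (simp add: box_real)
    ultimately show "integrable (lebesgue_on {a<..<b}) (\<lambda>x. 1 + (cmod (f x))\<^sup>2)"
      by (simp add: absolutely_integrable_imp_integrable)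
    show "f \<in> borel_measurable (lebesgue_on {a<..<b})"
      by (rule measurable_restrict_mono[OF meas \<open>{a<..<b} \<subseteq> {0<..}\<close>])
    have "cmod (f x) \<le> 1 + (cmod (f x))\<^sup>2" for x
    proof -
      have "0 \<le> (cmod (f x) - 1)\<^sup>2 + cmod (f x)" by simp
      then show ?thesis by (simp add: power2_diff)
    qed
    then show "AE x in lebesgue_on {a<..<b}. norm (f x) \<le> norm (1 + (cmod (f x))\<^sup>2)" by simp
  qed
  then have "f absolutely_integrable_on {a<..<b}"
    by (simp add: set_integrable_def integrable_restrict_space)
  then show ?thesis
    by (simp add: absolutely_integrable_on_Icc_iff_Ioo)
qed

lemma absolutely_integrable_Icc_of_halfline:
  fixes f :: "real \<Rightarrow> 'b::euclidean_space"
  assumes "integrable halfline f" "0 \<le> a"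
  shows "f absolutely_integrable_on {a..b}"
proof -
  have "f absolutely_integrable_on {a<..<b}"
    using assms(1) unfolding integrable_halfline_iff
    by (rule set_integrable_subset) (use assms(2) in auto)
  then show ?thesis
    by (simp add: absolutely_integrable_on_Icc_iff_Ioo)
qed

text \<open>Dominated convergence with the truncations \<open>indicator {..X}\<close>. It connects
  the Bochner integral, which defines the Hilbert space, with the gauge integrals over
  \<open>{0..X}\<close>, in which all the calculus is done.\<close>

lemma integral_tendsto_halfline:
  fixes f :: "real \<Rightarrow> 'b::euclidean_space"
  assumes "integrable halfline f"
  shows "((\<lambda>X. integral {0..X} f) \<longlongrightarrow> (LINT x|halfline. f x)) at_top"
proof -
  have [measurable]: "f \<in> borel_measurable halfline" using assms by auto
  have "((\<lambda>X. LINT x|halfline. indicator {..X} x *\<^sub>R f x) \<longlongrightarrow> (LINT x|halfline. f x)) at_top"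
  proof (rule integral_dominated_convergence_at_top)
    have [measurable]: "{..X} \<inter> {0<..} \<in> sets halfline" for X :: real
      unfolding sets_restrict_space by (rule image_eqI[where x = "{..X}"]) auto
    have m: "(\<lambda>x. if x \<in> {..X} then f x else 0) \<in> borel_measurable halfline" for X
      by (rule measurable_If_set) (auto simp: space_restrict_space)
    have eq: "(\<lambda>x. indicator {..X} x *\<^sub>R f x) = (\<lambda>x. if x \<in> {..X} then f x else 0)" for X
      by auto
    show "(\<lambda>x. indicator {..X} x *\<^sub>R f x) \<in> borel_measurable halfline" for X
      unfolding eq by (rule m)
    show "AE x in halfline. ((\<lambda>X. indicator {..X} x *\<^sub>R f x) \<longlongrightarrow> f x) at_top"
    proof (rule AE_I2)
      fix x :: real
      have "\<forall>\<^sub>F X in at_top. x \<le> X" by (rule eventually_ge_at_top)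
      then have "\<forall>\<^sub>F X in at_top. indicator {..X} x *\<^sub>R f x = f x"
        by eventually_elim simp
      then show "((\<lambda>X. indicator {..X} x *\<^sub>R f x) \<longlongrightarrow> f x) at_top"
        by (rule tendsto_eventually)
    qed
    show "integrable halfline (\<lambda>x. norm (f x))" using assms by simp
  qed (auto simp: indicator_def)
  also have "(\<lambda>X. LINT x|halfline. indicator {..X} x *\<^sub>R f x) = (\<lambda>X. integral {0..X} f)"
  proof
    fix X :: real
    have "integrable (lebesgue_on {0<..X}) f"
      using assms unfolding integrable_halfline_iff
      by (intro absolutely_integrable_imp_integrable, rule set_integrable_subset) auto
    then have "integral {0<..X} f = (LINT x|lebesgue_on {0<..X}. f x)"
      by (simp add: lebesgue_integral_eq_integral)
    also have "\<dots> = (LINT x|halfline. indicator {..X} x *\<^sub>R f x)"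
    proof -
      have "(LINT x|lebesgue_on {0<..X}. f x) = (LINT x|lebesgue. indicator {0<..X} x *\<^sub>R f x)"
        by (rule integral_restrict_space) simp
      also have "\<dots> = (LINT x|lebesgue. indicator {0<..} x *\<^sub>R (indicator {..X} x *\<^sub>R f x))"
        by (rule Bochner_Integration.integral_cong) (auto simp: indicator_def)
      also have "\<dots> = (LINT x|halfline. indicator {..X} x *\<^sub>R f x)"
        by (rule integral_restrict_space[symmetric]) simp
      finally show ?thesis .
    qed
    also have "integral {0<..X} f = integral {0..X} f"
      by (rule integral_spike_set; rule negligible_subset[of "{0}"]) auto
    finally show "(LINT x|halfline. indicator {..X} x *\<^sub>R f x) = integral {0..X} f" ..
  qed
  finally show ?thesis .
qed

text \<open>Monotone convergence along X = 0, 1, 2, ...: the way in which membership in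
  \<open>L2_halfline\<close> is obtained below from bounds on compact intervals.\<close>

lemma integrable_halflineI_bounded:
  fixes f :: "real \<Rightarrow> real"
  assumes nonneg: "\<And>x. x > 0 \<Longrightarrow> f x \<ge> 0"
    and int: "\<And>X. X > 0 \<Longrightarrow> f integrable_on {0..X}" and bd: "\<And>X. X > 0 \<Longrightarrow> integral {0..X} f \<le> B"
  shows "integrable halfline f"
proof -
  have int': "f integrable_on {0<..real k}" for k
  proof (cases "k = 0")
    case False
    then have "f integrable_on {0..real k}" using int by simp
    then show ?thesis
      by (rule integrable_spike_set) (rule negligible_subset[of "{0}"], force, force)+
  qed auto
  have eq: "integral {0<..real k} f = integral {0..real k} f" for k
    by (rule integral_spike_set; rule negligible_subset[of "{0}"]) auto
  have "(\<lambda>x. if x \<in> {0<..} then f x else 0) integrable_on UNIV \<and>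
     (\<lambda>k. integral UNIV (\<lambda>x. if x \<in> {0<..real k} then f x else 0)) \<longlonglongrightarrow> 
       integral UNIV (\<lambda>x. if x \<in> {0<..} then f x else 0)"
  proof (rule monotone_convergence_increasing)
    show "(\<lambda>x. if x \<in> {0<..real k} then f x else 0) integrable_on UNIV" for k
      using int' by (simp only: integrable_restrict_UNIV)
    show "(if x \<in> {0<..real k} then f x else 0) \<le> (if x \<in> {0<..real (Suc k)} then f x else 0)" for k x
      using nonneg by auto
    show "(\<lambda>k. if x \<in> {0<..real k} then f x else 0) \<longlonglongrightarrow> (if x \<in> {0<..} then f x else 0)" for x
    proof (rule tendsto_eventually)
      obtain N where "x \<le> real N" using real_arch_simple by blast
      then have "\<forall>\<^sub>F k in sequentially. x \<le> real k"
        by (auto simp: eventually_sequentially intro!: exI[of _ N])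
      then show "\<forall>\<^sub>F k in sequentially. (if x \<in> {0<..real k} then f x else 0) = (if x \<in> {0<..} then f x else 0)"
        by eventually_elim auto
    qed
    have "\<bar>integral {0<..real k} f\<bar> \<le> max 0 B" for k
    proof (cases "k = 0")
      case False
      then show ?thesis
        using bd[of "real k"] integral_nonneg[OF int'[of k]] nonneg by (simp add: eq)
    qed auto
    then show "bounded (range (\<lambda>k. integral UNIV (\<lambda>x. if x \<in> {0<..real k} then f x else 0)))"
      by (intro boundedI[of _ "max 0 B"]) (auto simp only: integral_restrict_UNIV real_norm_def)
  qed
  then have "f integrable_on {0<..}" by (simp only: integrable_restrict_UNIV)
  then have "f absolutely_integrable_on {0<..}"
    by (rule nonnegative_absolutely_integrable_1) (use nonneg in auto)
  then show ?thesis by (simp add: integrable_halfline_iff)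
qed

section \<open>Locally absolutely continuous functions on the half-line\<close>

text \<open>Local absolute continuity on the closed half-line, encoded by the integral formula: g is
  an almost everywhere derivative of f and may be changed on null sets, whereas f is fixed pointwise
  on \<open>{0..}\<close>.\<close>

definition ac_deriv :: "(real \<Rightarrow> complex) \<Rightarrow> (real \<Rightarrow> complex) \<Rightarrow> bool" where
  "ac_deriv f g \<longleftrightarrow> (\<forall>x\<ge>0. g absolutely_integrable_on {0..x} \<and> f x = f 0 + integral {0..x} g)"

lemma ac_derivD:
  assumes "ac_deriv f g" "0 \<le> x"
  shows "f x = f 0 + integral {0..x} g"
  using assms unfolding ac_deriv_def by blast

lemma ac_deriv_integrable:
  assumes "ac_deriv f g" "0 \<le> a"
  shows "g absolutely_integrable_on {a..b}"
proof (cases "a \<le> b")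
  case True
  then have "g absolutely_integrable_on {0..b}" using assms by (simp add: ac_deriv_def)
  then show ?thesis by (rule absolutely_integrable_on_subinterval) (use assms in auto)
qed auto

lemma ac_deriv_integrable_on:
  assumes "ac_deriv f g" "0 \<le> a"
  shows "g integrable_on {a..b}"
  using ac_deriv_integrable[OF assms] by (rule set_lebesgue_integral_eq_integral)

lemma ac_deriv_integral:
  assumes "ac_deriv f g" "0 \<le> a" "a \<le> b"
  shows "integral {a..b} g = f b - f a"
proof -
  have "integral {0..a} g + integral {a..b} g = integral {0..b} g"
    by (rule Henstock_Kurzweil_Integration.integral_combine) (use assms ac_deriv_integrable_on[OF assms(1), of 0 b] in simp_all)
  moreover have "f a = f 0 + integral {0..a} g" "f b = f 0 + integral {0..b} g"
    using assms by (blast intro: ac_derivD order_trans)+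
  ultimately show ?thesis by (metis add_diff_cancel_left add_diff_cancel_left')
qed

lemma ac_deriv_has_integral:
  assumes "ac_deriv f g" "0 \<le> a" "a \<le> b"
  shows "(g has_integral (f b - f a)) {a..b}"
  using ac_deriv_integral[OF assms] ac_deriv_integrable_on[OF assms(1,2)] by (metis integrable_integral)

lemma at_within_halfline_eq: "0 \<le> x \<Longrightarrow> at x within {0..x + 1} = at (x::real) within {0..}"
  by (rule at_within_nhd[of _ "{..<x + 1}"]) auto

lemma ac_deriv_continuous:
  assumes "ac_deriv f g"
  shows "continuous_on {0..} f"
  unfolding continuous_on_eq_continuous_within
proof
  fix x :: real assume "x \<in> {0..}"
  then have x: "x \<ge> 0" by simp
  have "continuous_on {0..x+1} (\<lambda>x. f 0 + integral {0..x} g)"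
    by (rule continuous_on_add[OF continuous_on_const indefinite_integral_continuous_1])
       (rule ac_deriv_integrable_on[OF assms order_refl])
  then have "continuous_on {0..x+1} f"
    by (rule continuous_on_eq) (rule ac_derivD[OF assms, symmetric], simp)
  then have "continuous (at x within {0..x+1}) f"
    using x by (simp add: continuous_on_eq_continuous_within)
  then show "continuous (at x within {0..}) f"
    using x by (simp add: at_within_halfline_eq)
qed

lemma ac_deriv_vector_derivative:
  assumes "ac_deriv f g" "continuous_on {0..} g" "0 \<le> x"
  shows "(f has_vector_derivative g x) (at x within {0..})"
proof -
  have "continuous_on {0..x+1} g"
    by (rule continuous_on_subset[OF assms(2)]) auto
  then have "((\<lambda>x. f 0 + integral {0..x} g) has_vector_derivative 0 + g x) (at x within {0..x+1})"
    by (rule has_vector_derivative_add[OF has_vector_derivative_const integral_has_vector_derivative])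
       (use assms in auto)
  then have "(f has_vector_derivative 0 + g x) (at x within {0..x+1})"
    by (rule has_vector_derivative_transform[rotated 2])
       (use assms(3) in \<open>auto intro!: ac_derivD[OF assms(1)]\<close>)
  then show ?thesis
    using assms by (simp add: at_within_halfline_eq)
qed

lemma ac_derivI_vector:
  assumes "\<And>x. x \<ge> 0 \<Longrightarrow> (f has_vector_derivative g x) (at x within {0..})" "continuous_on {0..} g"
  shows "ac_deriv f g"
  unfolding ac_deriv_def
proof (intro allI impI conjI)
  fix x :: real assume x: "0 \<le> x"
  show "g absolutely_integrable_on {0..x}"
    by (rule absolutely_integrable_continuous_real) (rule continuous_on_subset[OF assms(2)], auto)
  have "(g has_integral (f x - f 0)) {0..x}"
    by (rule fundamental_theorem_of_calculus[OF x])
       (rule has_vector_derivative_within_subset[OF assms(1)], auto)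
  then show "f x = f 0 + integral {0..x} g"
    by (simp add: integral_unique)
qed

lemma ac_derivI_integral:
  assumes "\<And>x. x \<ge> 0 \<Longrightarrow> g absolutely_integrable_on {0..x}"
  shows "ac_deriv (\<lambda>x. c + integral {0..x} g) g"
  using assms by (simp add: ac_deriv_def)

lemma ac_deriv_cong:
  assumes "ac_deriv f g" "\<And>x. x \<ge> 0 \<Longrightarrow> f x = f' x" "\<And>x. x > 0 \<Longrightarrow> g x = g' x"
  shows "ac_deriv f' g'"
  unfolding ac_deriv_def
proof (intro allI impI conjI)
  fix x :: real assume x: "0 \<le> x"
  have 1: "g absolutely_integrable_on {0..x}" "f x = f 0 + integral {0..x} g"
    using assms(1) x unfolding ac_deriv_def by blast+
  show "g' absolutely_integrable_on {0..x}"
    using 1(1) by (rule absolutely_integrable_spike[of _ _ "{0}"]) (use assms(3) in auto)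
  have "integral {0..x} g = integral {0..x} g'"
    by (rule integral_spike[of "{0}"]) (use assms(3) in auto)
  then show "f' x = f' 0 + integral {0..x} g'"
    using 1(2) assms(2) x by auto
qed

lemma ac_deriv_const: "ac_deriv (\<lambda>x. c) (\<lambda>x. 0)"
  by (simp add: ac_deriv_def)

lemma ac_deriv_add:
  assumes "ac_deriv f f'" "ac_deriv g g'"
  shows "ac_deriv (\<lambda>x. f x + g x) (\<lambda>x. f' x + g' x)"
  unfolding ac_deriv_def
proof (intro allI impI conjI)
  fix x :: real assume x: "0 \<le> x"
  show "(\<lambda>x. f' x + g' x) absolutely_integrable_on {0..x}"
    using assms by (intro set_integral_add ac_deriv_integrable) auto
  have "integral {0..x} (\<lambda>x. f' x + g' x) = integral {0..x} f' + integral {0..x} g'"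
    using assms by (intro Henstock_Kurzweil_Integration.integral_add ac_deriv_integrable_on) auto
  then show "f x + g x = f 0 + g 0 + integral {0..x} (\<lambda>x. f' x + g' x)"
    using ac_deriv_integral[OF assms(1), of 0 x] ac_deriv_integral[OF assms(2), of 0 x] x by simp
qed

lemma ac_deriv_cmult:
  assumes "ac_deriv f f'"
  shows "ac_deriv (\<lambda>x. c * f x) (\<lambda>x. c * f' x)"
  unfolding ac_deriv_def
proof (intro allI impI conjI)
  fix x :: real assume x: "0 \<le> x"
  show "(\<lambda>x. c * f' x) absolutely_integrable_on {0..x}"
    using assms by (intro set_integrable_mult_right ac_deriv_integrable) auto
  show "c * f x = c * f 0 + integral {0..x} (\<lambda>x. c * f' x)"
    by (simp add: ac_deriv_integral[OF assms(1), of 0 x] x right_diff_distrib)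
qed

lemma ac_deriv_diff:
  assumes "ac_deriv f f'" "ac_deriv g g'"
  shows "ac_deriv (\<lambda>x. f x - g x) (\<lambda>x. f' x - g' x)"
  using ac_deriv_add[OF assms(1) ac_deriv_cmult[OF assms(2), of "-1"]] by simp

lemma ac_deriv_sum:
  assumes "\<And>i. i \<in> I \<Longrightarrow> ac_deriv (f i) (f' i)"
  shows "ac_deriv (\<lambda>x. \<Sum>i\<in>I. f i x) (\<lambda>x. \<Sum>i\<in>I. f' i x)"
  using assms by (induction I rule: infinite_finite_induct) (auto intro: ac_deriv_const ac_deriv_add)

lemma ac_deriv_cnj:
  assumes "ac_deriv f f'"
  shows "ac_deriv (\<lambda>x. cnj (f x)) (\<lambda>x. cnj (f' x))"
  unfolding ac_deriv_def
proof (intro allI impI conjI)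
  fix x :: real assume x: "0 \<le> x"
  have "f' absolutely_integrable_on {0..x}" using assms x by (simp add: ac_deriv_def)
  then show "(\<lambda>x. cnj (f' x)) absolutely_integrable_on {0..x}"
    by (rule absolutely_integrable_linear[OF _ bounded_linear_cnj, unfolded o_def])
  show "cnj (f x) = cnj (f 0) + integral {0..x} (\<lambda>x. cnj (f' x))"
    by (simp add: ac_deriv_integral[OF assms(1), of 0 x] x flip: Henstock_Kurzweil_Integration.integral_cnj)
qed

section \<open>Products of locally absolutely continuous functions\<close>

lemma absolutely_integrable_continuous_mult:
  fixes f g :: "real \<Rightarrow> complex"
  assumes "continuous_on {a..b} f" "g absolutely_integrable_on {a..b}"
  shows "(\<lambda>x. f x * g x) absolutely_integrable_on {a..b}"
  by (rule absolutely_integrable_bounded_measurable_product)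
     (use assms in \<open>auto simp: bilinear_conv_bounded_bilinear bounded_bilinear_mult
        intro!: continuous_imp_measurable_on_sets_lebesgue compact_imp_bounded compact_continuous_image\<close>)

text \<open>The hypothesis is local, for intervals shorter than d; adding it up over a division into
  m equal pieces, with m > X / d, telescopes on the right and is a triangle inequality on the
  left.\<close>

lemma norm_increment_le_by_fine_partition:
  fixes \<Phi> V :: "real \<Rightarrow> 'a::real_normed_vector"
  assumes "0 < d" "0 \<le> X"
    and "\<And>a b. 0 \<le> a \<Longrightarrow> a \<le> b \<Longrightarrow> b \<le> X \<Longrightarrow> b - a < d \<Longrightarrow> norm (\<Phi> b - \<Phi> a) \<le> W b - W a"
  shows "norm (\<Phi> X - \<Phi> 0) \<le> W X - W 0"
proof -
  obtain m :: nat where m: "X / d < real m" using reals_Archimedean2 by blast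
  moreover have "0 \<le> X / d" using assms by simp
  ultimately have "m > 0" by (metis of_nat_0 not_gr_zero not_le)
  have Xm: "X / real m < d" using m assms \<open>m > 0\<close> by (simp add: field_simps)
  have "norm (\<Phi> (real k * (X / real m)) - \<Phi> 0) \<le> W (real k * (X / real m)) - W 0" if "k \<le> m" for k
    using that
  proof (induction k)
    case (Suc k)
    let ?a = "real k * (X / real m)" and ?b = "real (Suc k) * (X / real m)"
    have "norm (\<Phi> ?b - \<Phi> ?a) \<le> W ?b - W ?a"
    proof (rule assms(3))
      have "?b \<le> real m * (X / real m)"
        using Suc.prems assms by (intro mult_right_mono) auto
      then show "?b \<le> X" using \<open>m > 0\<close> by simp
      show "0 \<le> ?a" using assms by simp
      show "?a \<le> ?b" using assms by (intro mult_right_mono) auto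
      have "?b - ?a = X / real m" by (simp add: algebra_simps add_divide_distrib)
      then show "?b - ?a < d" using Xm by simp
    qed
    moreover have "norm (\<Phi> ?b - \<Phi> 0) \<le> norm (\<Phi> ?b - \<Phi> ?a) + norm (\<Phi> ?a - \<Phi> 0)"
      using dist_triangle[of "\<Phi> ?b" "\<Phi> 0" "\<Phi> ?a"] unfolding dist_norm .
    ultimately show ?case using Suc.IH Suc.prems by linarith
  qed simp
  from this[of m] show ?thesis using \<open>m > 0\<close> by simp
qed

text \<open>The difference \<Phi> between the product and the integral of the expected derivative is
  shown to be constant: over short intervals its increments are at most e times those of the
  integral V of |f'| + |g'|, by uniform continuity of f and g. Hence the same holds over
  \<open>{0..X}\<close>, and e is arbitrary.\<close>

lemma ac_deriv_mult:
  assumes f: "ac_deriv f f'" and g: "ac_deriv g g'"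
  shows "ac_deriv (\<lambda>x. f x * g x) (\<lambda>x. f' x * g x + f x * g' x)"
proof -
  let ?h = "\<lambda>x. f' x * g x + f x * g' x"
  have cont: "continuous_on {a..b} f" "continuous_on {a..b} g" if "0 \<le> a" for a b
    using ac_deriv_continuous[OF f] ac_deriv_continuous[OF g] that by (auto elim: continuous_on_subset)
  have int: "(\<lambda>x. f' x * g x) absolutely_integrable_on {a..b}" "(\<lambda>x. f x * g' x) absolutely_integrable_on {a..b}"
    if "0 \<le> a" for a b
    using absolutely_integrable_continuous_mult[OF cont(2) ac_deriv_integrable[OF f]]
      absolutely_integrable_continuous_mult[OF cont(1) ac_deriv_integrable[OF g]] that
    by (simp_all add: mult.commute)
  then have inth: "?h absolutely_integrable_on {a..b}" if "0 \<le> a" for a b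
    using that by (intro set_integral_add)
  then have inth': "?h integrable_on {a..b}" if "0 \<le> a" for a b
    using that by (blast intro: set_lebesgue_integral_eq_integral(1))
  define v where "v = (\<lambda>x. norm (f' x) + norm (g' x))"
  have intv: "v integrable_on {a..b}" if "0 \<le> a" for a b
    unfolding v_def using ac_deriv_integrable[OF f that] ac_deriv_integrable[OF g that]
    by (intro integrable_add) (auto simp: absolutely_integrable_on_def)
  have "f X * g X = f 0 * g 0 + integral {0..X} ?h" if X: "0 \<le> X" for X
  proof -
    define \<Phi> where "\<Phi> = (\<lambda>x. f x * g x - integral {0..x} ?h)"
    define V where "V = (\<lambda>x. integral {0..x} v)"
    have "norm (\<Phi> X - \<Phi> 0) \<le> e * V X" if e: "e > 0" for e
    proof -
      have uc: "uniformly_continuous_on {0..X} f" "uniformly_continuous_on {0..X} g"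
        using cont by (auto intro!: compact_uniformly_continuous)
      obtain d1 where d1: "d1 > 0" "\<And>x y. x \<in> {0..X} \<Longrightarrow> y \<in> {0..X} \<Longrightarrow> dist x y < d1 \<Longrightarrow> dist (f x) (f y) < e"
        using uc(1) e unfolding uniformly_continuous_on_def by (metis dist_commute)
      obtain d2 where d2: "d2 > 0" "\<And>x y. x \<in> {0..X} \<Longrightarrow> y \<in> {0..X} \<Longrightarrow> dist x y < d2 \<Longrightarrow> dist (g x) (g y) < e"
        using uc(2) e unfolding uniformly_continuous_on_def by (metis dist_commute)
      have "norm (\<Phi> X - \<Phi> 0) \<le> e * V X - e * V 0"
      proof (rule norm_increment_le_by_fine_partition[where d = "min d1 d2" and W = "\<lambda>x. e * V x"])
        fix a b assume ab: "0 \<le> a" "a \<le> b" "b \<le> X" "b - a < min d1 d2"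
        have comb: "integral {0..a} w + integral {a..b} w = integral {0..b} w"
          if "w integrable_on {0..b}" for w :: "real \<Rightarrow> 'z::banach"
          by (rule Henstock_Kurzweil_Integration.integral_combine) (use ab that in auto)
        \<comment> \<open>The increment of the product is split with g taken at b and f at a. Both
          increments being integrals of f' and g', the integrand becomes f'(t) (g b - g t) + (f a -
          f t) g'(t), with a small factor in each term.\<close>
        have "\<Phi> b - \<Phi> a = (f b - f a) * g b + f a * (g b - g a) - integral {a..b} ?h"
          using comb[OF inth'[of 0 b]] by (simp add: \<Phi>_def algebra_simps)
        also have "\<dots> = integral {a..b} (\<lambda>t. f' t * g b + f a * g' t) - integral {a..b} ?h"
          using ac_deriv_integral[OF f ab(1,2)] ac_deriv_integral[OF g ab(1,2)] ac_deriv_integrable_on[OF f ab(1)]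
            ac_deriv_integrable_on[OF g ab(1)]
          by (subst Henstock_Kurzweil_Integration.integral_add) (auto intro!: integrable_on_mult_left integrable_on_mult_right)
        also have "\<dots> = integral {a..b} (\<lambda>t. f' t * g b + f a * g' t - ?h t)"
          using ac_deriv_integrable_on[OF f ab(1)] ac_deriv_integrable_on[OF g ab(1)] inth'[OF ab(1)]
          by (subst Henstock_Kurzweil_Integration.integral_diff)
             (auto intro!: integrable_add integrable_on_mult_left integrable_on_mult_right)
        also have "norm \<dots> \<le> integral {a..b} (\<lambda>t. e * v t)"
        proof (rule integral_norm_bound_integral)
          show "(\<lambda>t. f' t * g b + f a * g' t - ?h t) integrable_on {a..b}"
            using ac_deriv_integrable_on[OF f ab(1)] ac_deriv_integrable_on[OF g ab(1)] inth'[OF ab(1), of b]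
            by (intro integrable_diff) (auto intro!: integrable_add integrable_on_mult_left integrable_on_mult_right)
          show "(\<lambda>t. e * v t) integrable_on {a..b}"
            using intv[OF ab(1)] by (intro integrable_on_mult_right)
          fix t assume t: "t \<in> {a..b}"
          have "norm (g b - g t) \<le> e" "norm (f a - f t) \<le> e"
            using d1(2)[of a t] d2(2)[of b t] ab t by (auto simp: dist_norm)
          then have "norm (f' t * (g b - g t)) \<le> e * norm (f' t)" "norm ((f a - f t) * g' t) \<le> e * norm (g' t)"
            by (simp_all add: norm_mult mult_right_mono mult.commute[of "norm (f' t)"])
          then show "norm (f' t * g b + f a * g' t - ?h t) \<le> e * v t"
            using norm_triangle_ineq[of "f' t * (g b - g t)" "(f a - f t) * g' t"]
            by (simp add: v_def algebra_simps)
        qed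
        also have "integral {a..b} (\<lambda>t. e * v t) = e * V b - e * V a"
          using comb[OF intv[of 0 b]] by (simp add: V_def flip: right_diff_distrib)
        finally show "norm (\<Phi> b - \<Phi> a) \<le> e * V b - e * V a" .
      qed (use d1 d2 X in auto)
      then show ?thesis by (simp add: V_def)
    qed
    then have lim: "\<And>e. e > 0 \<Longrightarrow> norm (\<Phi> X - \<Phi> 0) \<le> e * V X" by blast
    have "((\<lambda>e. e * V X) \<longlongrightarrow> 0 * V X) (at_right 0)" by (intro tendsto_intros)
    then have "norm (\<Phi> X - \<Phi> 0) \<le> 0 * V X"
      by (rule tendsto_lowerbound) (auto intro!: lim eventually_mono[OF eventually_at_right_less])
    then have "f X * g X - integral {0..X} ?h = f 0 * g 0" by (simp add: \<Phi>_def)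
    then show ?thesis by (simp only: diff_eq_eq)
  qed
  then show ?thesis
    unfolding ac_deriv_def using inth by blast
qed

lemma ac_deriv_shift:
  assumes "ac_deriv f f'" "s \<ge> 0"
  shows "ac_deriv (\<lambda>x. f (s + x)) (\<lambda>x. f' (s + x))"
  unfolding ac_deriv_def
proof (intro allI impI conjI)
  fix x :: real assume x: "0 \<le> x"
  have "f' absolutely_integrable_on {s..s + x}" by (rule ac_deriv_integrable[OF assms])
  then have "integrable lebesgue (\<lambda>y. indicator {s..s + x} y *\<^sub>R f' y)"
    by (simp add: set_integrable_def)
  then have "integrable lebesgue (\<lambda>y. indicator {s..s + x} (s + 1 * y) *\<^sub>R f' (s + 1 * y))"
    by (subst lebesgue_integrable_real_affine_iff) auto
  then show "(\<lambda>x. f' (s + x)) absolutely_integrable_on {0..x}"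
    unfolding set_integrable_def
    by (rule Bochner_Integration.integrable_cong[THEN iffD1, rotated 2]) (auto simp: indicator_def)
  have "((\<lambda>y. f' (1 *\<^sub>R y + s)) has_integral (1 / \<bar>1\<bar>) *\<^sub>R (f (s + x) - f s)) ((\<lambda>y. (1 / 1) *\<^sub>R y + - ((1 / 1) *\<^sub>R s)) ` cbox s (s + x))"
    using has_integral_affinity[OF _ _, of f' "f (s + x) - f s" s "s + x" 1 s] ac_deriv_has_integral[OF assms, of "s + x"] x
    by (simp add: add.commute)
  moreover have "(\<lambda>y. (1 / 1) *\<^sub>R y + - ((1 / 1) *\<^sub>R s)) ` cbox s (s + x) = {0..x}"
    by (auto simp: image_iff intro!: bexI[of _ "_ + s"])
  ultimately have "((\<lambda>y. f' (s + y)) has_integral (f (s + x) - f s)) {0..x}"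
    by (simp add: add.commute)
  then show "f (s + x) = f (s + 0) + integral {0..x} (\<lambda>x. f' (s + x))"
    by (simp add: integral_unique)
qed

section \<open>Smooth functions\<close>

definition smooth :: "(real \<Rightarrow> complex) \<Rightarrow> bool" where
  "smooth f \<longleftrightarrow> (\<forall>k x. (vderiv ^^ k) f differentiable at x)"

lemma vderiv_eqI: "(\<And>x. (f has_vector_derivative g x) (at x)) \<Longrightarrow> vderiv f = g"
  unfolding vderiv_def by (rule ext) (rule vector_derivative_at)

text \<open>\<open>vderiv\<close> is a total function, so smoothness has to mean differentiability
  of every iterate; a class closed under differentiation contains all of them.\<close>

lemma smooth_closedI:
  assumes "f \<in> S" and step: "\<And>f. f \<in> S \<Longrightarrow> \<exists>g\<in>S. \<forall>x. (f has_vector_derivative g x) (at x)"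
  shows "smooth f"
proof -
  have S: "(vderiv ^^ k) f \<in> S" for k
  proof (induction k)
    case (Suc k)
    then obtain g where "g \<in> S" "\<forall>x. ((vderiv ^^ k) f has_vector_derivative g x) (at x)"
      using step by blast
    then show ?case using vderiv_eqI[of "(vderiv ^^ k) f" g] by simp
  qed (simp add: assms)
  show ?thesis
    unfolding smooth_def using step[OF S] by (meson differentiableI_vector)
qed

lemma smooth_vector_derivative:
  assumes "smooth f"
  shows "((vderiv ^^ k) f has_vector_derivative (vderiv ^^ Suc k) f x) (at x)"
  using assms vector_derivative_works[of "(vderiv ^^ k) f" "at x"] by (simp add: smooth_def vderiv_def)

lemma smooth_vector_derivative1: "smooth f \<Longrightarrow> (f has_vector_derivative vderiv f x) (at x)"
  using smooth_vector_derivative[of f 0 x] by simp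

lemma smooth_vderiv: "smooth f \<Longrightarrow> smooth (vderiv f)"
  unfolding smooth_def by (metis funpow_Suc_right o_apply)

lemma smooth_vderiv_pow: "smooth f \<Longrightarrow> smooth ((vderiv ^^ k) f)"
  by (induction k) (auto intro: smooth_vderiv)

lemma vderiv_pow_eqI:
  assumes "\<And>k x. (u k has_vector_derivative u (Suc k) x) (at x)"
  shows "(vderiv ^^ k) (u 0) = u k"
  by (induction k) (auto intro: vderiv_eqI assms)

lemma smooth_seqI:
  assumes "\<And>k x. (u k has_vector_derivative u (Suc k) x) (at x)"
  shows "smooth (u 0)"
  by (rule smooth_closedI[of _ "range u"]) (use assms in auto)

lemma smooth_continuous_on: "smooth f \<Longrightarrow> continuous_on S f"
  by (metis continuous_at_imp_continuous_on has_vector_derivative_continuous smooth_vector_derivative1)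

section \<open>The Leibniz rule\<close>

lemma leibniz_step:
  fixes a b :: "nat \<Rightarrow> complex"
  shows "(\<Sum>i\<le>k. of_nat (k choose i) * (a (Suc i) * b (k - i) + a i * b (Suc (k - i)))) =
    (\<Sum>i\<le>Suc k. of_nat (Suc k choose i) * (a i * b (Suc k - i)))"
proof -
  have "(\<Sum>i\<le>k. of_nat (k choose i) * (a i * b (Suc (k - i)))) =
      (\<Sum>i\<le>Suc k. of_nat (k choose i) * (a i * b (Suc k - i)))"
    by (simp add: Suc_diff_le)
  also have "\<dots> = a 0 * b (Suc k) + (\<Sum>i\<le>k. of_nat (k choose Suc i) * (a (Suc i) * b (k - i)))"
    by (simp add: sum.atMost_Suc_shift del: sum.atMost_Suc)
  finally have shift: "(\<Sum>i\<le>k. of_nat (k choose i) * (a i * b (Suc (k - i)))) =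
      a 0 * b (Suc k) + (\<Sum>i\<le>k. of_nat (k choose Suc i) * (a (Suc i) * b (k - i)))" .
  have "(\<Sum>i\<le>k. of_nat (k choose i) * (a (Suc i) * b (k - i) + a i * b (Suc (k - i)))) =
     a 0 * b (Suc k) + (\<Sum>i\<le>k. of_nat ((k choose i) + (k choose Suc i)) * (a (Suc i) * b (k - i)))"
    unfolding distrib_left sum.distrib shift by (simp add: sum.distrib distrib_right)
  also have "\<dots> = (\<Sum>i\<le>Suc k. of_nat (Suc k choose i) * (a i * b (Suc k - i)))"
    by (simp add: sum.atMost_Suc_shift del: sum.atMost_Suc)
  finally show ?thesis .
qed

text \<open>Formulated for two sequences of functions instead of iterated \<open>vderiv\<close>,
  because it is also applied to the chain of derivatives of an element of the maximal domain, which
  is not smooth.\<close>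

definition leibniz :: "(nat \<Rightarrow> real \<Rightarrow> complex) \<Rightarrow> (nat \<Rightarrow> real \<Rightarrow> complex) \<Rightarrow> nat \<Rightarrow> real \<Rightarrow> complex" where
  "leibniz u v k x = (\<Sum>i\<le>k. of_nat (k choose i) * (u i x * v (k - i) x))"

lemma leibniz_0: "leibniz u v 0 x = u 0 x * v 0 x"
  by (simp add: leibniz_def)

lemma leibniz_vector_derivative:
  assumes "\<And>i. i \<le> k \<Longrightarrow> (u i has_vector_derivative u (Suc i) x) (at x)"
    and "\<And>i. i \<le> k \<Longrightarrow> (v i has_vector_derivative v (Suc i) x) (at x)"
  shows "(leibniz u v k has_vector_derivative leibniz u v (Suc k) x) (at x)"
proof -
  have "((\<lambda>x. \<Sum>i\<le>k. of_nat (k choose i) * (u i x * v (k - i) x)) has_vector_derivative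
     (\<Sum>i\<le>k. of_nat (k choose i) * (u i x * v (Suc (k - i)) x + u (Suc i) x * v (k - i) x))) (at x)"
    using assms
    by (intro has_vector_derivative_sum has_vector_derivative_mult_right has_vector_derivative_mult) auto
  then show ?thesis
    unfolding leibniz_def[abs_def] leibniz_step[of k "\<lambda>i. u i x" "\<lambda>i. v i x", symmetric] by (simp add: add.commute)
qed

lemma smooth_mult_vderiv:
  assumes "smooth f" "smooth g"
  shows "smooth (\<lambda>x. f x * g x)"
    and "(vderiv ^^ k) (\<lambda>x. f x * g x) = leibniz (\<lambda>i. (vderiv ^^ i) f) (\<lambda>i. (vderiv ^^ i) g) k"
proof -
  let ?L = "leibniz (\<lambda>i. (vderiv ^^ i) f) (\<lambda>i. (vderiv ^^ i) g)"
  have L: "(?L k has_vector_derivative ?L (Suc k) x) (at x)" for k x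
    by (rule leibniz_vector_derivative) (rule smooth_vector_derivative[OF assms(1)] smooth_vector_derivative[OF assms(2)])+
  have [simp]: "?L 0 = (\<lambda>x. f x * g x)" by (simp add: fun_eq_iff leibniz_0)
  show "smooth (\<lambda>x. f x * g x)" using smooth_seqI[of ?L, OF L] by simp
  show "(vderiv ^^ k) (\<lambda>x. f x * g x) = ?L k" using vderiv_pow_eqI[of ?L, OF L] by simp
qed

lemmas smooth_mult = smooth_mult_vderiv(1)

lemma smooth_add_vderiv:
  assumes "smooth f" "smooth g"
  shows "smooth (\<lambda>x. f x + g x)"
    and "(vderiv ^^ k) (\<lambda>x. f x + g x) = (\<lambda>x. (vderiv ^^ k) f x + (vderiv ^^ k) g x)"
proof -
  let ?L = "\<lambda>k x. (vderiv ^^ k) f x + (vderiv ^^ k) g x"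
  have L: "(?L k has_vector_derivative ?L (Suc k) x) (at x)" for k x
    by (intro has_vector_derivative_add smooth_vector_derivative assms)
  show "smooth (\<lambda>x. f x + g x)" using smooth_seqI[of ?L, OF L] by simp
  show "(vderiv ^^ k) (\<lambda>x. f x + g x) = ?L k" using vderiv_pow_eqI[of ?L, OF L] by simp
qed

lemmas smooth_add = smooth_add_vderiv(1)

lemma smooth_cmult_vderiv:
  assumes "smooth f"
  shows "smooth (\<lambda>x. c * f x)"
    and "(vderiv ^^ k) (\<lambda>x. c * f x) = (\<lambda>x. c * (vderiv ^^ k) f x)"
proof -
  let ?L = "\<lambda>k x. c * (vderiv ^^ k) f x"
  have L: "(?L k has_vector_derivative ?L (Suc k) x) (at x)" for k x
    by (intro has_vector_derivative_mult_right smooth_vector_derivative assms)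
  show "smooth (\<lambda>x. c * f x)" using smooth_seqI[of ?L, OF L] by simp
  show "(vderiv ^^ k) (\<lambda>x. c * f x) = ?L k" using vderiv_pow_eqI[of ?L, OF L] by simp
qed

lemmas smooth_cmult = smooth_cmult_vderiv(1)

lemma smooth_affine_vderiv:
  assumes "smooth f"
  shows "smooth (\<lambda>x. f (c * x + d))"
    and "(vderiv ^^ k) (\<lambda>x. f (c * x + d)) = (\<lambda>x. of_real c ^ k * (vderiv ^^ k) f (c * x + d))"
proof -
  let ?L = "\<lambda>k x. of_real c ^ k * (vderiv ^^ k) f (c * x + d)"
  have L: "(?L k has_vector_derivative ?L (Suc k) x) (at x)" for k x
  proof -
    have "((vderiv ^^ k) f has_vector_derivative (vderiv ^^ Suc k) f (c * x + d)) (at (c * x + d))"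
      by (rule smooth_vector_derivative[OF assms])
    moreover have "((\<lambda>x. c * x + d) has_vector_derivative c) (at x)"
      by (auto intro!: derivative_eq_intros simp flip: has_real_derivative_iff_has_vector_derivative)
    ultimately have "((vderiv ^^ k) f \<circ> (\<lambda>x. c * x + d) has_vector_derivative c *\<^sub>R (vderiv ^^ Suc k) f (c * x + d)) (at x)"
      by (intro vector_diff_chain_at)
    then have "((\<lambda>x. of_real c ^ k * (vderiv ^^ k) f (c * x + d)) has_vector_derivative 
        of_real c ^ k * (c *\<^sub>R (vderiv ^^ Suc k) f (c * x + d))) (at x)"
      by (intro has_vector_derivative_mult_right) (simp add: o_def)
    then show ?thesis by (simp add: scaleR_conv_of_real mult_ac)
  qed
  show "smooth (\<lambda>x. f (c * x + d))" using smooth_seqI[of ?L, OF L] by simp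
  show "(vderiv ^^ k) (\<lambda>x. f (c * x + d)) = ?L k" using vderiv_pow_eqI[of ?L, OF L] by simp
qed

lemma smooth_const: "smooth (\<lambda>x. c)"
  using smooth_seqI[of "\<lambda>k x. if k = 0 then c else 0"] by simp

lemma vderiv_pow_eq_on_open:
  assumes "smooth f" "smooth g" "open S" "\<And>x. x \<in> S \<Longrightarrow> f x = g x" "x \<in> S"
  shows "(vderiv ^^ k) f x = (vderiv ^^ k) g x"
  using assms(5)
proof (induction k arbitrary: x)
  case (Suc k)
  have "((vderiv ^^ k) g has_vector_derivative (vderiv ^^ Suc k) f x) (at x)"
    using smooth_vector_derivative[OF assms(1)]
    by (rule has_vector_derivative_transform_within_open[OF _ assms(3) Suc.prems Suc.IH])
  then show ?case
    using smooth_vector_derivative[OF assms(2)] by (rule vector_derivative_unique_at)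
qed (simp add: assms)

lemma vderiv_pow_zero: "(vderiv ^^ k) (\<lambda>x. 0) = (\<lambda>x. 0)"
  using vderiv_pow_eqI[of "\<lambda>k x. 0" k] by simp

lemma monomial_vderiv:
  defines "p \<equiv> \<lambda>a x. of_real (x ^ a / fact a) :: complex"
  shows "smooth (p a)" "(vderiv ^^ k) (p a) = (\<lambda>x. if k \<le> a then p (a - k) x else 0)"
proof -
  let ?L = "\<lambda>k x. if k \<le> a then p (a - k) x else 0"
  have p: "(p (Suc b) has_vector_derivative p b x) (at x)" for b x
  proof -
    have "((\<lambda>x. x ^ Suc b / fact (Suc b)) has_real_derivative (real (Suc b) * x ^ b / fact (Suc b))) (at x)"
    proof -
      have eq: "real (Suc b) * x ^ b / fact (Suc b) = real (Suc b) * x ^ (Suc b - Suc 0) / fact (Suc b)" by simp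
      show ?thesis unfolding eq by (rule DERIV_cdivide[OF DERIV_pow])
    qed
    moreover have "real (Suc b) * x ^ b / fact (Suc b) = x ^ b / fact b"
      by (simp add: fact_reduce divide_simps)
    ultimately show ?thesis
      unfolding p_def by (intro has_vector_derivative_of_real) (simp flip: has_real_derivative_iff_has_vector_derivative)
  qed
  have p0: "p 0 = (\<lambda>x. 1)" by (simp add: p_def)
  have L: "(?L k has_vector_derivative ?L (Suc k) x) (at x)" for k x
  proof -
    consider "Suc k \<le> a" | "k = a" | "k > a" by linarith
    then show ?thesis
    proof cases
      case 1
      then have "a - k = Suc (a - Suc k)" by simp
      then show ?thesis using p[of "a - Suc k" x] 1 by simp
    qed (simp_all add: p0)
  qed
  show "smooth (p a)" using smooth_seqI[of ?L, OF L] by simp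
  show "(vderiv ^^ k) (p a) = ?L k" using vderiv_pow_eqI[of ?L, OF L] by simp
qed

lemma smooth_polynomial_function: "polynomial_function f \<Longrightarrow> smooth f"
  by (rule smooth_closedI[of _ "Collect polynomial_function"]) (auto dest: has_vector_derivative_polynomial_function)

subsection \<open>Cutoff functions\<close>

text \<open>The functions p(1/x) exp(-1/x), extended by zero. With arbitrary polynomials p the
  family is closed under differentiation, so that one derivative computation yields
  smoothness.\<close>

definition flat_exp :: "real poly \<Rightarrow> real \<Rightarrow> real" where
  "flat_exp p x = (if x > 0 then poly p (1 / x) * exp (- (1 / x)) else 0)"

lemma poly_times_exp_tendsto_0: "((\<lambda>t. poly p t * exp (- t)) \<longlongrightarrow> (0::real)) at_top"
proof -
  have "((\<lambda>t. \<Sum>i\<le>degree p. coeff p i * (t ^ i / exp t)) \<longlongrightarrow> (\<Sum>i\<le>degree p. coeff p i * 0)) at_top"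
    by (intro tendsto_sum tendsto_mult tendsto_const tendsto_power_div_exp_0)
  then show ?thesis
    by (simp add: poly_altdef sum_distrib_right exp_minus divide_inverse mult.assoc)
qed

text \<open>The chain rule produces the factor 1/x^2 twice, with sign minus from p(1/x) and with
  sign plus from the exponential; hence the polynomial X^2 (p - p').\<close>

lemma flat_exp_has_derivative:
  "(flat_exp p has_real_derivative flat_exp ([:0, 0, 1:] * (p - pderiv p)) x) (at x)"
proof -
  let ?q = "[:0, 0, 1:] * (p - pderiv p)"
  consider "x > 0" | "x < 0" | "x = 0" by linarith
  then show ?thesis
  proof cases
    case 1
    have "((\<lambda>x. poly p (1 / x) * exp (- (1 / x))) has_real_derivative flat_exp ?q x) (at x)"
      using 1 by (auto intro!: derivative_eq_intros DERIV_chain'[OF _ poly_DERIV] simp: flat_exp_def field_simps power2_eq_square)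
    then show ?thesis
      by (rule has_field_derivative_transform_within_open[of _ _ _ "{0<..}"]) (use 1 in \<open>auto simp: flat_exp_def\<close>)
  next
    case 2
    have "((\<lambda>x. 0) has_real_derivative 0) (at x)" by simp
    then have "(flat_exp p has_real_derivative 0) (at x)"
      by (rule has_field_derivative_transform_within_open[of _ _ _ "{..<0}"]) (use 2 in \<open>auto simp: flat_exp_def\<close>)
    then show ?thesis using 2 by (simp add: flat_exp_def)
  next
    case 3
    \<comment> \<open>With t = 1/h the difference quotient at 0 from the right is t p(t) exp(-t),
      which tends to 0 as t grows.\<close>
    have "((\<lambda>h. flat_exp p h / h) \<longlongrightarrow> 0) (at_right 0)"
    proof -
      have "((\<lambda>t. poly ([:0, 1:] * p) t * exp (- t)) \<longlongrightarrow> (0::real)) at_top"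
        by (rule poly_times_exp_tendsto_0)
      then have "((\<lambda>h. poly ([:0, 1:] * p) (inverse h) * exp (- inverse h)) \<longlongrightarrow> (0::real)) (at_right 0)"
        by (rule filterlim_compose) (rule filterlim_inverse_at_top_right)
      then show ?thesis
        by (rule Lim_transform_eventually)
           (auto simp: flat_exp_def field_simps intro!: eventually_mono[OF eventually_at_right_less])
    qed
    moreover have "((\<lambda>h. flat_exp p h / h) \<longlongrightarrow> 0) (at_left 0)"
    proof (rule tendsto_eventually)
      have "\<forall>\<^sub>F h in at_left (0::real). h < 0" by (auto simp: eventually_at_filter)
      then show "\<forall>\<^sub>F h in at_left 0. flat_exp p h / h = 0"
        by eventually_elim (simp add: flat_exp_def)
    qed
    ultimately have "((\<lambda>h. flat_exp p h / h) \<longlongrightarrow> 0) (at 0)"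
      by (simp add: filterlim_at_split)
    then show ?thesis
      using 3 by (simp add: has_field_derivative_iff flat_exp_def)
  qed
qed

lemma smooth_flat_exp: "smooth (\<lambda>x. of_real (flat_exp p x))"
proof (rule smooth_closedI[of _ "range (\<lambda>p x. of_real (flat_exp p x))"])
  fix f assume "f \<in> range (\<lambda>p x. complex_of_real (flat_exp p x))"
  then obtain p where f: "f = (\<lambda>x. complex_of_real (flat_exp p x))" by blast
  have "\<forall>x. (f has_vector_derivative of_real (flat_exp ([:0, 0, 1:] * (p - pderiv p)) x)) (at x)"
    unfolding f using flat_exp_has_derivative[of p]
    by (intro allI has_vector_derivative_of_real) (simp only: has_real_derivative_iff_has_vector_derivative)
  then show "\<exists>g\<in>range (\<lambda>p x. complex_of_real (flat_exp p x)). \<forall>x. (f has_vector_derivative g x) (at x)"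
    by (rule bexI[where x = "\<lambda>x. complex_of_real (flat_exp ([:0, 0, 1:] * (p - pderiv p)) x)"]) (rule rangeI)
qed auto

text \<open>For negative x the integral over \<open>{0..x}\<close> is 0 rather than minus an
  integral; the vanishing of \<phi> up to some a > 0 makes the two agree, and the antiderivative is
  smooth across 0.\<close>

lemma smooth_antiderivative:
  assumes "smooth \<phi>" "0 < a" "\<And>x. x \<le> a \<Longrightarrow> \<phi> x = 0"
  shows "smooth (\<lambda>x. integral {0..x} \<phi>)" "vderiv (\<lambda>x. integral {0..x} \<phi>) = \<phi>"
    "\<And>x. x \<le> a \<Longrightarrow> integral {0..x} \<phi> = 0"
proof -
  let ?\<Psi> = "\<lambda>x. integral {0..x} \<phi>"
  show zero: "?\<Psi> x = 0" if "x \<le> a" for x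
    using that assms(3) by (subst Henstock_Kurzweil_Integration.integral_cong[of _ _ "\<lambda>_. 0"]) auto
  have der: "(?\<Psi> has_vector_derivative \<phi> x) (at x)" for x
  proof (cases "x > 0")
    case True
    have "(?\<Psi> has_vector_derivative \<phi> x) (at x within {0..x+1})"
      by (rule integral_has_vector_derivative) (use True in \<open>auto intro: smooth_continuous_on[OF assms(1)]\<close>)
    moreover have "at x within {0..x+1} = at x"
      using True by (intro at_within_interior) simp
    ultimately show ?thesis by simp
  next
    case False
    have "((\<lambda>x. 0) has_vector_derivative 0) (at x)" by simp
    then have "(?\<Psi> has_vector_derivative 0) (at x)"
      by (rule has_vector_derivative_transform_within_open[of _ _ _ "{..<a}"]) (use False assms(2) zero in auto)
    then show ?thesis using False assms(2,3) by simp
  qed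
  show "smooth ?\<Psi>"
  proof (rule smooth_closedI[of _ "insert ?\<Psi> (Collect smooth)"])
    fix f assume "f \<in> insert ?\<Psi> (Collect smooth)"
    then show "\<exists>g\<in>insert ?\<Psi> (Collect smooth). \<forall>x. (f has_vector_derivative g x) (at x)"
    proof
      assume "f = ?\<Psi>"
      then show ?thesis using der assms(1) by (intro bexI[of _ \<phi>]) auto
    next
      assume "f \<in> Collect smooth"
      then show ?thesis using smooth_vector_derivative1 smooth_vderiv by (intro bexI[of _ "vderiv f"]) auto
    qed
  qed simp
  show "vderiv ?\<Psi> = \<phi>"
    by (rule vderiv_eqI[OF der])
qed

lemma exists_smooth_bump:
  obtains \<beta> :: "real \<Rightarrow> complex" and b where "smooth \<beta>" "\<And>x. x \<le> 1 \<Longrightarrow> \<beta> x = 0" "\<And>x. x \<ge> 2 \<Longrightarrow> \<beta> x = 0"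
    "\<beta> = (\<lambda>x. of_real (b x))" "\<And>x. b x \<ge> 0" "integral {0..2} b = 1" "continuous_on UNIV b"
proof -
  define e where "e = flat_exp 1"
  \<comment> \<open>Positive exactly on (1, 2). The affine arguments are spelled out to fit
    \<open>smooth_affine_vderiv\<close>.\<close>
  define b where "b = (\<lambda>x. e (1 * x + (-1)) * e ((-1) * x + 2))"
  have sm: "smooth (\<lambda>x. of_real (e (1 * x + (-1))) * of_real (e ((-1) * x + 2)))"
    unfolding e_def by (intro smooth_mult smooth_affine_vderiv(1)[of "\<lambda>x. of_real (flat_exp 1 x)"] smooth_flat_exp)
  have ec: "continuous_on S e" for S
    unfolding e_def using flat_exp_has_derivative[of 1]
    by (meson DERIV_isCont continuous_at_imp_continuous_on)
  have cont: "continuous_on S b" for S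
    unfolding b_def by (intro continuous_intros continuous_on_compose2[OF ec[of UNIV]]) auto
  have nn: "b x \<ge> 0" for x by (simp add: b_def e_def flat_exp_def)
  have "integral {0..2} b \<noteq> 0"
  proof
    assume "integral {0..2} b = 0"
    then have "(b has_integral 0) {0..2}"
      using integrable_continuous_real[OF cont] by (metis integrable_integral)
    then have "b (3/2) = 0"
      by (intro has_integral_0_cbox_imp_0[of 0 2 b, unfolded cbox_interval box_real]) (auto simp: nn cont)
    then show False by (simp add: b_def e_def flat_exp_def)
  qed
  moreover have "integral {0..2} b \<ge> 0"
    by (rule integral_nonneg) (auto simp: nn intro: integrable_continuous_real cont)
  ultimately have pos: "integral {0..2} b > 0" by simp
  define c where "c = inverse (integral {0..2} b)"
  show thesis
  proof (rule that[of "\<lambda>x. of_real (c * b x)" "\<lambda>x. c * b x"])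
    have "smooth (\<lambda>x. of_real c * (of_real (e (1 * x + (-1))) * of_real (e ((-1) * x + 2))))"
      by (rule smooth_cmult[OF sm])
    then show "smooth (\<lambda>x. of_real (c * b x))" by (simp add: b_def)
    show "integral {0..2} (\<lambda>x. c * b x) = 1" using pos by (simp add: c_def)
    show "continuous_on UNIV (\<lambda>x. c * b x)" by (intro continuous_intros cont)
  qed (use pos nn in \<open>auto simp: b_def e_def flat_exp_def c_def\<close>)
qed

lemma exists_smooth_step:
  obtains \<sigma> where "smooth \<sigma>" "\<And>x. x \<le> 1 \<Longrightarrow> \<sigma> x = 0" "\<And>x. x \<ge> 2 \<Longrightarrow> \<sigma> x = 1" "\<And>x. cmod (\<sigma> x) \<le> 1"
proof -
  obtain \<beta> b where b: "smooth \<beta>" "\<And>x. x \<le> 1 \<Longrightarrow> \<beta> x = 0" "\<And>x. x \<ge> 2 \<Longrightarrow> \<beta> x = 0"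
    "\<beta> = (\<lambda>x. of_real (b x))" "\<And>x. b x \<ge> 0" "integral {0..2} b = 1" "continuous_on UNIV b"
    using exists_smooth_bump by blast
  let ?\<sigma> = "\<lambda>x. integral {0..x} \<beta>"
  have int: "b integrable_on {x..y}" for x y
    by (rule integrable_continuous_real) (rule continuous_on_subset[OF b(7)], simp)
  have eq: "?\<sigma> x = of_real (integral {0..x} b)" for x
    unfolding b(4) by (metis int integral_complex_of_real integral_of_real has_integral_of_real integrable_integral integral_unique)
  have b0: "b x = 0" if "x \<ge> 2" for x using b(3)[OF that] b(4) by simp
  have one: "integral {0..x} b = 1" if "x \<ge> 2" for x
  proof -
    have "integral {0..2} b + integral {2..x} b = integral {0..x} b"
      by (rule Henstock_Kurzweil_Integration.integral_combine) (use that int in auto)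
    moreover have "integral {2..x} b = integral {2..x} (\<lambda>_. 0)"
      by (rule Henstock_Kurzweil_Integration.integral_cong) (simp add: b0)
    ultimately show ?thesis using b(6) by simp
  qed
  have bd: "0 \<le> integral {0..x} b" "integral {0..x} b \<le> 1" for x
  proof -
    show "0 \<le> integral {0..x} b" by (rule integral_nonneg) (use int b(5) in auto)
    have "integral {0..x} b \<le> integral {0..max 2 x} b"
      by (rule integral_subset_le) (use int b(5) in auto)
    also have "\<dots> = 1" by (rule one) simp
    finally show "integral {0..x} b \<le> 1" .
  qed
  show thesis
  proof (rule that[of ?\<sigma>])
    show "smooth ?\<sigma>" "\<And>x. x \<le> 1 \<Longrightarrow> ?\<sigma> x = 0"
      using smooth_antiderivative[OF b(1), of 1] b(2) by simp_all
  qed (use bd in \<open>auto simp: eq one norm_of_real\<close>)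
qed

lemma exists_smooth_cutoff:
  obtains \<eta> where "smooth \<eta>" "\<And>x. x \<le> 1 \<Longrightarrow> \<eta> x = 1" "\<And>x. x \<ge> 2 \<Longrightarrow> \<eta> x = 0" "\<And>x. cmod (\<eta> x) \<le> 1"
proof -
  obtain \<sigma> where s: "smooth \<sigma>" "\<And>x. x \<le> 1 \<Longrightarrow> \<sigma> x = 0" "\<And>x. x \<ge> 2 \<Longrightarrow> \<sigma> x = 1" "\<And>x. cmod (\<sigma> x) \<le> 1"
    using exists_smooth_step by blast
  show thesis
    by (rule that[of "\<lambda>x. \<sigma> ((-1) * x + 3)"]) (use s smooth_affine_vderiv(1)[OF s(1), of "-1" 3] in auto)
qed

text \<open>A function with prescribed jet at 0: only its a-th derivative is nonzero there, so that
  in \<open>boundary_form\<close> it selects one boundary value. Small support together with the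
  bound 1, uniform in \<epsilon>, makes its L2 norm small.\<close>

lemma exists_jet:
  fixes a :: nat and \<epsilon> :: real
  assumes "0 < \<epsilon>" "\<epsilon> \<le> 1"
  obtains w where "\<And>k x. (w k has_vector_derivative w (Suc k) x) (at x)"
    "\<And>k. w k 0 = (if k = a then 1 else 0)" "\<And>k x. x \<ge> \<epsilon> \<Longrightarrow> w k x = 0" "\<And>x. x \<ge> 0 \<Longrightarrow> cmod (w 0 x) \<le> 1"
proof -
  obtain \<eta> where c: "smooth \<eta>" "\<And>x. x \<le> 1 \<Longrightarrow> \<eta> x = 1" "\<And>x. x \<ge> 2 \<Longrightarrow> \<eta> x = 0" "\<And>x. cmod (\<eta> x) \<le> 1"
    using exists_smooth_cutoff by blast
  define p where "p = (\<lambda>x. of_real (x ^ a / fact a) :: complex)"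
  \<comment> \<open>The cutoff is 1 up to \<epsilon>/4 and 0 from \<epsilon>/2 on, so that all
    derivatives agree with those of p near 0 and vanish on an open set containing
    \<epsilon>.\<close>
  define f where "f = (\<lambda>x. p x * \<eta> (4 / \<epsilon> * x + 0))"
  have p: "smooth p" unfolding p_def by (rule monomial_vderiv)
  have f: "smooth f"
    unfolding f_def by (intro smooth_mult p smooth_affine_vderiv(1) c(1))
  have fz: "f x = 0" if "x > \<epsilon> / 2" for x
    using that assms c(3)[of "4 / \<epsilon> * x + 0"] by (simp add: f_def field_simps)
  have fp: "f x = p x" if "x < \<epsilon> / 4" for x
    using that assms c(2)[of "4 / \<epsilon> * x + 0"] by (simp add: f_def field_simps)
  show thesis
  proof (rule that[of "\<lambda>k. (vderiv ^^ k) f"])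
    show "((vderiv ^^ k) f has_vector_derivative (vderiv ^^ Suc k) f x) (at x)" for k x
      by (rule smooth_vector_derivative[OF f])
    show "(vderiv ^^ k) f 0 = (if k = a then 1 else 0)" for k
    proof -
      have "(vderiv ^^ k) f 0 = (vderiv ^^ k) p 0"
        by (rule vderiv_pow_eq_on_open[OF f p, of "{..<\<epsilon> / 4}"]) (use assms fp in auto)
      also have "\<dots> = (if k = a then 1 else 0)"
        unfolding p_def monomial_vderiv(2) by (auto simp: power_0_left)
      finally show ?thesis .
    qed
    show "(vderiv ^^ k) f x = 0" if "x \<ge> \<epsilon>" for k x
    proof -
      have "(vderiv ^^ k) f x = (vderiv ^^ k) (\<lambda>x. 0) x"
        by (rule vderiv_pow_eq_on_open[OF f smooth_const, of "{\<epsilon> / 2<..}"]) (use assms fz that in auto)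
      then show ?thesis by (simp add: vderiv_pow_zero)
    qed
    show "cmod ((vderiv ^^ 0) f x) \<le> 1" if "x \<ge> 0" for x
    proof (cases "x > 1")
      case True
      then show ?thesis using fz assms by simp
    next
      case False
      then have "x ^ a \<le> 1" using that by (simp add: power_le_one)
      also have "(1::real) \<le> fact a" by simp
      finally have "cmod (p x) \<le> 1" using that by (simp add: p_def norm_of_real norm_divide norm_power)
      then show ?thesis
        using mult_mono[of "cmod (p x)" 1 "cmod (\<eta> (4 / \<epsilon> * x + 0))" 1] c(4)
        by (simp add: f_def norm_mult)
    qed
  qed
qed

section \<open>Weak derivatives and the adjoint of the minimal operator\<close>

lemma test_functions_iff:
  "\<phi> \<in> test_functions \<longleftrightarrow> smooth \<phi> \<and> (\<exists>a b. 0 < a \<and> (\<forall>x. x \<le> a \<or> b \<le> x \<longrightarrow> \<phi> x = 0))"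
proof -
  have "(\<exists>a b. 0 < a \<and> (\<forall>x. x \<le> a \<or> b \<le> x \<longrightarrow> \<phi> x = 0))"
    if "0 < a" "\<forall>x. x \<notin> {a..b} \<longrightarrow> \<phi> x = 0" for a b :: real
    by (rule exI[of _ "a / 2"], rule exI[of _ "b + 1"]) (use that in auto)
  moreover have "\<exists>a b. 0 < a \<and> (\<forall>x. x \<notin> {a..b} \<longrightarrow> \<phi> x = 0)"
    if "0 < a" "\<forall>x. x \<le> a \<or> b \<le> x \<longrightarrow> \<phi> x = 0" for a b :: real
    by (rule exI[of _ a], rule exI[of _ b]) (use that in auto)
  ultimately show ?thesis
    unfolding test_functions_def smooth_def by blast
qed

lemma test_functionsE:
  assumes "\<phi> \<in> test_functions"
  obtains a b where "smooth \<phi>" "0 < a" "a < b" "\<And>k x. x \<le> a \<or> b \<le> x \<Longrightarrow> (vderiv ^^ k) \<phi> x = 0"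
proof -
  obtain a b where ab: "smooth \<phi>" "0 < a" "\<And>x. x \<le> a \<or> b \<le> x \<Longrightarrow> \<phi> x = 0"
    using assms unfolding test_functions_iff by blast
  \<comment> \<open>Halving a and enlarging b puts every such x into an open set on which \<phi>
    vanishes, so that its derivatives vanish there too.\<close>
  have "(vderiv ^^ k) \<phi> x = (vderiv ^^ k) (\<lambda>x. 0) x" if "x \<le> a / 2 \<or> max a b + 1 \<le> x" for k x
    by (rule vderiv_pow_eq_on_open[OF ab(1) smooth_const, of "{..<a} \<union> {b<..}"]) (use that ab in auto)
  then show thesis
    using ab(1,2) by (intro that[of "a / 2" "max a b + 1"]) (auto simp: vderiv_pow_zero)
qed

lemma test_vderiv_pow: "\<phi> \<in> test_functions \<Longrightarrow> (vderiv ^^ k) \<phi> \<in> test_functions"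
  by (metis test_functionsE test_functions_iff smooth_vderiv_pow)

lemma test_add_cmult:
  assumes "\<phi> \<in> test_functions" "\<psi> \<in> test_functions"
  shows "(\<lambda>x. \<phi> x + c * \<psi> x) \<in> test_functions"
proof -
  obtain a b where ab: "0 < a" "\<And>x. x \<le> a \<or> b \<le> x \<Longrightarrow> \<phi> x = 0"
    using assms(1) unfolding test_functions_iff by blast
  obtain a' b' where ab': "0 < a'" "\<And>x. x \<le> a' \<or> b' \<le> x \<Longrightarrow> \<psi> x = 0"
    using assms(2) unfolding test_functions_iff by blast
  have "\<forall>x. x \<le> min a a' \<or> max b b' \<le> x \<longrightarrow> \<phi> x + c * \<psi> x = 0"
    using ab ab' by auto
  moreover have "smooth (\<lambda>x. \<phi> x + c * \<psi> x)"
    using assms by (auto simp: test_functions_iff intro: smooth_add smooth_cmult)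
  moreover have "0 < min a a'" using ab ab' by simp
  ultimately show ?thesis unfolding test_functions_iff by blast
qed

lemma smooth_ac_deriv: "smooth f \<Longrightarrow> ac_deriv ((vderiv ^^ k) f) ((vderiv ^^ Suc k) f)"
  by (rule ac_derivI_vector)
     (auto intro: has_vector_derivative_at_within smooth_vector_derivative[of f k, simplified] smooth_continuous_on smooth_vderiv smooth_vderiv_pow)

section \<open>Integrals against test functions\<close>

lemma integral_halfline_eq_Icc:
  fixes f :: "real \<Rightarrow> complex"
  assumes "\<And>x. x \<ge> b \<Longrightarrow> f x = 0"
  shows "integral {0<..} f = integral {0..b} f"
proof (rule integral_spike_set)
  have "f x = 0" if "x \<in> {0<..} - {0..b}" for x
    using that by (intro assms(1)) auto
  then have "{x \<in> {0<..} - {0..b}. f x \<noteq> 0} = {}" by blast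
  then show "negligible {x \<in> {0<..} - {0..b}. f x \<noteq> 0}" by (simp only: negligible_empty)
  show "negligible {x \<in> {0..b} - {0<..}. f x \<noteq> 0}"
    by (rule negligible_subset[of "{0}"]) auto
qed

lemma integrable_on_halfline_Icc:
  fixes f :: "real \<Rightarrow> complex"
  assumes "\<And>x. x \<ge> b \<Longrightarrow> f x = 0" "f integrable_on {0..b}"
  shows "f integrable_on {0<..}"
proof (rule integrable_spike_set[OF assms(2)])
  have "f x = 0" if "x \<in> {0<..} - {0..b}" for x
    using that by (intro assms(1)) auto
  then have "{x \<in> {0<..} - {0..b}. f x \<noteq> 0} = {}" by blast
  then show "negligible {x \<in> {0<..} - {0..b}. f x \<noteq> 0}" by (simp only: negligible_empty)
  show "negligible {x \<in> {0..b} - {0<..}. f x \<noteq> 0}"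
    by (rule negligible_subset[of "{0}"]) auto
qed

lemma smooth_compact_mult_integrable:
  assumes "smooth \<phi>" "\<And>x. x \<ge> b \<Longrightarrow> \<phi> x = 0" "k absolutely_integrable_on {0..b}"
  shows "(\<lambda>x. \<phi> x * k x) integrable_on {0<..}"
proof (rule integrable_on_halfline_Icc[of b])
  have "(\<lambda>x. \<phi> x * k x) absolutely_integrable_on {0..b}"
    by (rule absolutely_integrable_continuous_mult[OF smooth_continuous_on[OF assms(1)] assms(3)])
  then show "(\<lambda>x. \<phi> x * k x) integrable_on {0..b}" by (rule set_lebesgue_integral_eq_integral)
qed (simp add: assms)

lemma test_mult_integrable:
  assumes "\<phi> \<in> test_functions" "\<And>x. k absolutely_integrable_on {0..x}"
  shows "(\<lambda>x. \<phi> x * k x) integrable_on {0<..}"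
  using assms unfolding test_functions_iff by (metis smooth_compact_mult_integrable)

text \<open>Lebesgue differentiation, applied to the extension of k by zero to the whole
  line.\<close>

lemma AE_zero_of_integrals_zero:
  fixes k :: "real \<Rightarrow> complex"
  assumes int: "\<And>x. k absolutely_integrable_on {0..x}" and zero: "\<And>x. x \<ge> 0 \<Longrightarrow> integral {0..x} k = 0"
  shows "AE x in halfline. k x = 0"
proof -
  have kint: "k integrable_on {a..b}" if "0 \<le> a" for a b
  proof (cases "a \<le> b")
    case True
    have "k integrable_on {0..b}" using int[of b] by (rule set_lebesgue_integral_eq_integral)
    then show ?thesis by (rule integrable_on_subinterval) (use that in auto)
  qed auto
  let ?f = "\<lambda>x. if x \<in> {0..} then k x else 0"
  have "?f integrable_on cbox a b" for a b :: real
  proof -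
    have "{0..} \<inter> {a..b} = {max 0 a..b}" by auto
    then show ?thesis using kint[of "max 0 a" b] by (simp only: integrable_restrict_Int cbox_interval)
  qed
  then obtain N where N: "negligible N" "\<And>x e. \<lbrakk>x \<notin> N; 0 < e\<rbrakk> \<Longrightarrow> \<exists>d>0. \<forall>h. 0 < h \<and> h < d \<longrightarrow>
      norm (integral (cbox x (x + h *\<^sub>R One)) ?f /\<^sub>R h ^ DIM(real) - ?f x) < e"
    using integrable_ccontinuous_explicit[of ?f] by blast
  have "k x = 0" if x: "x \<notin> N" "x > 0" for x
  proof (rule ccontr)
    assume "k x \<noteq> 0"
    then obtain d where d: "d > 0" "\<And>h. 0 < h \<and> h < d \<Longrightarrow>
      norm (integral (cbox x (x + h *\<^sub>R One)) ?f /\<^sub>R h ^ DIM(real) - ?f x) < norm (k x)"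
      using N(2)[of x "norm (k x)"] x by auto
    have "integral {x..x + d / 2} ?f = integral {x..x + d / 2} k"
      by (rule Henstock_Kurzweil_Integration.integral_cong) (use that in auto)
    also have "\<dots> = integral {0..x + d / 2} k - integral {0..x} k"
      using Henstock_Kurzweil_Integration.integral_combine[of 0 x "x + d / 2" k] that d(1) kint by (simp add: algebra_simps)
    also have "\<dots> = 0" using zero that d(1) by simp
    finally show False using d(2)[of "d / 2"] d(1) that by simp
  qed
  moreover have "AE x in lebesgue. x \<notin> N"
    using N(1) by (simp add: negligible_iff_null_sets AE_not_in)
  ultimately show ?thesis unfolding AE_halfline_iff by (auto elim: eventually_mono)
qed

text \<open>The fundamental lemma of the calculus of variations: the indicator of (0, X) is a
  bounded pointwise limit of test functions, so the integrals of g over \<open>{0..X}\<close> vanish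
  as well.\<close>

lemma AE_zero_of_test_integrals_zero:
  assumes int: "\<And>x. g absolutely_integrable_on {0..x}"
    and zero: "\<And>\<phi>. \<phi> \<in> test_functions \<Longrightarrow> integral {0<..} (\<lambda>x. \<phi> x * g x) = 0"
  shows "AE x in halfline. g x = 0"
proof (rule AE_zero_of_integrals_zero[OF int])
  fix X :: real assume X: "X \<ge> 0"
  obtain \<sigma> where s: "smooth \<sigma>" "\<And>x. x \<le> 1 \<Longrightarrow> \<sigma> x = 0" "\<And>x. x \<ge> 2 \<Longrightarrow> \<sigma> x = 1" "\<And>x. cmod (\<sigma> x) \<le> 1"
    using exists_smooth_step by blast
  \<comment> \<open>Each factor cuts off one end point: \<phi> m vanishes within 1/(m+1) of 0 and of
    X and equals 1 at points of (0, X) at distance at least 2/(m+1) from both.\<close>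
  define \<phi> where "\<phi> = (\<lambda>m t. \<sigma> (real (Suc m) * t + 0) * \<sigma> (- real (Suc m) * t + real (Suc m) * X))"
  have sm: "smooth (\<phi> m)" for m
    unfolding \<phi>_def by (intro smooth_mult smooth_affine_vderiv(1) s(1))
  have z: "\<phi> m t = 0" if "t \<ge> X" for m t
  proof -
    have "real (Suc m) * X \<le> real (Suc m) * t" using that by (intro mult_left_mono) auto
    then have "- real (Suc m) * t + real (Suc m) * X \<le> 1" by linarith
    then show ?thesis by (simp only: \<phi>_def s(2) mult_zero_right)
  qed
  have z': "\<phi> m t = 0" if "t \<le> 1 / real (Suc m)" for m t
    using s(2)[of "real (Suc m) * t + 0"] that by (simp add: \<phi>_def field_simps)
  have test: "\<phi> m \<in> test_functions" for m
    unfolding test_functions_iff using sm z z' by (metis of_nat_0_less_iff zero_less_Suc zero_less_divide_1_iff)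
  have bd: "cmod (\<phi> m t) \<le> 1" for m t
    using mult_mono[OF s(4) s(4)] by (simp add: \<phi>_def norm_mult)
  have lim: "(\<lambda>m. \<phi> m t * g t) \<longlonglongrightarrow> (if t \<in> {0<..<X} then g t else 0)" if t: "t \<in> {0..X}" for t
  proof (cases "t \<in> {0<..<X}")
    case True
    obtain M where M: "2 / min t (X - t) \<le> real M" using real_arch_simple by blast
    have "\<phi> m t = 1" if "m \<ge> M" for m
    proof -
      have "2 / min t (X - t) \<le> real (Suc m)" using M that by linarith
      then have "2 \<le> real (Suc m) * min t (X - t)" using True by (simp add: pos_divide_le_eq)
      moreover have "real (Suc m) * min t (X - t) \<le> real (Suc m) * t"
        "real (Suc m) * min t (X - t) \<le> real (Suc m) * (X - t)"
        by (intro mult_left_mono; simp)+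
      ultimately have "2 \<le> real (Suc m) * t + 0" "2 \<le> - real (Suc m) * t + real (Suc m) * X"
        unfolding right_diff_distrib by linarith+
      then show ?thesis by (simp only: \<phi>_def s(3) mult_1)
    qed
    then have "\<forall>\<^sub>F m in sequentially. \<phi> m t * g t = g t"
      by (auto simp: eventually_sequentially intro!: exI[of _ M])
    then show ?thesis using True by (simp add: tendsto_eventually)
  next
    case False
    then have "t = 0 \<or> t = X" using t by auto
    then have "\<phi> m t = 0" for m using z z'[of 0 m] by auto
    then show ?thesis using False by auto
  qed
  have "(\<lambda>m. integral {0..X} (\<lambda>t. \<phi> m t * g t)) \<longlonglongrightarrow> integral {0..X} (\<lambda>t. if t \<in> {0<..<X} then g t else 0)"
  proof (rule dominated_convergence(2))
    show "(\<lambda>t. \<phi> m t * g t) integrable_on {0..X}" for m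
      by (rule set_lebesgue_integral_eq_integral(1)[OF absolutely_integrable_continuous_mult[OF smooth_continuous_on[OF sm] int]])
    show "(\<lambda>t. norm (g t)) integrable_on {0..X}"
      using int[of X] by (simp add: absolutely_integrable_on_def)
    show "norm (\<phi> m t * g t) \<le> norm (g t)" for m t
      using bd[of m t] by (simp add: norm_mult mult_left_le_one_le)
  qed (rule lim)
  moreover have "integral {0..X} (\<lambda>t. \<phi> m t * g t) = 0" for m
    using zero[OF test[of m]] integral_halfline_eq_Icc[of X "\<lambda>t. \<phi> m t * g t"] z by simp
  ultimately have "integral {0..X} (\<lambda>t. if t \<in> {0<..<X} then g t else 0) = 0"
    by (simp add: LIMSEQ_const_iff)
  moreover have "integral {0..X} (\<lambda>t. if t \<in> {0<..<X} then g t else 0) = integral {0..X} g"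
    by (rule integral_spike[of "{0, X}"]) auto
  ultimately show "integral {0..X} g = 0" by simp
qed

lemma test_integral_by_parts:
  assumes "\<psi> \<in> test_functions" "ac_deriv H h"
  shows "integral {0<..} (\<lambda>x. vderiv \<psi> x * H x) = - integral {0<..} (\<lambda>x. \<psi> x * h x)"
proof -
  obtain a b where ab: "smooth \<psi>" "0 < a" "a < b" "\<And>k x. x \<le> a \<or> b \<le> x \<Longrightarrow> (vderiv ^^ k) \<psi> x = 0"
    using test_functionsE[OF assms(1)] by metis
  have z: "\<psi> x = 0" "vderiv \<psi> x = 0" if "x \<le> a \<or> b \<le> x" for x
    using ab(4)[of x 0] ab(4)[of x 1] that by auto
  have 1: "ac_deriv (\<lambda>x. \<psi> x * H x) (\<lambda>x. vderiv \<psi> x * H x + \<psi> x * h x)"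
    using ac_deriv_mult[OF smooth_ac_deriv[OF ab(1), of 0] assms(2)] by simp
  have i1: "(\<lambda>x. vderiv \<psi> x * H x) integrable_on {0<..}"
    by (rule smooth_compact_mult_integrable[of _ b])
       (use ab z smooth_vderiv ac_deriv_continuous[OF assms(2)] in
         \<open>auto intro!: absolutely_integrable_continuous_real elim: continuous_on_subset\<close>)
  have i2: "(\<lambda>x. \<psi> x * h x) integrable_on {0<..}"
    by (rule smooth_compact_mult_integrable[of _ b]) (use ab z ac_deriv_integrable[OF assms(2)] in auto)
  have "integral {0<..} (\<lambda>x. vderiv \<psi> x * H x) + integral {0<..} (\<lambda>x. \<psi> x * h x) =
      integral {0<..} (\<lambda>x. vderiv \<psi> x * H x + \<psi> x * h x)"
    by (rule Henstock_Kurzweil_Integration.integral_add[symmetric, OF i1 i2])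
  also have "\<dots> = integral {0..b} (\<lambda>x. vderiv \<psi> x * H x + \<psi> x * h x)"
    by (rule integral_halfline_eq_Icc) (simp add: z)
  also have "\<dots> = \<psi> b * H b - \<psi> 0 * H 0"
    using ab by (intro ac_deriv_integral[OF 1]) auto
  also have "\<dots> = 0" using z ab by simp
  finally show ?thesis by (simp add: add_eq_0_iff2)
qed

text \<open>A vanishing total integral is what makes the antiderivative from 0 vanish again beyond
  the support.\<close>

lemma test_antiderivative:
  assumes "\<phi> \<in> test_functions" "integral {0<..} \<phi> = 0"
  obtains \<psi> where "\<psi> \<in> test_functions" "vderiv \<psi> = \<phi>"
proof -
  obtain a b where ab: "smooth \<phi>" "0 < a" "a < b" "\<And>k x. x \<le> a \<or> b \<le> x \<Longrightarrow> (vderiv ^^ k) \<phi> x = 0"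
    using test_functionsE[OF assms(1)] by metis
  have z: "\<phi> x = 0" if "x \<le> a \<or> b \<le> x" for x using ab(4)[of x 0] that by auto
  note A = smooth_antiderivative[OF ab(1,2), OF z, simplified]
  have "integral {0..x} \<phi> = 0" if "x \<ge> b" for x
    using integral_halfline_eq_Icc[of x \<phi>] assms(2) z that by simp
  then have "(\<lambda>x. integral {0..x} \<phi>) \<in> test_functions"
    unfolding test_functions_iff using A ab(2) by blast
  then show thesis using A(2) by (intro that)
qed

text \<open>Induction on the order with h arbitrary, in the style of du Bois-Reymond. An
  antiderivative H of h is the candidate for the weak derivative of order N. The error functional L
  kills derivatives of test functions, hence depends on \<phi> only through its integral, so H is
  correct up to an additive constant c.\<close>

lemma weak_derivative_imp_chain:
  assumes "\<And>x. k absolutely_integrable_on {0..x}" "\<And>x. h absolutely_integrable_on {0..x}"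
    and "\<And>\<phi>. \<phi> \<in> test_functions \<Longrightarrow>
      integral {0<..} (\<lambda>x. (vderiv ^^ N) \<phi> x * k x) = (-1) ^ N * integral {0<..} (\<lambda>x. \<phi> x * h x)"
  shows "\<exists>u. (\<forall>i<N. ac_deriv (u i) (u (Suc i))) \<and> u N = h \<and> (AE x in halfline. k x = u 0 x)"
  using assms(2,3)
proof (induction N arbitrary: h)
  case 0
  have "AE x in halfline. k x - h x = 0"
  proof (rule AE_zero_of_test_integrals_zero)
    show "(\<lambda>x. k x - h x) absolutely_integrable_on {0..x}" for x
      using assms(1) 0(1) by (intro set_integral_diff)
    fix \<phi> assume phi: "\<phi> \<in> test_functions"
    have "integral {0<..} (\<lambda>x. \<phi> x * (k x - h x)) = integral {0<..} (\<lambda>x. \<phi> x * k x) - integral {0<..} (\<lambda>x. \<phi> x * h x)"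
      unfolding right_diff_distrib
      by (rule Henstock_Kurzweil_Integration.integral_diff) (intro test_mult_integrable phi assms(1) 0(1))+
    then show "integral {0<..} (\<lambda>x. \<phi> x * (k x - h x)) = 0"
      using 0(2)[OF phi] by simp
  qed
  then show ?case by (intro exI[of _ "\<lambda>_. h"]) auto
next
  case (Suc N)
  \<comment> \<open>As \<beta> has integral 1, subtracting a suitable multiple of it from a test
    function leaves the derivative of a test function.\<close>
  obtain \<beta> b where b: "smooth \<beta>" "\<And>x. x \<le> 1 \<Longrightarrow> \<beta> x = 0" "\<And>x. x \<ge> 2 \<Longrightarrow> \<beta> x = 0"
    "\<beta> = (\<lambda>x. of_real (b x))" "\<And>x. b x \<ge> 0" "integral {0..2} b = 1" "continuous_on UNIV b"
    using exists_smooth_bump by blast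
  have "b integrable_on {0..2}"
    by (rule integrable_continuous_real) (rule continuous_on_subset[OF b(7)], simp)
  then have "(b has_integral 1) {0..2}" using b(6) by (metis integrable_integral)
  then have "integral {0..2} \<beta> = 1"
    unfolding b(4) using has_integral_of_real[of b 1 "{0..2}"] by (metis integral_unique of_real_1)
  then have beta1: "integral {0<..} \<beta> = 1"
    using integral_halfline_eq_Icc[of 2 \<beta>] b(3) by simp
  have "\<forall>x. x \<le> 1 \<or> 2 \<le> x \<longrightarrow> \<beta> x = 0" using b(2,3) by blast
  then have beta: "\<beta> \<in> test_functions"
    unfolding test_functions_iff using b(1) by (intro conjI exI[of _ 1] exI[of _ 2]) simp_all
  define H where "H = (\<lambda>x. integral {0..x} h)"
  have H: "ac_deriv H h" using ac_derivI_integral[of h 0] Suc.prems(1) by (simp add: H_def)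
  have Hint: "H absolutely_integrable_on {0..x}" for x
    using ac_deriv_continuous[OF H] by (auto intro!: absolutely_integrable_continuous_real elim: continuous_on_subset)
  define L where "L \<phi> = integral {0<..} (\<lambda>x. (vderiv ^^ N) \<phi> x * k x) - (-1) ^ N * integral {0<..} (\<lambda>x. \<phi> x * H x)" for \<phi>
  have L0: "L (vderiv \<psi>) = 0" if "\<psi> \<in> test_functions" for \<psi>
  proof -
    have "(vderiv ^^ N) (vderiv \<psi>) = (vderiv ^^ Suc N) \<psi>" by (simp only: funpow_Suc_right o_apply)
    then show ?thesis
      unfolding L_def test_integral_by_parts[OF that H] by (simp only: Suc.prems(2)[OF that]) simp
  qed
  \<comment> \<open>The constant that absorbs L; its sign undoes the factor (-1)^N in front of the
    integral.\<close>
  define c where "c = (-1) ^ N * L \<beta>"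
  have key: "integral {0<..} (\<lambda>x. (vderiv ^^ N) \<phi> x * k x) = (-1) ^ N * integral {0<..} (\<lambda>x. \<phi> x * (c + H x))"
    if phi: "\<phi> \<in> test_functions" for \<phi>
  proof -
    define s where "s = integral {0<..} \<phi>"
    have int1: "\<psi> integrable_on {0<..}" if "\<psi> \<in> test_functions" for \<psi>
      using test_mult_integrable[OF that, of "\<lambda>_. 1"] by simp
    let ?\<phi> = "\<lambda>x. \<phi> x + (- s) * \<beta> x"
    have t: "?\<phi> \<in> test_functions" by (rule test_add_cmult[OF phi beta])
    have "integral {0<..} ?\<phi> = integral {0<..} \<phi> + integral {0<..} (\<lambda>x. (- s) * \<beta> x)"
      by (rule Henstock_Kurzweil_Integration.integral_add) (intro int1 phi beta integrable_on_mult_right)+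
    also have "\<dots> = 0" using beta1 by (simp add: s_def)
    finally obtain \<psi> where psi: "\<psi> \<in> test_functions" "vderiv \<psi> = ?\<phi>"
      using test_antiderivative[OF t] by metis
    have sm: "smooth \<phi>" "smooth \<beta>" using phi beta by (auto simp: test_functions_iff)
    have "L ?\<phi> = L \<phi> - s * L \<beta>"
    proof -
      have d: "(vderiv ^^ N) ?\<phi> = (\<lambda>x. (vderiv ^^ N) \<phi> x + (- s) * (vderiv ^^ N) \<beta> x)"
        by (simp only: smooth_add_vderiv(2)[OF sm(1) smooth_cmult[OF sm(2)]] smooth_cmult_vderiv(2)[OF sm(2)])
      have lin: "integral {0<..} (\<lambda>x. (f x + (- s) * g x) * q x) =
          integral {0<..} (\<lambda>x. f x * q x) - s * integral {0<..} (\<lambda>x. g x * q x)"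
        if "f \<in> test_functions" "g \<in> test_functions" "\<And>x. q absolutely_integrable_on {0..x}" for f g q
      proof -
        have "integral {0<..} (\<lambda>x. f x * q x + (- s) * (g x * q x)) =
          integral {0<..} (\<lambda>x. f x * q x) + integral {0<..} (\<lambda>x. (- s) * (g x * q x))"
          by (rule Henstock_Kurzweil_Integration.integral_add) (intro test_mult_integrable that integrable_on_mult_right)+
        then show ?thesis by (simp add: algebra_simps)
      qed
      show ?thesis
        unfolding L_def d lin[OF test_vderiv_pow[OF phi] test_vderiv_pow[OF beta] assms(1)] lin[OF phi beta Hint]
        by (simp add: algebra_simps)
    qed
    then have "L \<phi> = s * L \<beta>" using L0[OF psi(1)] psi(2) by simp
    then have "integral {0<..} (\<lambda>x. (vderiv ^^ N) \<phi> x * k x) = (-1) ^ N * (integral {0<..} (\<lambda>x. \<phi> x * H x) + c * s)"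
      by (simp add: L_def[of \<phi>] c_def algebra_simps power_add[symmetric] flip: mult_2)
    moreover have "integral {0<..} (\<lambda>x. \<phi> x * (c + H x)) = integral {0<..} (\<lambda>x. \<phi> x * H x) + c * s"
    proof -
      have "integral {0<..} (\<lambda>x. \<phi> x * H x + c * \<phi> x) = integral {0<..} (\<lambda>x. \<phi> x * H x) + integral {0<..} (\<lambda>x. c * \<phi> x)"
        by (rule Henstock_Kurzweil_Integration.integral_add) (intro test_mult_integrable phi Hint int1 integrable_on_mult_right)+
      then show ?thesis by (simp add: s_def algebra_simps)
    qed
    ultimately show ?thesis by simp
  qed
  have "(\<lambda>x. c + H x) absolutely_integrable_on {0..x}" for x
    using Hint by (intro set_integral_add) auto
  from Suc.IH[OF this key] obtain u where u: "\<forall>i<N. ac_deriv (u i) (u (Suc i))" "u N = (\<lambda>x. c + H x)"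
    "AE x in halfline. k x = u 0 x" by blast
  let ?u = "u(Suc N := h)"
  have "\<forall>i<Suc N. ac_deriv (?u i) (?u (Suc i))"
    using u(1,2) ac_derivI_integral[of h c] Suc.prems(1) by (auto simp: less_Suc_eq H_def)
  then show ?case using u(3) by (intro exI[of _ ?u]) auto
qed

subsection \<open>Chains of derivatives\<close>

text \<open>\<open>u i\<close> plays the part of the i-th derivative of \<open>u 0\<close>. The
  members below N are continuous on the closed half-line; the last one is merely locally
  integrable.\<close>

definition ac_chain :: "nat \<Rightarrow> (nat \<Rightarrow> real \<Rightarrow> complex) \<Rightarrow> bool" where
  "ac_chain N u \<longleftrightarrow> (\<forall>i<N. ac_deriv (u i) (u (Suc i)))"

lemma ac_chainD: "ac_chain N u \<Longrightarrow> i < N \<Longrightarrow> ac_deriv (u i) (u (Suc i))"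
  by (simp add: ac_chain_def)

lemma ac_chain_continuous: "ac_chain N u \<Longrightarrow> i < N \<Longrightarrow> continuous_on {0..} (u i)"
  using ac_chainD ac_deriv_continuous by blast

lemma ac_chain_mono: "ac_chain N u \<Longrightarrow> M \<le> N \<Longrightarrow> ac_chain M u"
  by (simp add: ac_chain_def)

lemma ac_chain_cnj: "ac_chain N u \<Longrightarrow> ac_chain N (\<lambda>i x. cnj (u i x))"
  by (simp add: ac_chain_def ac_deriv_cnj)

lemma ac_chain_shift: "ac_chain N u \<Longrightarrow> s \<ge> 0 \<Longrightarrow> ac_chain N (\<lambda>i x. u i (s + x))"
  by (simp add: ac_chain_def ac_deriv_shift)

lemma ac_chain_lincomb:
  "ac_chain N u \<Longrightarrow> ac_chain N v \<Longrightarrow> ac_chain N (\<lambda>i x. a * u i x + b * v i x)"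
  by (simp add: ac_chain_def ac_deriv_add ac_deriv_cmult)

lemma ac_chain_sum:
  "(\<And>a. a \<in> I \<Longrightarrow> ac_chain N (u a)) \<Longrightarrow> ac_chain N (\<lambda>i x. \<Sum>a\<in>I. c a * u a i x)"
  by (simp add: ac_chain_def ac_deriv_sum ac_deriv_cmult)

lemma ac_chainI_vector_derivative:
  assumes "\<And>k x. (w k has_vector_derivative w (Suc k) x) (at x)"
  shows "ac_chain N w"
proof -
  have "continuous_on {0..} (w k)" for k
    by (rule continuous_at_imp_continuous_on) (rule ballI, rule has_vector_derivative_continuous[OF assms])
  then have "ac_deriv (w k) (w (Suc k))" for k
    by (rule ac_derivI_vector[OF has_vector_derivative_at_within[OF assms]])
  then show ?thesis by (simp add: ac_chain_def)
qed

text \<open>The Lagrange concomitant of the N-th derivative: the alternating signs make the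
  derivative of the sum telescope to its two extreme terms, as in
  \<open>ac_deriv_boundary_form\<close>. It is bilinear; conjugates are inserted where it is
  applied.\<close>

definition boundary_form :: "nat \<Rightarrow> (nat \<Rightarrow> real \<Rightarrow> complex) \<Rightarrow> (nat \<Rightarrow> real \<Rightarrow> complex) \<Rightarrow> real \<Rightarrow> complex" where
  "boundary_form N u v x = (\<Sum>i<N. (-1) ^ i * (u (N - Suc i) x * v i x))"

lemma ac_deriv_boundary_form:
  assumes "ac_chain N u" "ac_chain N v"
  shows "ac_deriv (boundary_form N u v) (\<lambda>x. u N x * v 0 x - (-1) ^ N * (u 0 x * v N x))"
proof -
  have "ac_deriv (\<lambda>x. \<Sum>i<N. (-1) ^ i * (u (N - Suc i) x * v i x))
     (\<lambda>x. \<Sum>i<N. (-1) ^ i * (u (Suc (N - Suc i)) x * v i x + u (N - Suc i) x * v (Suc i) x))"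
    using assms by (intro ac_deriv_sum ac_deriv_cmult ac_deriv_mult) (auto intro!: ac_chainD)
  moreover have "(\<Sum>i<N. (-1) ^ i * (u (Suc (N - Suc i)) x * v i x + u (N - Suc i) x * v (Suc i) x)) =
      u N x * v 0 x - (-1) ^ N * (u 0 x * v N x)" for x
  proof -
    let ?t = "\<lambda>i. (-1) ^ i * (u (N - i) x * v i x)"
    have "(\<Sum>i<N. (-1) ^ i * (u (Suc (N - Suc i)) x * v i x + u (N - Suc i) x * v (Suc i) x)) = (\<Sum>i<N. ?t i - ?t (Suc i))"
      by (rule sum.cong) (auto simp: Suc_diff_Suc algebra_simps)
    also have "\<dots> = ?t 0 - ?t N" by (rule sum_lessThan_telescope')
    finally show ?thesis by simp
  qed
  ultimately show ?thesis by (simp add: boundary_form_def[abs_def])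
qed

lemma integral_boundary_form:
  assumes "ac_chain N u" "ac_chain N v" "0 \<le> X"
  shows "integral {0..X} (\<lambda>x. u N x * v 0 x - (-1) ^ N * (u 0 x * v N x)) = boundary_form N u v X - boundary_form N u v 0"
  by (rule ac_deriv_integral[OF ac_deriv_boundary_form]) (use assms in auto)

lemma boundary_form_jet:
  assumes "a < N" "\<And>k. v k x = (if k = a then 1 else 0)"
  shows "boundary_form N u v x = (-1) ^ a * u (N - Suc a) x"
proof -
  have "boundary_form N u v x = (\<Sum>i<N. if i = a then (-1) ^ a * u (N - Suc a) x else 0)"
    unfolding boundary_form_def by (rule sum.cong) (auto simp: assms(2))
  then show ?thesis using assms(1) by simp
qed

section \<open>Intermediate derivatives: local bounds, decay, square integrability\<close>

lemma square_integral_le: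
  fixes f :: "real \<Rightarrow> real"
  assumes "f integrable_on {a..a + 1}" "(\<lambda>x. (f x)\<^sup>2) integrable_on {a..a + 1}"
  shows "(integral {a..a + 1} f)\<^sup>2 \<le> integral {a..a + 1} (\<lambda>x. (f x)\<^sup>2)"
proof -
  define m where "m = integral {a..a + 1} f"
  have "((\<lambda>x. (f x)\<^sup>2 - (2 * m) * f x + m\<^sup>2) has_integral
     (integral {a..a + 1} (\<lambda>x. (f x)\<^sup>2) - (2 * m) * m + m\<^sup>2)) {a..a + 1}"
  proof (intro has_integral_add has_integral_diff has_integral_mult_right)
    show "((\<lambda>x. (f x)\<^sup>2) has_integral integral {a..a + 1} (\<lambda>x. (f x)\<^sup>2)) {a..a + 1}"
      using assms(2) by (rule integrable_integral)
    show "(f has_integral m) {a..a + 1}"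
      using assms(1) unfolding m_def by (rule integrable_integral)
    show "((\<lambda>x. m\<^sup>2) has_integral m\<^sup>2) {a..a + 1}"
      using has_integral_const_real[of "m\<^sup>2" a "a + 1"] by simp
  qed
  then have "0 \<le> integral {a..a + 1} (\<lambda>x. (f x)\<^sup>2) - (2 * m) * m + m\<^sup>2"
    by (rule has_integral_nonneg) (use zero_le_power2[of "f x - m" for x] in \<open>simp add: power2_diff algebra_simps\<close>)
  then show ?thesis by (simp add: m_def power2_eq_square)
qed

lemma L2_square_integrable_on:
  assumes "f \<in> L2_halfline" "0 \<le> a"
  shows "(\<lambda>x. (cmod (f x))\<^sup>2) integrable_on {a..b}" "(\<lambda>x. cmod (f x)) integrable_on {a..b}"
proof -
  show "(\<lambda>x. (cmod (f x))\<^sup>2) integrable_on {a..b}"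
    by (rule set_lebesgue_integral_eq_integral(1)[OF absolutely_integrable_Icc_of_halfline])
       (use assms L2_halflineD(2) in auto)
  show "(\<lambda>x. cmod (f x)) integrable_on {a..b}"
    using L2_absolutely_integrable[OF assms, of b] by (simp add: absolutely_integrable_on_def)
qed

lemma continuous_on_norm_bound_Icc:
  fixes f :: "real \<Rightarrow> 'b::real_normed_vector"
  assumes "continuous_on {a..b} f"
  obtains B where "B > 0" "\<And>x. x \<in> {a..b} \<Longrightarrow> norm (f x) \<le> B"
proof -
  have "bounded (f ` {a..b})" using assms by (intro compact_imp_bounded compact_continuous_image) auto
  then show thesis using that by (metis bounded_pos imageI)
qed

text \<open>Green's identity on [x, x + 1] against a jet that starts at x and is zero at x + 1
  leaves one boundary term, u_j(x), expressed by integrals of the first and the last member.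
  Translating one fixed jet makes C independent of x.\<close>

lemma ac_chain_local_bound:
  assumes u: "ac_chain N u" and L2: "u 0 \<in> L2_halfline" "u N \<in> L2_halfline" and "j < N"
  shows "\<exists>C\<ge>0. \<forall>x\<ge>0. (cmod (u j x))\<^sup>2 \<le> C * integral {x..x + 1} (\<lambda>t. (cmod (u 0 t))\<^sup>2 + (cmod (u N t))\<^sup>2)"
proof -
  \<comment> \<open>In \<open>boundary_form\<close> the jet of index N - 1 - j is paired with
    u_j.\<close>
  obtain w where w: "\<And>k x. (w k has_vector_derivative w (Suc k) x) (at x)"
    "\<And>k. w k 0 = (if k = N - Suc j then 1 else 0)" "\<And>k x. x \<ge> 1 \<Longrightarrow> w k x = (0 :: complex)" "\<And>x. x \<ge> 0 \<Longrightarrow> cmod (w 0 x) \<le> 1"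
    by (rule exists_jet[of 1 "N - Suc j"]) auto
  \<comment> \<open>Length N + 1, so that continuity of \<open>w N\<close> is included.\<close>
  have cw: "ac_chain (Suc N) w" by (rule ac_chainI_vector_derivative) (rule w(1))
  then have "continuous_on {0..1} (w N)"
    using ac_chain_continuous[OF cw, of N] by (auto elim: continuous_on_subset)
  then obtain B where B: "B > 0" "\<And>x. x \<in> {0..1} \<Longrightarrow> cmod (w N x) \<le> B"
    using continuous_on_norm_bound_Icc by blast
  define K where "K = max 1 B"
  have K: "K \<ge> 1" "\<And>x. x \<in> {0..1} \<Longrightarrow> cmod (w 0 x) \<le> K" "\<And>x. x \<in> {0..1} \<Longrightarrow> cmod (w N x) \<le> K"
    using B w(4) by (fastforce simp: K_def)+
  have "(cmod (u j x))\<^sup>2 \<le> 2 * K\<^sup>2 * integral {x..x + 1} (\<lambda>t. (cmod (u 0 t))\<^sup>2 + (cmod (u N t))\<^sup>2)" if x: "x \<ge> 0" for x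
  proof -
    let ?v = "\<lambda>i t. u i (x + t)"
    let ?g = "\<lambda>t. ?v N t * w 0 t - (-1) ^ N * (?v 0 t * w N t)"
    have v: "ac_chain N ?v" by (rule ac_chain_shift[OF u x])
    have wN: "ac_chain N w" using cw by (rule ac_chain_mono) simp
    note Df = ac_deriv_boundary_form[OF v wN]
    have b1: "boundary_form N ?v w 1 = 0" by (simp add: boundary_form_def w(3))
    have b0: "boundary_form N ?v w 0 = (-1) ^ (N - Suc j) * u j x"
    proof -
      have "boundary_form N ?v w 0 = (-1) ^ (N - Suc j) * ?v (N - Suc (N - Suc j)) 0"
        by (rule boundary_form_jet) (use \<open>j < N\<close> w(2) in auto)
      moreover have "N - Suc (N - Suc j) = j" using \<open>j < N\<close> by simp
      ultimately show ?thesis by simp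
    qed
    have "cmod (u j x) = cmod (integral {0..1} ?g)"
      using ac_deriv_integral[OF Df, of 0 1] b1 b0 by (simp add: norm_mult norm_power)
    also have "\<dots> \<le> integral {0..1} (\<lambda>t. K * (cmod (?v N t) + cmod (?v 0 t)))"
    proof (rule integral_norm_bound_integral)
      show "?g integrable_on {0..1}" by (rule ac_deriv_integrable_on[OF Df]) simp
      have shift: "(\<lambda>t. cmod (f (x + t))) integrable_on {0..1}" if "f \<in> L2_halfline" for f
      proof -
        have "(\<lambda>t. cmod (f t)) integrable_on cbox x (x + 1)"
          using L2_square_integrable_on(2)[OF that x] by (simp add: cbox_interval)
        from integrable_affinity[OF this, of 1 x] show ?thesis by (simp add: add.commute)
      qed
      show "(\<lambda>t. K * (cmod (?v N t) + cmod (?v 0 t))) integrable_on {0..1}"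
        by (intro integrable_on_mult_right integrable_add shift L2)
      fix t :: real assume t: "t \<in> {0..1}"
      have "cmod (?g t) \<le> cmod (?v N t) * cmod (w 0 t) + cmod (?v 0 t) * cmod (w N t)"
        by (rule order_trans[OF norm_triangle_ineq4]) (simp add: norm_mult norm_power)
      also have "\<dots> \<le> cmod (?v N t) * K + cmod (?v 0 t) * K"
        using K t by (intro add_mono mult_left_mono) auto
      finally show "cmod (?g t) \<le> K * (cmod (?v N t) + cmod (?v 0 t))" by (simp add: algebra_simps)
    qed
    also have "\<dots> = K * (integral {x..x + 1} (\<lambda>t. cmod (u N t)) + integral {x..x + 1} (\<lambda>t. cmod (u 0 t)))"
    proof -
      have "((\<lambda>t. K * (cmod (u N t) + cmod (u 0 t))) has_integral 
         K * (integral {x..x + 1} (\<lambda>t. cmod (u N t)) + integral {x..x + 1} (\<lambda>t. cmod (u 0 t)))) (cbox x (x + 1))"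
        unfolding cbox_interval using L2_square_integrable_on(2)[OF L2(1) x] L2_square_integrable_on(2)[OF L2(2) x]
        by (intro has_integral_mult_right has_integral_add integrable_integral)
      from has_integral_affinity[OF this, of 1 x]
      have "((\<lambda>t. K * (cmod (u N (t + x)) + cmod (u 0 (t + x)))) has_integral 
         K * (integral {x..x + 1} (\<lambda>t. cmod (u N t)) + integral {x..x + 1} (\<lambda>t. cmod (u 0 t)))) {0..1}"
        by simp
      moreover have "(\<lambda>t. K * (cmod (u N (t + x)) + cmod (u 0 (t + x)))) = (\<lambda>t. K * (cmod (?v N t) + cmod (?v 0 t)))"
        by (simp add: add.commute)
      ultimately show ?thesis by (simp only: integral_unique)
    qed
    finally have "(cmod (u j x))\<^sup>2 \<le> (K * (integral {x..x + 1} (\<lambda>t. cmod (u N t)) + integral {x..x + 1} (\<lambda>t. cmod (u 0 t))))\<^sup>2"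
      by (rule power_mono) simp
    also have "\<dots> \<le> K\<^sup>2 * (2 * (integral {x..x + 1} (\<lambda>t. cmod (u N t)))\<^sup>2 + 2 * (integral {x..x + 1} (\<lambda>t. cmod (u 0 t)))\<^sup>2)"
    proof -
      have "(a + b)\<^sup>2 \<le> 2 * a\<^sup>2 + 2 * b\<^sup>2" for a b :: real
        using zero_le_power2[of "a - b"] by (simp add: power2_sum power2_diff)
      then show ?thesis unfolding power_mult_distrib by (intro mult_left_mono) auto
    qed
    also have "\<dots> \<le> K\<^sup>2 * (2 * integral {x..x + 1} (\<lambda>t. (cmod (u N t))\<^sup>2) + 2 * integral {x..x + 1} (\<lambda>t. (cmod (u 0 t))\<^sup>2))"
      using L2 x by (intro mult_left_mono add_mono square_integral_le L2_square_integrable_on) auto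
    also have "\<dots> = 2 * K\<^sup>2 * integral {x..x + 1} (\<lambda>t. (cmod (u 0 t))\<^sup>2 + (cmod (u N t))\<^sup>2)"
      using L2 x by (subst Henstock_Kurzweil_Integration.integral_add) (auto intro: L2_square_integrable_on simp: algebra_simps)
    finally show ?thesis .
  qed
  moreover have "2 * K\<^sup>2 \<ge> 0" by simp
  ultimately show ?thesis by blast
qed

lemma L2_sum_square_integrable:
  assumes "f \<in> L2_halfline" "g \<in> L2_halfline"
  shows "integrable halfline (\<lambda>t. (cmod (f t))\<^sup>2 + (cmod (g t))\<^sup>2)"
  by (rule Bochner_Integration.integrable_add) (rule L2_halflineD(2)[OF assms(1)] L2_halflineD(2)[OF assms(2)])+

text \<open>By the local bound |u_j(x)|^2 is controlled by the mass of F in [x, x + 1], a difference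
  of two quantities with the same limit.\<close>

lemma ac_chain_tendsto_0:
  assumes u: "ac_chain N u" and L2: "u 0 \<in> L2_halfline" "u N \<in> L2_halfline" and "j < N"
  shows "(u j \<longlongrightarrow> 0) at_top"
proof -
  let ?F = "\<lambda>t. (cmod (u 0 t))\<^sup>2 + (cmod (u N t))\<^sup>2"
  obtain C where C: "C \<ge> 0" "\<And>x. x \<ge> 0 \<Longrightarrow> (cmod (u j x))\<^sup>2 \<le> C * integral {x..x + 1} ?F"
    using ac_chain_local_bound[OF assms] by blast
  note int = L2_sum_square_integrable[OF L2]
  have lim: "((\<lambda>x. integral {0..x} ?F) \<longlongrightarrow> (LINT x|halfline. ?F x)) at_top"
    by (rule integral_tendsto_halfline[OF int])
  have "filterlim (\<lambda>x::real. x + 1) at_top at_top"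
    by (intro filterlim_tendsto_add_at_top[OF tendsto_const filterlim_ident, of 1, simplified add.commute])
  from filterlim_compose[OF lim this]
  have "((\<lambda>x. C * (integral {0..x + 1} ?F - integral {0..x} ?F)) \<longlongrightarrow> C * ((LINT x|halfline. ?F x) - (LINT x|halfline. ?F x))) at_top"
    using lim by (intro tendsto_intros)
  then have lim0: "((\<lambda>x. C * (integral {0..x + 1} ?F - integral {0..x} ?F)) \<longlongrightarrow> 0) at_top" by simp
  have Fint: "?F integrable_on {0..b}" for b
    by (rule set_lebesgue_integral_eq_integral(1)[OF absolutely_integrable_Icc_of_halfline[OF int]]) simp
  have "((\<lambda>x. (cmod (u j x))\<^sup>2) \<longlongrightarrow> 0) at_top"
  proof (rule tendsto_sandwich[OF _ _ tendsto_const lim0])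
    show "\<forall>\<^sub>F x in at_top. (cmod (u j x))\<^sup>2 \<le> C * (integral {0..x + 1} ?F - integral {0..x} ?F)"
      using eventually_ge_at_top[of 0]
    proof eventually_elim
      case (elim x)
      have "integral {0..x} ?F + integral {x..x + 1} ?F = integral {0..x + 1} ?F"
        by (rule Henstock_Kurzweil_Integration.integral_combine) (use elim Fint in auto)
      then have "integral {x..x + 1} ?F = integral {0..x + 1} ?F - integral {0..x} ?F" by (simp only: eq_diff_eq add.commute)
      then show ?case
        using C(2)[of x] elim by simp
    qed
  qed simp
  then have "((\<lambda>x. sqrt ((cmod (u j x))\<^sup>2)) \<longlongrightarrow> sqrt 0) at_top" by (intro tendsto_intros)
  then show ?thesis by (simp add: tendsto_norm_zero_iff)
qed

lemma continuous_measurable_halfline: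
  assumes "continuous_on {0..} f"
  shows "f \<in> borel_measurable halfline"
  by (rule continuous_imp_measurable_on_sets_lebesgue) (auto intro: continuous_on_subset[OF assms])

text \<open>Integrating the local bound over x in [0, X] leads to the integral of \<Phi>(x + 1) -
  \<Phi>(x), where \<Phi> is increasing and bounded by I. In terms of an antiderivative P of \<Phi>
  it is a difference of two integrals of \<Phi> over unit intervals and so at most 2 I.\<close>

lemma ac_chain_L2:
  assumes u: "ac_chain N u" and L2: "u 0 \<in> L2_halfline" "u N \<in> L2_halfline" and "j \<le> N"
  shows "u j \<in> L2_halfline"
proof (cases "j = N")
  case True then show ?thesis using L2 by simp
next
  case False
  then have j: "j < N" using assms by simp
  let ?F = "\<lambda>t. (cmod (u 0 t))\<^sup>2 + (cmod (u N t))\<^sup>2"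
  obtain C where C: "C \<ge> 0" "\<And>x. x \<ge> 0 \<Longrightarrow> (cmod (u j x))\<^sup>2 \<le> C * integral {x..x + 1} ?F"
    using ac_chain_local_bound[OF u L2 j] by blast
  note int = L2_sum_square_integrable[OF L2]
  define I where "I = (LINT x|halfline. ?F x)"
  define \<Phi> where "\<Phi> = (\<lambda>x. integral {0..x} ?F)"
  have Fint: "?F integrable_on {a..b}" if "0 \<le> a" for a b
    by (rule set_lebesgue_integral_eq_integral(1)[OF absolutely_integrable_Icc_of_halfline[OF int that]])
  have mono: "\<Phi> x \<le> \<Phi> y" if "0 \<le> x" "x \<le> y" for x y
    unfolding \<Phi>_def by (rule integral_subset_le) (use that Fint in auto)
  have \<Phi>I: "0 \<le> \<Phi> x" "\<Phi> x \<le> I" if "x \<ge> 0" for x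
  proof -
    show "0 \<le> \<Phi> x" using mono[of 0 x] that by (simp add: \<Phi>_def)
    show "\<Phi> x \<le> I"
      unfolding I_def by (rule tendsto_lowerbound[OF integral_tendsto_halfline[OF int]])
        (use mono that in \<open>auto simp: \<Phi>_def intro!: eventually_mono[OF eventually_ge_at_top[of x]]\<close>)
  qed
  have cont: "continuous_on {0..b} \<Phi>" for b
    unfolding \<Phi>_def by (rule indefinite_integral_continuous_1[OF Fint]) simp
  \<comment> \<open>Complex-valued in order to fit \<open>ac_deriv\<close>.\<close>
  define P where "P = (\<lambda>x. 0 + integral {0..x} (\<lambda>x. complex_of_real (\<Phi> x)))"
  have P: "ac_deriv P (\<lambda>x. of_real (\<Phi> x))"
    unfolding P_def by (rule ac_derivI_integral) (auto intro!: absolutely_integrable_continuous_real continuous_intros cont)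
  have D: "ac_deriv (\<lambda>x. P (1 + x) - P x) (\<lambda>x. of_real (\<Phi> (1 + x)) - of_real (\<Phi> x))"
    by (rule ac_deriv_diff[OF ac_deriv_shift[OF P] P]) simp
  have PB: "cmod (P (1 + x) - P x) \<le> I" if "x \<ge> 0" for x
  proof -
    have "P (1 + x) - P x = integral {x..1 + x} (\<lambda>x. of_real (\<Phi> x))"
      using ac_deriv_integral[OF P, of x "1 + x"] that by simp
    also have "cmod \<dots> \<le> integral {x..1 + x} (\<lambda>x. I)"
      by (rule integral_norm_bound_integral)
         (use ac_deriv_integrable_on[OF P that] \<Phi>I that in \<open>auto intro: order_trans\<close>)
    finally show ?thesis by simp
  qed
  have cj: "continuous_on {0..} (u j)" by (rule ac_chain_continuous[OF u j])
  have "integrable halfline (\<lambda>x. (cmod (u j x))\<^sup>2)"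
  proof (rule integrable_halflineI_bounded)
    fix X :: real assume X: "X > 0"
    have c: "continuous_on {0..X} (u j)" by (rule continuous_on_subset[OF cj]) auto
    show i: "(\<lambda>x. (cmod (u j x))\<^sup>2) integrable_on {0..X}"
      by (intro integrable_continuous_real continuous_intros c)
    have "integral {0..X} (\<lambda>x. (cmod (u j x))\<^sup>2) \<le> integral {0..X} (\<lambda>x. C * (\<Phi> (x + 1) - \<Phi> x))"
    proof (rule integral_le[OF i])
      have "continuous_on {0..X} (\<lambda>x. \<Phi> (x + 1))"
        by (rule continuous_on_compose2[OF cont[of "X + 1"]]) (auto intro!: continuous_intros)
      then show "(\<lambda>x. C * (\<Phi> (x + 1) - \<Phi> x)) integrable_on {0..X}"
        by (intro integrable_continuous_real continuous_intros cont)
      fix x assume x: "x \<in> {0..X}"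
      have "integral {0..x} ?F + integral {x..x + 1} ?F = integral {0..x + 1} ?F"
        by (rule Henstock_Kurzweil_Integration.integral_combine) (use x Fint[of 0] in auto)
      then have "integral {x..x + 1} ?F = integral {0..x + 1} ?F - integral {0..x} ?F" by (simp only: eq_diff_eq add.commute)
      then show "(cmod (u j x))\<^sup>2 \<le> C * (\<Phi> (x + 1) - \<Phi> x)"
        using C(2)[of x] x by (simp add: \<Phi>_def)
    qed
    also have "\<dots> = C * integral {0..X} (\<lambda>x. \<Phi> (x + 1) - \<Phi> x)" by simp
    also have "integral {0..X} (\<lambda>x. \<Phi> (x + 1) - \<Phi> x) \<le> cmod (integral {0..X} (\<lambda>x. of_real (\<Phi> (1 + x)) - of_real (\<Phi> x)))"
    proof -
      have "integral {0..X} (\<lambda>x. complex_of_real (\<Phi> (1 + x) - \<Phi> x)) = of_real (integral {0..X} (\<lambda>x. \<Phi> (1 + x) - \<Phi> x))"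
      proof -
        have "continuous_on {0..X} (\<lambda>x. \<Phi> (1 + x))"
          by (rule continuous_on_compose2[OF cont[of "X + 1"]]) (auto intro!: continuous_intros)
        then have "(\<lambda>x. \<Phi> (1 + x) - \<Phi> x) integrable_on {0..X}"
          by (intro integrable_continuous_real continuous_intros cont)
        then show ?thesis by (metis has_integral_of_real integrable_integral integral_unique)
      qed
      then show ?thesis by (simp add: add.commute norm_of_real)
    qed
    also have "\<dots> = cmod ((P (1 + X) - P X) - (P (1 + 0) - P 0))"
      using ac_deriv_integral[OF D, of 0 X] X by simp
    also have "\<dots> \<le> I + I"
      by (rule order_trans[OF norm_triangle_ineq4 add_mono[OF PB PB]]) (use X in auto)
    finally show "integral {0..X} (\<lambda>x. (cmod (u j x))\<^sup>2) \<le> C * (I + I)"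
      using C(1) by (simp add: mult_left_mono)
  qed simp
  then show ?thesis
    using continuous_measurable_halfline[OF cj] by (simp add: L2_halfline_def)
qed

lemma boundary_form_tendsto_0:
  assumes "ac_chain N u" "u 0 \<in> L2_halfline" "u N \<in> L2_halfline"
    and "ac_chain N v" "v 0 \<in> L2_halfline" "v N \<in> L2_halfline"
  shows "(boundary_form N u v \<longlongrightarrow> 0) at_top"
proof -
  have "((\<lambda>x. \<Sum>i<N. (-1) ^ i * (u (N - Suc i) x * v i x)) \<longlongrightarrow> (\<Sum>i<N. (-1) ^ i * (0 * 0))) at_top"
    by (intro tendsto_sum tendsto_mult tendsto_const ac_chain_tendsto_0[OF assms(1-3)] ac_chain_tendsto_0[OF assms(4-6)]) auto
  then show ?thesis by (simp add: boundary_form_def[abs_def])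
qed

text \<open>The boundary term at infinity disappears because all members below N tend to 0, a
  consequence of the square integrability of the two ends of each chain.\<close>

lemma Green_halfline:
  assumes "ac_chain N u" "u 0 \<in> L2_halfline" "u N \<in> L2_halfline"
    and "ac_chain N v" "v 0 \<in> L2_halfline" "v N \<in> L2_halfline"
  shows "(LINT x|halfline. u N x * v 0 x) - (-1) ^ N * (LINT x|halfline. u 0 x * v N x) = - boundary_form N u v 0"
proof -
  let ?g = "\<lambda>x. u N x * v 0 x - (-1) ^ N * (u 0 x * v N x)"
  have i: "integrable halfline (\<lambda>x. u N x * v 0 x)" "integrable halfline (\<lambda>x. u 0 x * v N x)"
    by (intro L2_mult_integrable assms)+
  then have int: "integrable halfline ?g" by simp
  have "((\<lambda>X. integral {0..X} ?g) \<longlongrightarrow> 0 - boundary_form N u v 0) at_top"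
  proof (rule Lim_transform_eventually)
    show "((\<lambda>X. boundary_form N u v X - boundary_form N u v 0) \<longlongrightarrow> 0 - boundary_form N u v 0) at_top"
      by (intro tendsto_intros boundary_form_tendsto_0 assms)
    show "\<forall>\<^sub>F X in at_top. boundary_form N u v X - boundary_form N u v 0 = integral {0..X} ?g"
      using eventually_ge_at_top[of 0] by eventually_elim (simp add: integral_boundary_form assms)
  qed
  from tendsto_unique[OF _ this integral_tendsto_halfline[OF int]] i
  show ?thesis by simp
qed

section \<open>The boundary triplet\<close>

definition test_operator :: "nat \<Rightarrow> operator" where
  "test_operator n = {(\<phi>, \<lambda>x. (-1) ^ n * (vderiv ^^ (2 * n)) \<phi> x) | \<phi>. \<phi> \<in> test_functions}"

lemma minimal_operator_eq: "minimal_operator n = op_closure (test_operator n)"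
  by (simp add: minimal_operator_def test_operator_def)

lemma L2_tendsto_const: "L2_tendsto (\<lambda>m. f) f"
  by (simp add: L2_tendsto_def L2_norm_def)

lemma op_closure_superset: "T \<subseteq> L2_halfline \<times> L2_halfline \<Longrightarrow> T \<subseteq> op_closure T"
  unfolding op_closure_def using L2_tendsto_const by fast

lemma op_adjoint_antimono: "S \<subseteq> T \<Longrightarrow> op_adjoint T \<subseteq> op_adjoint S"
  unfolding op_adjoint_def by fast

text \<open>Inner products are continuous, so testing against T amounts to testing against its
  closure. The adjoint of the minimal operator becomes that of the operator on test
  functions.\<close>

lemma op_adjoint_closure:
  assumes T: "T \<subseteq> L2_halfline \<times> L2_halfline"
  shows "op_adjoint (op_closure T) = op_adjoint T"
proof
  show "op_adjoint (op_closure T) \<subseteq> op_adjoint T"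
    by (rule op_adjoint_antimono[OF op_closure_superset[OF T]])
  show "op_adjoint T \<subseteq> op_adjoint (op_closure T)"
  proof clarify
    fix g h assume gh: "(g, h) \<in> op_adjoint T"
    then have L2: "g \<in> L2_halfline" "h \<in> L2_halfline" by (auto simp: op_adjoint_def)
    have "L2_inner f' g = L2_inner f h" if ff: "(f, f') \<in> op_closure T" for f f'
    proof -
      obtain F G where FG: "\<And>m. (F m, G m) \<in> T" "L2_tendsto F f" "L2_tendsto G f'" "f \<in> L2_halfline" "f' \<in> L2_halfline"
        using ff unfolding op_closure_def by blast
      have "L2_inner (G m) g = L2_inner (F m) h" for m
        using gh FG(1)[of m] by (auto simp: op_adjoint_def)
      then have eq: "(\<lambda>m. L2_inner (G m) g) = (\<lambda>m. L2_inner (F m) h)" by (rule ext)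
      have m: "F m \<in> L2_halfline" "G m \<in> L2_halfline" for m using FG(1)[of m] T by auto
      show ?thesis
        by (rule LIMSEQ_unique[OF L2_inner_tendsto_left[OF FG(3) m(2) FG(5) L2(1), unfolded eq]
              L2_inner_tendsto_left[OF FG(2) m(1) FG(4) L2(2)]])
    qed
    then show "(g, h) \<in> op_adjoint (op_closure T)"
      using L2 by (auto simp: op_adjoint_def)
  qed
qed

lemma continuous_compact_L2:
  assumes "continuous_on {0..} f" "\<And>x. x \<ge> b \<Longrightarrow> f x = 0"
  shows "f \<in> L2_halfline"
proof -
  have "integrable halfline (\<lambda>x. (cmod (f x))\<^sup>2)"
  proof (rule integrable_halflineI_bounded)
    have c: "continuous_on {0..y} f" for y by (rule continuous_on_subset[OF assms(1)]) auto
    show i: "(\<lambda>x. (cmod (f x))\<^sup>2) integrable_on {0..X}" for X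
      by (intro integrable_continuous_real continuous_intros c)
    fix X :: real assume "X > 0"
    show "integral {0..X} (\<lambda>x. (cmod (f x))\<^sup>2) \<le> integral {0..max 0 b} (\<lambda>x. (cmod (f x))\<^sup>2)"
    proof (cases "X \<le> max 0 b")
      case True
      then show ?thesis by (intro integral_subset_le i) auto
    next
      case False
      have "integral {0..max 0 b} (\<lambda>x. (cmod (f x))\<^sup>2) + integral {max 0 b..X} (\<lambda>x. (cmod (f x))\<^sup>2) = integral {0..X} (\<lambda>x. (cmod (f x))\<^sup>2)"
        by (rule Henstock_Kurzweil_Integration.integral_combine) (use False i in auto)
      moreover have "integral {max 0 b..X} (\<lambda>x. (cmod (f x))\<^sup>2) = integral {max 0 b..X} (\<lambda>x. 0)"
        by (rule Henstock_Kurzweil_Integration.integral_cong) (simp add: assms(2))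
      ultimately show ?thesis by simp
    qed
  qed simp
  then show ?thesis
    using continuous_measurable_halfline[OF assms(1)] by (simp add: L2_halfline_def)
qed

lemma test_L2: "\<phi> \<in> test_functions \<Longrightarrow> \<phi> \<in> L2_halfline"
  unfolding test_functions_iff by (blast intro: continuous_compact_L2 smooth_continuous_on)

lemma test_operator_L2: "test_operator n \<subseteq> L2_halfline \<times> L2_halfline"
  by (auto simp: test_operator_def intro: test_L2 L2_cmult[OF test_L2[OF test_vderiv_pow]])

lemma op_adjoint_minimal: "op_adjoint (minimal_operator n) = op_adjoint (test_operator n)"
  by (simp add: minimal_operator_eq op_adjoint_closure test_operator_L2)

text \<open>The graph of the maximal operator made concrete: f matters up to null sets, while u
  consists of its regular representative and the derivatives of that. The last equation is
  pointwise, g itself serving as the top derivative up to sign.\<close>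

definition maximal_repr :: "nat \<Rightarrow> (real \<Rightarrow> complex) \<Rightarrow> (real \<Rightarrow> complex) \<Rightarrow> (nat \<Rightarrow> real \<Rightarrow> complex) \<Rightarrow> bool" where
  "maximal_repr n f g u \<longleftrightarrow> f \<in> L2_halfline \<and> g \<in> L2_halfline \<and> ac_chain (2 * n) u \<and>
     (AE x in halfline. f x = u 0 x) \<and> u (2 * n) = (\<lambda>x. (-1) ^ n * g x)"

lemma maximal_reprD:
  assumes "maximal_repr n f g u"
  shows "f \<in> L2_halfline" "g \<in> L2_halfline" "ac_chain (2 * n) u" "AE x in halfline. f x = u 0 x"
    "u (2 * n) = (\<lambda>x. (-1) ^ n * g x)" "u 0 \<in> L2_halfline" "u (2 * n) \<in> L2_halfline"
  using assms L2_AE_cong[of f "u 0"] by (auto simp: maximal_repr_def L2_cmult)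

lemma L2_inner_eq_integral:
  assumes "f \<in> L2_halfline" "g \<in> L2_halfline"
  shows "L2_inner f g = integral {0<..} (\<lambda>x. f x * cnj (g x))"
  unfolding L2_inner_def by (rule lebesgue_integral_eq_integral[OF L2_inner_integrable[OF assms]]) simp

lemma op_adjoint_imp_maximal_repr:
  assumes "(g, h) \<in> op_adjoint (minimal_operator n)"
  obtains u where "maximal_repr n g h u"
proof -
  have L2: "g \<in> L2_halfline" "h \<in> L2_halfline"
    and adj: "\<And>\<phi>. \<phi> \<in> test_functions \<Longrightarrow> L2_inner (\<lambda>x. (-1) ^ n * (vderiv ^^ (2 * n)) \<phi> x) g = L2_inner \<phi> h"
    using assms unfolding op_adjoint_minimal by (auto simp: op_adjoint_def test_operator_def)
  \<comment> \<open>The inner product is conjugate linear in its second argument, so the weak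
    derivative is found for the conjugates of g and h and conjugated at the end.\<close>
  have "\<exists>u. (\<forall>i<2 * n. ac_deriv (u i) (u (Suc i))) \<and> u (2 * n) = (\<lambda>x. (-1) ^ n * cnj (h x)) \<and> (AE x in halfline. cnj (g x) = u 0 x)"
  proof (rule weak_derivative_imp_chain)
    show "(\<lambda>x. cnj (g x)) absolutely_integrable_on {0..x}" for x
      by (rule L2_absolutely_integrable[OF L2_cnj[OF L2(1)]]) simp
    show "(\<lambda>x. (-1) ^ n * cnj (h x)) absolutely_integrable_on {0..x}" for x
      by (rule L2_absolutely_integrable[OF L2_cmult[OF L2_cnj[OF L2(2)]]]) simp
    fix \<phi> assume phi: "\<phi> \<in> test_functions"
    have "(-1) ^ n * L2_inner ((vderiv ^^ (2 * n)) \<phi>) g = L2_inner \<phi> h"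
      using adj[OF phi] by (simp add: L2_inner_cmult_left)
    then have "(-1) ^ n * ((-1) ^ n * L2_inner ((vderiv ^^ (2 * n)) \<phi>) g) = (-1) ^ n * L2_inner \<phi> h"
      by simp
    then have "L2_inner ((vderiv ^^ (2 * n)) \<phi>) g = (-1) ^ n * L2_inner \<phi> h"
      by (simp flip: mult.assoc power_add mult_2)
    then show "integral {0<..} (\<lambda>x. (vderiv ^^ (2 * n)) \<phi> x * cnj (g x)) =
        (-1) ^ (2 * n) * integral {0<..} (\<lambda>x. \<phi> x * ((-1) ^ n * cnj (h x)))"
      using test_L2[OF phi] test_L2[OF test_vderiv_pow[OF phi]] L2
      by (simp add: L2_inner_eq_integral mult.left_commute[of _ "(-1) ^ n"])
  qed
  then obtain u where u: "ac_chain (2 * n) u" "u (2 * n) = (\<lambda>x. (-1) ^ n * cnj (h x))" "AE x in halfline. cnj (g x) = u 0 x"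
    unfolding ac_chain_def by blast
  have "AE x in halfline. g x = cnj (u 0 x)"
    using u(3) by eventually_elim (metis complex_cnj_cnj)
  then have "maximal_repr n g h (\<lambda>i x. cnj (u i x))"
    using u L2 by (simp add: maximal_repr_def ac_chain_cnj)
  then show thesis by (rule that)
qed

lemma smooth_ac_chain: "smooth \<phi> \<Longrightarrow> ac_chain N (\<lambda>k. (vderiv ^^ k) \<phi>)"
  using smooth_ac_deriv by (simp add: ac_chain_def)

lemma maximal_repr_test:
  assumes "\<phi> \<in> test_functions"
  shows "maximal_repr n \<phi> (\<lambda>x. (-1) ^ n * (vderiv ^^ (2 * n)) \<phi> x) (\<lambda>k. (vderiv ^^ k) \<phi>)"
  unfolding maximal_repr_def
  using assms test_L2[OF assms] L2_cmult[OF test_L2[OF test_vderiv_pow[OF assms]]]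
  by (auto simp: smooth_ac_chain test_functions_iff simp flip: mult.assoc power_add mult_2)

lemma Green_maximal:
  assumes f: "maximal_repr n f f' u" and g: "maximal_repr n g g' v"
  shows "L2_inner f' g - L2_inner f g' = - ((-1) ^ n * boundary_form (2 * n) u (\<lambda>i x. cnj (v i x)) 0)"
proof -
  let ?v = "\<lambda>i x. cnj (v i x)"
  note F = maximal_reprD[OF f] and G = maximal_reprD[OF g]
  have sq: "(-1) ^ n * ((-1) ^ n * z) = z" for z :: complex
    by (simp flip: mult.assoc power_add mult_2)
  have "(LINT x|halfline. u (2 * n) x * ?v 0 x) - (-1) ^ (2 * n) * (LINT x|halfline. u 0 x * ?v (2 * n) x) =
      - boundary_form (2 * n) u ?v 0"
    by (rule Green_halfline) (use F G in \<open>auto intro: ac_chain_cnj L2_cnj L2_cmult\<close>)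
  then have "L2_inner (u (2 * n)) (v 0) - L2_inner (u 0) (v (2 * n)) = - boundary_form (2 * n) u ?v 0"
    by (simp add: L2_inner_def)
  moreover have "L2_inner (u (2 * n)) (v 0) = (-1) ^ n * L2_inner f' g"
    using L2_inner_cong_AE[OF F(2) _ G(1,4), of f'] F(5) by (simp add: L2_inner_cmult_left)
  moreover have "L2_inner (u 0) (v (2 * n)) = (-1) ^ n * L2_inner f g'"
    using L2_inner_cong_AE[OF F(1,4) G(2), of g'] G(5) by (simp add: L2_inner_cmult_right)
  ultimately have "(-1) ^ n * (L2_inner f' g - L2_inner f g') = - boundary_form (2 * n) u ?v 0"
    by (simp add: algebra_simps)
  then have "(-1) ^ n * ((-1) ^ n * (L2_inner f' g - L2_inner f g')) = (-1) ^ n * - boundary_form (2 * n) u ?v 0"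
    by (rule arg_cong)
  then show ?thesis unfolding sq by simp
qed

lemma boundary_form_0: "(\<And>k. k < N \<Longrightarrow> u k x = 0) \<Longrightarrow> boundary_form N u v x = 0"
  by (auto simp: boundary_form_def intro!: sum.neutral)

text \<open>Green's formula against a test function, whose derivatives all vanish at 0.\<close>

lemma maximal_repr_imp_op_adjoint:
  assumes "maximal_repr n g h u"
  shows "(g, h) \<in> op_adjoint (minimal_operator n)"
proof -
  have "L2_inner (\<lambda>x. (-1) ^ n * (vderiv ^^ (2 * n)) \<phi> x) g = L2_inner \<phi> h" if phi: "\<phi> \<in> test_functions" for \<phi>
  proof -
    obtain a b where ab: "0 < a" "\<And>k x. x \<le> a \<or> b \<le> x \<Longrightarrow> (vderiv ^^ k) \<phi> x = 0"
      using test_functionsE[OF phi] by metis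
    show ?thesis
      using Green_maximal[OF maximal_repr_test[OF phi] assms] ab by (simp add: boundary_form_0)
  qed
  then show ?thesis
    unfolding op_adjoint_minimal using maximal_reprD[OF assms] by (auto simp: op_adjoint_def test_operator_def)
qed

lemma op_adjoint_minimal_iff: "(g, h) \<in> op_adjoint (minimal_operator n) \<longleftrightarrow> (\<exists>u. maximal_repr n g h u)"
proof
  assume "(g, h) \<in> op_adjoint (minimal_operator n)"
  then obtain u where "maximal_repr n g h u" by (rule op_adjoint_imp_maximal_repr)
  then show "Ex (maximal_repr n g h)" by blast
qed (auto intro: maximal_repr_imp_op_adjoint)

subsection \<open>Boundary values\<close>

text \<open>On the open half-line the functions differ on a set that is open and null, hence empty;
  the point 0 follows by continuity. This is why the boundary values of a class are well
  defined.\<close>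

lemma continuous_AE_eq_imp_eq:
  fixes f g :: "real \<Rightarrow> complex"
  assumes f: "continuous_on {0..} f" and g: "continuous_on {0..} g" and ae: "AE x in halfline. f x = g x" and x: "x \<ge> 0"
  shows "f x = g x"
proof -
  define U where "U = {x \<in> {0<..}. f x - g x \<in> - {0}}"
  have c: "continuous_on {0..} (\<lambda>x. f x - g x)" by (intro continuous_intros f g)
  have "open U"
    unfolding U_def by (rule continuous_open_preimage[unfolded vimage_def Int_def, simplified])
      (auto intro: continuous_on_subset[OF c])
  moreover have "negligible U"
  proof -
    have "AE x in lebesgue. x \<notin> U"
      using ae unfolding AE_halfline_iff by eventually_elim (auto simp: U_def)
    moreover have "U \<in> sets lebesgue" using \<open>open U\<close> by simp
    ultimately show ?thesis by (simp add: negligible_iff_null_sets AE_iff_null_sets)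
  qed
  ultimately have "U = {}" using open_not_negligible by blast
  then have "f x - g x = 0" if "x \<in> {0<..}" for x using that by (auto simp: U_def)
  moreover have "continuous_on (closure {0<..}) (\<lambda>x. f x - g x)" using c by simp
  moreover have "x \<in> closure {0<..}" using x by simp
  ultimately have "f x - g x = 0" by (metis (no_types, lifting) continuous_constant_on_closure)
  then show ?thesis by simp
qed

lemma derivs_of_repr_continuous:
  assumes "derivs_of_repr k y u" "i \<le> k"
  shows "continuous_on {0..} (u i)"
proof (cases "i = k")
  case False
  then have "(u i has_vector_derivative u (Suc i) x) (at x within {0..})" if "x \<ge> 0" for x
    using assms that by (simp add: derivs_of_repr_def)
  then show ?thesis
    unfolding continuous_on_eq_continuous_within using has_vector_derivative_continuous by blast
qed (use assms in \<open>simp add: derivs_of_repr_def\<close>)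

lemma at_within_halfline_nontrivial: "0 \<le> x \<Longrightarrow> at x within {0..} \<noteq> (bot :: real filter)"
  by (metis at_le bot.extremum_unique trivial_limit_at_right_real Ioi_le_Ico order_trans atLeast_subset_iff)

lemma derivs_of_repr_unique:
  assumes u: "derivs_of_repr k y u" and v: "derivs_of_repr k y v" and "i \<le> k" "x \<ge> 0"
  shows "u i x = v i x"
  using assms(3,4)
proof (induction i arbitrary: x)
  case 0
  show ?case
  proof (rule continuous_AE_eq_imp_eq[OF derivs_of_repr_continuous[OF u] derivs_of_repr_continuous[OF v] _ 0(2)])
    have "AE x in halfline. y x = u 0 x" "AE x in halfline. y x = v 0 x"
      using u v by (auto simp: derivs_of_repr_def)
    then show "AE x in halfline. u 0 x = v 0 x" by eventually_elim simp
  qed auto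
next
  case (Suc i)
  have "(u i has_vector_derivative u (Suc i) x) (at x within {0..})"
    "(v i has_vector_derivative v (Suc i) x) (at x within {0..})"
    using u v Suc.prems by (auto simp: derivs_of_repr_def)
  moreover have "(v i has_vector_derivative u (Suc i) x) (at x within {0..})"
    by (rule has_vector_derivative_transform[OF _ _ calculation(1)]) (use Suc in auto)
  ultimately show ?case
    using vector_derivative_unique_within[OF at_within_halfline_nontrivial[OF Suc.prems(2)]] by blast
qed

lemma deriv_at_0_eq:
  assumes "derivs_of_repr k y u"
  shows "deriv_at_0 k y = u k 0"
  unfolding deriv_at_0_def
proof (rule the_equality)
  show "\<exists>v. derivs_of_repr k y v \<and> v k 0 = u k 0" using assms by blast
  fix c assume "\<exists>v. derivs_of_repr k y v \<and> v k 0 = c"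
  then obtain v where v: "derivs_of_repr k y v" "v k 0 = c" by blast
  show "c = u k 0" using derivs_of_repr_unique[OF v(1) assms order_refl, of 0] v(2) by simp
qed

text \<open>Orders below 2n are those for which the member of the chain is continuous.\<close>

lemma deriv_at_0_maximal:
  assumes "maximal_repr n f g u" "k < 2 * n"
  shows "deriv_at_0 k f = u k 0"
proof (rule deriv_at_0_eq)
  note U = maximal_reprD[OF assms(1)]
  show "derivs_of_repr k f u"
    unfolding derivs_of_repr_def
    using U(4) assms(2) ac_chain_continuous[OF U(3)] ac_deriv_vector_derivative[OF ac_chainD[OF U(3)]] by auto
qed

lemma Gamma_maximal:
  assumes "maximal_repr n f g u"
  shows "Gamma0 n f = vec n (\<lambda>j. u (n - 1 - j) 0)" "Gamma1 n f = vec n (\<lambda>j. (-1) ^ j * u (n + j) 0)"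
  using deriv_at_0_maximal[OF assms] by (auto simp: Gamma0_def Gamma1_def intro!: eq_vecI)

text \<open>A linear combination of 2n jets; compact support makes every derivative
  square-integrable.\<close>

lemma exists_boundary_values:
  obtains f g u where "maximal_repr n f g u" "\<And>k. k < 2 * n \<Longrightarrow> u k 0 = c k"
proof -
  have "\<exists>w. (\<forall>k x. (w k has_vector_derivative w (Suc k) x) (at x)) \<and>
    (\<forall>k. w k 0 = (if k = a then 1 else 0)) \<and> (\<forall>k x. x \<ge> 1 \<longrightarrow> w k x = (0 :: complex))" for a
    by (rule exists_jet[of 1 a]) (simp, simp, blast)
  then obtain w where w: "\<And>a k x. (w a k has_vector_derivative w a (Suc k) x) (at x)"
    "\<And>a k. w a k 0 = (if k = a then 1 else 0)" "\<And>a k x. x \<ge> 1 \<Longrightarrow> w a k x = (0 :: complex)"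
    by metis
  define u where "u = (\<lambda>k x. \<Sum>a<2 * n. c a * w a k x)"
  have chain: "ac_chain N u" for N
    unfolding u_def by (rule ac_chain_sum, rule ac_chainI_vector_derivative, rule w)
  have L2: "u k \<in> L2_halfline" for k
    by (rule continuous_compact_L2[of _ 1]) (use ac_chain_continuous[OF chain, of k "Suc k"] in \<open>auto simp: u_def w(3)\<close>)
  have "maximal_repr n (u 0) (\<lambda>x. (-1) ^ n * u (2 * n) x) u"
    unfolding maximal_repr_def using chain L2 L2_cmult[OF L2] by (simp flip: mult.assoc power_add mult_2)
  moreover have "u k 0 = c k" if "k < 2 * n" for k
    using that by (simp add: u_def w(2) if_distrib cong: if_cong)
  ultimately show thesis by (rule that)
qed

lemma maximal_repr_lincomb:
  assumes "maximal_repr n f f' u" "maximal_repr n g g' v"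
  shows "maximal_repr n (\<lambda>x. a * f x + b * g x) (\<lambda>x. a * f' x + b * g' x) (\<lambda>k x. a * u k x + b * v k x)"
proof -
  note F = maximal_reprD[OF assms(1)] and G = maximal_reprD[OF assms(2)]
  have "AE x in halfline. a * f x + b * g x = a * u 0 x + b * v 0 x"
    using F(4) G(4) by eventually_elim simp
  then show ?thesis
    unfolding maximal_repr_def using F G
    by (auto intro!: L2_add L2_cmult ac_chain_lincomb simp: algebra_simps)
qed

text \<open>The 2n terms are split in the middle. In the lower half v contributes orders below n and
  u orders from n on; after reversal this is \<open>Gamma1\<close> of f against
  \<open>Gamma0\<close> of g. The upper half is the opposite pairing. The alternating signs in
  \<open>Gamma1\<close> are those of the boundary form.\<close>

lemma boundary_form_Gamma:
  assumes f: "maximal_repr n f f' u" and g: "maximal_repr n g g' v"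
  shows "- ((-1) ^ n * boundary_form (2 * n) u (\<lambda>i x. cnj (v i x)) 0) = Gamma1 n f \<bullet>c Gamma0 n g - Gamma0 n f \<bullet>c Gamma1 n g"
proof -
  let ?t = "\<lambda>i. (-1) ^ i * (u (2 * n - Suc i) 0 * cnj (v i 0))"
  have "boundary_form (2 * n) u (\<lambda>i x. cnj (v i x)) 0 = (\<Sum>i<n. ?t i) + (\<Sum>i<n. ?t (n + i))"
    unfolding boundary_form_def mult_2 by (simp add: sum.nat_group[symmetric] lessThan_atLeast0 sum.atLeastLessThan_concat[of 0 n "n + n", symmetric] sum.shift_bounds_nat_ivl[of _ 0 n n, simplified] add.commute)
  also have "(\<Sum>i<n. ?t i) = (\<Sum>i<n. ?t (n - Suc i))"
    by (rule sum.nat_diff_reindex[symmetric])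
  finally have "- ((-1) ^ n * boundary_form (2 * n) u (\<lambda>i x. cnj (v i x)) 0) =
      (\<Sum>i<n. - ((-1) ^ n * ?t (n - Suc i))) - (\<Sum>i<n. (-1) ^ n * ?t (n + i))"
    by (simp add: distrib_left sum_distrib_left sum_negf)
  also have "(\<Sum>i<n. - ((-1) ^ n * ?t (n - Suc i))) = (\<Sum>i<n. (-1) ^ i * u (n + i) 0 * cnj (v (n - 1 - i) 0))"
  proof (rule sum.cong[OF refl])
    fix i assume "i \<in> {..<n}"
    then have i: "i < n" by simp
    \<comment> \<open>Since n = (n - 1 - i) + (i + 1), the two sign factors combine to
      -(-1)^i.\<close>
    have "(-1) ^ n = (-1) ^ (n - Suc i) * (-1) ^ Suc i * (1 :: complex)"
      using i by (simp only: power_add[symmetric]) simp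
    then have "(-1) ^ n * (-1) ^ (n - Suc i) = - ((-1) ^ i * (1 :: complex))"
      by (simp add: mult_ac flip: power_mult_distrib)
    moreover have "2 * n - Suc (n - Suc i) = n + i" using i by simp
    ultimately show "- ((-1) ^ n * ?t (n - Suc i)) = (-1) ^ i * u (n + i) 0 * cnj (v (n - 1 - i) 0)"
      by (simp add: mult.assoc[symmetric])
  qed
  also have "(\<Sum>i<n. (-1) ^ n * ?t (n + i)) = (\<Sum>i<n. u (n - 1 - i) 0 * ((-1) ^ i * cnj (v (n + i) 0)))"
  proof (rule sum.cong[OF refl])
    fix i assume "i \<in> {..<n}"
    then have i: "i < n" by simp
    have "(-1) ^ n * (-1) ^ (n + i) = ((-1) ^ i :: complex)"
      by (simp add: power_add flip: mult.assoc power_mult_distrib)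
    moreover have "2 * n - Suc (n + i) = n - 1 - i" using i by simp
    ultimately show "(-1) ^ n * ?t (n + i) = u (n - 1 - i) 0 * ((-1) ^ i * cnj (v (n + i) 0))"
      by (simp add: mult_ac)
  qed
  finally show ?thesis
    by (simp add: Gamma_maximal[OF f] Gamma_maximal[OF g] scalar_prod_def lessThan_atLeast0 conjugate_complex_def)
qed

lemma Green_Gamma:
  assumes "(f, f') \<in> op_adjoint (minimal_operator n)" "(g, g') \<in> op_adjoint (minimal_operator n)"
  shows "L2_inner f' g - L2_inner f g' = Gamma1 n f \<bullet>c Gamma0 n g - Gamma0 n f \<bullet>c Gamma1 n g"
proof -
  obtain u v where "maximal_repr n f f' u" "maximal_repr n g g' v"
    using assms op_adjoint_minimal_iff by blast
  then show ?thesis using Green_maximal boundary_form_Gamma by metis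
qed

lemma Gamma_lincomb:
  assumes "(f, f') \<in> op_adjoint (minimal_operator n)" "(g, g') \<in> op_adjoint (minimal_operator n)"
  shows "(\<lambda>x. a * f x + b * g x, \<lambda>x. a * f' x + b * g' x) \<in> op_adjoint (minimal_operator n)"
    "Gamma0 n (\<lambda>x. a * f x + b * g x) = a \<cdot>\<^sub>v Gamma0 n f + b \<cdot>\<^sub>v Gamma0 n g"
    "Gamma1 n (\<lambda>x. a * f x + b * g x) = a \<cdot>\<^sub>v Gamma1 n f + b \<cdot>\<^sub>v Gamma1 n g"
proof -
  obtain u v where uv: "maximal_repr n f f' u" "maximal_repr n g g' v"
    using assms op_adjoint_minimal_iff by blast
  note L = maximal_repr_lincomb[OF uv, of a b]
  show "(\<lambda>x. a * f x + b * g x, \<lambda>x. a * f' x + b * g' x) \<in> op_adjoint (minimal_operator n)"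
    using L op_adjoint_minimal_iff by blast
  show "Gamma0 n (\<lambda>x. a * f x + b * g x) = a \<cdot>\<^sub>v Gamma0 n f + b \<cdot>\<^sub>v Gamma0 n g"
    "Gamma1 n (\<lambda>x. a * f x + b * g x) = a \<cdot>\<^sub>v Gamma1 n f + b \<cdot>\<^sub>v Gamma1 n g"
    unfolding Gamma_maximal[OF L] Gamma_maximal[OF uv(1)] Gamma_maximal[OF uv(2)]
    by (auto intro!: eq_vecI simp: algebra_simps)
qed

lemma Gamma_carrier: "Gamma0 n f \<in> carrier_vec n" "Gamma1 n f \<in> carrier_vec n"
  by (simp_all add: Gamma0_def Gamma1_def)

lemma Gamma_surjective:
  assumes "a \<in> carrier_vec n" "b \<in> carrier_vec n"
  obtains f f' where "(f, f') \<in> op_adjoint (minimal_operator n)" "Gamma0 n f = a" "Gamma1 n f = b"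
proof -
  define c where "c = (\<lambda>k. if k < n then a $ (n - 1 - k) else (-1) ^ (k - n) * b $ (k - n))"
  obtain f g u where u: "maximal_repr n f g u" "\<And>k. k < 2 * n \<Longrightarrow> u k 0 = c k"
    using exists_boundary_values[of n c] by metis
  have "Gamma0 n f = a" "Gamma1 n f = b"
    unfolding Gamma_maximal[OF u(1)] using assms
    by (auto intro!: eq_vecI simp: u(2) c_def simp flip: mult.assoc power_mult_distrib)
  then show thesis using u(1) op_adjoint_minimal_iff by (intro that) blast+
qed

theorem boundary_triplet_Gamma: "boundary_triplet (minimal_operator n) n (Gamma0 n) (Gamma1 n)"
  unfolding boundary_triplet_def
proof (intro conjI)
  show "\<forall>\<Gamma>\<in>{Gamma0 n, Gamma1 n}. (\<forall>f\<in>Domain (op_adjoint (minimal_operator n)). \<Gamma> f \<in> carrier_vec n) \<and>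
    (\<forall>f\<in>Domain (op_adjoint (minimal_operator n)). \<forall>g\<in>Domain (op_adjoint (minimal_operator n)). \<forall>a b.
      \<Gamma> (\<lambda>x. a * f x + b * g x) = a \<cdot>\<^sub>v \<Gamma> f + b \<cdot>\<^sub>v \<Gamma> g)"
    using Gamma_carrier Gamma_lincomb(2,3) by blast
  show "\<forall>(f, f')\<in>op_adjoint (minimal_operator n). \<forall>(g, g')\<in>op_adjoint (minimal_operator n).
      L2_inner f' g - L2_inner f g' = Gamma1 n f \<bullet>c Gamma0 n g - Gamma0 n f \<bullet>c Gamma1 n g"
    using Green_Gamma by blast
  show "\<forall>u\<in>carrier_vec n. \<forall>v\<in>carrier_vec n. \<exists>f\<in>Domain (op_adjoint (minimal_operator n)). Gamma0 n f = u \<and> Gamma1 n f = v"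
    using Gamma_surjective by (metis Domain.intros)
qed

section \<open>The Friedrichs extension\<close>

text \<open>For test functions this is Green's formula without boundary terms; it passes to L2
  limits in the argument that is approximated.\<close>

lemma minimal_subset_adjoint: "minimal_operator n \<subseteq> op_adjoint (minimal_operator n)"
proof clarify
  fix f f' assume "(f, f') \<in> minimal_operator n"
  then obtain F G where FG: "\<And>m. (F m, G m) \<in> test_operator n" "L2_tendsto F f" "L2_tendsto G f'"
    and L2: "f \<in> L2_halfline" "f' \<in> L2_halfline"
    unfolding minimal_operator_eq op_closure_def by blast
  have m: "F m \<in> L2_halfline" "G m \<in> L2_halfline" for m using FG(1)[of m] test_operator_L2 by auto
  have adj: "(F m, G m) \<in> op_adjoint (test_operator n)" for m
    using FG(1)[of m] maximal_repr_imp_op_adjoint[OF maximal_repr_test[of "F m" n]]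
    unfolding op_adjoint_minimal by (auto simp: test_operator_def)
  have "L2_inner h' f = L2_inner h f'" if hh: "(h, h') \<in> test_operator n" for h h'
  proof -
    have "L2_inner h' (F m) = L2_inner h (G m)" for m
      using adj[of m] hh by (auto simp: op_adjoint_def)
    then have eq: "(\<lambda>m. L2_inner h' (F m)) = (\<lambda>m. L2_inner h (G m))" by (rule ext)
    have "h \<in> L2_halfline" "h' \<in> L2_halfline" using hh test_operator_L2 by auto
    then show ?thesis
      by (intro LIMSEQ_unique[OF L2_inner_tendsto_right[OF FG(2) m(1) L2(1), of h', unfolded eq]
            L2_inner_tendsto_right[OF FG(3) m(2) L2(2), of h]])
  qed
  then show "(f, f') \<in> op_adjoint (minimal_operator n)"
    using L2 unfolding op_adjoint_minimal by (auto simp: op_adjoint_def)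
qed

lemma cscalar_prod_zero:
  fixes v :: "complex vec"
  assumes "v \<in> carrier_vec n"
  shows "v \<bullet>c 0\<^sub>v n = 0" "0\<^sub>v n \<bullet>c v = 0"
  using assms by (auto simp: scalar_prod_def)

text \<open>In Green's formula an element of the minimal operator gives zero against the whole
  domain of the adjoint. As the boundary maps are jointly surjective, g can be chosen with
  \<open>Gamma0\<close> of g equal to \<open>Gamma1\<close> of f and \<open>Gamma1\<close> of g
  zero; then the square norm of \<open>Gamma1\<close> of f is zero. The other value is treated in
  the same way.\<close>

lemma Gamma_minimal_zero:
  assumes "(f, f') \<in> minimal_operator n"
  shows "Gamma0 n f = 0\<^sub>v n" "Gamma1 n f = 0\<^sub>v n"
proof -
  have adj: "(f, f') \<in> op_adjoint (minimal_operator n)" using assms minimal_subset_adjoint by blast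
  have eq: "Gamma1 n f \<bullet>c Gamma0 n g = Gamma0 n f \<bullet>c Gamma1 n g" if g: "(g, g') \<in> op_adjoint (minimal_operator n)" for g g'
  proof -
    have "L2_inner f' g = L2_inner f g'" using g assms by (auto simp: op_adjoint_def)
    then show ?thesis using Green_Gamma[OF adj g] by simp
  qed
  obtain g g' where g: "(g, g') \<in> op_adjoint (minimal_operator n)" "Gamma0 n g = Gamma1 n f" "Gamma1 n g = 0\<^sub>v n"
    using Gamma_surjective[OF Gamma_carrier(2) zero_carrier_vec] by metis
  show "Gamma1 n f = 0\<^sub>v n"
    using eq[OF g(1)] conjugate_square_eq_0_vec[OF Gamma_carrier(2)[of n f]] cscalar_prod_zero[OF Gamma_carrier(1)] by (simp add: g(2,3))
  obtain h h' where h: "(h, h') \<in> op_adjoint (minimal_operator n)" "Gamma0 n h = 0\<^sub>v n" "Gamma1 n h = Gamma0 n f"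
    using Gamma_surjective[OF zero_carrier_vec Gamma_carrier(1)] by metis
  show "Gamma0 n f = 0\<^sub>v n"
    using eq[OF h(1)] conjugate_square_eq_0_vec[OF Gamma_carrier(1)[of n f]] cscalar_prod_zero[OF Gamma_carrier(2)] by (simp add: h(2,3))
qed

lemma Gamma0_zero_iff:
  assumes "maximal_repr n f f' u"
  shows "Gamma0 n f = 0\<^sub>v n \<longleftrightarrow> (\<forall>i<n. u i 0 = 0)"
proof
  assume Z: "Gamma0 n f = 0\<^sub>v n"
  show "\<forall>i<n. u i 0 = 0"
  proof (intro allI impI)
    fix i assume "i < n"
    then have "Gamma0 n f $ (n - 1 - i) = u i 0" by (simp add: Gamma_maximal[OF assms])
    then show "u i 0 = 0" using Z \<open>i < n\<close> by simp
  qed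
qed (auto simp: Gamma_maximal[OF assms] intro!: eq_vecI)

lemma ac_chain_drop: "ac_chain (M + N) u \<Longrightarrow> ac_chain N (\<lambda>i. u (M + i))"
  by (simp add: ac_chain_def)

lemma maximal_repr_L2: "maximal_repr n f f' u \<Longrightarrow> k \<le> 2 * n \<Longrightarrow> u k \<in> L2_halfline"
  by (rule ac_chain_L2[of "2 * n"]) (auto dest: maximal_reprD)

text \<open>Of the 2n derivatives n are moved: Green's formula of order n for the upper half of the
  chain u against the lower half of v, whose boundary terms contain v_i(0) with i < n. Applied to
  differences of approximants, it turns the form into a squared L2 norm of n-th derivatives.\<close>

lemma quadratic_form_eq:
  assumes f: "maximal_repr n f f' u" and g: "maximal_repr n g g' v" and zero: "\<And>i. i < n \<Longrightarrow> v i 0 = 0"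
  shows "L2_inner f' g = L2_inner (u n) (v n)"
proof -
  note F = maximal_reprD[OF f] and G = maximal_reprD[OF g]
  have "(LINT x|halfline. u (n + n) x * cnj (v 0 x)) - (-1) ^ n * (LINT x|halfline. u (n + 0) x * cnj (v n x)) =
     - boundary_form n (\<lambda>i. u (n + i)) (\<lambda>i x. cnj (v i x)) 0"
  proof (rule Green_halfline)
    show "ac_chain n (\<lambda>i. u (n + i))" using ac_chain_drop[of n n u] F(3) by (simp add: mult_2)
    show "ac_chain n (\<lambda>i x. cnj (v i x))" by (rule ac_chain_cnj[OF ac_chain_mono[OF G(3)]]) simp
  qed (use maximal_repr_L2[OF f] maximal_repr_L2[OF g] in \<open>auto intro: L2_cnj\<close>)
  also have "boundary_form n (\<lambda>i. u (n + i)) (\<lambda>i x. cnj (v i x)) 0 = 0"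
    unfolding boundary_form_def by (rule sum.neutral) (simp add: zero)
  finally have "L2_inner (u (2 * n)) (v 0) = (-1) ^ n * L2_inner (u n) (v n)"
    by (simp add: L2_inner_def mult_2)
  moreover have "L2_inner (u (2 * n)) (v 0) = (-1) ^ n * L2_inner f' g"
    using L2_inner_cong_AE[OF F(2) _ G(1,4), of f'] F(5) by (simp add: L2_inner_cmult_left)
  ultimately show ?thesis by simp
qed

lemma L2_norm_jet_le:
  assumes "continuous_on {0..} w" "\<And>x. x \<ge> \<epsilon> \<Longrightarrow> w x = 0" "\<And>x. x \<ge> 0 \<Longrightarrow> cmod (w x) \<le> 1" "0 < \<epsilon>"
  shows "L2_norm w \<le> sqrt \<epsilon>"
proof -
  have L2: "w \<in> L2_halfline" by (rule continuous_compact_L2[OF assms(1,2)])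
  have "of_real ((L2_norm w)\<^sup>2) = integral {0<..} (\<lambda>x. w x * cnj (w x))"
    unfolding L2_inner_self[symmetric] by (rule L2_inner_eq_integral[OF L2 L2])
  also have "\<dots> = integral {0..\<epsilon>} (\<lambda>x. w x * cnj (w x))"
    by (rule integral_halfline_eq_Icc) (simp add: assms)
  finally have "(L2_norm w)\<^sup>2 = cmod (integral {0..\<epsilon>} (\<lambda>x. w x * cnj (w x)))"
    by (metis norm_of_real abs_of_nonneg zero_le_power2)
  also have "\<dots> \<le> integral {0..\<epsilon>} (\<lambda>x. 1)"
  proof (rule integral_norm_bound_integral)
    have "continuous_on {0..\<epsilon>} w" by (rule continuous_on_subset[OF assms(1)]) auto
    then show "(\<lambda>x. w x * cnj (w x)) integrable_on {0..\<epsilon>}"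
      by (intro integrable_continuous_real continuous_intros)
    show "cmod (w x * cnj (w x)) \<le> 1" if "x \<in> {0..\<epsilon>}" for x
      using assms(3)[of x] that by (simp add: norm_mult mult_le_one)
  qed auto
  also have "\<dots> = \<epsilon>" using assms(4) by simp
  finally show ?thesis using real_le_rsqrt by blast
qed

text \<open>The Cauchy condition bounds the n-th derivatives of the approximants in L2, by C.
  Against a jet w supported in [0, \<epsilon>] Green's formula has no boundary term for them, so
  their inner product with the conjugated n-th derivative of w is at most C sqrt \<epsilon>. This
  survives the L2 limit, and for u the formula then bounds |u_i(0)| by sqrt \<epsilon> times the sum
  of C and the norm of u_n.\<close>

lemma friedrichs_domain_imp_Gamma0_zero:
  assumes u: "maximal_repr n f f' u" and FG: "\<And>m. (F m, G m) \<in> minimal_operator n" and lim: "L2_tendsto F f"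
    and cauchy: "\<And>\<epsilon>. \<epsilon> > 0 \<Longrightarrow> \<exists>N. \<forall>m\<ge>N. \<forall>k\<ge>N. cmod (L2_inner (\<lambda>x. G m x - G k x) (\<lambda>x. F m x - F k x)) < \<epsilon>"
    and i: "i < n"
  shows "u i 0 = 0"
proof -
  note U = maximal_reprD[OF u]
  have "\<exists>v. maximal_repr n (F m) (G m) v" for m
    using FG minimal_subset_adjoint op_adjoint_minimal_iff by blast
  then obtain v where v: "\<And>m. maximal_repr n (F m) (G m) (v m)" by metis
  have v0: "v m j 0 = 0" if "j < n" for m j
    using Gamma0_zero_iff[OF v[of m]] Gamma_minimal_zero(1)[OF FG[of m]] that by simp
  note vL2 = maximal_repr_L2[OF v] and uL2 = maximal_repr_L2[OF u]
  note V = maximal_reprD[OF v]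
  \<comment> \<open>Tolerance 1 turns the Cauchy condition into a uniform bound on the n-th
    derivatives.\<close>
  obtain N where N: "\<And>m k. m \<ge> N \<Longrightarrow> k \<ge> N \<Longrightarrow> cmod (L2_inner (\<lambda>x. G m x - G k x) (\<lambda>x. F m x - F k x)) < 1"
    using cauchy[of 1] by auto
  define C where "C = L2_norm (v N n) + 1"
  have C: "L2_norm (v m n) \<le> C" if "m \<ge> N" for m
  proof -
    have r: "maximal_repr n (\<lambda>x. 1 * F m x + (-1) * F N x) (\<lambda>x. 1 * G m x + (-1) * G N x) (\<lambda>k x. 1 * v m k x + (-1) * v N k x)"
      by (rule maximal_repr_lincomb[OF v v])
    have "L2_inner (\<lambda>x. G m x - G N x) (\<lambda>x. F m x - F N x) = L2_inner (\<lambda>x. v m n x - v N n x) (\<lambda>x. v m n x - v N n x)"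
      using quadratic_form_eq[OF r r] v0 by simp
    then have "(L2_norm (\<lambda>x. v m n x - v N n x))\<^sup>2 < 1"
      using N[OF that order_refl] by (simp add: L2_inner_self norm_power)
    then have "L2_norm (\<lambda>x. v m n x - v N n x) \<le> 1"
      by (metis L2_norm_nonneg less_eq_real_def power2_less_imp_less one_power2 zero_le_one)
    moreover have L: "v k n \<in> L2_halfline" for k by (rule vL2) simp
    have "L2_norm (v m n) \<le> L2_norm (\<lambda>x. v m n x - v N n x) + L2_norm (v N n)"
      using L2_norm_triangle[OF L2_diff[OF L[of m] L[of N]] L[of N]] by simp
    ultimately show ?thesis by (simp add: C_def)
  qed
  have "cmod (u i 0) \<le> (L2_norm (u n) + C) * sqrt \<epsilon>" if e: "0 < \<epsilon>" "\<epsilon> < 1" for \<epsilon>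
  proof -
    \<comment> \<open>In the boundary form of order n the jet of index n - 1 - i selects
      u_i(0).\<close>
    obtain w where w: "\<And>k x. (w k has_vector_derivative w (Suc k) x) (at x)"
      "\<And>k. w k 0 = (if k = n - Suc i then 1 else 0)" "\<And>k x. x \<ge> \<epsilon> \<Longrightarrow> w k x = (0 :: complex)" "\<And>x. x \<ge> 0 \<Longrightarrow> cmod (w 0 x) \<le> 1"
      using exists_jet[of \<epsilon> "n - Suc i"] e by auto
    have wc: "ac_chain M w" for M by (rule ac_chainI_vector_derivative) (rule w(1))
    have wcont: "continuous_on {0..} (w k)" for k by (rule ac_chain_continuous[OF wc, of k "Suc k"]) simp
    have wL2: "w k \<in> L2_halfline" for k by (rule continuous_compact_L2[OF wcont w(3)])
    have w0: "L2_norm (w 0) \<le> sqrt \<epsilon>" by (rule L2_norm_jet_le[OF wcont w(3,4) e(1)])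
    let ?w = "\<lambda>k x. cnj (w k x)"
    have wcL2: "?w k \<in> L2_halfline" for k by (rule L2_cnj[OF wL2])
    have wc0: "L2_norm (?w 0) = L2_norm (w 0)" by (simp add: L2_norm_def)
    have "cmod (L2_inner (v m 0) (?w n)) \<le> C * L2_norm (w 0)" if "m \<ge> N" for m
    proof -
      have "L2_inner (v m n) (?w 0) - (-1) ^ n * L2_inner (v m 0) (?w n) = - boundary_form n (v m) w 0"
        unfolding L2_inner_def complex_cnj_cnj
        by (rule Green_halfline) (use ac_chain_mono[OF V(3)[of m]] vL2 wc wL2 in auto)
      also have "boundary_form n (v m) w 0 = 0" by (rule boundary_form_0) (rule v0)
      finally have "L2_inner (v m n) (?w 0) = (-1) ^ n * L2_inner (v m 0) (?w n)" by simp
      then have "cmod (L2_inner (v m 0) (?w n)) = cmod (L2_inner (v m n) (?w 0))"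
        by (simp add: norm_mult norm_power)
      also have "\<dots> \<le> L2_norm (v m n) * L2_norm (?w 0)" by (rule L2_Cauchy_Schwarz) (use vL2 wcL2 in auto)
      also have "\<dots> \<le> C * L2_norm (w 0)" unfolding wc0 by (intro mult_right_mono C that L2_norm_nonneg)
      finally show ?thesis .
    qed
    then have "cmod (L2_inner (F m) (?w n)) \<le> C * L2_norm (w 0)" if "m \<ge> N" for m
      using L2_inner_cong_AE[OF V(1,4)[of m] wcL2[of n], of "?w n"] that by simp
    then have "\<forall>\<^sub>F m in sequentially. cmod (L2_inner (F m) (?w n)) \<le> C * L2_norm (w 0)"
      by (auto simp: eventually_sequentially)
    moreover have "(\<lambda>m. cmod (L2_inner (F m) (?w n))) \<longlonglongrightarrow> cmod (L2_inner f (?w n))"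
      by (intro tendsto_norm L2_inner_tendsto_left[OF lim V(1) U(1) wcL2])
    ultimately have "cmod (L2_inner f (?w n)) \<le> C * L2_norm (w 0)"
      by (intro tendsto_upperbound) auto
    then have 1: "cmod (L2_inner (u 0) (?w n)) \<le> C * L2_norm (w 0)"
      using L2_inner_cong_AE[OF U(1,4) wcL2[of n], of "?w n"] by simp
    have "L2_inner (u n) (?w 0) - (-1) ^ n * L2_inner (u 0) (?w n) = - boundary_form n u w 0"
      unfolding L2_inner_def complex_cnj_cnj
      by (rule Green_halfline) (use ac_chain_mono[OF U(3)] uL2 wc wL2 in auto)
    moreover have "boundary_form n u w 0 = (-1) ^ (n - Suc i) * u (n - Suc (n - Suc i)) 0"
      by (rule boundary_form_jet) (use i w(2) in auto)
    moreover have "n - Suc (n - Suc i) = i" using i by simp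
    ultimately have "cmod (u i 0) = cmod (L2_inner (u n) (?w 0) - (-1) ^ n * L2_inner (u 0) (?w n))"
      by (simp add: norm_mult norm_power)
    also have "\<dots> \<le> cmod (L2_inner (u n) (?w 0)) + cmod (L2_inner (u 0) (?w n))"
      by (rule order_trans[OF norm_triangle_ineq4]) (simp add: norm_mult norm_power)
    also have "\<dots> \<le> L2_norm (u n) * L2_norm (w 0) + C * L2_norm (w 0)"
      using L2_Cauchy_Schwarz[OF uL2 wcL2, of n 0] 1 wc0 by simp
    also have "\<dots> = (L2_norm (u n) + C) * L2_norm (w 0)" by (simp add: algebra_simps)
    also have "\<dots> \<le> (L2_norm (u n) + C) * sqrt \<epsilon>"
      using w0 L2_norm_nonneg[of "u n"] L2_norm_nonneg[of "v N n"] by (intro mult_left_mono) (auto simp: C_def)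
    finally show ?thesis .
  qed
  then have "\<forall>\<^sub>F \<epsilon> in at_right 0. cmod (u i 0) \<le> (L2_norm (u n) + C) * sqrt \<epsilon>"
    unfolding eventually_at_right_field by (intro exI[of _ 1]) auto
  moreover have "((\<lambda>\<epsilon>. (L2_norm (u n) + C) * sqrt \<epsilon>) \<longlongrightarrow> (L2_norm (u n) + C) * sqrt 0) (at_right 0)"
    by (intro tendsto_intros)
  ultimately have "cmod (u i 0) \<le> (L2_norm (u n) + C) * sqrt 0"
    by (intro tendsto_lowerbound) auto
  then show ?thesis by simp
qed

subsection \<open>Approximation by test functions\<close>

lemma L2_tendsto_eventually:
  "L2_tendsto F f \<Longrightarrow> 0 < e \<Longrightarrow> \<forall>\<^sub>F m in sequentially. L2_norm (\<lambda>x. F m x - f x) < e"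
  unfolding L2_tendsto_def by (rule order_tendstoD(2))

lemma L2_tendsto_dominated:
  assumes "\<And>m. F m \<in> L2_halfline" "f \<in> L2_halfline" "G \<in> L2_halfline"
    and "\<And>m x. x > 0 \<Longrightarrow> cmod (F m x - f x) \<le> cmod (G x)"
    and "\<And>x. x > 0 \<Longrightarrow> (\<lambda>m. F m x) \<longlonglongrightarrow> f x"
  shows "L2_tendsto F f"
proof -
  have d: "(\<lambda>x. F m x - f x) \<in> L2_halfline" for m by (rule L2_diff[OF assms(1,2)])
  have "(\<lambda>m. LINT x|halfline. (cmod (F m x - f x))\<^sup>2) \<longlonglongrightarrow> (LINT x|halfline. 0)"
  proof (rule integral_dominated_convergence[where w = "\<lambda>x. (cmod (G x))\<^sup>2"])
    show "(\<lambda>x. (cmod (F m x - f x))\<^sup>2) \<in> borel_measurable halfline" for m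
      using borel_measurable_integrable[OF L2_halflineD(2)[OF d]] .
    show "integrable halfline (\<lambda>x. (cmod (G x))\<^sup>2)" by (rule L2_halflineD(2)[OF assms(3)])
    show "AE x in halfline. (\<lambda>m. (cmod (F m x - f x))\<^sup>2) \<longlonglongrightarrow> 0"
    proof (rule AE_halflineI)
      fix x :: real assume "x > 0"
      then have "(\<lambda>m. (cmod (F m x - f x))\<^sup>2) \<longlonglongrightarrow> (cmod (f x - f x))\<^sup>2"
        by (intro tendsto_intros assms(5))
      then show "(\<lambda>m. (cmod (F m x - f x))\<^sup>2) \<longlonglongrightarrow> 0" by simp
    qed
    show "AE x in halfline. norm ((cmod (F m x - f x))\<^sup>2) \<le> (cmod (G x))\<^sup>2" for m
      by (rule AE_halflineI) (use assms(4) in \<open>simp add: power_mono\<close>)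
  qed simp
  then have "(\<lambda>m. sqrt (LINT x|halfline. (cmod (F m x - f x))\<^sup>2)) \<longlonglongrightarrow> sqrt 0"
    by (intro tendsto_real_sqrt) simp
  then show ?thesis by (simp add: L2_tendsto_def L2_norm_def)
qed

lemma L2_cmod: "f \<in> L2_halfline \<Longrightarrow> (\<lambda>x. of_real (cmod (f x))) \<in> L2_halfline"
proof -
  assume f: "f \<in> L2_halfline"
  have [measurable]: "f \<in> borel_measurable halfline" by (rule L2_halflineD(1)[OF f])
  have "(\<lambda>x. complex_of_real (cmod (f x))) \<in> borel_measurable halfline" by measurable
  then show ?thesis using L2_halflineD(2)[OF f] by (simp add: L2_halfline_def)
qed

text \<open>Integrating n times from 0 recovers a function from its n-th derivative exactly when its
  boundary values of orders below n vanish. Approximating the n-th derivative by functions that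
  vanish near 0 and integrating back keeps the supports away from 0.\<close>

fun iterated_integral :: "(real \<Rightarrow> complex) \<Rightarrow> nat \<Rightarrow> real \<Rightarrow> complex" where
  "iterated_integral p 0 = p"
| "iterated_integral p (Suc j) = (\<lambda>x. integral {0..x} (iterated_integral p j))"

lemma smooth_iterated_integral:
  assumes "smooth p" "0 < a" "\<And>x. x \<le> a \<Longrightarrow> p x = 0"
  shows "smooth (iterated_integral p j) \<and> (\<forall>x\<le>a. iterated_integral p j x = 0)"
  using assms by (induction j) (auto intro: smooth_antiderivative)

lemma vderiv_iterated_integral:
  assumes "smooth p" "0 < a" "\<And>x. x \<le> a \<Longrightarrow> p x = 0" "i \<le> j"
  shows "(vderiv ^^ i) (iterated_integral p j) = iterated_integral p (j - i)"
  using assms(4)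
proof (induction i)
  case (Suc i)
  then have "j - i = Suc (j - Suc i)" by simp
  then show ?case
    using Suc smooth_antiderivative(2)[OF _ assms(2), of "iterated_integral p (j - Suc i)"]
      smooth_iterated_integral[OF assms(1-3), of "j - Suc i"] by simp
qed simp

text \<open>Dominated convergence at each integration; the zero boundary values turn the integral of
  u_{n-j} into u_{n-j-1} without a constant. Convergence is claimed for x > 0, since all
  \<open>p m 0\<close> are 0 while u_n(0) may be different.\<close>

lemma truncated_iterated_integral_tendsto:
  assumes chain: "ac_chain n u" and zero: "\<And>i. i < n \<Longrightarrow> u i 0 = 0" and "R > 0"
    and p: "\<And>m. continuous_on {0..R} (p m)" "\<And>m. p m 0 = 0"
    and bound: "\<And>m x. x \<in> {0..R} \<Longrightarrow> cmod (p m x) \<le> B"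
    and lim: "\<And>x. 0 < x \<Longrightarrow> x \<le> R \<Longrightarrow> (\<lambda>m. p m x) \<longlonglongrightarrow> u n x" and "j \<le> n"
  shows "(\<forall>m. continuous_on {0..R} (iterated_integral (p m) j)) \<and>
    (\<exists>B. \<forall>m. \<forall>x\<in>{0..R}. cmod (iterated_integral (p m) j x) \<le> B) \<and>
    (\<forall>x. 0 < x \<and> x \<le> R \<longrightarrow> (\<lambda>m. iterated_integral (p m) j x) \<longlonglongrightarrow> u (n - j) x)"
  using \<open>j \<le> n\<close>
proof (induction j)
  case 0
  have "\<exists>B. \<forall>m. \<forall>x\<in>{0..R}. cmod (p m x) \<le> B" using bound by blast
  then show ?case using p(1) lim by simp
next
  case (Suc j)
  let ?W = "\<lambda>m. iterated_integral (p m) j"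
  note H = Suc.IH[OF Suc_leD[OF Suc.prems]]
  obtain B where B: "\<forall>m. \<forall>x\<in>{0..R}. cmod (?W m x) \<le> B" using H by blast
  have IH: "\<And>m. continuous_on {0..R} (?W m)" "\<And>m x. x \<in> {0..R} \<Longrightarrow> cmod (?W m x) \<le> B"
    "\<And>x. 0 < x \<Longrightarrow> x \<le> R \<Longrightarrow> (\<lambda>m. ?W m x) \<longlonglongrightarrow> u (n - j) x"
    using H B by blast+
  have int: "?W m integrable_on {0..x}" if "x \<le> R" for m x
    by (rule integrable_continuous_real) (rule continuous_on_subset[OF IH(1)], use that in auto)
  have W0: "?W m 0 = 0" for m using p(2) by (cases j) auto
  have "continuous_on {0..R} (iterated_integral (p m) (Suc j))" for m
    using indefinite_integral_continuous_1[OF int[OF order_refl]] by simp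
  moreover have "\<exists>B'. \<forall>m. \<forall>x\<in>{0..R}. cmod (iterated_integral (p m) (Suc j) x) \<le> B'"
  proof (intro exI allI ballI)
    fix m x assume x: "x \<in> {0..R}"
    have "cmod (integral {0..x} (?W m)) \<le> integral {0..x} (\<lambda>_. B)"
      by (rule integral_norm_bound_integral) (use x IH(2) int in auto)
    also have "\<dots> = x * B" using x by simp
    also have "\<dots> \<le> x * \<bar>B\<bar>" using x by (intro mult_left_mono) auto
    also have "\<dots> \<le> R * \<bar>B\<bar>" using x by (intro mult_right_mono) auto
    finally show "cmod (iterated_integral (p m) (Suc j) x) \<le> R * \<bar>B\<bar>" by simp
  qed
  moreover have "(\<lambda>m. iterated_integral (p m) (Suc j) x) \<longlonglongrightarrow> u (n - Suc j) x" if x: "0 < x" "x \<le> R" for x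
  proof -
    \<comment> \<open>The pointwise limit at t = 0 is the common value 0 of the approximants,
      whatever u_{n-j}(0) is; a single point does not change the integral.\<close>
    have "(\<lambda>m. integral {0..x} (?W m)) \<longlonglongrightarrow> integral {0..x} (\<lambda>t. if t = 0 then 0 else u (n - j) t)"
    proof (rule dominated_convergence(2))
      show "?W m integrable_on {0..x}" for m by (rule int[OF x(2)])
      show "(\<lambda>_. B) integrable_on {0..x}" by auto
      show "norm (?W m t) \<le> B" if "t \<in> {0..x}" for m t using IH(2) x that by auto
      show "(\<lambda>m. ?W m t) \<longlonglongrightarrow> (if t = 0 then 0 else u (n - j) t)" if "t \<in> {0..x}" for t
        using IH(3)[of t] that x W0 by auto
    qed
    also have "integral {0..x} (\<lambda>t. if t = 0 then 0 else u (n - j) t) = integral {0..x} (u (n - j))"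
      by (rule integral_spike[of "{0}"]) auto
    also have "\<dots> = u (n - Suc j) x"
    proof -
      have "ac_deriv (u (n - Suc j)) (u (Suc (n - Suc j)))"
        by (rule ac_chainD[OF chain]) (use Suc.prems in auto)
      moreover have "Suc (n - Suc j) = n - j" using Suc.prems by simp
      ultimately show ?thesis
        using ac_deriv_integral[of "u (n - Suc j)" "u (n - j)" 0 x] x zero[of "n - Suc j"] Suc.prems by simp
    qed
    finally show ?thesis by simp
  qed
  ultimately show ?case by blast
qed

text \<open>Weierstrass polynomials multiplied by a step that is 0 up to 1/(m+1). Near 0 the
  convergence need not be uniform, but it is pointwise and bounded, as dominated convergence
  requires.\<close>

lemma smooth_approximation:
  assumes f: "continuous_on {0..R} f" and "R > 0"
  obtains p :: "nat \<Rightarrow> real \<Rightarrow> complex" and B where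
    "\<And>m. smooth (p m)" "\<And>m. \<exists>a>0. \<forall>x\<le>a. p m x = 0"
    "\<And>m x. x \<in> {0..R} \<Longrightarrow> cmod (p m x) \<le> B"
    "\<And>x. 0 < x \<Longrightarrow> x \<le> R \<Longrightarrow> (\<lambda>m. p m x) \<longlonglongrightarrow> f x"
proof -
  obtain \<sigma> where s: "smooth \<sigma>" "\<And>x. x \<le> 1 \<Longrightarrow> \<sigma> x = 0" "\<And>x. x \<ge> 2 \<Longrightarrow> \<sigma> x = 1" "\<And>x. cmod (\<sigma> x) \<le> 1"
    using exists_smooth_step by blast
  have "\<exists>q. polynomial_function q \<and> (\<forall>x\<in>{0..R}. norm (f x - q x) < 1 / real (Suc m))" for m
    by (rule Stone_Weierstrass_polynomial_function) (use f in auto)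
  then obtain q where q: "\<And>m. polynomial_function (q m)" "\<And>m x. x \<in> {0..R} \<Longrightarrow> norm (f x - q m x) < 1 / real (Suc m)"
    by metis
  obtain B where B: "B > 0" "\<And>x. x \<in> {0..R} \<Longrightarrow> cmod (f x) \<le> B"
    using continuous_on_norm_bound_Icc[OF f] by blast
  define p where "p = (\<lambda>m x. \<sigma> (real (Suc m) * x + 0) * q m x)"
  show thesis
  proof (rule that[of p "B + 1"])
    show "smooth (p m)" for m
      unfolding p_def by (intro smooth_mult smooth_affine_vderiv(1) s(1) smooth_polynomial_function q)
    show "\<exists>a>0. \<forall>x\<le>a. p m x = 0" for m
    proof (intro exI conjI allI impI)
      fix x :: real assume "x \<le> 1 / real (Suc m)"
      then have "real (Suc m) * x + 0 \<le> 1" by (simp add: field_simps)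
      then show "p m x = 0" unfolding p_def by (simp only: s(2)) simp
    qed simp
    show "cmod (p m x) \<le> B + 1" if x: "x \<in> {0..R}" for m x
    proof -
      have "1 / real (Suc m) \<le> 1" by simp
      then have "cmod (q m x) \<le> B + 1"
        using q(2)[OF x, of m] B(2)[OF x] norm_triangle_ineq3[of "f x" "q m x"] by linarith
      then show ?thesis
        using mult_mono[of "cmod (\<sigma> (real (Suc m) * x + 0))" 1 "cmod (q m x)" "B + 1"] s(4) B(1)
        by (simp add: p_def norm_mult)
    qed
    show "(\<lambda>m. p m x) \<longlonglongrightarrow> f x" if x: "0 < x" "x \<le> R" for x
    proof -
      have "(\<lambda>m. q m x) \<longlonglongrightarrow> f x"
      proof (rule LIMSEQ_norm_0[of "\<lambda>m. q m x - f x", THEN LIM_zero_cancel])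
        show "cmod (q m x - f x) < 1 / real (Suc m)" for m
          using q(2)[of x m] x by (simp add: norm_minus_commute)
      qed
      moreover have "(\<lambda>m. \<sigma> (real (Suc m) * x + 0)) \<longlonglongrightarrow> 1"
      proof (rule tendsto_eventually)
        obtain M where M: "2 / x \<le> real M" using real_arch_simple by blast
        have "\<sigma> (real (Suc m) * x + 0) = 1" if "m \<ge> M" for m
        proof (rule s(3))
          have "2 / x \<le> real (Suc m)" using M that by linarith
          then show "2 \<le> real (Suc m) * x + 0" using x by (simp add: pos_divide_le_eq)
        qed
        then show "\<forall>\<^sub>F m in sequentially. \<sigma> (real (Suc m) * x + 0) = 1"
          by (auto simp: eventually_sequentially)
      qed
      ultimately have "(\<lambda>m. \<sigma> (real (Suc m) * x + 0) * q m x) \<longlonglongrightarrow> 1 * f x" by (intro tendsto_mult)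
      then show ?thesis by (simp add: p_def)
    qed
  qed
qed

lemma smooth_cutoff_derivatives:
  obtains \<eta> M where "smooth \<eta>" "\<And>x. x < 1 \<Longrightarrow> \<eta> x = 1" "\<And>k x. x < 1 \<Longrightarrow> k > 0 \<Longrightarrow> (vderiv ^^ k) \<eta> x = 0"
    "\<And>k x. x > 2 \<Longrightarrow> (vderiv ^^ k) \<eta> x = 0" "\<And>k x. 0 \<le> x \<Longrightarrow> cmod ((vderiv ^^ k) \<eta> x) \<le> M k"
proof -
  obtain \<eta> where c: "smooth \<eta>" "\<And>x. x \<le> 1 \<Longrightarrow> \<eta> x = 1" "\<And>x. x \<ge> 2 \<Longrightarrow> \<eta> x = 0" "\<And>x. cmod (\<eta> x) \<le> 1"
    using exists_smooth_cutoff by blast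
  have z2: "(vderiv ^^ k) \<eta> x = 0" if "x > 2" for k x
  proof -
    have "(vderiv ^^ k) \<eta> x = (vderiv ^^ k) (\<lambda>x. 0) x"
      by (rule vderiv_pow_eq_on_open[OF c(1) smooth_const, of "{2<..}"]) (use that c(3) in auto)
    then show ?thesis by (simp add: vderiv_pow_zero)
  qed
  have z1: "(vderiv ^^ k) \<eta> x = 0" if x: "x < 1" and k: "k > 0" for k x
  proof -
    obtain k' where k': "k = Suc k'" using k by (cases k) auto
    have "(vderiv ^^ k) \<eta> x = (vderiv ^^ k) (\<lambda>x. 1) x"
      by (rule vderiv_pow_eq_on_open[OF c(1) smooth_const, of "{..<1}"]) (use x c(2) in auto)
    also have "\<dots> = (vderiv ^^ k') (vderiv (\<lambda>x. 1)) x" unfolding k' by (simp only: funpow_Suc_right o_apply)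
    also have "vderiv (\<lambda>x. 1) = (\<lambda>x. 0)" by (rule vderiv_eqI) simp
    finally show ?thesis by (simp add: vderiv_pow_zero)
  qed
  have "\<exists>B\<ge>0. \<forall>x\<ge>0. cmod ((vderiv ^^ k) \<eta> x) \<le> B" for k
  proof -
    have "continuous_on {0..2} ((vderiv ^^ k) \<eta>)" by (rule smooth_continuous_on[OF smooth_vderiv_pow[OF c(1)]])
    then obtain B where B: "B > 0" "\<And>x. x \<in> {0..2} \<Longrightarrow> cmod ((vderiv ^^ k) \<eta> x) \<le> B"
      using continuous_on_norm_bound_Icc by blast
    have "cmod ((vderiv ^^ k) \<eta> x) \<le> B" if "x \<ge> 0" for x
      using B z2[of x k] that by (cases "x > 2") auto
    then show ?thesis using B(1) by (intro exI[of _ B]) auto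
  qed
  then obtain M where "\<And>k x. x \<ge> 0 \<Longrightarrow> cmod ((vderiv ^^ k) \<eta> x) \<le> M k" by metis
  then show thesis using c(1,2) z1 z2 by (intro that[of \<eta> M]) auto
qed

lemma cmod_leibniz_le:
  "cmod (leibniz u v k x) \<le> (\<Sum>i\<le>k. real (k choose i) * (cmod (u i x) * cmod (v (k - i) x)))"
  unfolding leibniz_def by (rule order_trans[OF norm_sum]) (simp add: norm_mult)

lemma leibniz_tendsto:
  assumes "\<And>i. i \<le> k \<Longrightarrow> (\<lambda>m. u m i x) \<longlonglongrightarrow> u' i x" "\<And>i. i \<le> k \<Longrightarrow> (\<lambda>m. v m i x) \<longlonglongrightarrow> v' i x"
  shows "(\<lambda>m. leibniz (u m) (v m) k x) \<longlonglongrightarrow> leibniz u' v' k x"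
  unfolding leibniz_def using assms by (intro tendsto_intros) auto

text \<open>With the cutoff \<eta> at infinity fixed, the approximation concerns the end point 0: on
  [0, b] the n-fold integral W of a smooth approximation of u_n replaces u_0, and W times \<eta> is
  a test function. By the Leibniz rule the derivatives of orders 0 and n converge in L2, those of W
  being the lower iterated integrals.\<close>

lemma cutoff_approximation:
  assumes u: "maximal_repr n f f' u" and zero: "\<And>i. i < n \<Longrightarrow> u i 0 = 0" and n: "n \<ge> 1"
    and \<eta>: "smooth \<eta>" "\<And>k x. x > b \<Longrightarrow> (vderiv ^^ k) \<eta> x = 0" "b > 0"
  obtains \<phi> where "\<And>m. \<phi> m \<in> test_functions" "L2_tendsto \<phi> (\<lambda>x. u 0 x * \<eta> x)"
    "L2_tendsto (\<lambda>m. (vderiv ^^ n) (\<phi> m)) (leibniz u (\<lambda>k. (vderiv ^^ k) \<eta>) n)"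
proof -
  note U = maximal_reprD[OF u]
  have ucont: "continuous_on {0..b} (u i)" if "i \<le> n" for i
    by (rule continuous_on_subset[OF ac_chain_continuous[OF U(3)]]) (use that n in auto)
  obtain p B where p: "\<And>m. smooth (p m)" "\<And>m. \<exists>a>0. \<forall>x\<le>a. p m x = 0"
    "\<And>m x. x \<in> {0..b} \<Longrightarrow> cmod (p m x) \<le> B" "\<And>x. 0 < x \<Longrightarrow> x \<le> b \<Longrightarrow> (\<lambda>m. p m x) \<longlonglongrightarrow> u n x"
    using smooth_approximation[OF ucont[OF order_refl] \<eta>(3)] by metis
  obtain a where a: "\<And>m. a m > 0" "\<And>m x. x \<le> a m \<Longrightarrow> p m x = 0" using p(2) by metis
  define W where "W = (\<lambda>m. iterated_integral (p m))"
  have "p m 0 = 0" for m using a(2)[of 0 m] a(1)[of m] by simp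
  note W0 = truncated_iterated_integral_tendsto[OF ac_chain_mono[OF U(3)] zero \<eta>(3) smooth_continuous_on[OF p(1)] this p(3,4)]
  have Wlim: "(\<lambda>m. W m j x) \<longlonglongrightarrow> u (n - j) x" if "j \<le> n" "0 < x" "x \<le> b" for j x
    using W0[of j] that by (simp add: W_def)
  have "\<exists>B. \<forall>m. \<forall>x\<in>{0..b}. cmod (W m j x) \<le> B" if "j \<le> n" for j
    using W0[of j] that by (simp add: W_def)
  then obtain C where C: "\<And>j m x. j \<le> n \<Longrightarrow> x \<in> {0..b} \<Longrightarrow> cmod (W m j x) \<le> C j" by metis
  define \<phi> where "\<phi> = (\<lambda>m x. W m n x * \<eta> x)"
  have Wsm: "smooth (W m j)" "\<And>x. x \<le> a m \<Longrightarrow> W m j x = 0" for m j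
    using smooth_iterated_integral[OF p(1) a] by (auto simp: W_def)
  have test: "\<phi> m \<in> test_functions" for m
  proof -
    have "smooth (\<phi> m)" unfolding \<phi>_def by (intro smooth_mult Wsm \<eta>)
    moreover have "\<forall>x. x \<le> a m \<or> b + 1 \<le> x \<longrightarrow> \<phi> m x = 0" using Wsm(2) \<eta>(2)[of _ 0] by (auto simp: \<phi>_def)
    ultimately show ?thesis unfolding test_functions_iff using a(1) by blast
  qed
  let ?e = "\<lambda>k. (vderiv ^^ k) \<eta>"
  have "\<exists>B\<ge>0. \<forall>x\<in>{0..b}. cmod (?e k x) \<le> B \<and> (k \<le> n \<longrightarrow> cmod (u k x) \<le> B)" for k
  proof -
    obtain B1 where B1: "B1 > 0" "\<And>x. x \<in> {0..b} \<Longrightarrow> cmod (?e k x) \<le> B1"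
      using continuous_on_norm_bound_Icc[OF smooth_continuous_on[OF smooth_vderiv_pow[OF \<eta>(1)]]] by metis
    have "\<exists>B2. \<forall>x\<in>{0..b}. k \<le> n \<longrightarrow> cmod (u k x) \<le> B2"
    proof (cases "k \<le> n")
      case True
      show ?thesis by (rule continuous_on_norm_bound_Icc[OF ucont[OF True]]) blast
    qed auto
    then obtain B2 where "\<And>x. x \<in> {0..b} \<Longrightarrow> k \<le> n \<Longrightarrow> cmod (u k x) \<le> B2" by blast
    then show ?thesis using B1 by (intro exI[of _ "max B1 B2"]) (fastforce)
  qed
  then obtain E where E: "\<And>k. E k \<ge> 0" "\<And>k x. x \<in> {0..b} \<Longrightarrow> cmod (?e k x) \<le> E k"
    "\<And>k x. x \<in> {0..b} \<Longrightarrow> k \<le> n \<Longrightarrow> cmod (u k x) \<le> E k" by metis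
  have leib: "(vderiv ^^ k) (\<phi> m) = leibniz (\<lambda>i. W m (n - i)) ?e k" if "k \<le> n" for k m
  proof
    fix x
    have "(vderiv ^^ k) (\<phi> m) x = leibniz (\<lambda>i. (vderiv ^^ i) (W m n)) ?e k x"
      unfolding \<phi>_def smooth_mult_vderiv(2)[OF Wsm(1) \<eta>(1)] ..
    also have "\<dots> = leibniz (\<lambda>i. W m (n - i)) ?e k x"
      unfolding leibniz_def
      by (rule sum.cong) (use that vderiv_iterated_integral[OF p(1) a] in \<open>auto simp: W_def\<close>)
    finally show "(vderiv ^^ k) (\<phi> m) x = leibniz (\<lambda>i. W m (n - i)) ?e k x" .
  qed
  \<comment> \<open>A second cutoff, equal to 1 on [0, b] after rescaling; multiplied by the
    constant K below it is the L2 majorant for dominated convergence.\<close>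
  obtain \<rho> where r: "smooth \<rho>" "\<And>x. x \<le> 1 \<Longrightarrow> \<rho> x = 1" "\<And>x. x \<ge> 2 \<Longrightarrow> \<rho> x = 0" "\<And>x. cmod (\<rho> x) \<le> 1"
    using exists_smooth_cutoff by blast
  have rL2: "(\<lambda>x. c * \<rho> (1 / b * x + 0)) \<in> L2_halfline" for c
    by (intro L2_cmult continuous_compact_L2[of _ "2 * b"] smooth_continuous_on smooth_affine_vderiv(1) r(1) r(3))
       (use \<eta>(3) in \<open>auto simp: field_simps\<close>)
  have lim: "L2_tendsto (\<lambda>m. (vderiv ^^ k) (\<phi> m)) (leibniz u ?e k)" if k: "k \<le> n" for k
  proof -
    define K where "K = (\<Sum>i\<le>k. real (k choose i) * (\<bar>C (n - i)\<bar> * E (k - i))) + (\<Sum>i\<le>k. real (k choose i) * (E i * E (k - i)))"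
    have K0: "K \<ge> 0" unfolding K_def using E(1) by (intro add_nonneg_nonneg sum_nonneg) auto
    have zb: "leibniz w ?e k x = 0" if "x > b" for w x
      unfolding leibniz_def by (rule sum.neutral) (simp add: \<eta>(2)[OF that])
    have ccont: "continuous_on {0..} (leibniz u ?e k)"
      unfolding leibniz_def[abs_def]
      by (intro continuous_intros ac_chain_continuous[OF U(3)] smooth_continuous_on[OF smooth_vderiv_pow[OF \<eta>(1)]]) (use k n in auto)
    show ?thesis
    proof (rule L2_tendsto_dominated[where G = "\<lambda>x. of_real K * \<rho> (1 / b * x + 0)"])
      show "(vderiv ^^ k) (\<phi> m) \<in> L2_halfline" for m by (rule test_L2[OF test_vderiv_pow[OF test]])
      show "leibniz u ?e k \<in> L2_halfline"
        by (rule continuous_compact_L2[OF ccont, of "b + 1"]) (simp add: zb)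
      show "(\<lambda>x. of_real K * \<rho> (1 / b * x + 0)) \<in> L2_halfline" by (rule rL2)
      fix x :: real assume x: "x > 0"
      show "cmod ((vderiv ^^ k) (\<phi> m) x - leibniz u ?e k x) \<le> cmod (of_real K * \<rho> (1 / b * x + 0))" for m
      proof (cases "x > b")
        case True
        then show ?thesis by (simp add: leib[OF k] zb)
      next
        case False
        then have xb: "x \<in> {0..b}" using x by simp
        have rho: "\<rho> (1 / b * x + 0) = 1" using xb \<eta>(3) by (intro r(2)) simp
        have "cmod ((vderiv ^^ k) (\<phi> m) x) \<le> (\<Sum>i\<le>k. real (k choose i) * (\<bar>C (n - i)\<bar> * E (k - i)))"
          unfolding leib[OF k]
          by (rule order_trans[OF cmod_leibniz_le], intro sum_mono mult_left_mono mult_mono)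
             (use C[of _ x m] E xb k in \<open>auto intro: order_trans[OF _ abs_ge_self]\<close>)
        moreover have "cmod (leibniz u ?e k x) \<le> (\<Sum>i\<le>k. real (k choose i) * (E i * E (k - i)))"
          by (rule order_trans[OF cmod_leibniz_le], intro sum_mono mult_left_mono mult_mono)
             (use E xb k in auto)
        ultimately have "cmod ((vderiv ^^ k) (\<phi> m) x - leibniz u ?e k x) \<le> K"
          unfolding K_def by (intro order_trans[OF norm_triangle_ineq4] add_mono)
        then show ?thesis using rho K0 by (simp add: norm_mult)
      qed
      show "(\<lambda>m. (vderiv ^^ k) (\<phi> m) x) \<longlonglongrightarrow> leibniz u ?e k x"
      proof (cases "x > b")
        case True
        then show ?thesis by (simp add: leib[OF k] zb)
      next
        case False
        have "(\<lambda>m. leibniz (\<lambda>i. W m (n - i)) ?e k x) \<longlonglongrightarrow> leibniz u ?e k x"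
        proof (rule leibniz_tendsto)
          fix i assume "i \<le> k"
          then have "n - (n - i) = i" using k by simp
          then show "(\<lambda>m. W m (n - i) x) \<longlonglongrightarrow> u i x"
            using Wlim[of "n - i" x] False x by simp
        qed simp
        then show ?thesis by (simp add: leib[OF k])
      qed
    qed
  qed
  have "leibniz u ?e 0 = (\<lambda>x. u 0 x * \<eta> x)" by (simp add: fun_eq_iff leibniz_0)
  then show thesis using that[OF test] lim[of 0] lim[of n] by simp
qed

text \<open>Stretching a cutoff multiplies its i-th derivative by (R + 1)^(-i), so all Leibniz terms
  are dominated by multiples of the |u_i|, which are square-integrable. Near any given point the
  cutoff is eventually constant 1 and the term u_k alone remains.\<close>

lemma cutoff_tendsto:
  assumes u: "maximal_repr n f f' u"
    and \<eta>: "smooth \<eta>" "\<And>x. x < 1 \<Longrightarrow> \<eta> x = 1" "\<And>k x. x < 1 \<Longrightarrow> k > 0 \<Longrightarrow> (vderiv ^^ k) \<eta> x = 0"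
    and M: "\<And>k x. 0 \<le> x \<Longrightarrow> cmod ((vderiv ^^ k) \<eta> x) \<le> M k"
    and k: "k \<le> n"
  shows "L2_tendsto (\<lambda>R. leibniz u (\<lambda>i. (vderiv ^^ i) (\<lambda>x. \<eta> (1 / real (Suc R) * x + 0))) k) (u k)"
proof -
  let ?e = "\<lambda>R i. (vderiv ^^ i) (\<lambda>x. \<eta> (1 / real (Suc R) * x + 0))"
  have e: "?e R i x = of_real (1 / real (Suc R)) ^ i * (vderiv ^^ i) \<eta> (1 / real (Suc R) * x + 0)" for R i x
    unfolding smooth_affine_vderiv(2)[OF \<eta>(1)] ..
  have eM: "cmod (?e R i x) \<le> M i" if "x \<ge> 0" for R i x
  proof -
    have "cmod (of_real (1 / real (Suc R)) ^ i) \<le> 1" unfolding norm_power norm_of_real by (rule power_le_one) auto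
    then have "cmod (?e R i x) \<le> 1 * M i"
      unfolding e norm_mult by (intro mult_mono M) (use that in auto)
    then show ?thesis by simp
  qed
  have M0: "M i \<ge> 0" for i using M[of 0 i] norm_ge_zero order_trans by blast
  note uL2 = maximal_repr_L2[OF u]
  note U = maximal_reprD[OF u]
  \<comment> \<open>The majorant: all Leibniz terms with the bounds M in place of the cutoff, plus
    the limit itself.\<close>
  define G where "G = (\<lambda>x. (\<Sum>i\<le>k. of_real (real (k choose i) * M (k - i)) * complex_of_real (cmod (u i x))) + of_real (cmod (u k x)))"
  have GL2: "G \<in> L2_halfline"
    unfolding G_def by (intro L2_add L2_sum L2_cmult L2_cmod uL2) (use k in auto)
  have Greal: "G x = of_real ((\<Sum>i\<le>k. real (k choose i) * M (k - i) * cmod (u i x)) + cmod (u k x))" for x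
    by (simp add: G_def)
  have "cmod (G x) = (\<Sum>i\<le>k. real (k choose i) * M (k - i) * cmod (u i x)) + cmod (u k x)" for x
    unfolding Greal norm_of_real using M0 by (intro abs_of_nonneg add_nonneg_nonneg sum_nonneg) auto
  moreover have lb: "cmod (leibniz u (?e R) k x) \<le> (\<Sum>i\<le>k. real (k choose i) * M (k - i) * cmod (u i x))" if "x \<ge> 0" for R x
  proof -
    have "cmod (leibniz u (?e R) k x) \<le> (\<Sum>i\<le>k. real (k choose i) * (cmod (u i x) * cmod (?e R (k - i) x)))"
      by (rule cmod_leibniz_le)
    also have "\<dots> \<le> (\<Sum>i\<le>k. real (k choose i) * (cmod (u i x) * M (k - i)))"
      by (intro sum_mono mult_left_mono eM that) auto
    finally show ?thesis by (simp only: mult_ac)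
  qed
  ultimately have dom: "cmod (leibniz u (?e R) k x - u k x) \<le> cmod (G x)" if "x \<ge> 0" for R x
    using order_trans[OF norm_triangle_ineq4 add_right_mono[OF lb[OF that]]] by simp
  show ?thesis
  proof (rule L2_tendsto_dominated[OF _ _ GL2])
    show "u k \<in> L2_halfline" by (rule uL2) (use k in auto)
    show "leibniz u (?e R) k \<in> L2_halfline" for R
    proof -
      have L: "(\<lambda>x. ?e R i x * u j x) \<in> L2_halfline" if "j \<le> 2 * n" for i j
      proof -
        have meas: "u j \<in> borel_measurable halfline" by (rule L2_halflineD(1)[OF uL2[OF that]])
        have "?e R i \<in> borel_measurable halfline"
          by (intro continuous_measurable_halfline smooth_continuous_on smooth_vderiv_pow smooth_affine_vderiv(1) \<eta>(1))
        then have m: "(\<lambda>x. ?e R i x * u j x) \<in> borel_measurable halfline" using meas by (rule borel_measurable_times)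
        have "integrable halfline (\<lambda>x. (cmod (?e R i x * u j x))\<^sup>2)"
        proof (rule Bochner_Integration.integrable_bound)
          show "integrable halfline (\<lambda>x. (cmod (of_real (M i) * u j x))\<^sup>2)"
            by (rule L2_halflineD(2)[OF L2_cmult[OF uL2[OF that]]])
          show "(\<lambda>x. (cmod (?e R i x * u j x))\<^sup>2) \<in> borel_measurable halfline" using m by measurable
          show "AE x in halfline. norm ((cmod (?e R i x * u j x))\<^sup>2) \<le> norm ((cmod (of_real (M i) * u j x))\<^sup>2)"
            by (rule AE_halflineI) (use eM M0 in \<open>auto simp: norm_mult intro!: power_mono mult_right_mono\<close>)
        qed
        then show ?thesis using m by (simp add: L2_halfline_def)
      qed
      have "leibniz u (?e R) k = (\<lambda>x. \<Sum>i\<le>k. of_nat (k choose i) * (?e R (k - i) x * u i x))"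
        by (simp add: leibniz_def fun_eq_iff mult.commute)
      also have "\<dots> \<in> L2_halfline" by (intro L2_sum L2_cmult L) (use k in auto)
      finally show ?thesis .
    qed
    show "cmod (leibniz u (?e R) k x - u k x) \<le> cmod (G x)" if "x > 0" for R x using dom that by simp
    show "(\<lambda>R. leibniz u (?e R) k x) \<longlonglongrightarrow> u k x" if "x > 0" for x
    proof (rule tendsto_eventually)
      obtain N where N: "x < real N" using reals_Archimedean2 by blast
      have "leibniz u (?e R) k x = u k x" if "R \<ge> N" for R
      proof -
        have lt: "1 / real (Suc R) * x + 0 < 1" using N that by (simp add: field_simps)
        have "?e R i x = (if i = 0 then 1 else 0)" for i
        proof (cases "i = 0")
          case True then show ?thesis unfolding e using \<eta>(2)[OF lt] by simp
        next
          case False then show ?thesis unfolding e using \<eta>(3)[OF lt, of i] by simp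
        qed
        then have "leibniz u (?e R) k x = (\<Sum>i\<le>k. if i = k then u k x else 0)"
          unfolding leibniz_def by (intro sum.cong) auto
        then show ?thesis by simp
      qed
      then show "\<forall>\<^sub>F R in sequentially. leibniz u (?e R) k x = u k x"
        by (auto simp: eventually_sequentially)
    qed
  qed
qed

text \<open>The cutoff at infinity and the approximation at 0 each take half of the error. Orders 0
  and n are treated together because both enter the form norm.\<close>

lemma test_functions_dense:
  assumes u: "maximal_repr n f f' u" and zero: "\<And>i. i < n \<Longrightarrow> u i 0 = 0" and n: "n \<ge> 1" and "\<epsilon> > 0"
  obtains \<phi> where "\<phi> \<in> test_functions" "L2_norm (\<lambda>x. \<phi> x - f x) < \<epsilon>"
    "L2_norm (\<lambda>x. (vderiv ^^ n) \<phi> x - u n x) < \<epsilon>"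
proof -
  note U = maximal_reprD[OF u]
  obtain \<eta> M where \<eta>: "smooth \<eta>" "\<And>x. x < 1 \<Longrightarrow> \<eta> x = 1" "\<And>k x. x < 1 \<Longrightarrow> k > 0 \<Longrightarrow> (vderiv ^^ k) \<eta> x = 0"
    "\<And>k x. x > 2 \<Longrightarrow> (vderiv ^^ k) \<eta> x = 0" and M: "\<And>k x. 0 \<le> x \<Longrightarrow> cmod ((vderiv ^^ k) \<eta> x) \<le> M k"
    using smooth_cutoff_derivatives by metis
  let ?\<eta> = "\<lambda>R x. \<eta> (1 / real (Suc R) * x + 0)"
  let ?z = "\<lambda>R k. leibniz u (\<lambda>i. (vderiv ^^ i) (?\<eta> R)) k"
  have "L2_tendsto (\<lambda>R. ?z R k) (u k)" if "k \<le> n" for k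
    by (rule cutoff_tendsto[OF u \<eta>(1-3) M that])
  then have lim: "\<forall>\<^sub>F R in sequentially. L2_norm (\<lambda>x. ?z R k x - u k x) < \<epsilon> / 2" if "k \<le> n" for k
    by (rule L2_tendsto_eventually) (use that \<open>\<epsilon> > 0\<close> in auto)
  have "\<forall>\<^sub>F R in sequentially. L2_norm (\<lambda>x. ?z R 0 x - u 0 x) < \<epsilon> / 2 \<and> L2_norm (\<lambda>x. ?z R n x - u n x) < \<epsilon> / 2"
    by (rule eventually_conj[OF lim[OF le0] lim[OF order_refl]])
  then obtain R where R: "L2_norm (\<lambda>x. ?z R 0 x - u 0 x) < \<epsilon> / 2" "L2_norm (\<lambda>x. ?z R n x - u n x) < \<epsilon> / 2"
    using eventually_happens'[OF sequentially_bot] by blast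
  have sm: "smooth (?\<eta> R)" by (rule smooth_affine_vderiv(1)[OF \<eta>(1)])
  have z: "(vderiv ^^ k) (?\<eta> R) x = 0" if "x > 2 * real (Suc R)" for k x
  proof -
    have "1 / real (Suc R) * x + 0 > 2" using that by (simp add: field_simps)
    then show ?thesis unfolding smooth_affine_vderiv(2)[OF \<eta>(1)] by (simp only: \<eta>(4)) simp
  qed
  obtain \<phi> where phi: "\<And>m. \<phi> m \<in> test_functions" "L2_tendsto \<phi> (\<lambda>x. u 0 x * ?\<eta> R x)"
    "L2_tendsto (\<lambda>m. (vderiv ^^ n) (\<phi> m)) (?z R n)"
    by (rule cutoff_approximation[OF u _ n sm, of "2 * real (Suc R)"]) (erule zero, erule z, simp, blast)
  have z0: "?z R 0 = (\<lambda>x. u 0 x * ?\<eta> R x)" by (simp add: fun_eq_iff leibniz_0)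
  have e1: "\<forall>\<^sub>F m in sequentially. L2_norm (\<lambda>x. \<phi> m x - ?z R 0 x) < \<epsilon> / 2"
    unfolding z0 by (rule L2_tendsto_eventually[OF phi(2)]) (use \<open>\<epsilon> > 0\<close> in simp)
  have e2: "\<forall>\<^sub>F m in sequentially. L2_norm (\<lambda>x. (vderiv ^^ n) (\<phi> m) x - ?z R n x) < \<epsilon> / 2"
    by (rule L2_tendsto_eventually[OF phi(3)]) (use \<open>\<epsilon> > 0\<close> in simp)
  obtain m where m: "L2_norm (\<lambda>x. \<phi> m x - ?z R 0 x) < \<epsilon> / 2" "L2_norm (\<lambda>x. (vderiv ^^ n) (\<phi> m) x - ?z R n x) < \<epsilon> / 2"
    using eventually_happens'[OF sequentially_bot eventually_conj[OF e1 e2]] by blast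
  have zL2: "?z R k \<in> L2_halfline" if "k \<le> n" for k
  proof (rule continuous_compact_L2)
    show "continuous_on {0..} (?z R k)"
      unfolding leibniz_def[abs_def]
      by (intro continuous_intros ac_chain_continuous[OF U(3)] smooth_continuous_on[OF smooth_vderiv_pow[OF sm]]) (use that n in auto)
    show "?z R k x = 0" if "x \<ge> 2 * real (Suc R) + 1" for x
      unfolding leibniz_def by (rule sum.neutral) (use z[of x] that in auto)
  qed
  note uL2 = maximal_repr_L2[OF u]
  have tri: "L2_norm (\<lambda>x. a x - c x) < \<epsilon>"
    if "L2_norm (\<lambda>x. a x - b x) < \<epsilon> / 2" "L2_norm (\<lambda>x. b x - c x) < \<epsilon> / 2"
      "a \<in> L2_halfline" "b \<in> L2_halfline" "c \<in> L2_halfline" for a b c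
    using L2_norm_triangle[OF L2_diff[OF that(3,4)] L2_diff[OF that(4,5)]] that(1,2) by simp
  have "L2_norm (\<lambda>x. \<phi> m x - u 0 x) < \<epsilon>"
    by (rule tri[OF m(1) R(1)]) (use test_L2[OF phi(1)] zL2 uL2 in auto)
  moreover have "L2_norm (\<lambda>x. \<phi> m x - u 0 x) = L2_norm (\<lambda>x. \<phi> m x - f x)"
  proof (rule L2_norm_cong_AE)
    show "(\<lambda>x. \<phi> m x - u 0 x) \<in> L2_halfline" by (rule L2_diff[OF test_L2[OF phi(1)] U(6)])
    show "AE x in halfline. \<phi> m x - u 0 x = \<phi> m x - f x" using U(4) by eventually_elim simp
  qed
  moreover have "L2_norm (\<lambda>x. (vderiv ^^ n) (\<phi> m) x - u n x) < \<epsilon>"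
    by (rule tri[OF m(2) R(2)]) (use test_L2[OF test_vderiv_pow[OF phi(1)]] zL2 uL2 in auto)
  ultimately show thesis using phi(1) by (intro that[of "\<phi> m"]) auto
qed

text \<open>Test functions whose n-th derivatives converge in L2 are Cauchy in the form: by
  \<open>quadratic_form_eq\<close> the form of a difference is the squared norm of the difference of
  the n-th derivatives.\<close>

lemma Gamma0_zero_imp_friedrichs_domain:
  assumes u: "maximal_repr n f f' u" and zero: "\<And>i. i < n \<Longrightarrow> u i 0 = 0" and n: "n \<ge> 1"
  shows "\<exists>F G. (\<forall>m. (F m, G m) \<in> minimal_operator n) \<and> L2_tendsto F f \<and>
    (\<forall>\<epsilon>>0. \<exists>N. \<forall>m\<ge>N. \<forall>k\<ge>N. cmod (L2_inner (\<lambda>x. G m x - G k x) (\<lambda>x. F m x - F k x)) < \<epsilon>)"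
proof -
  have "\<exists>\<phi>. \<phi> \<in> test_functions \<and> L2_norm (\<lambda>x. \<phi> x - f x) < 1 / real (Suc m) \<and>
     L2_norm (\<lambda>x. (vderiv ^^ n) \<phi> x - u n x) < 1 / real (Suc m)" for m
    by (rule test_functions_dense[OF u zero n, of "1 / real (Suc m)"]) (assumption, simp, blast)
  then obtain \<phi> where phi: "\<And>m. \<phi> m \<in> test_functions" "\<And>m. L2_norm (\<lambda>x. \<phi> m x - f x) < 1 / real (Suc m)"
    "\<And>m. L2_norm (\<lambda>x. (vderiv ^^ n) (\<phi> m) x - u n x) < 1 / real (Suc m)"
    by metis
  let ?V = "\<lambda>m. (vderiv ^^ n) (\<phi> m)"
  let ?G = "\<lambda>m x. (-1) ^ n * (vderiv ^^ (2 * n)) (\<phi> m) x"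
  have VL2: "?V m \<in> L2_halfline" for m by (rule test_L2[OF test_vderiv_pow[OF phi(1)]])
  have unL2: "u n \<in> L2_halfline" by (rule maximal_repr_L2[OF u]) simp
  have "(\<phi> m, ?G m) \<in> minimal_operator n" for m
    using op_closure_superset[OF test_operator_L2[of n]] phi(1)[of m]
    unfolding minimal_operator_eq by (auto simp: test_operator_def)
  moreover have "L2_tendsto \<phi> f"
    unfolding L2_tendsto_def
    by (rule LIMSEQ_norm_0) (use phi(2) L2_norm_nonneg in simp)
  moreover have "\<exists>N. \<forall>m\<ge>N. \<forall>k\<ge>N. cmod (L2_inner (\<lambda>x. ?G m x - ?G k x) (\<lambda>x. \<phi> m x - \<phi> k x)) < \<epsilon>"
    if e: "\<epsilon> > 0" for \<epsilon>
  proof -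
    \<comment> \<open>Two errors below sqrt \<epsilon> / 2 give a norm below sqrt \<epsilon>, and
      the form is the square of that norm.\<close>
    obtain N where N: "N > 0" "1 / real N < sqrt \<epsilon> / 2"
      using real_arch_inverse[of "sqrt \<epsilon> / 2"] e by (auto simp: inverse_eq_divide)
    have "cmod (L2_inner (\<lambda>x. ?G m x - ?G k x) (\<lambda>x. \<phi> m x - \<phi> k x)) < \<epsilon>" if mk: "m \<ge> N" "k \<ge> N" for m k
    proof -
      have r: "maximal_repr n (\<lambda>x. 1 * \<phi> m x + (-1) * \<phi> k x) (\<lambda>x. 1 * ?G m x + (-1) * ?G k x)
          (\<lambda>i x. 1 * (vderiv ^^ i) (\<phi> m) x + (-1) * (vderiv ^^ i) (\<phi> k) x)"
        by (rule maximal_repr_lincomb[OF maximal_repr_test[OF phi(1)] maximal_repr_test[OF phi(1)]])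
      have z: "(vderiv ^^ i) (\<phi> m) 0 = 0" for i m
        using phi(1)[of m] by (elim test_functionsE) auto
      have "L2_inner (\<lambda>x. ?G m x - ?G k x) (\<lambda>x. \<phi> m x - \<phi> k x) = L2_inner (\<lambda>x. ?V m x - ?V k x) (\<lambda>x. ?V m x - ?V k x)"
        using quadratic_form_eq[OF r r] z by simp
      then have eq: "cmod (L2_inner (\<lambda>x. ?G m x - ?G k x) (\<lambda>x. \<phi> m x - \<phi> k x)) = (L2_norm (\<lambda>x. ?V m x - ?V k x))\<^sup>2"
        by (simp add: L2_inner_self norm_power L2_norm_nonneg)
      have lt: "L2_norm (\<lambda>x. ?V m x - u n x) < sqrt \<epsilon> / 2" if "m \<ge> N" for m
      proof -
        have "1 / real (Suc m) \<le> 1 / real N" using that N(1) by (intro divide_left_mono) auto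
        then show ?thesis using phi(3)[of m] N(2) by linarith
      qed
      have "L2_norm (\<lambda>x. ?V m x - ?V k x) \<le> L2_norm (\<lambda>x. ?V m x - u n x) + L2_norm (\<lambda>x. u n x - ?V k x)"
        using L2_norm_triangle[OF L2_diff[OF VL2[of m] unL2] L2_diff[OF unL2 VL2[of k]]] by simp
      also have "\<dots> < sqrt \<epsilon>"
        using lt[OF mk(1)] lt[OF mk(2)] unfolding L2_norm_minus_commute[of "u n"] by linarith
      finally have "(L2_norm (\<lambda>x. ?V m x - ?V k x))\<^sup>2 < (sqrt \<epsilon>)\<^sup>2"
        by (intro power_strict_mono) (auto simp: L2_norm_nonneg)
      then show ?thesis using e eq by simp
    qed
    then show ?thesis by blast
  qed
  ultimately show ?thesis by (intro exI[of _ \<phi>] exI[of _ ?G] conjI allI impI)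
qed

definition dirichlet_operator :: "nat \<Rightarrow> operator" where
  "dirichlet_operator n = op_restrict (op_adjoint (minimal_operator n)) {f. Gamma0 n f = 0\<^sub>v n}"

lemma dirichlet_operator_iff:
  "(f, f') \<in> dirichlet_operator n \<longleftrightarrow> (f, f') \<in> op_adjoint (minimal_operator n) \<and> Gamma0 n f = 0\<^sub>v n"
  by (auto simp: dirichlet_operator_def op_restrict_def)

lemma friedrichs_extension_minimal:
  assumes "n \<ge> 1"
  shows "friedrichs_extension (minimal_operator n) = dirichlet_operator n"
proof -
  let ?X = "{f. \<exists>F G. (\<forall>m. (F m, G m) \<in> minimal_operator n) \<and> L2_tendsto F f \<and>
    (\<forall>\<epsilon>>0. \<exists>N. \<forall>m\<ge>N. \<forall>k\<ge>N. cmod (L2_inner (\<lambda>x. G m x - G k x) (\<lambda>x. F m x - F k x)) < \<epsilon>)}"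
  have "f \<in> ?X \<longleftrightarrow> Gamma0 n f = 0\<^sub>v n" if adj: "(f, f') \<in> op_adjoint (minimal_operator n)" for f f'
  proof -
    obtain u where u: "maximal_repr n f f' u" using op_adjoint_imp_maximal_repr[OF adj] .
    show ?thesis
      unfolding Gamma0_zero_iff[OF u]
      using friedrichs_domain_imp_Gamma0_zero[OF u] Gamma0_zero_imp_friedrichs_domain[OF u _ assms] by blast
  qed
  then have "(f, f') \<in> friedrichs_extension (minimal_operator n) \<longleftrightarrow> (f, f') \<in> dirichlet_operator n" for f f'
    unfolding dirichlet_operator_iff unfolding friedrichs_extension_def op_restrict_def by blast
  then show ?thesis by (intro equalityI subrelI) blast+
qed

text \<open>An element g of the adjoint is tested against an f with \<open>Gamma0\<close> of f zero
  and \<open>Gamma1\<close> of f equal to \<open>Gamma0\<close> of g; Green's formula then shows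
  that the square norm of \<open>Gamma0\<close> of g is zero.\<close>

lemma op_adjoint_dirichlet: "op_adjoint (dirichlet_operator n) = dirichlet_operator n"
proof -
  have sub: "minimal_operator n \<subseteq> dirichlet_operator n"
  proof clarify
    fix f f' assume "(f, f') \<in> minimal_operator n"
    then show "(f, f') \<in> dirichlet_operator n"
      using minimal_subset_adjoint Gamma_minimal_zero(1) unfolding dirichlet_operator_iff by blast
  qed
  have "(g, h) \<in> op_adjoint (dirichlet_operator n) \<longleftrightarrow> (g, h) \<in> dirichlet_operator n" for g h
  proof
    assume gh: "(g, h) \<in> op_adjoint (dirichlet_operator n)"
    then have adj: "(g, h) \<in> op_adjoint (minimal_operator n)" using op_adjoint_antimono[OF sub] by blast
    obtain f f' where f: "(f, f') \<in> op_adjoint (minimal_operator n)" "Gamma0 n f = 0\<^sub>v n" "Gamma1 n f = Gamma0 n g"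
      using Gamma_surjective[OF zero_carrier_vec Gamma_carrier(1)] by metis
    then have "(f, f') \<in> dirichlet_operator n" by (simp add: dirichlet_operator_iff)
    then have "L2_inner f' g = L2_inner f h" using gh unfolding op_adjoint_def by blast
    then have "Gamma0 n g \<bullet>c Gamma0 n g = 0"
      using Green_Gamma[OF f(1) adj] cscalar_prod_zero[OF Gamma_carrier(2)] f(2,3) by simp
    then have "Gamma0 n g = 0\<^sub>v n" using conjugate_square_eq_0_vec[OF Gamma_carrier(1)] by blast
    then show "(g, h) \<in> dirichlet_operator n" using adj by (simp add: dirichlet_operator_iff)
  next
    assume "(g, h) \<in> dirichlet_operator n"
    then have g: "(g, h) \<in> op_adjoint (minimal_operator n)" "Gamma0 n g = 0\<^sub>v n" by (simp_all add: dirichlet_operator_iff)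
    have "L2_inner f' g = L2_inner f h" if "(f, f') \<in> dirichlet_operator n" for f f'
    proof -
      have f: "(f, f') \<in> op_adjoint (minimal_operator n)" "Gamma0 n f = 0\<^sub>v n" using that by (simp_all add: dirichlet_operator_iff)
      show ?thesis
        using Green_Gamma[OF f(1) g(1)] cscalar_prod_zero[OF Gamma_carrier(2)] f(2) g(2) by simp
    qed
    moreover have "g \<in> L2_halfline" "h \<in> L2_halfline" using g(1) by (simp_all add: op_adjoint_def)
    ultimately show "(g, h) \<in> op_adjoint (dirichlet_operator n)" by (auto simp: op_adjoint_def)
  qed
  then show ?thesis by (intro equalityI subrelI) blast+
qed

theorem corresponds_to_friedrichs:
  assumes "n \<ge> 1"
  shows "corresponds_to (minimal_operator n) n (Gamma0 n) (friedrichs_extension (minimal_operator n))"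
proof -
  have "minimal_operator n \<subseteq> dirichlet_operator n"
  proof clarify
    fix f f' assume "(f, f') \<in> minimal_operator n"
    then show "(f, f') \<in> dirichlet_operator n"
      using minimal_subset_adjoint Gamma_minimal_zero(1) unfolding dirichlet_operator_iff by blast
  qed
  moreover have "Domain (dirichlet_operator n) = {f \<in> Domain (op_adjoint (minimal_operator n)). Gamma0 n f = 0\<^sub>v n}"
    by (auto simp: Domain_iff dirichlet_operator_iff)
  ultimately show ?thesis
    unfolding corresponds_to_def friedrichs_extension_minimal[OF assms] using op_adjoint_dirichlet by blast
qed

section \<open>A trigonometric identity\<close>

text \<open>The q-binomial coefficient (-1; q)_k / (q; q)_k. From k = n + 1 on its numerator
  contains the factor 1 + q^n, so for q^n = -1 the series naturally stops at x^n.\<close>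

definition qpoch_quot :: "complex \<Rightarrow> nat \<Rightarrow> complex" where
  "qpoch_quot q k = (\<Prod>p<k. (1 + q ^ p) / (1 - q ^ Suc p))"

definition qpoch_sum :: "complex \<Rightarrow> nat \<Rightarrow> complex \<Rightarrow> complex" where
  "qpoch_sum q n x = (\<Sum>k\<le>n. qpoch_quot q k * x ^ k)"

text \<open>For \<open>q = cis (2 \<alpha>)\<close> this is \<open>\<i>\<^sup>k C\<^sub>k\<close>.\<close>

definition qcot :: "complex \<Rightarrow> nat \<Rightarrow> complex" where
  "qcot q k = (\<Prod>p=1..k. (1 + q ^ p) / (1 - q ^ p))"

text \<open>The sum over k that has to be evaluated, after the sines have been rewritten in terms of
  1 - q^(j+k+1).\<close>

definition qcot_sum :: "complex \<Rightarrow> nat \<Rightarrow> nat \<Rightarrow> complex \<Rightarrow> complex" where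
  "qcot_sum q n j x = (\<Sum>k<n. qcot q k * x ^ (j + k + 1) / (1 - q ^ (j + k + 1)))"

context
  fixes q :: complex and n :: nat
  assumes qn: "q ^ n = -1" and q1: "\<And>i. 0 < i \<Longrightarrow> i < 2 * n \<Longrightarrow> q ^ i \<noteq> 1"
begin

lemma qpoch_quot_Suc: "Suc k < 2 * n \<Longrightarrow> qpoch_quot q (Suc k) * (1 - q ^ Suc k) = qpoch_quot q k * (1 + q ^ k)"
  using q1[of "Suc k"] by (simp add: qpoch_quot_def)

text \<open>By the functional equation the zero at \<open>q\<close>, forced by \<open>x = 1\<close>, propagates along \<open>q, q\<^sup>2, \<dots>\<close>.\<close>

lemma qpoch_sum_functional: "(1 - x) * qpoch_sum q n x = (1 + x) * qpoch_sum q n (q * x)"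
proof -
  have n: "n > 0" using qn by (cases n) auto
  have "qpoch_sum q n x - qpoch_sum q n (q * x) = (\<Sum>k\<le>n. qpoch_quot q k * (1 - q ^ k) * x ^ k)"
    unfolding qpoch_sum_def sum_subtractf[symmetric]
    by (rule sum.cong) (simp_all add: algebra_simps power_mult_distrib)
  also have "\<dots> = (\<Sum>k\<in>{..<Suc n}. qpoch_quot q k * (1 - q ^ k) * x ^ k)"
    by (simp add: lessThan_Suc_atMost)
  also have "\<dots> = (\<Sum>k<n. qpoch_quot q (Suc k) * (1 - q ^ Suc k) * x ^ Suc k)"
    by (subst sum.lessThan_Suc_shift) simp
  also have "\<dots> = (\<Sum>k<n. qpoch_quot q k * (1 + q ^ k) * x ^ Suc k)"
    using n by (intro sum.cong refl) (simp only: qpoch_quot_Suc lessThan_iff)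
  \<comment> \<open>The term k = n may be added since 1 + q^n = 0.\<close>
  also have "\<dots> = (\<Sum>k<Suc n. qpoch_quot q k * (1 + q ^ k) * x ^ Suc k)"
    by (simp add: qn)
  also have "\<dots> = x * (qpoch_sum q n x + qpoch_sum q n (q * x))"
    unfolding qpoch_sum_def lessThan_Suc_atMost distrib_left sum_distrib_left sum.distrib[symmetric]
    by (rule sum.cong) (simp_all add: algebra_simps power_mult_distrib)
  finally show ?thesis by (simp add: algebra_simps)
qed

lemma qpoch_sum_zero:
  assumes "0 < l" "l \<le> n"
  shows "qpoch_sum q n (q ^ l) = 0"
  using assms
proof (induction l)
  case (Suc l)
  \<comment> \<open>Otherwise q^(2 l) = 1 with 0 < 2 l < 2 n; for l = 0 the claim is that 2 is not
    0.\<close>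
  have "1 + q ^ l \<noteq> 0"
  proof
    assume "1 + q ^ l = 0"
    then have "q ^ l = -1" by (simp add: add_eq_0_iff)
    then have "q ^ (2 * l) = 1" by (simp add: power_mult mult.commute[of 2])
    moreover have "l > 0" using \<open>q ^ l = -1\<close> by (cases l) auto
    ultimately show False using q1[of "2 * l"] Suc.prems by simp
  qed
  moreover have "(1 - q ^ l) * qpoch_sum q n (q ^ l) = 0"
    using Suc by (cases "l = 0") auto
  ultimately show ?case using qpoch_sum_functional[of "q ^ l"] by simp
qed simp

text \<open>The numerators of \<open>qcot\<close> are 1 + q^p for p = 1, ..., k, those of
  \<open>qpoch_quot\<close> for p = 0, ..., k - 1; trading 1 + q^0 = 2 for 1 + q^k gives the first
  form, and the recursion of the coefficients gives the second. The two forms are combined in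
  \<open>qcot_sum_Suc\<close>.\<close>

lemma qcot_eq:
  assumes "k < n"
  shows "qcot q k = (1 + q ^ k) * qpoch_quot q k / 2" "qcot q k = (1 - q ^ Suc k) * qpoch_quot q (Suc k) / 2"
proof -
  show *: "qcot q k = (1 + q ^ k) * qpoch_quot q k / 2"
    using assms
  proof (induction k)
    case (Suc k)
    have "qcot q (Suc k) = qcot q k * ((1 + q ^ Suc k) / (1 - q ^ Suc k))"
      by (simp add: qcot_def)
    also have "\<dots> = (1 + q ^ k) * qpoch_quot q k / 2 * ((1 + q ^ Suc k) / (1 - q ^ Suc k))"
      by (simp only: Suc.IH[OF Suc_lessD[OF Suc.prems]])
    also have "\<dots> = (1 + q ^ Suc k) * qpoch_quot q (Suc k) / 2"
      by (simp add: qpoch_quot_def mult_ac)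
    finally show ?case .
  qed (simp add: qcot_def qpoch_quot_def)
  show "qcot q k = (1 - q ^ Suc k) * qpoch_quot q (Suc k) / 2"
    using * qpoch_quot_Suc[of k] assms by (simp add: mult.commute)
qed

text \<open>For j = 0 the second form of \<open>qcot\<close> cancels the denominators, and what is
  left is half of the polynomial without its constant term 1.\<close>

lemma qcot_sum_0:
  assumes "qpoch_sum q n x = 0"
  shows "qcot_sum q n 0 x = - 1 / 2"
proof -
  have "qcot_sum q n 0 x = (\<Sum>k<n. qpoch_quot q (Suc k) * x ^ Suc k) / 2"
    unfolding qcot_sum_def sum_divide_distrib
  proof (rule sum.cong[OF refl])
    fix k assume "k \<in> {..<n}"
    then have "k < n" "1 - q ^ Suc k \<noteq> 0" using q1[of "Suc k"] by auto
    then show "qcot q k * x ^ (0 + k + 1) / (1 - q ^ (0 + k + 1)) = qpoch_quot q (Suc k) * x ^ Suc k / 2"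
      unfolding qcot_eq(2)[OF \<open>k < n\<close>] by (simp add: field_simps)
  qed
  also have "(\<Sum>k<n. qpoch_quot q (Suc k) * x ^ Suc k) = qpoch_sum q n x - 1"
    unfolding qpoch_sum_def lessThan_Suc_atMost[symmetric]
    by (subst sum.lessThan_Suc_shift) (simp add: qpoch_quot_def)
  finally show ?thesis by (simp add: assms)
qed

text \<open>The sum for j uses the first form of \<open>qcot\<close>, the sum for j + 1 the second
  form shifted by one index, so that both have the denominators 1 - q^(j+k+1). With a = q^(j+1) and
  b = q^k the numerators combine by (1 + a)(1 - b) + (1 - a)(1 + b) = 2 (1 - a b); the denominators
  cancel and x^(j+1) times the vanishing polynomial remains.\<close>

lemma qcot_sum_Suc:
  assumes "qpoch_sum q n x = 0" "Suc j < n"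
  shows "(1 + q ^ Suc j) * qcot_sum q n (Suc j) x = - ((1 - q ^ Suc j) * qcot_sum q n j x)"
proof -
  have ne: "1 - q ^ (j + k + 1) \<noteq> 0" if "k \<le> n" for k
    using q1[of "j + k + 1"] assms(2) that by auto
  have "(1 - q ^ Suc j) * qcot_sum q n j x = (\<Sum>k<n. (1 - q ^ Suc j) * (1 + q ^ k) * qpoch_quot q k / 2 * x ^ (j + k + 1) / (1 - q ^ (j + k + 1)))"
    unfolding qcot_sum_def sum_distrib_left by (rule sum.cong[OF refl]) (simp add: qcot_eq(1))
  \<comment> \<open>The term k = n is zero because of the factor 1 + q^n.\<close>
  also have "\<dots> = (\<Sum>k\<le>n. (1 - q ^ Suc j) * (1 + q ^ k) * qpoch_quot q k / 2 * x ^ (j + k + 1) / (1 - q ^ (j + k + 1)))"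
    by (simp add: qn flip: lessThan_Suc_atMost)
  finally have A: "(1 - q ^ Suc j) * qcot_sum q n j x = \<dots>" .
  have "(1 + q ^ Suc j) * qcot_sum q n (Suc j) x = (\<Sum>k<n. (1 + q ^ Suc j) * (1 - q ^ Suc k) * qpoch_quot q (Suc k) / 2 * x ^ (j + Suc k + 1) / (1 - q ^ (j + Suc k + 1)))"
    unfolding qcot_sum_def sum_distrib_left by (rule sum.cong[OF refl]) (simp add: qcot_eq(2) del: power_Suc)
  \<comment> \<open>After the shift the sum may start at k = 0 because of the factor 1 - q^0 =
    0.\<close>
  also have "\<dots> = (\<Sum>k<Suc n. (1 + q ^ Suc j) * (1 - q ^ k) * qpoch_quot q k / 2 * x ^ (j + k + 1) / (1 - q ^ (j + k + 1)))"
    by (subst sum.lessThan_Suc_shift) simp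
  also have "\<dots> = (\<Sum>k\<le>n. (1 + q ^ Suc j) * (1 - q ^ k) * qpoch_quot q k / 2 * x ^ (j + k + 1) / (1 - q ^ (j + k + 1)))"
    by (simp only: lessThan_Suc_atMost)
  finally have "(1 + q ^ Suc j) * qcot_sum q n (Suc j) x + (1 - q ^ Suc j) * qcot_sum q n j x =
     (\<Sum>k\<le>n. (1 + q ^ Suc j) * (1 - q ^ k) * qpoch_quot q k / 2 * x ^ (j + k + 1) / (1 - q ^ (j + k + 1)) +
        (1 - q ^ Suc j) * (1 + q ^ k) * qpoch_quot q k / 2 * x ^ (j + k + 1) / (1 - q ^ (j + k + 1)))"
    unfolding A by (simp only: sum.distrib)
  also have "\<dots> = (\<Sum>k\<le>n. x ^ Suc j * (qpoch_quot q k * x ^ k))"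
  proof (rule sum.cong[OF refl])
    fix k assume "k \<in> {..n}"
    then have ne: "1 - q ^ (j + k + 1) \<noteq> 0" using ne by simp
    have "(1 + q ^ Suc j) * (1 - q ^ k) + (1 - q ^ Suc j) * (1 + q ^ k) = 2 * (1 - q ^ (j + k + 1))"
      by (simp add: algebra_simps power_add)
    moreover have "(1 + q ^ Suc j) * (1 - q ^ k) * qpoch_quot q k / 2 * x ^ (j + k + 1) / (1 - q ^ (j + k + 1)) +
        (1 - q ^ Suc j) * (1 + q ^ k) * qpoch_quot q k / 2 * x ^ (j + k + 1) / (1 - q ^ (j + k + 1)) =
      ((1 + q ^ Suc j) * (1 - q ^ k) + (1 - q ^ Suc j) * (1 + q ^ k)) * (qpoch_quot q k / 2 * x ^ (j + k + 1) / (1 - q ^ (j + k + 1)))"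
    proof -
      have "A * B * c / 2 * y / d + C * D * c / 2 * y / d = (A * B + C * D) * (c / 2 * y / d)" for A B C D c y d :: complex
        by (simp add: algebra_simps add_divide_distrib)
      then show ?thesis .
    qed
    ultimately show "(1 + q ^ Suc j) * (1 - q ^ k) * qpoch_quot q k / 2 * x ^ (j + k + 1) / (1 - q ^ (j + k + 1)) +
        (1 - q ^ Suc j) * (1 + q ^ k) * qpoch_quot q k / 2 * x ^ (j + k + 1) / (1 - q ^ (j + k + 1)) = x ^ Suc j * (qpoch_quot q k * x ^ k)"
      using ne by (simp add: power_add)
  qed
  also have "\<dots> = x ^ Suc j * qpoch_sum q n x" by (simp only: qpoch_sum_def sum_distrib_left)
  finally show ?thesis using assms(1) by (simp add: eq_neg_iff_add_eq_0)
qed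

text \<open>From j to j + 1 the sum is multiplied by -(1 - q^(j+1)) / (1 + q^(j+1)), the negative
  inverse of what \<open>qcot\<close> gains; the product merely alternates in sign.\<close>

lemma qcot_sum_eq:
  assumes "qpoch_sum q n x = 0" "j < n"
  shows "qcot q j * qcot_sum q n j x = - ((-1) ^ j / 2)"
  using assms(2)
proof (induction j)
  case 0
  then show ?case using qcot_sum_0[OF assms(1)] by (simp add: qcot_def)
next
  case (Suc j)
  have ne: "1 - q ^ Suc j \<noteq> 0" using q1[of "Suc j"] Suc.prems by auto
  have "qcot q (Suc j) = qcot q j * ((1 + q ^ Suc j) / (1 - q ^ Suc j))" by (simp add: qcot_def)
  then have "qcot q (Suc j) * qcot_sum q n (Suc j) x = qcot q j / (1 - q ^ Suc j) * ((1 + q ^ Suc j) * qcot_sum q n (Suc j) x)"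
    by (simp only: times_divide_eq_left times_divide_eq_right mult.assoc)
  also have "\<dots> = - (qcot q j * qcot_sum q n j x)"
    unfolding qcot_sum_Suc[OF assms(1) Suc.prems] using ne by (simp del: power_Suc)
  also have "\<dots> = - ((-1) ^ Suc j / 2)" using Suc by simp
  finally show ?case .
qed

end

section \<open>From powers of q to cotangents\<close>

lemma cis_pi_div_power: "n > 0 \<Longrightarrow> cis (pi / real n) ^ n = -1"
  by (simp add: Complex.DeMoivre)

lemma cis_pi_div_power_ne_1:
  assumes "0 < i" "i < 2 * n"
  shows "cis (pi / real n) ^ i \<noteq> 1"
proof
  assume "cis (pi / real n) ^ i = 1"
  then have "cos (real i * (pi / real n)) = 1" by (simp add: Complex.DeMoivre complex_eq_iff)
  then obtain m :: int where m: "real i * (pi / real n) = of_int m * 2 * pi" using cos_one_2pi_int by blast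
  have "n > 0" using assms by simp
  then have "real i = of_int m * (2 * real n)" using m by (simp add: field_simps)
  then have eq: "real_of_int (int i) = real_of_int (m * (2 * int n))" by simp
  have "int i = m * (2 * int n)" using eq by (rule of_int_eq_iff[THEN iffD1])
  then have "2 * int n dvd int i" by (rule dvdI[of _ _ m, OF trans[OF _ mult.commute]])
  moreover have "0 < int i" using assms(1) by simp
  ultimately have "2 * int n \<le> int i" by (rule zdvd_imp_le)
  then show False using assms(2) by simp
qed

lemma i_cot: "cis (2 * t) \<noteq> 1 \<Longrightarrow> (1 + cis (2 * t)) / (1 - cis (2 * t)) = \<i> * of_real (cot t)"
proof -
  assume ne: "cis (2 * t) \<noteq> 1"
  have c: "cis (2 * t) = cis t * cis t" by (simp add: cis_mult)
  have 1: "cis (-t) * cis t = 1" by (simp add: cis_mult)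
  have "1 + cis (2 * t) = cis t * (cis (-t) + cis t)" using 1 c by (simp add: algebra_simps)
  also have "cis (-t) + cis t = 2 * of_real (cos t)" by (simp add: complex_eq_iff)
  finally have n: "1 + cis (2 * t) = cis t * (2 * of_real (cos t))" .
  have "1 - cis (2 * t) = cis t * (cis (-t) - cis t)" using 1 c by (simp add: algebra_simps)
  also have "cis (-t) - cis t = - (2 * \<i> * of_real (sin t))" by (simp add: complex_eq_iff)
  finally have d: "1 - cis (2 * t) = cis t * - (2 * \<i> * of_real (sin t))" .
  then have "sin t \<noteq> 0" using ne by auto
  then show ?thesis unfolding n d by (simp add: cot_def field_simps)
qed

text \<open>The condition that the claimed matrix maps \<open>Gamma0\<close> of one exponential
  solution to \<open>Gamma1\<close> of it, with the power of the root divided out. The index s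
  numbers the root, and m is its angle relative to -w, in units of \<alpha>, where w is the chosen
  root of -z.\<close>

lemma cot_prod_identity:
  assumes j: "j < n" and s: "s < n"
  defines "m \<equiv> 2 * real s - (real n - 1)"
  shows "(\<Sum>k<n. (-1) ^ k * of_real (cot_prod n j * cot_prod n k / sin (real (j + k + 1) * alpha n)) *
     cis (- (alpha n * m)) ^ (j + k + 1)) = 1"
proof -
  have n: "n > 0" using s by simp
  define q where "q = cis (pi / real n)"
  have q: "q ^ n = -1" "\<And>i. 0 < i \<Longrightarrow> i < 2 * n \<Longrightarrow> q ^ i \<noteq> 1"
    unfolding q_def using cis_pi_div_power[OF n] cis_pi_div_power_ne_1 by auto
  have qp: "q ^ p = cis (2 * (real p * alpha n))" for p
    using n by (simp add: q_def Complex.DeMoivre alpha_def)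
  have qcot: "qcot q k = \<i> ^ k * of_real (cot_prod n k)" if "k < n" for k
  proof -
    have "qcot q k = (\<Prod>p=1..k. \<i> * of_real (cot (real p * alpha n)))"
      unfolding qcot_def
    proof (rule prod.cong[OF refl])
      fix p assume "p \<in> {1..k}"
      then show "(1 + q ^ p) / (1 - q ^ p) = \<i> * of_real (cot (real p * alpha n))"
        using i_cot[of "real p * alpha n"] q(2)[of p] that unfolding qp by auto
    qed
    then show ?thesis by (simp add: prod.distrib cot_prod_def)
  qed
  \<comment> \<open>For s = 0, ..., n - 1 the exponents n - s are 1, ..., n, precisely those at
    which the polynomial vanishes.\<close>
  define x where "x = q ^ (n - s)"
  have x0: "qpoch_sum q n x = 0" unfolding x_def by (rule qpoch_sum_zero[OF q]) (use s in auto)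
  have xeq: "cis (alpha n) * cis (- (alpha n * m)) = - \<i> * x"
  proof -
    \<comment> \<open>Both sides are pi/2 - 2 s \<alpha>, because \<alpha> n = pi/2.\<close>
    have "alpha n + - (alpha n * m) = - (pi / 2) + 2 * (real (n - s) * alpha n)"
      using n s by (simp add: m_def alpha_def of_nat_diff field_simps)
    then have "cis (alpha n + - (alpha n * m)) = cis (- (pi / 2)) * x"
      by (simp only: x_def qp cis_mult)
    moreover have "cis (- (pi / 2)) = - \<i>" by (simp add: complex_eq_iff)
    ultimately show ?thesis by (simp add: cis_mult)
  qed
  \<comment> \<open>From 1 - q^N = -2 i cis (N \<alpha>) sin (N \<alpha>); the factor cis (N
    \<alpha>) is the N-th power of the one that \<open>xeq\<close> absorbs into x.\<close>
  have summand: "cis (- (alpha n * m)) ^ N / of_real (sin (real N * alpha n)) = - 2 * \<i> * (- \<i>) ^ N * (x ^ N / (1 - q ^ N))"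
    if N: "0 < N" "N < 2 * n" for N
  proof -
    let ?t = "real N * alpha n"
    have c: "q ^ N = cis ?t * cis ?t" unfolding qp by (simp only: cis_mult mult_2)
    have 1: "cis (- ?t) * cis ?t = 1" by (simp add: cis_mult)
    have "1 - q ^ N = cis ?t * (cis (- ?t) - cis ?t)" using 1 c by (simp add: algebra_simps)
    also have "cis (- ?t) - cis ?t = - (2 * \<i> * of_real (sin ?t))" by (simp add: complex_eq_iff)
    finally have d: "1 - q ^ N = cis ?t * - (2 * \<i> * of_real (sin ?t))" .
    have "1 - q ^ N \<noteq> 0" using q(2)[of N] N by simp
    then have sin: "sin ?t \<noteq> 0" using d by auto
    have "(- \<i> * x) ^ N = cis ?t * cis (- (alpha n * m)) ^ N"
      unfolding xeq[symmetric] power_mult_distrib by (simp add: Complex.DeMoivre)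
    then have e: "(- \<i>) ^ N * x ^ N = cis ?t * cis (- (alpha n * m)) ^ N" by (simp only: power_mult_distrib)
    have "- 2 * \<i> * (- \<i>) ^ N * (x ^ N / (1 - q ^ N)) = - 2 * \<i> * ((- \<i>) ^ N * x ^ N) / (1 - q ^ N)"
      by simp
    also have "\<dots> = - 2 * \<i> * (cis ?t * cis (- (alpha n * m)) ^ N) / (1 - q ^ N)" unfolding e ..
    also have "\<dots> = cis (- (alpha n * m)) ^ N / of_real (sin ?t)"
      unfolding d using sin by (simp add: field_simps)
    finally show ?thesis ..
  qed
  have "(\<Sum>k<n. (-1) ^ k * of_real (cot_prod n j * cot_prod n k / sin (real (j + k + 1) * alpha n)) * cis (- (alpha n * m)) ^ (j + k + 1)) =
    (\<Sum>k<n. - 2 * (-1) ^ j * (qcot q j * (qcot q k * x ^ (j + k + 1) / (1 - q ^ (j + k + 1)))))"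
  proof (rule sum.cong[OF refl])
    fix k assume "k \<in> {..<n}"
    then have k: "k < n" by simp
    let ?N = "j + k + 1"
    have "(-1) ^ k * of_real (cot_prod n j * cot_prod n k / sin (real ?N * alpha n)) * cis (- (alpha n * m)) ^ ?N =
       (-1) ^ k * of_real (cot_prod n j) * of_real (cot_prod n k) * (cis (- (alpha n * m)) ^ ?N / of_real (sin (real ?N * alpha n)))"
      by simp
    also have "\<dots> = (-1) ^ k * of_real (cot_prod n j) * of_real (cot_prod n k) * (- 2 * \<i> * (- \<i>) ^ ?N * (x ^ ?N / (1 - q ^ ?N)))"
      using j k by (subst summand) auto
    also have "(-1) ^ k * of_real (cot_prod n j) * of_real (cot_prod n k) * (- 2 * \<i> * (- \<i>) ^ ?N * (x ^ ?N / (1 - q ^ ?N))) =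
       - 2 * (-1) ^ j * (qcot q j * (qcot q k * x ^ ?N / (1 - q ^ ?N)))"
    proof -
      have i: "(- \<i>) ^ ?N = - \<i> * ((-1) ^ j * (-1) ^ k * (\<i> ^ j * \<i> ^ k))"
        by (simp add: power_add power_minus[of \<i>] mult_ac)
      have ii: "\<i> * \<i> = -1" by simp
      have s: "(-1) ^ k * (-1) ^ k = (1 :: complex)" by (simp flip: power_mult_distrib)
      have "K * a * b * (- 2 * t * (- t * (J * K * (p * r))) * y) = (K * K) * (t * t) * 2 * J * (p * a * (r * b * y))"
        for K J t a b p r y :: complex
        by (simp add: algebra_simps)
      then have "(-1) ^ k * of_real (cot_prod n j) * of_real (cot_prod n k) * (- 2 * \<i> * (- \<i>) ^ ?N * (x ^ ?N / (1 - q ^ ?N))) =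
         ((-1) ^ k * (-1) ^ k) * (\<i> * \<i>) * 2 * (-1) ^ j *
           (\<i> ^ j * of_real (cot_prod n j) * (\<i> ^ k * of_real (cot_prod n k) * (x ^ ?N / (1 - q ^ ?N))))"
        unfolding i by blast
      also have "\<dots> = - 2 * (-1) ^ j * (qcot q j * (qcot q k * x ^ ?N / (1 - q ^ ?N)))"
        unfolding s ii qcot[OF j] qcot[OF k] by simp
      finally show ?thesis .
    qed
    finally show "(-1) ^ k * of_real (cot_prod n j * cot_prod n k / sin (real (j + k + 1) * alpha n)) * cis (- (alpha n * m)) ^ (j + k + 1) =
       - 2 * (-1) ^ j * (qcot q j * (qcot q k * x ^ (j + k + 1) / (1 - q ^ (j + k + 1))))" .
  qed
  also have "\<dots> = - 2 * (-1) ^ j * (qcot q j * qcot_sum q n j x)"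
    unfolding qcot_sum_def sum_distrib_left ..
  also have "qcot q j * qcot_sum q n j x = - ((-1) ^ j / 2)"
    by (rule qcot_sum_eq[OF q(1) _ x0 j]) (rule q(2))
  also have "- 2 * (-1) ^ j * - ((-1) ^ j / 2) = (1 :: complex)"
    by (simp flip: power_mult_distrib)
  finally show ?thesis .
qed

section \<open>Solutions of the eigenvalue equation and the resolvent\<close>

text \<open>The derivative of |g|^2 is 2 Re \<rho> |g|^2 plus a cross term, which Young's inequality
  bounds by c |g|^2 + |h|^2 / c with c = |Re \<rho>|. Integration over [0, X] then bounds c times
  the integral of |g|^2 by the end point values, hence by K, and by the norm of h.\<close>

lemma square_integral_bound_of_first_order:
  assumes g: "ac_deriv g (\<lambda>x. \<rho> * g x + h x)" and h: "h \<in> L2_halfline" and \<rho>: "Re \<rho> \<noteq> 0"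
    and K: "\<And>x. x \<ge> 0 \<Longrightarrow> cmod (g x) \<le> K"
  shows "g \<in> L2_halfline"
proof -
  \<comment> \<open>The sign treats decaying and growing exponentials alike: s Re \<rho> = c > 0 in
    both cases.\<close>
  define s where "s = sgn (Re \<rho>)"
  define c where "c = \<bar>Re \<rho>\<bar>"
  have c: "c > 0" and s: "s * Re \<rho> = c" "\<bar>s\<bar> = 1" using \<rho> by (auto simp: c_def s_def sgn_if)
  let ?d = "\<lambda>x. (\<rho> * g x + h x) * cnj (g x) + g x * cnj (\<rho> * g x + h x)"
  have E: "ac_deriv (\<lambda>x. g x * cnj (g x)) ?d"
    by (rule ac_deriv_mult[OF g ac_deriv_cnj[OF g]])
  have cont: "continuous_on {0..} g" by (rule ac_deriv_continuous[OF g])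
  have pointwise: "c * (cmod (g x))\<^sup>2 \<le> s * Re (?d x) + (cmod (h x))\<^sup>2 / c" for x
  proof -
    have "Re (?d x) = 2 * Re (\<rho> * (g x * cnj (g x))) + 2 * Re (h x * cnj (g x))"
      by (simp add: algebra_simps)
    also have "\<rho> * (g x * cnj (g x)) = of_real ((cmod (g x))\<^sup>2) * \<rho>"
      by (simp add: complex_norm_square mult.commute del: of_real_power)
    also have "Re (of_real ((cmod (g x))\<^sup>2) * \<rho>) = (cmod (g x))\<^sup>2 * Re \<rho>" by simp
    finally have "s * Re (?d x) = 2 * (cmod (g x))\<^sup>2 * (s * Re \<rho>) + 2 * (s * Re (h x * cnj (g x)))"
      by (simp add: algebra_simps)
    then have 1: "s * Re (?d x) = 2 * c * (cmod (g x))\<^sup>2 + 2 * (s * Re (h x * cnj (g x)))"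
      using s(1) by simp
    have "\<bar>s * Re (h x * cnj (g x))\<bar> \<le> cmod (h x) * cmod (g x)"
      using abs_Re_le_cmod[of "h x * cnj (g x)"] s(2) by (simp add: abs_mult norm_mult)
    then have 2: "- (2 * (cmod (h x) * cmod (g x))) \<le> 2 * (s * Re (h x * cnj (g x)))" by linarith
    have "0 \<le> (c * cmod (g x) - cmod (h x))\<^sup>2 / c" using c by simp
    also have "\<dots> = c * (cmod (g x))\<^sup>2 - 2 * (cmod (h x) * cmod (g x)) + (cmod (h x))\<^sup>2 / c"
      using c by (simp add: power2_eq_square field_simps)
    finally show ?thesis using 1 2 by linarith
  qed
  have "integrable halfline (\<lambda>x. (cmod (g x))\<^sup>2)"
  proof (rule integrable_halflineI_bounded)
    fix X :: real assume X: "X > 0"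
    have "continuous_on {0..X} g" by (rule continuous_on_subset[OF cont]) auto
    then show i: "(\<lambda>x. (cmod (g x))\<^sup>2) integrable_on {0..X}"
      by (intro integrable_continuous_real continuous_intros)
    note hi = L2_square_integrable_on(1)[OF h order_refl, of X]
    have "(?d has_integral (g X * cnj (g X) - g 0 * cnj (g 0))) {0..X}"
      by (rule ac_deriv_has_integral[OF E]) (use X in auto)
    then have di: "((\<lambda>x. Re (?d x)) has_integral (Re (g X * cnj (g X) - g 0 * cnj (g 0)))) {0..X}"
      by (rule has_integral_Re)
    have "integral {0..X} (\<lambda>x. c * (cmod (g x))\<^sup>2) \<le> s * Re (g X * cnj (g X) - g 0 * cnj (g 0)) + integral {0..X} (\<lambda>x. (cmod (h x))\<^sup>2) / c"
    proof (rule has_integral_le[OF integrable_integral[OF integrable_on_mult_right[OF i]]])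
      show "((\<lambda>x. s * Re (?d x) + (cmod (h x))\<^sup>2 / c) has_integral
          s * Re (g X * cnj (g X) - g 0 * cnj (g 0)) + integral {0..X} (\<lambda>x. (cmod (h x))\<^sup>2) / c) {0..X}"
        by (intro has_integral_add has_integral_mult_right di has_integral_divide integrable_integral hi)
    qed (rule pointwise)
    also have "s * Re (g X * cnj (g X) - g 0 * cnj (g 0)) \<le> K\<^sup>2 + K\<^sup>2"
    proof -
      have sq: "(cmod (g x))\<^sup>2 \<le> K\<^sup>2" if "x \<ge> 0" for x using K[OF that] by (intro power_mono) auto
      have "g x * cnj (g x) = of_real ((cmod (g x))\<^sup>2)" for x by (simp add: complex_norm_square del: of_real_power)
      then have "s * Re (g X * cnj (g X) - g 0 * cnj (g 0)) = s * ((cmod (g X))\<^sup>2 - (cmod (g 0))\<^sup>2)" by simp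
      also have "\<dots> \<le> \<bar>(cmod (g X))\<^sup>2 - (cmod (g 0))\<^sup>2\<bar>" using s(2) by (metis abs_ge_self abs_mult mult_1)
      also have "\<dots> \<le> K\<^sup>2 + K\<^sup>2" using sq[of X] sq[of 0] X zero_le_power2[of "cmod (g X)"] zero_le_power2[of "cmod (g 0)"]
        by (intro abs_leI) linarith+
      finally show ?thesis .
    qed
    also have "integral {0..X} (\<lambda>x. (cmod (h x))\<^sup>2) / c \<le> (LINT x|halfline. (cmod (h x))\<^sup>2) / c"
    proof (rule divide_right_mono)
      show "integral {0..X} (\<lambda>x. (cmod (h x))\<^sup>2) \<le> (LINT x|halfline. (cmod (h x))\<^sup>2)"
      proof (rule tendsto_lowerbound[OF integral_tendsto_halfline[OF L2_halflineD(2)[OF h]]])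
        show "\<forall>\<^sub>F Y in at_top. integral {0..X} (\<lambda>x. (cmod (h x))\<^sup>2) \<le> integral {0..Y} (\<lambda>x. (cmod (h x))\<^sup>2)"
          using eventually_ge_at_top[of X]
          by eventually_elim (intro integral_subset_le L2_square_integrable_on[OF h], auto)
      qed simp
    qed (use c in simp)
    finally show "integral {0..X} (\<lambda>x. (cmod (g x))\<^sup>2) \<le> (K\<^sup>2 + K\<^sup>2 + (LINT x|halfline. (cmod (h x))\<^sup>2) / c) / c"
      using c by (simp add: field_simps)
  qed simp
  then show ?thesis using continuous_measurable_halfline[OF cont] by (simp add: L2_halfline_def)
qed

lemma exp_vector_derivative:
  fixes \<rho> :: complex
  shows "((\<lambda>x. exp (\<rho> * of_real x)) has_vector_derivative \<rho> * exp (\<rho> * of_real x)) (at x within S)"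
  by (rule has_vector_derivative_real_field[of "\<lambda>w. exp (\<rho> * w)"])
    (auto intro!: derivative_eq_intros)

lemma ac_deriv_exp: "ac_deriv (\<lambda>x. exp (\<rho> * of_real x)) (\<lambda>x. \<rho> * exp (\<rho> * of_real x))"
  by (rule ac_derivI_vector[OF exp_vector_derivative]) (intro continuous_intros)

text \<open>The homogeneous case of the preceding estimate.\<close>

lemma exp_L2:
  assumes "Re \<rho> < 0"
  shows "(\<lambda>x. exp (\<rho> * of_real x)) \<in> L2_halfline"
proof (rule square_integral_bound_of_first_order[where h = "\<lambda>x. 0" and K = 1])
  show "cmod (exp (\<rho> * complex_of_real x)) \<le> 1" if "x \<ge> 0" for x
    using assms that by (simp add: mult_nonpos_nonneg)
qed (use assms ac_deriv_exp L2_zero in auto)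

text \<open>The crude bound |e h| <= |e|^2 + |h|^2 is enough, since the aim is boundedness uniform
  in x; \<open>square_integral_bound_of_first_order\<close> improves it to square
  integrability.\<close>

lemma convolution_bound:
  assumes h: "h \<in> L2_halfline" and e: "continuous_on {a..b} e"
    and bd: "\<And>t. t \<in> {a..b} \<Longrightarrow> (cmod (e t))\<^sup>2 \<le> w t" "(w has_integral W) {a..b}" "W \<le> B" and a: "0 \<le> a"
  shows "cmod (integral {a..b} (\<lambda>t. e t * h t)) \<le> B + (LINT x|halfline. (cmod (h x))\<^sup>2)"
proof (cases "a \<le> b")
  case False
  then have "{a..b} = {}" by simp
  moreover have "W = 0" using bd(2) False by simp
  ultimately show ?thesis using bd(3) by (simp add: integral_nonneg_AE add_nonneg_nonneg)
next
  case True
  have hi: "(\<lambda>x. (cmod (h x))\<^sup>2) integrable_on {a..b}" by (rule L2_square_integrable_on[OF h a])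
  have "cmod (integral {a..b} (\<lambda>t. e t * h t)) \<le> integral {a..b} (\<lambda>t. w t + (cmod (h t))\<^sup>2)"
  proof (rule integral_norm_bound_integral)
    show "(\<lambda>t. e t * h t) integrable_on {a..b}"
      by (rule set_lebesgue_integral_eq_integral(1)[OF absolutely_integrable_continuous_mult[OF e L2_absolutely_integrable[OF h a]]])
    show "(\<lambda>t. w t + (cmod (h t))\<^sup>2) integrable_on {a..b}" using bd(2) hi by (intro integrable_add) auto
    fix t assume t: "t \<in> {a..b}"
    have "0 \<le> (cmod (e t) - cmod (h t))\<^sup>2" "0 \<le> cmod (e t) * cmod (h t)" by auto
    then have "cmod (e t) * cmod (h t) \<le> (cmod (e t))\<^sup>2 + (cmod (h t))\<^sup>2" unfolding power2_diff by linarith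
    then show "cmod (e t * h t) \<le> w t + (cmod (h t))\<^sup>2" using bd(1)[OF t] by (simp add: norm_mult)
  qed
  also have "\<dots> = W + integral {a..b} (\<lambda>t. (cmod (h t))\<^sup>2)"
    using bd(2) hi by (subst Henstock_Kurzweil_Integration.integral_add) (auto simp: integral_unique)
  also have "integral {a..b} (\<lambda>t. (cmod (h t))\<^sup>2) \<le> (LINT x|halfline. (cmod (h x))\<^sup>2)"
  proof (rule tendsto_lowerbound[OF integral_tendsto_halfline[OF L2_halflineD(2)[OF h]]])
    show "\<forall>\<^sub>F Y in at_top. integral {a..b} (\<lambda>x. (cmod (h x))\<^sup>2) \<le> integral {0..Y} (\<lambda>x. (cmod (h x))\<^sup>2)"
      using eventually_ge_at_top[of b]
      by eventually_elim (intro integral_subset_le L2_square_integrable_on[OF h], use a in auto)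
  qed simp
  finally show ?thesis using bd(3) by simp
qed

lemma exp_real_has_integral:
  fixes a b c d :: real
  assumes "c \<noteq> 0" "a \<le> b"
  shows "((\<lambda>t. exp (c * (t - d))) has_integral (exp (c * (b - d)) - exp (c * (a - d))) / c) {a..b}"
proof -
  have "((\<lambda>t. exp (c * (t - d))) has_integral (exp (c * (b - d)) / c - exp (c * (a - d)) / c)) {a..b}"
    by (rule fundamental_theorem_of_calculus[OF assms(2)])
       (use assms(1) in \<open>auto intro!: derivative_eq_intros simp flip: has_real_derivative_iff_has_vector_derivative\<close>)
  then show ?thesis by (simp add: diff_divide_distrib)
qed

text \<open>Variation of constants, with the integration started at 0 for Re \<rho> < 0 and at
  infinity for Re \<rho> > 0, so that the exponential kernel always decays with the distance from
  x.\<close>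

lemma first_order_L2_solution:
  assumes h: "h \<in> L2_halfline" and \<rho>: "Re \<rho> \<noteq> 0"
  obtains g where "g \<in> L2_halfline" "ac_deriv g (\<lambda>x. \<rho> * g x + h x)"
proof -
  let ?e = "\<lambda>t. exp (- \<rho> * of_real t)"
  let ?H = "LINT x|halfline. (cmod (h x))\<^sup>2"
  have ce: "continuous_on S ?e" for S by (intro continuous_intros)
  define I where "I = (\<lambda>x. integral {0..x} (\<lambda>t. ?e t * h t))"
  have ei: "(\<lambda>t. ?e t * h t) absolutely_integrable_on {a..b}" if "0 \<le> a" for a b
    by (rule absolutely_integrable_continuous_mult[OF ce L2_absolutely_integrable[OF h that]])
  have I: "ac_deriv (\<lambda>x. k + I x) (\<lambda>t. ?e t * h t)" for k
    unfolding I_def by (rule ac_derivI_integral[OF ei]) simp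
  have sol: "ac_deriv (\<lambda>x. exp (\<rho> * of_real x) * (k + I x)) (\<lambda>x. \<rho> * (exp (\<rho> * of_real x) * (k + I x)) + h x)" for k
  proof (rule ac_deriv_cong[OF ac_deriv_mult[OF ac_deriv_exp I]])
    have "exp (\<rho> * of_real x) * ?e x = 1" for x by (simp flip: exp_add)
    then have "exp (\<rho> * of_real x) * (?e x * h x) = h x" for x by (simp flip: mult.assoc)
    then show "\<rho> * exp (\<rho> * of_real x) * (k + I x) + exp (\<rho> * of_real x) * (?e x * h x) = \<rho> * (exp (\<rho> * of_real x) * (k + I x)) + h x" for x
      by simp
  qed simp
  have sq: "(cmod (exp (\<rho> * of_real x) * ?e t))\<^sup>2 = exp (- 2 * Re \<rho> * (t - x))" for x t
    by (simp add: norm_mult flip: exp_add exp_double) (simp add: algebra_simps)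
  have pull: "exp (\<rho> * of_real x) * integral {a..b} (\<lambda>t. ?e t * h t) = integral {a..b} (\<lambda>t. exp (\<rho> * of_real x) * ?e t * h t)" for x a b
    by (simp add: mult.assoc)
  show thesis
  proof (cases "Re \<rho> < 0")
    case True
    have "cmod (exp (\<rho> * of_real x) * (0 + I x)) \<le> 1 / (2 * \<bar>Re \<rho>\<bar>) + ?H" if x: "x \<ge> 0" for x
      unfolding I_def add_0 pull
    proof (rule convolution_bound[OF h _ eq_refl[OF sq] exp_real_has_integral])
      have "exp (2 * (Re \<rho> * x)) \<ge> 0" by simp
      then show "(exp (- 2 * Re \<rho> * (x - x)) - exp (- 2 * Re \<rho> * (0 - x))) / (- 2 * Re \<rho>) \<le> 1 / (2 * \<bar>Re \<rho>\<bar>)"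
        using True by (simp add: divide_simps)
    qed (use True x in \<open>auto intro!: continuous_intros\<close>)
    from square_integral_bound_of_first_order[OF sol h \<rho> this] sol show thesis by (rule that)
  next
    case False
    then have c: "Re \<rho> > 0" using \<rho> by simp
    have eL2: "?e \<in> L2_halfline" using exp_L2[of "- \<rho>"] c by simp
    \<comment> \<open>The free constant is chosen as -J, which makes the solution minus an integral
      from x to infinity.\<close>
    define J where "J = (LINT t|halfline. ?e t * h t)"
    have J: "(I \<longlongrightarrow> J) at_top"
      unfolding I_def J_def by (rule integral_tendsto_halfline[OF L2_mult_integrable[OF eL2 h]])
    have "cmod (exp (\<rho> * of_real x) * (- J + I x)) \<le> 1 / (2 * Re \<rho>) + ?H" if x: "x \<ge> 0" for x
    proof (rule tendsto_upperbound)
      show "((\<lambda>Y. cmod (exp (\<rho> * of_real x) * (- I Y + I x))) \<longlongrightarrow> cmod (exp (\<rho> * of_real x) * (- J + I x))) at_top"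
        by (intro tendsto_intros J)
      show "\<forall>\<^sub>F Y in at_top. cmod (exp (\<rho> * of_real x) * (- I Y + I x)) \<le> 1 / (2 * Re \<rho>) + ?H"
        using eventually_ge_at_top[of x]
      proof eventually_elim
        case (elim Y)
        have "I x + integral {x..Y} (\<lambda>t. ?e t * h t) = I Y"
          unfolding I_def by (rule Henstock_Kurzweil_Integration.integral_combine[OF x elim])
            (rule set_lebesgue_integral_eq_integral(1)[OF ei[OF order_refl]])
        then have "- I Y + I x = - integral {x..Y} (\<lambda>t. ?e t * h t)" by (simp add: algebra_simps)
        then have "cmod (exp (\<rho> * of_real x) * (- I Y + I x)) = cmod (exp (\<rho> * of_real x) * integral {x..Y} (\<lambda>t. ?e t * h t))"
          by (simp add: norm_mult)
        also have "\<dots> \<le> 1 / (2 * Re \<rho>) + ?H"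
          unfolding pull
        proof (rule convolution_bound[OF h _ eq_refl[OF sq] exp_real_has_integral])
          show "(exp (- 2 * Re \<rho> * (Y - x)) - exp (- 2 * Re \<rho> * (x - x))) / (- 2 * Re \<rho>) \<le> 1 / (2 * Re \<rho>)"
            using c by (simp add: divide_simps)
        qed (use c x elim in \<open>auto intro!: continuous_intros\<close>)
        finally show ?case .
      qed
    qed simp
    from square_integral_bound_of_first_order[OF sol h \<rho> this] sol show thesis by (rule that)
  qed
qed

text \<open>Elimination: equation i + 1 minus \<mu>_n times equation i removes the last unknown and
  leaves a system of size n for d_k = c_k (\<mu>_k - \<mu>_n); the last coefficient comes from the
  equation i = 0.\<close>

lemma vandermonde_solvable:
  fixes \<mu> :: "nat \<Rightarrow> complex"
  assumes "inj_on \<mu> {..<n}"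
  shows "\<exists>c. \<forall>i<n. (\<Sum>k<n. c k * \<mu> k ^ i) = b i"
  using assms
proof (induction n arbitrary: b)
  case (Suc n)
  have ne: "\<mu> k - \<mu> n \<noteq> 0" if "k < n" for k
    using Suc.prems that by (auto simp: inj_on_def)
  have "inj_on \<mu> {..<n}" using Suc.prems by (rule inj_on_subset) auto
  from Suc.IH[OF this, of "\<lambda>i. b (Suc i) - \<mu> n * b i"]
  obtain d where d: "\<And>i. i < n \<Longrightarrow> (\<Sum>k<n. d k * \<mu> k ^ i) = b (Suc i) - \<mu> n * b i" by blast
  define c where "c = (\<lambda>k. if k < n then d k / (\<mu> k - \<mu> n) else b 0 - (\<Sum>k<n. d k / (\<mu> k - \<mu> n)))"
  have "(\<Sum>k<Suc n. c k * \<mu> k ^ i) = b i" if "i < Suc n" for i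
    using that
  proof (induction i)
    case 0
    then show ?case by (simp add: c_def)
  next
    case (Suc i)
    have "(\<Sum>k<Suc n. c k * \<mu> k ^ Suc i) = (\<Sum>k<Suc n. c k * (\<mu> k - \<mu> n) * \<mu> k ^ i) + \<mu> n * (\<Sum>k<Suc n. c k * \<mu> k ^ i)"
      unfolding sum_distrib_left sum.distrib[symmetric] by (rule sum.cong) (auto simp: algebra_simps)
    also have "(\<Sum>k<Suc n. c k * (\<mu> k - \<mu> n) * \<mu> k ^ i) = (\<Sum>k<n. d k * \<mu> k ^ i)"
      using ne by (simp add: c_def)
    also have "\<dots> = b (Suc i) - \<mu> n * b i" using d Suc.prems by simp
    also have "(\<Sum>k<Suc n. c k * \<mu> k ^ i) = b i" using Suc by simp
    finally show ?case by simp
  qed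
  then show ?case by blast
qed simp

section \<open>Exponential solutions and the resolvent\<close>

lemma maximal_repr_zero: "maximal_repr n (\<lambda>x. 0) (\<lambda>x. 0) (\<lambda>k x. 0)"
  by (simp add: maximal_repr_def L2_zero ac_chain_def ac_deriv_const)

lemma maximal_repr_sum:
  fixes m :: nat
  assumes "\<And>l. l < m \<Longrightarrow> maximal_repr n (f l) (g l) (u l)"
  shows "maximal_repr n (\<lambda>x. \<Sum>l<m. c l * f l x) (\<lambda>x. \<Sum>l<m. c l * g l x) (\<lambda>k x. \<Sum>l<m. c l * u l k x)"
  using assms
proof (induction m)
  case (Suc m)
  have "maximal_repr n (\<lambda>x. 1 * (\<Sum>l<m. c l * f l x) + c m * f m x) (\<lambda>x. 1 * (\<Sum>l<m. c l * g l x) + c m * g m x)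
      (\<lambda>k x. 1 * (\<Sum>l<m. c l * u l k x) + c m * u m k x)"
    by (rule maximal_repr_lincomb) (use Suc in auto)
  then show ?case by simp
qed (simp add: maximal_repr_zero)

text \<open>The 2n roots of the characteristic equation, numbered so that the first n belong to
  decaying exponentials. Isolating these properties keeps the resolvent and the Weyl function free
  of angles; \<open>power_sum\<close> is Newton's relation for a polynomial without middle
  terms.\<close>

locale characteristic_roots =
  fixes n :: nat and z :: complex and \<rho> :: "nat \<Rightarrow> complex"
  assumes n: "n \<ge> 1" and Im_z: "Im z > 0"
    and root: "\<And>l. \<rho> l ^ (2 * n) = (-1) ^ n * z"
    and neg: "\<And>l. l < n \<Longrightarrow> Re (\<rho> l) < 0" and nonzero: "\<And>l. l < 2 * n \<Longrightarrow> Re (\<rho> l) \<noteq> 0"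
    and inj: "inj_on \<rho> {..<n}"
    and power_sum: "\<And>i. 0 < i \<Longrightarrow> i < 2 * n \<Longrightarrow> (\<Sum>l<2 * n. \<rho> l ^ i) = 0"
begin

lemma sign_cancel: "(-1) ^ n * ((-1) ^ n * a) = (a :: complex)"
  by (simp flip: mult.assoc power_mult_distrib)

lemma exp_maximal_repr:
  assumes "l < n"
  shows "maximal_repr n (\<lambda>x. exp (\<rho> l * of_real x)) (\<lambda>x. z * exp (\<rho> l * of_real x)) (\<lambda>k x. \<rho> l ^ k * exp (\<rho> l * of_real x))"
proof -
  have "ac_deriv (\<lambda>x. \<rho> l ^ k * exp (\<rho> l * of_real x)) (\<lambda>x. \<rho> l ^ Suc k * exp (\<rho> l * of_real x))" for k
    using ac_deriv_cmult[OF ac_deriv_exp[of "\<rho> l"], of "\<rho> l ^ k"] by (simp add: mult_ac)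
  then show ?thesis
    unfolding maximal_repr_def ac_chain_def using exp_L2[OF neg[OF assms]] root[of l] by (auto simp: L2_cmult mult.assoc)
qed

lemma exp_combination:
  obtains c where "maximal_repr n (\<lambda>x. \<Sum>l<n. c l * exp (\<rho> l * of_real x)) (\<lambda>x. z * (\<Sum>l<n. c l * exp (\<rho> l * of_real x)))
      (\<lambda>k x. \<Sum>l<n. c l * (\<rho> l ^ k * exp (\<rho> l * of_real x)))"
    "\<And>i. i < n \<Longrightarrow> (\<Sum>l<n. c l * \<rho> l ^ i) = b i"
proof -
  obtain c where c: "\<And>i. i < n \<Longrightarrow> (\<Sum>l<n. c l * \<rho> l ^ i) = b i" using vandermonde_solvable[OF inj, of b] by blast
  have "maximal_repr n (\<lambda>x. \<Sum>l<n. c l * exp (\<rho> l * of_real x)) (\<lambda>x. z * (\<Sum>l<n. c l * exp (\<rho> l * of_real x)))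
      (\<lambda>k x. \<Sum>l<n. c l * (\<rho> l ^ k * exp (\<rho> l * of_real x)))"
    using maximal_repr_sum[OF exp_maximal_repr, where c = c and m = n] by (simp add: sum_distrib_left mult.left_commute)
  then show thesis using c by (rule that)
qed

text \<open>Partial fractions: the inverse of D^(2n) - \<omega> is the sum of \<rho>_l / (2 n
  \<omega>) times the inverse of D - \<rho>_l, the residue being 1 / (2 n \<rho>_l^(2n-1)). Each
  first order equation has an L2 solution, and decaying exponentials then correct the boundary
  values.\<close>

lemma resolvent_exists:
  assumes h: "h \<in> L2_halfline"
  obtains f where "(f, \<lambda>x. z * f x + h x) \<in> dirichlet_operator n"
proof -
  define \<omega> where "\<omega> = (-1) ^ n * z"
  have \<omega>: "\<omega> \<noteq> 0" "\<And>l. \<rho> l ^ (2 * n) = \<omega>" "(-1) ^ n * \<omega> = z" using Im_z root by (auto simp: \<omega>_def sign_cancel)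
  define h' where "h' = (\<lambda>x. (-1) ^ n * h x)"
  have h': "h' \<in> L2_halfline" unfolding h'_def by (rule L2_cmult[OF h])
  have "\<exists>g. g \<in> L2_halfline \<and> ac_deriv g (\<lambda>x. \<rho> l * g x + h' x)" if "l < 2 * n" for l
    by (rule first_order_L2_solution[OF h' nonzero[OF that]]) blast
  then obtain g where g: "\<And>l. l < 2 * n \<Longrightarrow> g l \<in> L2_halfline" "\<And>l. l < 2 * n \<Longrightarrow> ac_deriv (g l) (\<lambda>x. \<rho> l * g l x + h' x)"
    by metis
  \<comment> \<open>Differentiation multiplies each weight by \<rho>_l, as long as the inhomogeneous
    terms cancel: the sum of the \<rho>_l^(i+1) vanishes for i + 1 < 2 n and is 2 n \<omega> for i +
    1 = 2 n, where h' appears with coefficient 1.\<close>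
  define v where "v = (\<lambda>i x. \<Sum>l<2 * n. \<rho> l ^ Suc i / (2 * of_nat n * \<omega>) * g l x)"
  define u where "u = (\<lambda>i x. if i < 2 * n then v i x else \<omega> * v 0 x + h' x)"
  have vd: "ac_deriv (v i) (\<lambda>x. v (Suc i) x + (\<Sum>l<2 * n. \<rho> l ^ Suc i) / (2 * of_nat n * \<omega>) * h' x)" for i
  proof -
    have "ac_deriv (v i) (\<lambda>x. \<Sum>l<2 * n. \<rho> l ^ Suc i / (2 * of_nat n * \<omega>) * (\<rho> l * g l x + h' x))"
      unfolding v_def by (intro ac_deriv_sum ac_deriv_cmult g(2)) simp
    moreover have "(\<Sum>l<2 * n. \<rho> l ^ Suc i / (2 * of_nat n * \<omega>) * (\<rho> l * g l x + h' x)) =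
       v (Suc i) x + (\<Sum>l<2 * n. \<rho> l ^ Suc i) / (2 * of_nat n * \<omega>) * h' x" for x
      unfolding v_def sum_divide_distrib sum_distrib_right sum.distrib[symmetric]
      by (rule sum.cong) (auto simp: algebra_simps add_divide_distrib)
    ultimately show ?thesis by simp
  qed
  have "ac_deriv (u i) (u (Suc i))" if i: "i < 2 * n" for i
  proof (cases "Suc i < 2 * n")
    case True
    then show ?thesis using vd[of i] power_sum[of "Suc i"] i by (simp add: u_def)
  next
    case False
    then have i': "Suc i = 2 * n" using i by simp
    have "v (Suc i) x = \<omega> * v 0 x" for x
      unfolding v_def i' sum_distrib_left by (rule sum.cong) (simp_all add: \<omega>(2))
    moreover have "(\<Sum>l<2 * n. \<rho> l ^ Suc i) / (2 * of_nat n * \<omega>) = 1"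
      unfolding i' \<omega>(2) using n \<omega>(1) by simp
    ultimately show ?thesis using vd[of i] i i' by (simp add: u_def)
  qed
  then have chain: "ac_chain (2 * n) u" by (simp add: ac_chain_def)
  have v0: "v 0 \<in> L2_halfline" unfolding v_def by (intro L2_sum L2_cmult g(1)) simp
  have f: "maximal_repr n (v 0) (\<lambda>x. z * v 0 x + h x) u"
    unfolding maximal_repr_def
  proof (intro conjI)
    show "(\<lambda>x. z * v 0 x + h x) \<in> L2_halfline" by (intro L2_add L2_cmult v0 h)
    show "AE x in halfline. v 0 x = u 0 x" using n by (simp add: u_def)
    show "u (2 * n) = (\<lambda>x. (-1) ^ n * (z * v 0 x + h x))"
      by (simp add: u_def fun_eq_iff \<omega>_def h'_def algebra_simps)
  qed (rule v0 chain)+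
  obtain c where c: "maximal_repr n (\<lambda>x. \<Sum>l<n. c l * exp (\<rho> l * of_real x)) (\<lambda>x. z * (\<Sum>l<n. c l * exp (\<rho> l * of_real x)))
      (\<lambda>k x. \<Sum>l<n. c l * (\<rho> l ^ k * exp (\<rho> l * of_real x)))"
    "\<And>i. i < n \<Longrightarrow> (\<Sum>l<n. c l * \<rho> l ^ i) = u i 0"
    by (rule exp_combination[of "\<lambda>i. u i 0"]) (rule that, assumption, blast)
  let ?f = "\<lambda>x. 1 * v 0 x + (-1) * (\<Sum>l<n. c l * exp (\<rho> l * of_real x))"
  note r = maximal_repr_lincomb[OF f c(1), of 1 "-1"]
  have "Gamma0 n ?f = 0\<^sub>v n"
    unfolding Gamma0_zero_iff[OF r] using c(2) by simp
  moreover have "(\<lambda>x. 1 * (z * v 0 x + h x) + (-1) * (z * (\<Sum>l<n. c l * exp (\<rho> l * of_real x)))) = (\<lambda>x. z * ?f x + h x)"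
    by (simp add: algebra_simps)
  ultimately have "(?f, \<lambda>x. z * ?f x + h x) \<in> dirichlet_operator n"
    unfolding dirichlet_operator_iff using maximal_repr_imp_op_adjoint[OF r] by simp
  then show thesis by (rule that)
qed

end

section \<open>Resolvent set, defect elements and the Weyl function\<close>

lemma dirichlet_symmetric:
  assumes "(f, f') \<in> dirichlet_operator n" "(g, g') \<in> dirichlet_operator n"
  shows "L2_inner f' g = L2_inner f g'"
proof -
  have "(g, g') \<in> op_adjoint (dirichlet_operator n)" using assms(2) op_adjoint_dirichlet by simp
  then show ?thesis using assms(1) by (auto simp: op_adjoint_def)
qed

lemma dirichlet_L2: "(f, f') \<in> dirichlet_operator n \<Longrightarrow> f \<in> L2_halfline \<and> f' \<in> L2_halfline"
  by (auto simp: dirichlet_operator_iff op_adjoint_def)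

text \<open>Symmetry makes (f', f) real, so the imaginary part of (f' - z f, f) is -Im z times the
  square norm of f; Cauchy-Schwarz bounds it from above.\<close>

lemma dirichlet_resolvent_bound:
  assumes f: "(f, f') \<in> dirichlet_operator n"
  shows "\<bar>Im z\<bar> * L2_norm f \<le> L2_norm (\<lambda>x. f' x - z * f x)"
proof -
  have L2: "f \<in> L2_halfline" "f' \<in> L2_halfline" using dirichlet_L2[OF f] by auto
  have "L2_inner f' f = cnj (L2_inner f' f)"
    using dirichlet_symmetric[OF f f] L2_inner_commute by metis
  then have "Im (L2_inner f' f) = - Im (L2_inner f' f)" by (metis cnj.simps(2))
  then have im: "Im (L2_inner f' f) = 0" by simp
  have "L2_inner (\<lambda>x. f' x - z * f x) f = L2_inner f' f - z * of_real ((L2_norm f)\<^sup>2)"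
    using L2 by (simp add: L2_inner_diff_left L2_cmult L2_inner_cmult_left L2_inner_self)
  then have "Im (L2_inner (\<lambda>x. f' x - z * f x) f) = - (Im z * (L2_norm f)\<^sup>2)"
    using im by (simp del: of_real_power)
  then have "\<bar>Im z\<bar> * (L2_norm f)\<^sup>2 \<le> cmod (L2_inner (\<lambda>x. f' x - z * f x) f)"
    using abs_Im_le_cmod[of "L2_inner (\<lambda>x. f' x - z * f x) f"] by (simp add: abs_mult)
  also have "\<dots> \<le> L2_norm (\<lambda>x. f' x - z * f x) * L2_norm f"
    by (rule L2_Cauchy_Schwarz) (intro L2 L2_diff L2_cmult)+
  finally have le: "\<bar>Im z\<bar> * L2_norm f * L2_norm f \<le> L2_norm (\<lambda>x. f' x - z * f x) * L2_norm f"
    by (simp add: power2_eq_square mult.assoc)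
  show ?thesis
  proof (cases "L2_norm f = 0")
    case False
    then have "L2_norm f > 0" using L2_norm_nonneg[of f] by simp
    then show ?thesis using le by (simp add: mult_le_cancel_right)
  qed (simp add: L2_norm_nonneg)
qed

lemma Gamma1_AE_zero:
  assumes "AE x in halfline. f x = 0"
  shows "Gamma1 n f = 0\<^sub>v n"
proof -
  have "derivs_of_repr k f (\<lambda>i x. 0)" for k
    unfolding derivs_of_repr_def using assms by simp
  then have "deriv_at_0 k f = 0" for k using deriv_at_0_eq by fastforce
  then show ?thesis by (auto simp: Gamma1_def intro!: eq_vecI)
qed

context characteristic_roots
begin

lemma in_resolvent_set: "z \<in> resolvent_set (dirichlet_operator n)"
  unfolding resolvent_set_def
proof (intro CollectI conjI ballI exI)
  fix h assume h: "h \<in> L2_halfline"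
  obtain f where f: "(f, \<lambda>x. z * f x + h x) \<in> dirichlet_operator n" using resolvent_exists[OF h] .
  show "\<exists>(f, g)\<in>dirichlet_operator n. AE x in halfline. g x - z * f x = h x"
    by (rule bexI[OF _ f]) simp
next
  fix p assume "p \<in> dirichlet_operator n"
  then show "case p of (f, g) \<Rightarrow> L2_norm f \<le> (1 / Im z) * L2_norm (\<lambda>x. g x - z * f x)"
    using dirichlet_resolvent_bound[of _ _ n z] Im_z by (auto simp: field_simps)
qed

text \<open>Two solutions of the eigenvalue equation with the same \<open>Gamma0\<close> differ by
  an eigenfunction of the Dirichlet operator, which for nonreal z is zero almost everywhere.\<close>

lemma defect_Gamma:
  assumes f: "(f, \<lambda>x. z * f x) \<in> op_adjoint (minimal_operator n)"
    and g: "(g, \<lambda>x. z * g x) \<in> op_adjoint (minimal_operator n)" and eq: "Gamma0 n f = Gamma0 n g"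
  shows "Gamma1 n f = Gamma1 n g"
proof -
  let ?d = "\<lambda>x. 1 * f x + (-1) * g x"
  note L = Gamma_lincomb[OF f g, of 1 "-1"]
  have "Gamma0 n ?d = 0\<^sub>v n" unfolding L(2) eq using Gamma_carrier[of n g] by (auto intro!: eq_vecI)
  then have d: "(?d, \<lambda>x. 1 * (z * f x) + (-1) * (z * g x)) \<in> dirichlet_operator n"
    using L(1) by (simp add: dirichlet_operator_iff)
  have "\<bar>Im z\<bar> * L2_norm ?d \<le> L2_norm (\<lambda>x. (1 * (z * f x) + (-1) * (z * g x)) - z * ?d x)"
    by (rule dirichlet_resolvent_bound[OF d])
  also have "\<dots> = 0" by (simp add: L2_norm_def algebra_simps)
  finally have "L2_norm ?d \<le> 0" using Im_z by (simp add: mult_le_0_iff)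
  then have "L2_norm ?d = 0" using L2_norm_nonneg[of ?d] by linarith
  then have "AE x in halfline. ?d x = 0"
    by (intro L2_norm_eq_0_imp_AE) (use dirichlet_L2[OF d] in auto)
  then have "Gamma1 n ?d = 0\<^sub>v n" by (rule Gamma1_AE_zero)
  then have 0: "1 \<cdot>\<^sub>v Gamma1 n f + (-1) \<cdot>\<^sub>v Gamma1 n g = 0\<^sub>v n" unfolding L(3) .
  show ?thesis
  proof (rule eq_vecI)
    fix i assume "i < dim_vec (Gamma1 n g)"
    then have i: "i < n" by (simp add: Gamma1_def)
    then have "(1 \<cdot>\<^sub>v Gamma1 n f + (-1) \<cdot>\<^sub>v Gamma1 n g) $ i = Gamma1 n f $ i - Gamma1 n g $ i"
      by (simp add: Gamma1_def)
    then show "Gamma1 n f $ i = Gamma1 n g $ i" using 0 i by simp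
  qed (simp add: Gamma1_def)
qed

text \<open>The coefficients are kept in the conclusion so that both boundary vectors can be
  compared exponential by exponential.\<close>

lemma defect_exists:
  assumes "v \<in> carrier_vec n"
  obtains c g where "(g, \<lambda>x. z * g x) \<in> op_adjoint (minimal_operator n)" "Gamma0 n g = v"
    "Gamma0 n g = vec n (\<lambda>k. \<Sum>l<n. c l * \<rho> l ^ (n - 1 - k))" "Gamma1 n g = vec n (\<lambda>j. (-1) ^ j * (\<Sum>l<n. c l * \<rho> l ^ (n + j)))"
proof -
  obtain c where c: "maximal_repr n (\<lambda>x. \<Sum>l<n. c l * exp (\<rho> l * of_real x)) (\<lambda>x. z * (\<Sum>l<n. c l * exp (\<rho> l * of_real x)))
      (\<lambda>k x. \<Sum>l<n. c l * (\<rho> l ^ k * exp (\<rho> l * of_real x)))"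
    "\<And>i. i < n \<Longrightarrow> (\<Sum>l<n. c l * \<rho> l ^ i) = v $ (n - 1 - i)"
    by (rule exp_combination[of "\<lambda>i. v $ (n - 1 - i)"]) (rule that, assumption, blast)
  note G = Gamma_maximal[OF c(1)]
  show thesis
  proof (rule that[OF maximal_repr_imp_op_adjoint[OF c(1)]])
    show "Gamma0 n (\<lambda>x. \<Sum>l<n. c l * exp (\<rho> l * of_real x)) = v"
      unfolding G using assms c(2) by (auto intro!: eq_vecI)
  qed (simp_all add: G)
qed

text \<open>On \<open>exp (\<rho> x)\<close> the entries of \<open>Gamma0\<close> are \<rho>^(n-1-k)
  and those of \<open>Gamma1\<close> are (-1)^j \<rho>^(n+j), so \<open>formula\<close> is the
  defining equation for each exponential. Their combinations reach every value of
  \<open>Gamma0\<close>, which gives the equation for all solutions and the uniqueness of M.\<close>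

lemma weyl_function_eq:
  assumes M: "M \<in> carrier_mat n n"
    and formula: "\<And>l j. l < n \<Longrightarrow> j < n \<Longrightarrow> (\<Sum>k<n. M $$ (j, k) * \<rho> l ^ (n - 1 - k)) = (-1) ^ j * \<rho> l ^ (n + j)"
  shows "weyl_function (minimal_operator n) n (Gamma0 n) (Gamma1 n) z = M"
    "\<And>f. (f, \<lambda>x. z * f x) \<in> op_adjoint (minimal_operator n) \<Longrightarrow> Gamma1 n f = M *\<^sub>v Gamma0 n f"
proof -
  have MG: "Gamma1 n g = M *\<^sub>v Gamma0 n g"
    if "Gamma0 n g = vec n (\<lambda>k. \<Sum>l<n. c l * \<rho> l ^ (n - 1 - k))" "Gamma1 n g = vec n (\<lambda>j. (-1) ^ j * (\<Sum>l<n. c l * \<rho> l ^ (n + j)))" for g c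
  proof (rule eq_vecI)
    fix j assume "j < dim_vec (M *\<^sub>v Gamma0 n g)"
    then have j: "j < n" using M by simp
    have "(M *\<^sub>v Gamma0 n g) $ j = (\<Sum>k<n. M $$ (j, k) * (\<Sum>l<n. c l * \<rho> l ^ (n - 1 - k)))"
      using M j unfolding that(1) by (simp add: scalar_prod_def lessThan_atLeast0)
    also have "\<dots> = (\<Sum>l<n. \<Sum>k<n. c l * (M $$ (j, k) * \<rho> l ^ (n - 1 - k)))"
      unfolding sum_distrib_left by (subst sum.swap) (simp add: mult_ac)
    also have "\<dots> = (\<Sum>l<n. c l * ((-1) ^ j * \<rho> l ^ (n + j)))"
      unfolding sum_distrib_left[symmetric] using formula j by simp
    also have "\<dots> = Gamma1 n g $ j" unfolding that(2) using j by (simp add: sum_distrib_left mult_ac)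
    finally show "Gamma1 n g $ j = (M *\<^sub>v Gamma0 n g) $ j" ..
  qed (use M in \<open>simp add: Gamma1_def\<close>)
  show all: "Gamma1 n f = M *\<^sub>v Gamma0 n f" if f: "(f, \<lambda>x. z * f x) \<in> op_adjoint (minimal_operator n)" for f
  proof -
    obtain c g where g: "(g, \<lambda>x. z * g x) \<in> op_adjoint (minimal_operator n)" "Gamma0 n g = Gamma0 n f"
      "Gamma0 n g = vec n (\<lambda>k. \<Sum>l<n. c l * \<rho> l ^ (n - 1 - k))" "Gamma1 n g = vec n (\<lambda>j. (-1) ^ j * (\<Sum>l<n. c l * \<rho> l ^ (n + j)))"
      by (rule defect_exists[OF Gamma_carrier(1)[of n f]]) (rule that)
    show ?thesis using MG[OF g(3,4)] defect_Gamma[OF f g(1) g(2)[symmetric]] g(2) by simp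
  qed
  have "(THE M. M \<in> carrier_mat n n \<and> (\<forall>f. (f, \<lambda>x. z * f x) \<in> op_adjoint (minimal_operator n) \<longrightarrow> Gamma1 n f = M *\<^sub>v Gamma0 n f)) = M"
  proof (rule the_equality)
    show "M \<in> carrier_mat n n \<and> (\<forall>f. (f, \<lambda>x. z * f x) \<in> op_adjoint (minimal_operator n) \<longrightarrow> Gamma1 n f = M *\<^sub>v Gamma0 n f)"
      using M all by blast
    fix M' assume M': "M' \<in> carrier_mat n n \<and> (\<forall>f. (f, \<lambda>x. z * f x) \<in> op_adjoint (minimal_operator n) \<longrightarrow> Gamma1 n f = M' *\<^sub>v Gamma0 n f)"
    have eq: "M' *\<^sub>v v = M *\<^sub>v v" if "v \<in> carrier_vec n" for v
      by (rule defect_exists[OF that]) (use M' all in metis)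
    show "M' = M"
    proof (rule eq_matI)
      fix i j assume "i < dim_row M" "j < dim_col M"
      then have ij: "i < n" "j < n" using M by auto
      then have "(M' *\<^sub>v unit_vec n j) $ i = (M *\<^sub>v unit_vec n j) $ i" by (simp add: eq)
      then show "M' $$ (i, j) = M $$ (i, j)" using ij M conjunct1[OF M'] by simp
    qed (use M M' in auto)
  qed
  moreover have "z \<in> resolvent_set (op_restrict (op_adjoint (minimal_operator n)) {f. Gamma0 n f = 0\<^sub>v n})"
    using in_resolvent_set unfolding dirichlet_operator_def .
  ultimately show "weyl_function (minimal_operator n) n (Gamma0 n) (Gamma1 n) z = M"
    unfolding weyl_function_def by simp
qed

end

section \<open>The characteristic matrix\<close>

text \<open>The roots start from -w, with w the chosen root of -z, and advance by the angle 2
  \<alpha> = pi/n. For s < n the offsets are symmetric about -w; s and s + n give opposite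
  roots.\<close>

definition char_root :: "nat \<Rightarrow> complex \<Rightarrow> nat \<Rightarrow> complex" where
  "char_root n w s = - w * cis (alpha n * (2 * real s - (real n - 1)))"

lemma char_root_geometric: "n > 0 \<Longrightarrow> char_root n w s = char_root n w 0 * cis (pi / real n) ^ s"
  by (simp add: char_root_def Complex.DeMoivre cis_mult alpha_def field_simps)

text \<open>The angle of w lies in (-\<alpha>, 0) and the offset is at most (n - 1) \<alpha> in
  absolute value; together this is less than n \<alpha> = pi/2.\<close>

lemma Re_char_root_neg:
  assumes n: "n > 0" and R: "R > 0" and \<phi>: "0 < \<phi>" "\<phi> < pi" and s: "s < n"
  shows "Re (char_root n (rcis R ((\<phi> - pi) / (2 * real n))) s) < 0"
proof -
  define \<beta> where "\<beta> = (\<phi> - pi) / (2 * real n) + alpha n * (2 * real s - (real n - 1))"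
  have "real s + 1 \<le> real n" using s by simp
  then have "\<bar>\<phi> - pi + pi * (2 * real s - (real n - 1))\<bar> < pi * real n"
  proof -
    assume le: "real s + 1 \<le> real n"
    have "pi * (2 * real s - (real n - 1)) \<le> pi * (real n - 1)" "- (pi * (real n - 1)) \<le> pi * (2 * real s - (real n - 1))"
      unfolding mult_minus_right[symmetric] using le by (intro mult_left_mono; simp)+
    then show ?thesis using \<phi> unfolding abs_less_iff right_diff_distrib by linarith
  qed
  moreover have "\<beta> = (\<phi> - pi + pi * (2 * real s - (real n - 1))) / (2 * real n)"
    using n by (simp add: \<beta>_def alpha_def add_divide_distrib)
  moreover have "\<bar>a / (2 * real n)\<bar> < (pi * real n) / (2 * real n)" if "\<bar>a\<bar> < pi * real n" for a
    using divide_strict_right_mono[OF that, of "2 * real n"] n by (simp add: abs_divide)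
  ultimately have "\<bar>\<beta>\<bar> < (pi * real n) / (2 * real n)" by metis
  then have "\<bar>\<beta>\<bar> < pi / 2" using n by simp
  then have "cos \<beta> > 0" by (intro cos_gt_zero_pi) auto
  moreover have "char_root n (rcis R ((\<phi> - pi) / (2 * real n))) s = - rcis R \<beta>"
    by (simp add: char_root_def \<beta>_def cis_rcis_eq rcis_mult)
  ultimately show ?thesis using R by simp
qed

lemma char_root_add: "n > 0 \<Longrightarrow> char_root n w (s + n) = - char_root n w s"
  by (subst (1 2) char_root_geometric) (simp_all add: power_add cis_pi_div_power)

lemma char_root_power:
  assumes n: "n > 0" and w: "w ^ (2 * n) = - z"
  shows "char_root n w s ^ (2 * n) = (-1) ^ n * z"
proof -
  let ?t = "alpha n * (2 * real s - (real n - 1))"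
  have "cis ?t ^ (2 * n) = cis (real (2 * n) * ?t)" by (rule Complex.DeMoivre)
  \<comment> \<open>Adding n full turns makes the angle a natural multiple of pi.\<close>
  also have "\<dots> = cis (real (2 * n) * ?t) * cis (2 * pi * real n)" by simp
  also have "\<dots> = cis (real (2 * n) * ?t + 2 * pi * real n)" by (rule cis_mult)
  also have "real (2 * n) * ?t + 2 * pi * real n = real (2 * s + n + 1) * pi"
    using n by (simp add: alpha_def field_simps)
  also have "cis (real (2 * s + n + 1) * pi) = cis pi ^ (2 * s + n + 1)" by (rule Complex.DeMoivre[symmetric])
  also have "\<dots> = - ((-1) ^ n)" by (simp add: power_add power_mult)
  finally have c: "cis ?t ^ (2 * n) = - ((-1) ^ n)" .
  have "char_root n w s ^ (2 * n) = (- 1) ^ (2 * n) * (w ^ (2 * n) * cis ?t ^ (2 * n))"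
    unfolding char_root_def power_mult_distrib[symmetric] by simp
  also have "\<dots> = (-1) ^ n * z" unfolding w c by (simp add: power_mult)
  finally show ?thesis .
qed

lemma characteristic_roots_char_root:
  assumes n: "n \<ge> 1" and r: "r > 0" and \<phi>: "0 < \<phi>" "\<phi> < pi"
  shows "characteristic_roots n (rcis r \<phi>) (char_root n (rcis (root (2 * n) r) ((\<phi> - pi) / (2 * real n))))"
proof
  let ?w = "rcis (root (2 * n) r) ((\<phi> - pi) / (2 * real n))"
  let ?q = "cis (pi / real n)"
  have n0: "n > 0" using n by simp
  have R: "root (2 * n) r > 0" using r n0 by simp
  have neg: "Re (char_root n ?w s) < 0" if "s < n" for s
    by (rule Re_char_root_neg[OF n0 R \<phi> that])
  show "Im (rcis r \<phi>) > 0" using r \<phi> by (simp add: sin_gt_zero)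
  have "?w ^ (2 * n) = rcis (root (2 * n) r ^ (2 * n)) (real (2 * n) * ((\<phi> - pi) / (2 * real n)))" by (rule DeMoivre2)
  also have "\<dots> = rcis r (\<phi> - pi)" using n0 r by simp
  also have "\<dots> = - rcis r \<phi>" by (simp add: complex_eq_iff cos_diff sin_diff)
  finally have w: "?w ^ (2 * n) = - rcis r \<phi>" .
  show "char_root n ?w l ^ (2 * n) = (-1) ^ n * rcis r \<phi>" for l
    by (rule char_root_power[OF n0 w])
  show "Re (char_root n ?w l) \<noteq> 0" if "l < 2 * n" for l
  proof (cases "l < n")
    case False
    then obtain s where s: "l = s + n" by (metis add.commute le_Suc_ex not_less)
    then show ?thesis using neg[of s] that by (simp add: char_root_add[OF n0])
  qed (use neg[of l] in simp)
  have A: "char_root n ?w 0 \<noteq> 0" using neg[of 0] n0 by auto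
  show "inj_on (char_root n ?w) {..<n}"
  proof -
    have "s = t" if "s \<le> t" "t < n" "char_root n ?w s = char_root n ?w t" for s t
    proof (rule ccontr)
      assume "s \<noteq> t"
      have "?q ^ t = ?q ^ s"
        using that(3) A unfolding char_root_geometric[OF n0, of ?w s] char_root_geometric[OF n0, of ?w t] by simp
      moreover have "?q ^ t = ?q ^ s * ?q ^ (t - s)" by (metis that(1) le_add_diff_inverse power_add)
      moreover have "?q ^ s \<noteq> 0" by simp
      ultimately have "?q ^ (t - s) = 1" by simp
      then show False using cis_pi_div_power_ne_1[of "t - s" n] that(1,2) \<open>s \<noteq> t\<close> by simp
    qed
    then show ?thesis by (intro inj_onI) (metis lessThan_iff linear)
  qed
  \<comment> \<open>A geometric sum with ratio q^i different from 1 and (q^i)^(2n) = 1.\<close>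
  show "(\<Sum>l<2 * n. char_root n ?w l ^ i) = 0" if i: "0 < i" "i < 2 * n" for i
  proof -
    have "(\<Sum>l<2 * n. char_root n ?w l ^ i) = (\<Sum>l<2 * n. char_root n ?w 0 ^ i * (?q ^ i) ^ l)"
      by (rule sum.cong[OF refl], subst char_root_geometric[OF n0])
        (simp add: power_mult_distrib mult.commute flip: power_mult)
    also have "\<dots> = char_root n ?w 0 ^ i * (\<Sum>l<2 * n. (?q ^ i) ^ l)" by (simp add: sum_distrib_left)
    also have "(\<Sum>l<2 * n. (?q ^ i) ^ l) = ((?q ^ i) ^ (2 * n) - 1) / (?q ^ i - 1)"
      by (rule geometric_sum) (rule cis_pi_div_power_ne_1[OF i])
    also have "(?q ^ i) ^ (2 * n) = ((?q ^ n) ^ 2) ^ i" by (simp add: mult_ac flip: power_mult)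
    also have "\<dots> = 1" using n0 by (simp add: cis_pi_div_power)
    finally show ?thesis by simp
  qed
  show "n \<ge> 1" by (rule n)
  show "Re (char_root n ?w l) < 0" if "l < n" for l by (rule neg[OF that])
qed

text \<open>By w = -\<rho> cis (-\<alpha> m) every term on the left contains the same power
  \<rho>^(n+j); the remaining factor is \<open>cot_prod_identity\<close>.\<close>

lemma char_root_identity:
  assumes l: "l < n" and j: "j < n"
  shows "(\<Sum>k<n. complex_of_real (- cot_prod n j * cot_prod n k / sin (real (j + k + 1) * alpha n)) * w ^ (j + k + 1) *
      char_root n w l ^ (n - 1 - k)) = (-1) ^ j * char_root n w l ^ (n + j)"
proof -
  let ?m = "2 * real l - (real n - 1)"
  let ?\<rho> = "char_root n w l"
  have "w = - (?\<rho> * cis (- (alpha n * ?m)))" by (simp add: char_root_def mult.assoc cis_mult)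
  then have w: "w ^ N = (-1) ^ N * (?\<rho> ^ N * cis (- (alpha n * ?m)) ^ N)" for N
    by (metis power_minus power_mult_distrib)
  have "(\<Sum>k<n. complex_of_real (- cot_prod n j * cot_prod n k / sin (real (j + k + 1) * alpha n)) * w ^ (j + k + 1) * ?\<rho> ^ (n - 1 - k)) =
     (\<Sum>k<n. (-1) ^ j * ?\<rho> ^ (n + j) * ((-1) ^ k * of_real (cot_prod n j * cot_prod n k / sin (real (j + k + 1) * alpha n)) *
       cis (- (alpha n * ?m)) ^ (j + k + 1)))"
  proof (rule sum.cong[OF refl])
    fix k assume "k \<in> {..<n}"
    then have "j + k + 1 + (n - 1 - k) = n + j" by simp
    then have p: "?\<rho> ^ (n + j) = ?\<rho> ^ (j + k + 1) * ?\<rho> ^ (n - 1 - k)" by (metis power_add)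
    have s: "(-1) ^ (j + k + 1) = - ((-1) ^ j * (-1) ^ k :: complex)" by (simp add: power_add)
    have m: "complex_of_real (- cot_prod n j * cot_prod n k / sin (real (j + k + 1) * alpha n)) =
        - of_real (cot_prod n j * cot_prod n k / sin (real (j + k + 1) * alpha n))" by simp
    show "complex_of_real (- cot_prod n j * cot_prod n k / sin (real (j + k + 1) * alpha n)) * w ^ (j + k + 1) * ?\<rho> ^ (n - 1 - k) =
      (-1) ^ j * ?\<rho> ^ (n + j) * ((-1) ^ k * of_real (cot_prod n j * cot_prod n k / sin (real (j + k + 1) * alpha n)) *
       cis (- (alpha n * ?m)) ^ (j + k + 1))"
      unfolding w p s m by (simp only: mult_minus_left mult_minus_right minus_minus mult_ac)
  qed
  also have "\<dots> = (-1) ^ j * ?\<rho> ^ (n + j)"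
    unfolding sum_distrib_left[symmetric] cot_prod_identity[OF j l] by simp
  finally show ?thesis .
qed

definition char_matrix :: "nat \<Rightarrow> complex \<Rightarrow> complex mat" where
  "char_matrix n w = mat n n (\<lambda>(j, k).
     complex_of_real (- cot_prod n j * cot_prod n k / sin (real (j + k + 1) * alpha n)) * w ^ (j + k + 1))"

text \<open>The second claim supplies solutions with arbitrary \<open>Gamma0\<close>; their norms
  appear in the imaginary part of the Weyl function.\<close>

lemma weyl_function_rcis:
  assumes n: "n \<ge> 1" and r: "r > 0" and \<phi>: "0 < \<phi>" "\<phi> < pi"
  defines "w \<equiv> rcis (root (2 * n) r) ((\<phi> - pi) / (2 * real n))"
  shows "weyl_function (minimal_operator n) n (Gamma0 n) (Gamma1 n) (rcis r \<phi>) = char_matrix n w"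
    "v \<in> carrier_vec n \<Longrightarrow> \<exists>g. (g, \<lambda>x. rcis r \<phi> * g x) \<in> op_adjoint (minimal_operator n) \<and>
       Gamma0 n g = v \<and> Gamma1 n g = char_matrix n w *\<^sub>v v"
proof -
  interpret characteristic_roots n "rcis r \<phi>" "char_root n w"
    unfolding w_def by (rule characteristic_roots_char_root[OF n r \<phi>])
  have M: "char_matrix n w \<in> carrier_mat n n" by (simp add: char_matrix_def)
  have formula: "(\<Sum>k<n. char_matrix n w $$ (j, k) * char_root n w l ^ (n - 1 - k)) = (-1) ^ j * char_root n w l ^ (n + j)"
    if "l < n" "j < n" for l j
    using char_root_identity[OF that, of w] that by (simp add: char_matrix_def)
  show "weyl_function (minimal_operator n) n (Gamma0 n) (Gamma1 n) (rcis r \<phi>) = char_matrix n w"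
    by (rule weyl_function_eq(1)[OF M formula])
  assume v: "v \<in> carrier_vec n"
  show "\<exists>g. (g, \<lambda>x. rcis r \<phi> * g x) \<in> op_adjoint (minimal_operator n) \<and> Gamma0 n g = v \<and> Gamma1 n g = char_matrix n w *\<^sub>v v"
  proof (rule defect_exists[OF v])
    fix c g assume g: "(g, \<lambda>x. rcis r \<phi> * g x) \<in> op_adjoint (minimal_operator n)" "Gamma0 n g = v"
    then show ?thesis using weyl_function_eq(2)[OF M formula g(1)] by (intro exI[of _ g]) simp
  qed
qed

text \<open>The argument \<phi> - pi of -z lies in (-pi, 0), so the prescribed root is the principal
  branch. In this form holomorphy is visible, and it is the form delivered by the Stieltjes
  transform.\<close>

lemma rcis_eq_powr:
  assumes n: "n \<ge> 1" and r: "r > 0" and \<phi>: "0 < \<phi>" "\<phi> < pi"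
  shows "rcis (root (2 * n) r) ((\<phi> - pi) / (2 * real n)) ^ N = (- rcis r \<phi>) powr of_real (real N / (2 * real n))"
proof -
  have "- rcis r \<phi> = rcis r (\<phi> - pi)" by (simp add: complex_eq_iff cos_diff sin_diff)
  also have "\<dots> = exp (of_real (ln r) + \<i> * of_real (\<phi> - pi))"
    using r by (simp add: rcis_def cis_conv_exp exp_add exp_of_real)
  finally have e: "- rcis r \<phi> = exp (of_real (ln r) + \<i> * of_real (\<phi> - pi))" .
  have Ln: "Ln (- rcis r \<phi>) = of_real (ln r) + \<i> * of_real (\<phi> - pi)"
    unfolding e by (rule Ln_exp) (use \<phi> in auto)
  have nz: "- rcis r \<phi> \<noteq> 0" using r by simp
  have "(- rcis r \<phi>) powr of_real (real N / (2 * real n)) =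
      exp (of_real (real N / (2 * real n)) * (of_real (ln r) + \<i> * of_real (\<phi> - pi)))"
    using nz by (simp add: powr_def Ln)
  also have "\<dots> = exp (of_nat N * (of_real (ln r / (2 * real n)) + \<i> * of_real ((\<phi> - pi) / (2 * real n))))"
    using n by (simp add: field_simps)
  also have "\<dots> = exp (of_real (ln r / (2 * real n)) + \<i> * of_real ((\<phi> - pi) / (2 * real n))) ^ N"
    by (rule exp_of_nat_mult)
  also have "exp (of_real (ln r / (2 * real n)) + \<i> * of_real ((\<phi> - pi) / (2 * real n))) = rcis (root (2 * n) r) ((\<phi> - pi) / (2 * real n))"
  proof -
    have "root (2 * n) r = exp (ln r / (2 * real n))"
      using r n by (simp add: root_powr_inverse powr_def field_simps)
    then show ?thesis by (simp add: rcis_def cis_conv_exp exp_add exp_of_real del: of_real_divide)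
  qed
  finally show ?thesis ..
qed

lemma upper_half_plane_rcis:
  assumes "Im z > 0"
  obtains r \<phi> where "z = rcis r \<phi>" "r > 0" "0 < \<phi>" "\<phi> < pi"
proof -
  have "z = rcis (cmod z) (Arg2pi z)" using Arg2pi_eq[of z] by (simp add: rcis_def cis_conv_exp)
  moreover have "cmod z > 0" using assms by auto
  moreover have "0 < Arg2pi z" "Arg2pi z < pi" using Arg2pi_lt_pi[of z] assms by auto
  ultimately show thesis by (rule that)
qed

lemma weyl_function_powr:
  assumes n: "n \<ge> 1" and z: "Im z > 0"
  shows "weyl_function (minimal_operator n) n (Gamma0 n) (Gamma1 n) z = mat n n (\<lambda>(j, k).
      complex_of_real (- cot_prod n j * cot_prod n k / sin (real (j + k + 1) * alpha n)) * (- z) powr of_real (real (j + k + 1) / (2 * real n)))"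
proof -
  obtain r \<phi> where r: "z = rcis r \<phi>" "r > 0" "0 < \<phi>" "\<phi> < pi" using upper_half_plane_rcis[OF z] .
  show ?thesis
    unfolding r(1) weyl_function_rcis(1)[OF n r(2-4)] char_matrix_def
    by (rule cong_mat) (simp_all only: rcis_eq_powr[OF n r(2-4)] case_prod_conv)
qed

section \<open>The Weyl function as an R-function\<close>

lemma mat_adjoint_index: "A \<in> carrier_mat n n \<Longrightarrow> i < n \<Longrightarrow> j < n \<Longrightarrow> mat_adjoint A $$ (i, j) = cnj (A $$ (j, i))"
  by (auto simp: mat_adjoint_def mat_of_rows_index conjugate_complex_def)

lemma mat_adjoint_carrier: "A \<in> carrier_mat n n \<Longrightarrow> mat_adjoint A \<in> carrier_mat n n"
  by (auto simp: mat_adjoint_def)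

lemma cscalar_prod_mult_mat_vec:
  fixes A :: "complex mat"
  assumes "A \<in> carrier_mat n n" "u \<in> carrier_vec n" "v \<in> carrier_vec n"
  shows "(A *\<^sub>v u) \<bullet>c v = (\<Sum>i<n. \<Sum>j<n. A $$ (i, j) * u $ j * cnj (v $ i))"
  using assms by (auto simp: scalar_prod_def lessThan_atLeast0 sum_distrib_right conjugate_complex_def intro!: sum.cong)

lemma cscalar_prod_mat_adjoint:
  fixes A :: "complex mat"
  assumes "A \<in> carrier_mat n n" "u \<in> carrier_vec n" "v \<in> carrier_vec n"
  shows "(mat_adjoint A *\<^sub>v u) \<bullet>c v = u \<bullet>c (A *\<^sub>v v)"
proof -
  have "(mat_adjoint A *\<^sub>v u) \<bullet>c v = (\<Sum>i<n. \<Sum>j<n. cnj (A $$ (j, i)) * u $ j * cnj (v $ i))"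
    unfolding cscalar_prod_mult_mat_vec[OF mat_adjoint_carrier[OF assms(1)] assms(2,3)]
    by (intro sum.cong refl) (simp add: mat_adjoint_index[OF assms(1)])
  also have "\<dots> = (\<Sum>j<n. \<Sum>i<n. cnj (A $$ (j, i)) * u $ j * cnj (v $ i))" by (rule sum.swap)
  also have "\<dots> = u \<bullet>c (A *\<^sub>v v)"
    using assms by (auto simp: scalar_prod_def lessThan_atLeast0 conjugate_complex_def sum_distrib_left mult_ac intro!: sum.cong)
  finally show ?thesis .
qed

text \<open>For a solution g with \<open>Gamma0\<close> of g equal to v, Green's formula reads (M v,
  v) - (v, M v) = 2 i Im z times the square norm of g. Holomorphy holds because -z stays off the cut
  of the principal power.\<close>

lemma R_function_weyl:
  assumes n: "n \<ge> 1"
  shows "R_function n (weyl_function (minimal_operator n) n (Gamma0 n) (Gamma1 n))"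
proof -
  let ?M = "weyl_function (minimal_operator n) n (Gamma0 n) (Gamma1 n)"
  have carrier: "?M z \<in> carrier_mat n n" if "Im z > 0" for z
    unfolding weyl_function_powr[OF n that] by simp
  have "nonneg_mat n ((1 / (2 * \<i>)) \<cdot>\<^sub>m (?M z - mat_adjoint (?M z)))" if z: "Im z > 0" for z
    unfolding nonneg_mat_def
  proof (intro conjI ballI)
    note M = carrier[OF z]
    note M' = mat_adjoint_carrier[OF M]
    show "(1 / (2 * \<i>)) \<cdot>\<^sub>m (?M z - mat_adjoint (?M z)) \<in> carrier_mat n n"
      using M M' by (intro smult_carrier_mat minus_carrier_mat)
    fix v :: "complex vec" assume v: "v \<in> carrier_vec n"
    obtain r \<phi> where r: "z = rcis r \<phi>" "r > 0" "0 < \<phi>" "\<phi> < pi" using upper_half_plane_rcis[OF z] .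
    obtain g where g: "(g, \<lambda>x. z * g x) \<in> op_adjoint (minimal_operator n)" "Gamma0 n g = v" "Gamma1 n g = ?M z *\<^sub>v v"
      using weyl_function_rcis(2)[OF n r(2-4) v] weyl_function_rcis(1)[OF n r(2-4)] unfolding r(1) by auto
    have "(?M z *\<^sub>v v) \<bullet>c v - v \<bullet>c (?M z *\<^sub>v v) = L2_inner (\<lambda>x. z * g x) g - L2_inner g (\<lambda>x. z * g x)"
      using Green_Gamma[OF g(1) g(1)] g(2,3) by simp
    also have "\<dots> = (z - cnj z) * of_real ((L2_norm g)\<^sup>2)"
      by (simp add: L2_inner_cmult_left L2_inner_cmult_right L2_inner_self algebra_simps)
    also have "z - cnj z = 2 * \<i> * of_real (Im z)" by (simp add: complex_eq_iff)
    finally have eq: "(?M z *\<^sub>v v) \<bullet>c v - v \<bullet>c (?M z *\<^sub>v v) = 2 * \<i> * of_real (Im z * (L2_norm g)\<^sup>2)" by simp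
    have "(((1 / (2 * \<i>)) \<cdot>\<^sub>m (?M z - mat_adjoint (?M z))) *\<^sub>v v) \<bullet>c v =
        (\<Sum>i<n. \<Sum>j<n. (1 / (2 * \<i>)) * (?M z $$ (i, j) * v $ j * cnj (v $ i) - mat_adjoint (?M z) $$ (i, j) * v $ j * cnj (v $ i)))"
      using M M' v by (subst cscalar_prod_mult_mat_vec) (auto simp: algebra_simps intro!: sum.cong)
    also have "\<dots> = (1 / (2 * \<i>)) * ((?M z *\<^sub>v v) \<bullet>c v - (mat_adjoint (?M z) *\<^sub>v v) \<bullet>c v)"
      unfolding cscalar_prod_mult_mat_vec[OF M v v] cscalar_prod_mult_mat_vec[OF M' v v]
      by (simp only: sum_subtractf flip: sum_distrib_left)
    also have "\<dots> = (1 / (2 * \<i>)) * (2 * \<i> * of_real (Im z * (L2_norm g)\<^sup>2))"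
      unfolding cscalar_prod_mat_adjoint[OF M v v] eq ..
    also have "\<dots> = of_real (Im z * (L2_norm g)\<^sup>2)" by simp
    finally show "0 \<le> (((1 / (2 * \<i>)) \<cdot>\<^sub>m (?M z - mat_adjoint (?M z))) *\<^sub>v v) \<bullet>c v"
      using z by (simp add: less_eq_complex_def del: of_real_power)
  qed
  moreover have "(\<lambda>z. ?M z $$ (j, k)) holomorphic_on {z. Im z > 0}" if jk: "j < n" "k < n" for j k
  proof (rule holomorphic_transform)
    have "- z \<notin> \<real>\<^sub>\<le>\<^sub>0" if "Im z > 0" for z using that by (auto simp: complex_nonpos_Reals_iff)
    then show "(\<lambda>z. complex_of_real (- cot_prod n j * cot_prod n k / sin (real (j + k + 1) * alpha n)) *
        (- z) powr of_real (real (j + k + 1) / (2 * real n))) holomorphic_on {z. Im z > 0}"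
      by (intro holomorphic_intros) auto
    show "complex_of_real (- cot_prod n j * cot_prod n k / sin (real (j + k + 1) * alpha n)) *
        (- z) powr of_real (real (j + k + 1) / (2 * real n)) = ?M z $$ (j, k)" if "z \<in> {z. Im z > 0}" for z
      using that jk by (simp add: weyl_function_powr[OF n])
  qed
  ultimately show ?thesis
    unfolding R_function_def using carrier by blast
qed

section \<open>Riemann--Stieltjes integrals with respect to a continuous density\<close>

text \<open>On a piece K of a fine division f is close to its value at the tag, while the increment
  of s is the integral of d over K; the error is at most \<epsilon>' B times the length of
  K.\<close>

lemma has_RS_integral_density:
  assumes ab: "a \<le> b" and f: "continuous_on {a..b} f" and d: "continuous_on {a..b} d"
    and s: "\<And>x y. a \<le> x \<Longrightarrow> x \<le> y \<Longrightarrow> y \<le> b \<Longrightarrow> (d has_integral (s y - s x)) {x..y}"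
  shows "has_RS_integral f s (integral {a..b} (\<lambda>x. f x * d x)) a b"
  unfolding has_RS_integral_def
proof (intro allI impI)
  fix \<epsilon> :: real assume e: "\<epsilon> > 0"
  obtain B where B: "B > 0" "\<And>x. x \<in> {a..b} \<Longrightarrow> cmod (d x) \<le> B"
    using continuous_on_norm_bound_Icc[OF d] by blast
  \<comment> \<open>The summand 1 keeps the denominator positive for a = b and makes the final
    inequality strict.\<close>
  define \<epsilon>' where "\<epsilon>' = \<epsilon> / (B * (b - a) + 1)"
  have pos: "B * (b - a) + 1 > 0" using B ab by (simp add: add_nonneg_pos)
  have e': "\<epsilon>' > 0" using e pos by (simp add: \<epsilon>'_def)
  have "uniformly_continuous_on {a..b} f" using f by (intro compact_uniformly_continuous) auto
  then obtain \<delta> where \<delta>: "\<delta> > 0" "\<And>x y. x \<in> {a..b} \<Longrightarrow> y \<in> {a..b} \<Longrightarrow> dist y x < \<delta> \<Longrightarrow> dist (f y) (f x) < \<epsilon>'"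
    using e' unfolding uniformly_continuous_on_def by metis
  have fd: "(\<lambda>x. f x * d x) integrable_on {a..b}" by (intro integrable_continuous_real continuous_intros f d)
  show "\<exists>\<delta>>0. \<forall>p. p tagged_division_of {a..b} \<and> (\<lambda>x. ball x \<delta>) fine p \<longrightarrow>
      cmod ((\<Sum>(x, K)\<in>p. f x * (s (Sup K) - s (Inf K))) - integral {a..b} (\<lambda>x. f x * d x)) < \<epsilon>"
  proof (intro exI[of _ \<delta>] conjI \<delta>(1) allI impI)
    fix p assume "p tagged_division_of {a..b} \<and> (\<lambda>x. ball x \<delta>) fine p"
    then have p: "p tagged_division_of {a..b}" and fine: "(\<lambda>x. ball x \<delta>) fine p" by auto
    have "integral {a..b} (\<lambda>x. f x * d x) = (\<Sum>(x, K)\<in>p. integral K (\<lambda>x. f x * d x))"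
      using integral_combine_tagged_division_topdown[of "\<lambda>x. f x * d x" a b p] fd p by (simp add: cbox_interval)
    then have "(\<Sum>(x, K)\<in>p. f x * (s (Sup K) - s (Inf K))) - integral {a..b} (\<lambda>x. f x * d x) =
        (\<Sum>(x, K)\<in>p. f x * (s (Sup K) - s (Inf K)) - integral K (\<lambda>x. f x * d x))"
      by (simp add: sum_subtractf case_prod_unfold)
    also have "cmod \<dots> \<le> (\<Sum>(x, K)\<in>p. \<epsilon>' * B * measure lborel K)"
    proof (rule sum_norm_le, clarify)
      fix x K assume xK: "(x, K) \<in> p"
      have sub: "x \<in> K" "K \<subseteq> {a..b}" using tagged_division_ofD(2,3)[OF p xK] by auto
      obtain c e where K: "K = cbox c e" using tagged_division_ofD(4)[OF p xK] by blast
      have ce: "c \<le> e" "a \<le> c" "e \<le> b" using sub K by (auto simp: cbox_interval)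
      have Kd: "(d has_integral (s e - s c)) {c..e}" by (rule s) (use ce in auto)
      have ball: "K \<subseteq> ball x \<delta>" using fine xK by (auto simp: fine_def)
      have close: "cmod (f x - f t) \<le> \<epsilon>'" if "t \<in> {c..e}" for t
        using \<delta>(2)[of t x] that ball K sub by (auto simp: cbox_interval dist_norm norm_minus_commute subset_iff intro: less_imp_le)
      have "f x * (s (Sup K) - s (Inf K)) - integral K (\<lambda>x. f x * d x) = integral {c..e} (\<lambda>t. f x * d t) - integral {c..e} (\<lambda>t. f t * d t)"
        using ce K Kd by (simp add: cbox_interval integral_unique)
      also have "\<dots> = integral {c..e} (\<lambda>t. f x * d t - f t * d t)"
      proof (rule Henstock_Kurzweil_Integration.integral_diff[symmetric])
        show "(\<lambda>t. f x * d t) integrable_on {c..e}" using Kd by (intro integrable_on_mult_right) auto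
        show "(\<lambda>t. f t * d t) integrable_on {c..e}" by (rule integrable_on_subinterval[OF fd]) (use ce in auto)
      qed
      also have "cmod \<dots> \<le> integral {c..e} (\<lambda>t. \<epsilon>' * B)"
      proof (rule integral_norm_bound_integral)
        show "(\<lambda>t. f x * d t - f t * d t) integrable_on {c..e}"
          using Kd by (intro integrable_diff integrable_on_mult_right integrable_on_subinterval[OF fd]) (use ce in auto)
        show "cmod (f x * d t - f t * d t) \<le> \<epsilon>' * B" if "t \<in> {c..e}" for t
          unfolding left_diff_distrib[symmetric] norm_mult using close[OF that] B(2)[of t] that ce e'
          by (intro mult_mono) auto
      qed auto
      also have "\<dots> = \<epsilon>' * B * measure lborel K" using ce K by (simp add: cbox_interval mult.commute)
      finally show "cmod (f x * (s (Sup K) - s (Inf K)) - integral K (\<lambda>x. f x * d x)) \<le> \<epsilon>' * B * measure lborel K" .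
    qed
    also have "\<dots> = \<epsilon>' * B * (\<Sum>(x, K)\<in>p. measure lborel K)" by (simp add: sum_distrib_left case_prod_unfold)
    also have "(\<Sum>(x, K)\<in>p. measure lborel K) = b - a"
      using additive_content_tagged_division[of p a b] p ab by (simp add: cbox_interval)
    also have "\<epsilon>' * B * (b - a) < \<epsilon>"
    proof -
      have "\<epsilon>' * (B * (b - a)) < \<epsilon>' * (B * (b - a) + 1)" using e' by simp
      also have "\<dots> = \<epsilon>" using pos by (simp add: \<epsilon>'_def)
      finally show ?thesis by (simp add: mult.assoc)
    qed
    finally show "cmod ((\<Sum>(x, K)\<in>p. f x * (s (Sup K) - s (Inf K))) - integral {a..b} (\<lambda>x. f x * d x)) < \<epsilon>" .
  qed
qed

text \<open>The density vanishes on the negative axis, so the limit in both end points reduces to a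
  limit in the upper one.\<close>

lemma has_RS_integral_real_line_density:
  assumes f: "continuous_on UNIV f" and d: "continuous_on UNIV d" and d0: "\<And>x. x \<le> 0 \<Longrightarrow> d x = 0"
    and s: "\<And>x y. x \<le> y \<Longrightarrow> (d has_integral (s y - s x)) {x..y}"
    and int: "integrable halfline (\<lambda>x. f x * d x)"
  shows "has_RS_integral_real_line f s (LINT x|halfline. f x * d x)"
  unfolding has_RS_integral_real_line_def
proof (intro exI[of _ "\<lambda>a b. integral {a..b} (\<lambda>x. f x * d x)"] conjI allI impI)
  show "has_RS_integral f s (integral {a..b} (\<lambda>x. f x * d x)) a b" if "a \<le> b" for a b
    by (rule has_RS_integral_density[OF that _ _ s]) (auto intro: continuous_on_subset[OF f] continuous_on_subset[OF d])
  let ?I = "LINT x|halfline. f x * d x"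
  have "((\<lambda>p. integral {0..snd p} (\<lambda>x. f x * d x)) \<longlongrightarrow> ?I) (at_bot \<times>\<^sub>F at_top)"
    by (rule filterlim_compose[OF integral_tendsto_halfline[OF int] filterlim_snd])
  moreover have "\<forall>\<^sub>F p in at_bot \<times>\<^sub>F at_top. integral {0..snd p} (\<lambda>x. f x * d x) = (case p of (a, b) \<Rightarrow> integral {a..b} (\<lambda>x. f x * d x))"
  proof -
    have "\<forall>\<^sub>F p in at_bot \<times>\<^sub>F at_top. fst p \<le> (0::real) \<and> snd p \<ge> (0::real)"
      by (rule eventually_prodI[OF eventually_le_at_bot[of 0] eventually_ge_at_top[of 0]])
    then show ?thesis
    proof eventually_elim
      case (elim p)
      obtain a b where p: "p = (a, b)" by (cases p)
      have c: "(\<lambda>x. f x * d x) integrable_on {a..b}"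
        by (intro integrable_continuous_real continuous_intros continuous_on_subset[OF f] continuous_on_subset[OF d]) auto
      have "integral {a..0} (\<lambda>x. f x * d x) + integral {0..b} (\<lambda>x. f x * d x) = integral {a..b} (\<lambda>x. f x * d x)"
        by (rule Henstock_Kurzweil_Integration.integral_combine[OF _ _ c]) (use elim p in auto)
      moreover have "integral {a..0} (\<lambda>x. f x * d x) = integral {a..0} (\<lambda>x. 0)"
        by (rule Henstock_Kurzweil_Integration.integral_cong) (simp add: d0)
      ultimately show ?case using p by simp
    qed
  qed
  ultimately show "((\<lambda>(a, b). integral {a..b} (\<lambda>x. f x * d x)) \<longlongrightarrow> ?I) (at_bot \<times>\<^sub>F at_top)"
    by (rule Lim_transform_eventually)
qed

section \<open>A Stieltjes transform\<close>

text \<open>The substitution t = x / (1 - x) leads to the Beta integral with parameters \<gamma> and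
  1 - \<gamma>, which the reflection formula evaluates.\<close>

lemma beta_integral_halfline:
  assumes \<gamma>: "0 < \<gamma>" "\<gamma> < 1"
  shows "integrable halfline (\<lambda>t. t powr (\<gamma> - 1) / (1 + t))" "(LINT t|halfline. t powr (\<gamma> - 1) / (1 + t)) = pi / sin (pi * \<gamma>)"
proof -
  let ?f = "\<lambda>t::real. t powr (\<gamma> - 1) / (1 + t)"
  let ?g = "\<lambda>x::real. x / (1 - x)"
  let ?g' = "\<lambda>x::real. 1 / (1 - x)\<^sup>2"
  have img: "?g ` {0<..<1} = {0<..}"
  proof
    show "{0<..} \<subseteq> ?g ` {0<..<1}"
    proof
      fix y :: real assume y: "y \<in> {0<..}"
      show "y \<in> ?g ` {0<..<1}"
        by (rule image_eqI[of _ _ "y / (1 + y)"]) (use y in \<open>auto simp: field_simps\<close>)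
    qed
  qed auto
  have inj: "inj_on ?g {0<..<1}" by (rule inj_onI) (auto simp: field_simps)
  have der: "(?g has_field_derivative ?g' x) (at x within {0<..<1})" if "x \<in> {0<..<1}" for x
    using that by (auto intro!: derivative_eq_intros simp: power2_eq_square field_simps)
  have pull: "\<bar>?g' x\<bar> * ?f (?g x) = x powr (\<gamma> - 1) * (1 - x) powr ((1 - \<gamma>) - 1)" if "x \<in> {0<..<1}" for x
  proof -
    have x: "0 < x" "x < 1" using that by auto
    have "1 + x / (1 - x) = 1 / (1 - x)" using x by (simp add: field_simps)
    then have "\<bar>?g' x\<bar> * ?f (?g x) = x powr (\<gamma> - 1) / (1 - x) powr (\<gamma> - 1) * (1 / (1 - x))"
      using x by (simp add: powr_divide power2_eq_square)
    also have "\<dots> = x powr (\<gamma> - 1) * ((1 - x) powr (- (\<gamma> - 1)) * (1 - x) powr (-1))"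
      unfolding powr_minus divide_inverse using x by (simp only: powr_one mult_1_left mult.assoc diff_ge_0_iff_ge less_imp_le)
    also have "(1 - x) powr (- (\<gamma> - 1)) * (1 - x) powr (-1) = (1 - x) powr ((1 - \<gamma>) - 1)"
      unfolding powr_add[symmetric] by (rule arg_cong[of _ _ "(powr) (1 - x)"]) simp
    finally show ?thesis .
  qed
  let ?h = "\<lambda>x::real. x powr (\<gamma> - 1) * (1 - x) powr ((1 - \<gamma>) - 1)"
  have B: "(?h has_integral Beta \<gamma> (1 - \<gamma>)) {0<..<1}"
    using has_integral_Beta_real[of \<gamma> "1 - \<gamma>"] \<gamma> by (simp add: has_integral_Icc_iff_Ioo)
  have "?h absolutely_integrable_on {0<..<1}"
    by (rule nonnegative_absolutely_integrable_1) (use B in auto)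
  then have "(\<lambda>x. \<bar>?g' x\<bar> * ?f (?g x)) absolutely_integrable_on {0<..<1}"
    by (rule set_integrable_cong[THEN iffD1, rotated 3]) (use pull in auto)
  moreover have "integral {0<..<1} (\<lambda>x. \<bar>?g' x\<bar> * ?f (?g x)) = Beta \<gamma> (1 - \<gamma>)"
    using integral_unique[OF B] Henstock_Kurzweil_Integration.integral_cong[of "{0<..<1}" "\<lambda>x. \<bar>?g' x\<bar> * ?f (?g x)" ?h] pull by simp
  ultimately have *: "?f absolutely_integrable_on {0<..} \<and> integral {0<..} ?f = Beta \<gamma> (1 - \<gamma>)"
    using has_absolute_integral_change_of_variables_1'[OF _ der inj, of ?f "Beta \<gamma> (1 - \<gamma>)"] img by simp
  then show i: "integrable halfline ?f" by (simp add: integrable_halfline_iff)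
  have "complex_of_real (Beta \<gamma> (1 - \<gamma>)) = Gamma (of_real \<gamma>) * Gamma (1 - of_real \<gamma>)"
    by (simp add: Beta_def flip: Gamma_complex_of_real)
  also have "\<dots> = of_real (pi / sin (pi * \<gamma>))"
    by (simp add: Gamma_reflection_complex flip: sin_of_real)
  finally have "Beta \<gamma> (1 - \<gamma>) = pi / sin (pi * \<gamma>)" using of_real_eq_iff by blast
  then show "(LINT t|halfline. ?f t) = pi / sin (pi * \<gamma>)"
    using * lebesgue_integral_eq_integral[OF i] by simp
qed

definition stieltjes_power :: "real \<Rightarrow> complex \<Rightarrow> complex" where
  "stieltjes_power \<gamma> w = (LINT t|halfline. of_real (t powr (\<gamma> - 1)) / (of_real t + w))"

text \<open>Decay like 1 / (1 + t) is what \<open>beta_integral_halfline\<close> can dominate. The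
  explicit bound serves as the uniform remainder estimate when the transform is
  differentiated.\<close>

lemma power_kernel_integrable:
  fixes K :: "real \<Rightarrow> complex"
  assumes \<gamma>: "0 < \<gamma>" "\<gamma> < 1" and K: "continuous_on {0<..} K" and bd: "\<And>t. t > 0 \<Longrightarrow> cmod (K t) \<le> C / (1 + t)"
  shows "integrable halfline (\<lambda>t. of_real (t powr (\<gamma> - 1)) * K t)"
    "cmod (LINT t|halfline. of_real (t powr (\<gamma> - 1)) * K t) \<le> C * (pi / sin (pi * \<gamma>))"
proof -
  note beta = beta_integral_halfline[OF \<gamma>]
  have le: "cmod (of_real (t powr (\<gamma> - 1)) * K t) \<le> C * (t powr (\<gamma> - 1) / (1 + t))" if "t > 0" for t
    using mult_left_mono[OF bd[OF that], of "t powr (\<gamma> - 1)"] by (simp add: norm_mult mult_ac)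
  have g: "integrable halfline (\<lambda>t. C * (t powr (\<gamma> - 1) / (1 + t)))"
    by (rule Bochner_Integration.integrable_mult_right) (rule beta(1))
  have "continuous_on {0<..} (\<lambda>t. of_real (t powr (\<gamma> - 1)) * K t)" by (intro continuous_intros K) auto
  then have meas: "(\<lambda>t. of_real (t powr (\<gamma> - 1)) * K t) \<in> borel_measurable halfline"
    by (rule continuous_imp_measurable_on_sets_lebesgue) simp
  show i: "integrable halfline (\<lambda>t. of_real (t powr (\<gamma> - 1)) * K t)"
  proof (rule Bochner_Integration.integrable_bound[OF g meas])
    show "AE t in halfline. norm (of_real (t powr (\<gamma> - 1)) * K t) \<le> norm (C * (t powr (\<gamma> - 1) / (1 + t)))"
      by (rule AE_halflineI) (use le in \<open>fastforce intro: order_trans[OF _ abs_ge_self] simp del: norm_mult abs_mult norm_of_real times_divide_eq_right\<close>)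
  qed
  have "cmod (LINT t|halfline. of_real (t powr (\<gamma> - 1)) * K t) \<le> (LINT t|halfline. C * (t powr (\<gamma> - 1) / (1 + t)))"
  proof (rule order_trans[OF integral_norm_bound integral_mono_AE])
    show "integrable halfline (\<lambda>t. cmod (of_real (t powr (\<gamma> - 1)) * K t))" using i by (rule integrable_norm)
    show "AE t in halfline. cmod (of_real (t powr (\<gamma> - 1)) * K t) \<le> C * (t powr (\<gamma> - 1) / (1 + t))"
      by (rule AE_halflineI[OF le])
  qed (rule g)
  then show "cmod (LINT t|halfline. of_real (t powr (\<gamma> - 1)) * K t) \<le> C * (pi / sin (pi * \<gamma>))"
    unfolding Bochner_Integration.integral_mult_right[OF beta(1)] beta(2) .
qed

text \<open>
  The transform is homogeneous: \<open>w J'(w) = (\<gamma> - 1) J(w)\<close> by integrating the derivative of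
  \<open>t\<^sup>\<gamma> / (t + w)\<close>. So \<open>J(w) w\<^sup>1\<^sup>-\<^sup>\<gamma>\<close> is constant on the half-plane \<open>{w. d \<le> Re (u w)}\<close>, on which the
  estimate \<open>d (1 + t) \<le> \<bar>t + w\<bar>\<close> makes all integrals converge uniformly.
\<close>

lemma stieltjes_power_eq:
  assumes \<gamma>: "0 < \<gamma>" "\<gamma> < 1" and w: "Im w < 0"
  shows "stieltjes_power \<gamma> w = of_real (pi / sin (pi * \<gamma>)) * w powr of_real (\<gamma> - 1)"
proof -
  obtain u d where u: "d > 0" "d \<le> Re u" "d \<le> Re (u * w)" "cmod u = 1"
  proof -
    have w0: "w \<noteq> 0" using w by auto
    define \<theta> where "\<theta> = Im (Ln w)"
    have th: "- pi < \<theta>" "\<theta> < 0" using mpi_less_Im_Ln[OF w0] Im_Ln_pos_lt_imp Im_Ln_less_pi w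
      by (auto simp: \<theta>_def) (metis Im_Ln_pos_le Im_Ln_le_pi not_le w0)
    have "w = exp (Ln w)" using w0 by simp
    also have "\<dots> = of_real (cmod w) * cis \<theta>" using w0 by (simp add: exp_eq_polar \<theta>_def)
    finally have weq: "w = of_real (cmod w) * cis \<theta>" .
    \<comment> \<open>The rotation that bisects the angle between 1 and w; afterwards both have real
      part equal to their modulus times cos (\<theta>/2), positive because |\<theta>| < pi.\<close>
    let ?u = "cis (- \<theta> / 2)"
    have c: "cos (\<theta> / 2) > 0" using th by (intro cos_gt_zero_pi) auto
    have "?u * w = of_real (cmod w) * cis (\<theta> / 2)"
      by (subst weq) (simp add: cis_mult mult.left_commute)
    then have Ruw: "Re (?u * w) = cmod w * cos (\<theta> / 2)" by simp
    show thesis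
      by (rule that[of "min (Re ?u) (Re (?u * w))" ?u]) (use c w0 Ruw in auto)
  qed
  define H where "H = {v. d \<le> Re (u * v)}"
  have H: "1 \<in> H" "w \<in> H" using u by (auto simp: H_def)
  have conv: "convex H"
  proof (rule convexI)
    fix x y :: complex and a b :: real
    assume xy: "x \<in> H" "y \<in> H" "0 \<le> a" "0 \<le> b" "a + b = 1"
    have "d = a * d + b * d" using xy(5) by (simp flip: distrib_right)
    also have "\<dots> \<le> a * Re (u * x) + b * Re (u * y)" using xy by (intro add_mono mult_left_mono) (auto simp: H_def)
    also have "\<dots> = Re (u * (a *\<^sub>R x + b *\<^sub>R y))" by (simp add: algebra_simps)
    finally show "a *\<^sub>R x + b *\<^sub>R y \<in> H" by (simp add: H_def)
  qed
  have lower: "d * (1 + t) \<le> cmod (of_real t + v)" if "v \<in> H" "t \<ge> 0" for v t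
  proof -
    have "d * (1 + t) = d * t + d" by (simp add: algebra_simps)
    also have "\<dots> \<le> Re u * t + Re (u * v)" using u that by (intro add_mono mult_right_mono) (auto simp: H_def)
    also have "\<dots> = Re (u * (of_real t + v))" by (simp add: algebra_simps)
    also have "\<dots> \<le> cmod (u * (of_real t + v))" by (rule complex_Re_le_cmod)
    finally show ?thesis by (simp add: norm_mult u)
  qed
  have nz: "of_real t + v \<noteq> 0" if "v \<in> H" "t \<ge> 0" for v t
  proof -
    have "0 < d * (1 + t)" using u(1) that by simp
    then show ?thesis using lower[OF that] by auto
  qed
  have inv: "cmod (1 / (of_real t + v)) \<le> (1 / d) / (1 + t)" "cmod (1 / (of_real t + v)) \<le> 1 / d" if "v \<in> H" "t > 0" for v t
  proof -
    have "cmod (1 / (of_real t + v)) \<le> 1 / (d * (1 + t))"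
      unfolding norm_divide norm_one
    proof (rule divide_left_mono)
      have "0 < d * (1 + t)" using u(1) that by simp
      moreover show "d * (1 + t) \<le> cmod (of_real t + v)" using lower[of v t] that by simp
      ultimately show "0 < cmod (of_real t + v) * (d * (1 + t))" by (metis less_le_trans mult_pos_pos)
    qed simp
    then show *: "cmod (1 / (of_real t + v)) \<le> (1 / d) / (1 + t)" by simp
    also have "\<dots> \<le> 1 / d" using u(1) that by (simp add: divide_simps)
    finally show "cmod (1 / (of_real t + v)) \<le> 1 / d" .
  qed
  have cinv: "continuous_on {0<..} (\<lambda>t. 1 / (of_real t + v))" if "v \<in> H" for v
    by (intro continuous_intros) (use nz[OF that] in auto)
  let ?p = "\<lambda>t. complex_of_real (t powr (\<gamma> - 1))"
  have J: "stieltjes_power \<gamma> v = (LINT t|halfline. ?p t * (1 / (of_real t + v)))" for v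
    by (simp add: stieltjes_power_def)
  have Ji: "integrable halfline (\<lambda>t. ?p t * (1 / (of_real t + v)))" if "v \<in> H" for v
    by (rule power_kernel_integrable(1)[OF \<gamma> cinv[OF that] inv(1)[OF that]])
  define K2 where "K2 = (\<lambda>v. LINT t|halfline. ?p t * (1 / (of_real t + v) * (1 / (of_real t + v))))"
  have K2i: "integrable halfline (\<lambda>t. ?p t * (1 / (of_real t + v) * (1 / (of_real t + v))))" if "v \<in> H" for v
  proof (rule power_kernel_integrable(1)[OF \<gamma>])
    show "continuous_on {0<..} (\<lambda>t. 1 / (of_real t + v) * (1 / (of_real t + v)))" by (intro continuous_on_mult cinv that)
    show "cmod (1 / (of_real t + v) * (1 / (of_real t + v))) \<le> (1 / d * (1 / d)) / (1 + t)" if "t > 0" for t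
    proof -
      have "cmod (1 / (of_real t + v) * (1 / (of_real t + v))) \<le> 1 / d * (1 / d / (1 + t))"
        unfolding norm_mult using inv[OF \<open>v \<in> H\<close> that] u(1) by (intro mult_mono) auto
      then show ?thesis by simp
    qed
  qed
  \<comment> \<open>The identity 1/(t+y) - 1/(t+v) + (y-v)/(t+v)^2 = (y-v)^2 / ((t+v)^2 (t+y))
    bounds the error of the linear approximation by a multiple of |y - v|^2, uniformly on H.\<close>
  have quad: "cmod (stieltjes_power \<gamma> y - stieltjes_power \<gamma> v + (y - v) * K2 v) \<le>
      (1 / d * (1 / d) * (1 / d)) * (pi / sin (pi * \<gamma>)) * (cmod (y - v))\<^sup>2" if yv: "y \<in> H" "v \<in> H" for y v
  proof -
    let ?k = "\<lambda>t. 1 / (complex_of_real t + v) * (1 / (of_real t + v)) * (1 / (of_real t + y))"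
    have kb: "cmod (?k t) \<le> (1 / d * (1 / d) * (1 / d)) / (1 + t)" if "t > 0" for t
    proof -
      have "cmod (1 / (complex_of_real t + v) * (1 / (of_real t + v))) \<le> 1 / d * (1 / d)"
        unfolding norm_mult using inv(2)[OF yv(2) that] u(1) by (intro mult_mono) auto
      then have "cmod (?k t) \<le> 1 / d * (1 / d) * ((1 / d) / (1 + t))"
        unfolding norm_mult[of _ "1 / (of_real t + y)"] using inv(1)[OF yv(1) that] u(1) by (intro mult_mono) auto
      then show ?thesis by simp
    qed
    have kc: "continuous_on {0<..} ?k" by (intro continuous_on_mult cinv yv)
    note ki = power_kernel_integrable[OF \<gamma> kc kb]
    have "stieltjes_power \<gamma> y - stieltjes_power \<gamma> v + (y - v) * K2 v =
       (LINT t|halfline. ?p t * (1 / (of_real t + y)) - ?p t * (1 / (of_real t + v)) + (y - v) * (?p t * (1 / (of_real t + v) * (1 / (of_real t + v)))))"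
    proof -
      have "(LINT t|halfline. f t - g t + (y - v) * h t) = (LINT t|halfline. f t) - (LINT t|halfline. g t) + (y - v) * (LINT t|halfline. h t)"
        if "integrable halfline f" "integrable halfline g" "integrable halfline h" for f g h :: "real \<Rightarrow> complex"
        using that by simp
      from this[OF Ji[OF yv(1)] Ji[OF yv(2)] K2i[OF yv(2)]] show ?thesis unfolding J K2_def by (rule sym)
    qed
    also have "\<dots> = (LINT t|halfline. (y - v)\<^sup>2 * (?p t * ?k t))"
    proof (rule Bochner_Integration.integral_cong[OF refl])
      fix t assume "t \<in> space halfline"
      then have "t \<ge> 0" by simp
      then have ne: "of_real t + y \<noteq> 0" "of_real t + v \<noteq> 0" using nz yv by auto
      have "1 / (of_real t + y) - 1 / (of_real t + v) + (y - v) * (1 / (of_real t + v) * (1 / (of_real t + v))) = (y - v)\<^sup>2 * ?k t"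
        using ne by (simp add: divide_simps) (simp add: algebra_simps power2_eq_square)
      then have "?p t * (1 / (of_real t + y) - 1 / (of_real t + v) + (y - v) * (1 / (of_real t + v) * (1 / (of_real t + v)))) = ?p t * ((y - v)\<^sup>2 * ?k t)"
        by (rule arg_cong)
      then show "?p t * (1 / (of_real t + y)) - ?p t * (1 / (of_real t + v)) + (y - v) * (?p t * (1 / (of_real t + v) * (1 / (of_real t + v)))) = (y - v)\<^sup>2 * (?p t * ?k t)"
        by (simp only: distrib_left right_diff_distrib mult.left_commute)
    qed
    also have "\<dots> = (y - v)\<^sup>2 * (LINT t|halfline. ?p t * ?k t)"
      by (rule Bochner_Integration.integral_mult_right_zero)
    finally show ?thesis
      using mult_left_mono[OF ki(2), of "(cmod (y - v))\<^sup>2"] by (simp only: norm_mult norm_power mult.commute zero_le_power2)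
  qed
  have der: "(stieltjes_power \<gamma> has_field_derivative - K2 v) (at v within H)" if v: "v \<in> H" for v
    unfolding has_field_derivative_iff
  proof (rule LIM_zero_cancel, rule Lim_null_comparison)
    let ?C = "(1 / d * (1 / d) * (1 / d)) * (pi / sin (pi * \<gamma>))"
    show "((\<lambda>y. ?C * cmod (y - v)) \<longlongrightarrow> 0) (at v within H)"
      by (intro tendsto_mult_right_zero tendsto_norm_zero LIM_zero tendsto_ident_at)
    have "\<forall>\<^sub>F y in at v within H. y \<in> H \<and> y \<noteq> v"
      by (simp add: eventually_at_filter)
    then show "\<forall>\<^sub>F y in at v within H. norm ((stieltjes_power \<gamma> y - stieltjes_power \<gamma> v) / (y - v) - - K2 v) \<le> ?C * cmod (y - v)"
    proof eventually_elim
      case (elim y)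
      then have "(stieltjes_power \<gamma> y - stieltjes_power \<gamma> v) / (y - v) - - K2 v = (stieltjes_power \<gamma> y - stieltjes_power \<gamma> v + (y - v) * K2 v) / (y - v)"
        by (simp add: field_simps)
      then show ?case
        using quad[of y v] elim v by (simp add: norm_divide power2_eq_square divide_le_eq mult.assoc)
    qed
  qed
  have ode: "v * K2 v = of_real (1 - \<gamma>) * stieltjes_power \<gamma> v" if v: "v \<in> H" for v
  proof -
    \<comment> \<open>This function vanishes at 0 because \<gamma> > 0 and at infinity because
      \<gamma> < 1, so the integral of its derivative is 0.\<close>
    let ?F = "\<lambda>t. complex_of_real (t powr \<gamma>) / (of_real t + v)"
    let ?f = "\<lambda>t. of_real (\<gamma> - 1) * (?p t * (1 / (of_real t + v))) + v * (?p t * (1 / (of_real t + v) * (1 / (of_real t + v))))"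
    have int: "integrable halfline ?f"
      by (intro Bochner_Integration.integrable_add Bochner_Integration.integrable_mult_right Ji K2i v)
    have "integral {0..X} ?f = ?F X" if X: "X > 0" for X
    proof -
      have "(?f has_integral (?F X - ?F 0)) {0..X}"
      proof (rule fundamental_theorem_of_calculus_interior)
        show "continuous_on {0..X} ?F"
          by (intro continuous_intros continuous_on_of_real continuous_on_powr') (use \<gamma> nz[OF v] in auto)
        fix t assume t: "t \<in> {0<..<X}"
        have ne: "of_real t + v \<noteq> 0" using nz[OF v] t by simp
        have "((\<lambda>t. complex_of_real (t powr \<gamma>)) has_vector_derivative of_real (\<gamma> * t powr (\<gamma> - 1))) (at t)"
          using t by (intro has_vector_derivative_of_real)
            (auto intro!: derivative_eq_intros simp flip: has_real_derivative_iff_has_vector_derivative)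
        moreover have "((\<lambda>t. 1 / (complex_of_real t + v)) has_vector_derivative - (1 / (of_real t + v) * (1 / (of_real t + v)))) (at t)"
          by (rule has_vector_derivative_real_field[of "\<lambda>x. 1 / (x + v)"]) (use ne in \<open>auto intro!: derivative_eq_intros simp: power2_eq_square\<close>)
        ultimately have "((\<lambda>t. complex_of_real (t powr \<gamma>) * (1 / (of_real t + v))) has_vector_derivative
            (of_real (t powr \<gamma>) * - (1 / (of_real t + v) * (1 / (of_real t + v))) + of_real (\<gamma> * t powr (\<gamma> - 1)) * (1 / (of_real t + v)))) (at t)"
          by (rule has_vector_derivative_mult)
        moreover have "of_real (t powr \<gamma>) * - (1 / (of_real t + v) * (1 / (of_real t + v))) + of_real (\<gamma> * t powr (\<gamma> - 1)) * (1 / (of_real t + v)) = ?f t"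
        proof -
          have "t powr \<gamma> = t powr (1 + (\<gamma> - 1))" by simp
          also have "\<dots> = t * t powr (\<gamma> - 1)" unfolding powr_add using t by simp
          finally have e: "complex_of_real (t powr \<gamma>) = of_real t * ?p t" by simp
          have "of_real t * p * - (1 / (of_real t + v) * (1 / (of_real t + v))) + of_real \<gamma> * p * (1 / (of_real t + v)) =
             of_real (\<gamma> - 1) * (p * (1 / (of_real t + v))) + v * (p * (1 / (of_real t + v) * (1 / (of_real t + v))))" for p
            using ne by (simp add: divide_simps) (simp add: algebra_simps)
          from this[of "?p t"] show ?thesis unfolding e by simp
        qed
        ultimately show "(?F has_vector_derivative ?f t) (at t)" by simp
      qed (use X in auto)
      then show ?thesis using \<gamma> by (simp add: integral_unique)
    qed
    then have "\<forall>\<^sub>F X in at_top. ?F X = integral {0..X} ?f"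
      by (auto intro!: eventually_mono[OF eventually_gt_at_top[of 0]])
    moreover have "(?F \<longlongrightarrow> 0) at_top"
    proof (rule Lim_null_comparison)
      show "\<forall>\<^sub>F t in at_top. norm (?F t) \<le> 1 / d * t powr (\<gamma> - 1)"
        using eventually_gt_at_top[of 0]
      proof eventually_elim
        case (elim t)
        have "norm (?F t) \<le> t powr \<gamma> * ((1 / d) / (1 + t))"
          using mult_left_mono[OF inv(1)[OF v elim], of "t powr \<gamma>"] by (simp add: norm_divide)
        also have "\<dots> \<le> t powr \<gamma> * ((1 / d) / t)"
          using elim u(1) by (intro mult_left_mono divide_left_mono) auto
        also have "\<dots> = 1 / d * t powr (\<gamma> - 1)" using elim by (simp add: powr_diff)
        finally show ?case .
      qed
      have "((\<lambda>t::real. t powr (\<gamma> - 1)) \<longlongrightarrow> 0) at_top"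
        by (rule tendsto_neg_powr[OF _ filterlim_ident]) (use \<gamma> in simp)
      then show "((\<lambda>t. 1 / d * t powr (\<gamma> - 1)) \<longlongrightarrow> 0) at_top" by (intro tendsto_mult_right_zero)
    qed
    ultimately have "((\<lambda>X. integral {0..X} ?f) \<longlongrightarrow> 0) at_top" by (rule Lim_transform_eventually[rotated])
    then have "(LINT t|halfline. ?f t) = 0"
      using integral_tendsto_halfline[OF int] tendsto_unique trivial_limit_at_top_linorder by blast
    moreover have "(LINT t|halfline. ?f t) = of_real (\<gamma> - 1) * stieltjes_power \<gamma> v + v * K2 v"
    proof -
      have "(LINT t|halfline. a * f t + b * g t) = a * (LINT t|halfline. f t) + b * (LINT t|halfline. g t)"
        if "integrable halfline f" "integrable halfline g" for f g :: "real \<Rightarrow> complex" and a b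
        using that by simp
      from this[OF Ji[OF v] K2i[OF v]] show ?thesis unfolding J K2_def .
    qed
    ultimately show ?thesis by (simp add: algebra_simps add_eq_0_iff)
  qed
  \<comment> \<open>A nonpositive real v satisfies Re (u v) <= 0, so H avoids the cut of the
    principal power.\<close>
  have slit: "v \<notin> \<real>\<^sub>\<le>\<^sub>0" if "v \<in> H" for v
  proof
    assume "v \<in> \<real>\<^sub>\<le>\<^sub>0"
    then obtain x where x: "v = of_real x" "x \<le> 0" by (elim nonpos_Reals_cases)
    then have "Re (u * v) = Re u * x" by simp
    also have "\<dots> \<le> 0" using x u by (intro mult_nonneg_nonpos) auto
    finally show False using that u by (simp add: H_def)
  qed
  let ?\<Phi> = "\<lambda>v. stieltjes_power \<gamma> v * v powr of_real (1 - \<gamma>)"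
  have "(?\<Phi> has_field_derivative 0) (at v within H)" if v: "v \<in> H" for v
  proof -
    have v0: "v \<noteq> 0" using slit[OF v] by auto
    have pd: "((\<lambda>v. v powr of_real (1 - \<gamma>)) has_field_derivative of_real (1 - \<gamma>) * v powr (of_real (1 - \<gamma>) - 1)) (at v within H)"
      by (rule has_field_derivative_at_within[OF has_field_derivative_powr[OF slit[OF v]]])
    have "(?\<Phi> has_field_derivative (- K2 v * v powr of_real (1 - \<gamma>) + of_real (1 - \<gamma>) * v powr (of_real (1 - \<gamma>) - 1) * stieltjes_power \<gamma> v)) (at v within H)"
      by (rule DERIV_cong[OF DERIV_mult'[OF der[OF v] pd]]) (simp add: algebra_simps)
    moreover have "v powr of_real (1 - \<gamma>) = v * v powr (of_real (1 - \<gamma>) - 1)"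
      using powr_add[of v 1 "of_real (1 - \<gamma>) - 1"] v0 by simp
    then have "- K2 v * v powr of_real (1 - \<gamma>) + of_real (1 - \<gamma>) * v powr (of_real (1 - \<gamma>) - 1) * stieltjes_power \<gamma> v =
       (of_real (1 - \<gamma>) * stieltjes_power \<gamma> v - v * K2 v) * v powr (of_real (1 - \<gamma>) - 1)"
      by (simp add: algebra_simps)
    then have "- K2 v * v powr of_real (1 - \<gamma>) + of_real (1 - \<gamma>) * v powr (of_real (1 - \<gamma>) - 1) * stieltjes_power \<gamma> v = 0"
      using ode[OF v] by simp
    ultimately show ?thesis by simp
  qed
  from has_field_derivative_zero_constant[OF conv this] obtain c where c: "\<And>v. v \<in> H \<Longrightarrow> ?\<Phi> v = c" by blast
  have const: "?\<Phi> w = ?\<Phi> 1" unfolding c[OF H(1)] c[OF H(2)] ..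
  have "stieltjes_power \<gamma> 1 = (LINT t|halfline. complex_of_real (t powr (\<gamma> - 1) / (1 + t)))"
    unfolding stieltjes_power_def by (simp add: add.commute)
  also have "\<dots> = of_real (pi / sin (pi * \<gamma>))"
    by (subst integral_complex_of_real) (simp only: beta_integral_halfline[OF \<gamma>])
  finally have J1: "stieltjes_power \<gamma> 1 = of_real (pi / sin (pi * \<gamma>))" .
  have w0: "w \<noteq> 0" using w by auto
  have "stieltjes_power \<gamma> w = ?\<Phi> w * w powr of_real (\<gamma> - 1)"
    using w0 by (simp add: mult.assoc flip: powr_add)
  also have "?\<Phi> w = of_real (pi / sin (pi * \<gamma>))" unfolding const J1 by simp
  finally show ?thesis .
qed

section \<open>The spectral function\<close>

lemma continuous_on_max_powr: "e > 0 \<Longrightarrow> continuous_on A (\<lambda>t::real. max 0 t powr e)"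
  by (intro continuous_on_powr' continuous_intros) auto

text \<open>Writing \<open>max 0 t\<close> joins the zero density on the negative axis and the power
  on the positive axis into one continuous function; 0 is the exceptional point of the fundamental
  theorem.\<close>

lemma has_integral_max_powr:
  fixes \<gamma> x y :: real
  assumes \<gamma>: "0 < \<gamma>" and xy: "x \<le> y"
  shows "((\<lambda>t. max 0 t powr \<gamma>) has_integral (max 0 y powr (1 + \<gamma>) / (1 + \<gamma>) - max 0 x powr (1 + \<gamma>) / (1 + \<gamma>))) {x..y}"
proof (rule fundamental_theorem_of_calculus_interior_strong[of "{0}"])
  fix t assume "t \<in> {x<..<y} - {0}"
  then consider "t < 0" | "t > 0" by force
  then show "((\<lambda>t. max 0 t powr (1 + \<gamma>) / (1 + \<gamma>)) has_vector_derivative max 0 t powr \<gamma>) (at t)"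
  proof cases
    case 1
    have "((\<lambda>t. 0) has_vector_derivative max 0 t powr \<gamma>) (at t)" using 1 by (simp add: max_def)
    then show ?thesis
      by (rule has_vector_derivative_transform_within_open[where S = "{..<0}"]) (use 1 in \<open>auto simp: max_def\<close>)
  next
    case 2
    have "((\<lambda>t. t powr (1 + \<gamma>) / (1 + \<gamma>)) has_real_derivative (1 + \<gamma>) * t powr (1 + \<gamma> - 1) / (1 + \<gamma>)) (at t)"
      by (rule DERIV_cdivide[OF has_real_derivative_powr[OF 2]])
    then have "((\<lambda>t. t powr (1 + \<gamma>) / (1 + \<gamma>)) has_vector_derivative max 0 t powr \<gamma>) (at t)"
      using 2 \<gamma> by (simp add: max_def has_real_derivative_iff_has_vector_derivative)
    then show ?thesis
      by (rule has_vector_derivative_transform_within_open[where S = "{0<..}"]) (use 2 in \<open>auto simp: max_def\<close>)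
  qed
next
  show "continuous_on {x..y} (\<lambda>t. max 0 t powr (1 + \<gamma>) / (1 + \<gamma>))"
    using \<gamma> by (intro continuous_on_divide continuous_on_max_powr continuous_on_const) auto
qed (use xy in auto)

lemma has_integral_max_powr_complex:
  fixes \<gamma> x y c :: real
  assumes \<gamma>: "0 < \<gamma>" and xy: "x \<le> y"
  shows "((\<lambda>t. of_real (c * (1 + \<gamma>) * max 0 t powr \<gamma>)) has_integral
    (complex_of_real (c * max 0 y powr (1 + \<gamma>)) - of_real (c * max 0 x powr (1 + \<gamma>)))) {x..y}"
proof -
  have "((\<lambda>t. c * (1 + \<gamma>) * max 0 t powr \<gamma>) has_integral
      c * (1 + \<gamma>) * (max 0 y powr (1 + \<gamma>) / (1 + \<gamma>) - max 0 x powr (1 + \<gamma>) / (1 + \<gamma>))) {x..y}"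
    by (rule has_integral_mult_right[OF has_integral_max_powr[OF \<gamma> xy]])
  also have "c * (1 + \<gamma>) * (max 0 y powr (1 + \<gamma>) / (1 + \<gamma>) - max 0 x powr (1 + \<gamma>) / (1 + \<gamma>)) =
      c * max 0 y powr (1 + \<gamma>) - c * max 0 x powr (1 + \<gamma>)"
    using \<gamma> by (simp add: right_diff_distrib)
  finally have I: "((\<lambda>t. c * (1 + \<gamma>) * max 0 t powr \<gamma>) has_integral c * max 0 y powr (1 + \<gamma>) - c * max 0 x powr (1 + \<gamma>)) {x..y}" .
  show ?thesis
    unfolding of_real_diff[symmetric] using has_integral_linear[OF I bounded_linear_of_real] unfolding o_def .
qed

text \<open>The density contains t^\<gamma>; one factor t is moved into the kernel, K(t) = t f(t),
  which leaves t^(\<gamma>-1) against a kernel of decay 1 / (1 + t).\<close>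

lemma has_RS_integral_max_powr:
  fixes K f :: "real \<Rightarrow> complex" and \<gamma> c C :: real
  assumes \<gamma>: "0 < \<gamma>" "\<gamma> < 1" and f: "continuous_on UNIV f"
    and K: "continuous_on {0<..} K" "\<And>t. t > 0 \<Longrightarrow> cmod (K t) \<le> C / (1 + t)"
    and fK: "\<And>t. t > 0 \<Longrightarrow> of_real t * f t = K t"
  shows "has_RS_integral_real_line f (\<lambda>t. of_real (c * max 0 t powr (1 + \<gamma>)))
    (of_real (c * (1 + \<gamma>)) * (LINT t|halfline. of_real (t powr (\<gamma> - 1)) * K t))"
proof -
  let ?d = "\<lambda>t. complex_of_real (c * (1 + \<gamma>) * max 0 t powr \<gamma>)"
  let ?g = "\<lambda>t. of_real (c * (1 + \<gamma>)) * (of_real (t powr (\<gamma> - 1)) * K t)"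
  have eq: "f t * ?d t = ?g t" if "t \<in> space halfline" for t
  proof -
    have t: "t > 0" using that by simp
    have "t powr \<gamma> = t powr (1 + (\<gamma> - 1))" by simp
    also have "\<dots> = t * t powr (\<gamma> - 1)" unfolding powr_add using t by simp
    finally have "max 0 t powr \<gamma> = t * t powr (\<gamma> - 1)" using t by (simp add: max_def)
    then show ?thesis by (simp add: fK[OF t, symmetric])
  qed
  have "integrable halfline ?g"
    by (rule Bochner_Integration.integrable_mult_right[OF power_kernel_integrable(1)[OF \<gamma> K]])
  then have int: "integrable halfline (\<lambda>t. f t * ?d t)"
    by (subst Bochner_Integration.integrable_cong[OF refl eq])
  have "has_RS_integral_real_line f (\<lambda>t. of_real (c * max 0 t powr (1 + \<gamma>))) (LINT t|halfline. f t * ?d t)"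
  proof (rule has_RS_integral_real_line_density[OF f _ _ _ int])
    show "continuous_on UNIV ?d" using \<gamma> by (intro continuous_on_of_real continuous_on_mult continuous_on_const continuous_on_max_powr) auto
    show "?d x = 0" if "x \<le> 0" for x using that by (simp add: max_def)
  qed (rule has_integral_max_powr_complex[OF \<gamma>(1)])
  also have "(LINT t|halfline. f t * ?d t) = (LINT t|halfline. ?g t)"
    by (rule Bochner_Integration.integral_cong[OF refl eq])
  finally show ?thesis unfolding Bochner_Integration.integral_mult_right_zero .
qed

section \<open>The kernels of the integral representation\<close>

lemma one_plus_square_nonzero: "1 + (complex_of_real t)\<^sup>2 \<noteq> 0"
proof -
  have "1 + t\<^sup>2 \<noteq> 0" using zero_le_power2[of t] by linarith
  moreover have "1 + (complex_of_real t)\<^sup>2 = of_real (1 + t\<^sup>2)" by simp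
  ultimately show ?thesis by (simp only: of_real_eq_0_iff not_False_eq_True)
qed

lemma cmod_inverse_one_plus_square: "t > 0 \<Longrightarrow> cmod (1 / (1 + (complex_of_real t)\<^sup>2)) \<le> 2 / (1 + t)"
proof -
  assume t: "t > 0"
  have "1 + (complex_of_real t)\<^sup>2 = of_real (1 + t\<^sup>2)" by simp
  then have "cmod (1 / (1 + (complex_of_real t)\<^sup>2)) = 1 / (1 + t\<^sup>2)"
    by (simp only: norm_divide norm_of_real norm_one) simp
  also have "\<dots> \<le> 2 / (1 + t)"
  proof -
    have "0 \<le> (t - 1)\<^sup>2" by simp
    then have "2 * t \<le> 1 + t\<^sup>2" by (simp add: power2_eq_square algebra_simps)
    then have "1 + t \<le> 2 * (1 + t\<^sup>2)" using t zero_le_power2[of t] by (smt (verit))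
    then show ?thesis using t by (simp add: divide_simps add_pos_nonneg)
  qed
  finally show ?thesis .
qed

lemma has_RS_integral_Cauchy_weight:
  fixes \<gamma> c :: real
  assumes \<gamma>: "0 < \<gamma>" "\<gamma> < 1"
  shows "\<exists>I. has_RS_integral_real_line (\<lambda>t. 1 / (1 + (complex_of_real t)\<^sup>2)) (\<lambda>t. of_real (c * max 0 t powr (1 + \<gamma>))) I"
proof (rule exI, rule has_RS_integral_max_powr[OF \<gamma>, where C = 2])
  show "continuous_on UNIV (\<lambda>t. 1 / (1 + (complex_of_real t)\<^sup>2))"
    by (intro continuous_intros) (auto simp: one_plus_square_nonzero)
  show "continuous_on {0<..} (\<lambda>t. of_real t * (1 / (1 + (complex_of_real t)\<^sup>2)))"
    by (intro continuous_intros) (auto simp: one_plus_square_nonzero)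
  fix t :: real assume t: "t > 0"
  have "1 + (complex_of_real t)\<^sup>2 = of_real (1 + t\<^sup>2)" by simp
  then have "cmod (of_real t * (1 / (1 + (complex_of_real t)\<^sup>2))) = t / (1 + t\<^sup>2)"
    using t by (simp only: norm_divide norm_mult norm_of_real norm_one) simp
  also have "\<dots> \<le> 2 / (1 + t)"
  proof -
    have "0 \<le> (t - 1)\<^sup>2" by simp
    then have "2 * t \<le> 1 + t\<^sup>2" by (simp add: power2_eq_square algebra_simps)
    then have "t * (1 + t) \<le> 2 * (1 + t\<^sup>2)" using t by (simp add: power2_eq_square algebra_simps)
    then show ?thesis using t by (simp add: divide_simps add_pos_nonneg)
  qed
  finally show "cmod (of_real t * (1 / (1 + (complex_of_real t)\<^sup>2))) \<le> 2 / (1 + t)" .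
qed simp

text \<open>The real constant left behind by the subtracted term t / (1 + t^2); the matrix P
  compensates it.\<close>

definition cauchy_power_moment :: "real \<Rightarrow> real" where
  "cauchy_power_moment \<gamma> = (LINT t|halfline. t powr (\<gamma> - 1) / (1 + t\<^sup>2))"

text \<open>The kernel times t is z / (t - z) + 1 / (1 + t^2), two constants 1 having cancelled. The
  first part gives the Stieltjes transform at -z, the second the constant
  \<open>cauchy_power_moment\<close>.\<close>

lemma has_RS_integral_Nevanlinna_kernel:
  fixes \<gamma> c :: real
  assumes \<gamma>: "0 < \<gamma>" "\<gamma> < 1" and z: "Im z > 0"
  shows "has_RS_integral_real_line (\<lambda>t. 1 / (complex_of_real t - z) - of_real t / (1 + (of_real t)\<^sup>2))
    (\<lambda>t. of_real (c * max 0 t powr (1 + \<gamma>)))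
    (of_real (c * (1 + \<gamma>)) * (of_real (cauchy_power_moment \<gamma>) - of_real (pi / sin (pi * \<gamma>)) * (- z) powr of_real \<gamma>))"
proof -
  let ?K1 = "\<lambda>t. 1 / (complex_of_real t + - z)"
  let ?K2 = "\<lambda>t. 1 / (1 + (complex_of_real t)\<^sup>2)"
  let ?p = "\<lambda>t. complex_of_real (t powr (\<gamma> - 1))"
  have ne: "complex_of_real t - z \<noteq> 0" "complex_of_real t + - z \<noteq> 0" for t using z by (auto simp: complex_eq_iff)
  note ne2 = one_plus_square_nonzero
  \<comment> \<open>From |t - z| >= Im z follows 1 + |z| <= ((1 + |z|) / Im z) |t - z|, and t <= |t
    - z| + |z|; the final 1 accounts for the second estimate.\<close>
  define C where "C = (1 + cmod z) / Im z + 1"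
  have b1: "cmod (?K1 t) \<le> C / (1 + t)" if t: "t > 0" for t
  proof -
    have "Im z \<le> cmod (of_real t + - z)" using abs_Im_le_cmod[of "of_real t + - z"] by simp
    then have "(1 + cmod z) / Im z * Im z \<le> (1 + cmod z) / Im z * cmod (of_real t + - z)"
      using z by (intro mult_left_mono) auto
    then have "1 + cmod z \<le> (1 + cmod z) / Im z * cmod (of_real t + - z)" using z by simp
    moreover have "cmod (of_real t) \<le> cmod (of_real t + - z) + cmod z" using norm_triangle_ineq[of "of_real t + - z" z] by simp
    ultimately have "1 + t \<le> C * cmod (of_real t + - z)"
      using t unfolding C_def distrib_right by simp
    moreover have "cmod (of_real t + - z) > 0" using ne(2) by simp
    ultimately show ?thesis
      unfolding norm_divide norm_one using t by (simp add: divide_simps mult.commute)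
  qed
  have c1: "continuous_on {0<..} ?K1" by (intro continuous_intros) (use ne in auto)
  have c2: "continuous_on {0<..} ?K2" by (intro continuous_intros) (use ne2 in auto)
  have "has_RS_integral_real_line (\<lambda>t. 1 / (complex_of_real t - z) - of_real t / (1 + (of_real t)\<^sup>2))
    (\<lambda>t. of_real (c * max 0 t powr (1 + \<gamma>)))
    (of_real (c * (1 + \<gamma>)) * (LINT t|halfline. ?p t * (z * ?K1 t + ?K2 t)))"
  proof (rule has_RS_integral_max_powr[OF \<gamma>, where C = "cmod z * C + 2"])
    show "continuous_on UNIV (\<lambda>t. 1 / (complex_of_real t - z) - of_real t / (1 + (of_real t)\<^sup>2))"
      by (intro continuous_intros) (use ne ne2 in auto)
    show "continuous_on {0<..} (\<lambda>t. z * ?K1 t + ?K2 t)"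
      by (intro continuous_on_add continuous_on_mult continuous_on_const c1 c2)
    fix t :: real assume t: "t > 0"
    have "cmod (z * ?K1 t + ?K2 t) \<le> cmod z * (C / (1 + t)) + 2 / (1 + t)"
      by (rule order_trans[OF norm_triangle_ineq add_mono[OF _ cmod_inverse_one_plus_square[OF t]]])
        (unfold norm_mult, rule mult_left_mono[OF b1[OF t]], simp)
    then show "cmod (z * ?K1 t + ?K2 t) \<le> (cmod z * C + 2) / (1 + t)" by (simp add: add_divide_distrib)
    show "of_real t * (1 / (complex_of_real t - z) - of_real t / (1 + (of_real t)\<^sup>2)) = z * ?K1 t + ?K2 t"
    proof -
      have "of_real t * (1 / (complex_of_real t - z)) = 1 + z * ?K1 t" using ne[of t] by (simp add: divide_simps)
      moreover have "of_real t * (of_real t / (1 + (of_real t)\<^sup>2)) = 1 - ?K2 t"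
        using ne2[of t] by (simp add: divide_simps power2_eq_square)
      ultimately show ?thesis unfolding right_diff_distrib by simp
    qed
  qed
  also have "(LINT t|halfline. ?p t * (z * ?K1 t + ?K2 t)) = z * stieltjes_power \<gamma> (- z) + of_real (cauchy_power_moment \<gamma>)"
  proof -
    have lin: "(LINT t|halfline. p t * (z * f t + g t)) = z * (LINT t|halfline. p t * f t) + (LINT t|halfline. p t * g t)"
      if "integrable halfline (\<lambda>t. p t * f t)" "integrable halfline (\<lambda>t. p t * g t)" for p f g :: "real \<Rightarrow> complex"
      using that by (simp add: distrib_left mult.left_commute)
    have "(LINT t|halfline. ?p t * (z * ?K1 t + ?K2 t)) = z * (LINT t|halfline. ?p t * ?K1 t) + (LINT t|halfline. ?p t * ?K2 t)"
      by (rule lin) (rule power_kernel_integrable(1)[OF \<gamma> c1 b1], assumption,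
        rule power_kernel_integrable(1)[OF \<gamma> c2 cmod_inverse_one_plus_square])
    moreover have "(LINT t|halfline. ?p t * ?K2 t) = (LINT t|halfline. complex_of_real (t powr (\<gamma> - 1) / (1 + t\<^sup>2)))"
      by (rule Bochner_Integration.integral_cong) auto
    ultimately show ?thesis
      unfolding stieltjes_power_def cauchy_power_moment_def integral_complex_of_real by simp
  qed
  also have "z * stieltjes_power \<gamma> (- z) = - of_real (pi / sin (pi * \<gamma>)) * (- z) powr of_real \<gamma>"
  proof -
    have nz: "- z \<noteq> 0" using z by auto
    have "stieltjes_power \<gamma> (- z) = of_real (pi / sin (pi * \<gamma>)) * (- z) powr of_real (\<gamma> - 1)"
      by (rule stieltjes_power_eq[OF \<gamma>]) (use z in simp)
    moreover have "(- z) powr of_real \<gamma> = (- z) * (- z) powr of_real (\<gamma> - 1)"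
      using powr_add[of "- z" 1 "of_real (\<gamma> - 1)"] nz by simp
    ultimately show ?thesis by simp
  qed
  also have "- of_real (pi / sin (pi * \<gamma>)) * (- z) powr of_real \<gamma> + of_real (cauchy_power_moment \<gamma>) =
      of_real (cauchy_power_moment \<gamma>) - of_real (pi / sin (pi * \<gamma>)) * (- z) powr of_real \<gamma>" by simp
  finally show ?thesis .
qed

lemma has_integral_of_real_nonneg:
  assumes I: "((\<lambda>x. complex_of_real (h x)) has_integral I) A" and h: "\<And>x. h x \<ge> 0"
  shows "0 \<le> I"
proof -
  have "(h has_integral Re I) A" using has_integral_linear[OF I bounded_linear_Re] by (simp add: o_def)
  then have "0 \<le> Re I" by (rule has_integral_nonneg) (rule h)
  moreover have "((\<lambda>x. 0) has_integral Im I) A" using has_integral_linear[OF I bounded_linear_Im] by (simp add: o_def)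
  then have "Im I = 0" using has_integral_unique has_integral_0 by blast
  ultimately show ?thesis by (simp add: less_eq_complex_def)
qed

section \<open>The candidate for the spectral function\<close>

definition spectral_matrix :: "nat \<Rightarrow> real \<Rightarrow> complex mat" where
  "spectral_matrix n t = (if t < 0 then 0\<^sub>m n n
     else mat n n (\<lambda>(j, k).
       complex_of_real (2 * real n / pi *
         (cot_prod n j * cot_prod n k / real (2 * n + 1 + j + k) *
          t powr (real (2 * n + 1 + j + k) / real (2 * n))))))"

lemma spectral_matrix_carrier: "spectral_matrix n t \<in> carrier_mat n n"
  by (simp add: spectral_matrix_def)

context
  fixes n :: nat
  assumes n: "n \<ge> 1"
begin

definition expo :: "nat \<Rightarrow> nat \<Rightarrow> real" where
  "expo j k = real (j + k + 1) / (2 * real n)"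

definition weight :: "nat \<Rightarrow> nat \<Rightarrow> real" where
  "weight j k = 2 * real n / pi * (cot_prod n j * cot_prod n k / real (2 * n + 1 + j + k))"

lemma expo_bounds: "0 < expo j k" "j < n \<Longrightarrow> k < n \<Longrightarrow> expo j k < 1" "real (j + k + 1) * alpha n = pi * expo j k"
  using n by (auto simp: expo_def alpha_def)

text \<open>\<open>weight\<close> belongs to the distribution function; differentiation brings down
  1 + \<open>expo\<close> and leaves the coefficient of the density, whose 1 / pi meets the pi / sin
  of the Stieltjes transform.\<close>

lemma weight_mult: "weight j k * (1 + expo j k) = cot_prod n j * cot_prod n k / pi"
proof -
  have "1 + expo j k = real (2 * n + 1 + j + k) / (2 * real n)"
    using n by (simp add: expo_def field_simps)
  then show ?thesis using n by (simp add: weight_def)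
qed

lemma spectral_matrix_index:
  assumes "j < n" "k < n"
  shows "spectral_matrix n t $$ (j, k) = of_real (weight j k * max 0 t powr (1 + expo j k))"
proof -
  have "1 + expo j k = real (2 * n + 1 + j + k) / real (2 * n)"
    using n by (simp add: expo_def field_simps)
  then show ?thesis using assms by (simp add: spectral_matrix_def weight_def max_def mult.assoc)
qed

text \<open>The density matrix has rank one: its entry (j, k) is t^(1/(2n)) / pi times the product
  of C_j t^(j/(2n)) and C_k t^(k/(2n)). The quadratic form of the difference is therefore the
  integral of a nonnegative function.\<close>

lemma nonneg_spectral_matrix_diff:
  assumes st: "s \<le> t"
  shows "nonneg_mat n (spectral_matrix n t - spectral_matrix n s)"
  unfolding nonneg_mat_def
proof (intro conjI ballI)
  let ?A = "spectral_matrix n t - spectral_matrix n s"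
  show A: "?A \<in> carrier_mat n n" by (intro minus_carrier_mat spectral_matrix_carrier)
  fix v :: "complex vec" assume v: "v \<in> carrier_vec n"
  let ?\<rho> = "\<lambda>i j x. complex_of_real (weight i j * (1 + expo i j) * max 0 x powr expo i j)"
  let ?u = "\<lambda>x. \<Sum>k<n. of_real (cot_prod n k * max 0 x powr (real k / (2 * real n))) * v $ k"
  let ?h = "\<lambda>x. max 0 x powr (1 / (2 * real n)) / pi * (cmod (?u x))\<^sup>2"
  have "((\<lambda>x. \<Sum>i<n. \<Sum>j<n. ?\<rho> i j x * (v $ j * cnj (v $ i))) has_integral (\<Sum>i<n. \<Sum>j<n. ?A $$ (i, j) * (v $ j * cnj (v $ i)))) {s..t}"
  proof (intro has_integral_sum finite_lessThan has_integral_mult_left)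
    fix i j assume ij: "i \<in> {..<n}" "j \<in> {..<n}"
    have "?A $$ (i, j) = of_real (weight i j * max 0 t powr (1 + expo i j)) - of_real (weight i j * max 0 s powr (1 + expo i j))"
      using ij spectral_matrix_carrier[of n s] spectral_matrix_carrier[of n t] by (simp add: spectral_matrix_index)
    then show "(?\<rho> i j has_integral ?A $$ (i, j)) {s..t}"
      using has_integral_max_powr_complex[OF expo_bounds(1) st] by simp
  qed
  moreover have "(\<Sum>i<n. \<Sum>j<n. ?\<rho> i j x * (v $ j * cnj (v $ i))) = of_real (?h x)" for x
  proof -
    have e: "weight i j * (1 + expo i j) * max 0 x powr expo i j = max 0 x powr (1 / (2 * real n)) / pi *
        ((cot_prod n j * max 0 x powr (real j / (2 * real n))) * (cot_prod n i * max 0 x powr (real i / (2 * real n))))" for i j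
    proof -
      have "expo i j = 1 / (2 * real n) + real j / (2 * real n) + real i / (2 * real n)"
        by (simp add: expo_def add_divide_distrib)
      then show ?thesis unfolding weight_mult by (simp add: powr_add)
    qed
    have "of_real (?h x) = of_real (max 0 x powr (1 / (2 * real n)) / pi) * (?u x * cnj (?u x))"
      by (simp only: of_real_mult complex_norm_square)
    also have "?u x * cnj (?u x) = (\<Sum>i<n. \<Sum>j<n. (of_real (cot_prod n j * max 0 x powr (real j / (2 * real n))) * v $ j) *
        (of_real (cot_prod n i * max 0 x powr (real i / (2 * real n))) * cnj (v $ i)))"
      unfolding sum_product cnj_sum complex_cnj_mult complex_cnj_complex_of_real by (rule sum.swap)
    finally show ?thesis unfolding e of_real_mult[of "_ / pi"] sum_distrib_left by (simp add: mult_ac)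
  qed
  ultimately have "((\<lambda>x. of_real (?h x)) has_integral (\<Sum>i<n. \<Sum>j<n. ?A $$ (i, j) * (v $ j * cnj (v $ i)))) {s..t}" by simp
  then have "0 \<le> (\<Sum>i<n. \<Sum>j<n. ?A $$ (i, j) * (v $ j * cnj (v $ i)))" by (rule has_integral_of_real_nonneg) simp
  then show "0 \<le> (?A *\<^sub>v v) \<bullet>c v" unfolding cscalar_prod_mult_mat_vec[OF A v v] by (simp only: mult.assoc)
qed

text \<open>P takes away the constants \<open>cauchy_power_moment\<close>, and Q is zero. What
  remains is -C_j C_k / pi times pi / sin (pi \<gamma>) (-z)^\<gamma>, the entry of the Weyl
  function.\<close>

lemma spectral_function_weyl:
  "spectral_function n (weyl_function (minimal_operator n) n (Gamma0 n) (Gamma1 n)) (spectral_matrix n)"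
  unfolding spectral_function_def
proof (intro conjI allI impI)
  let ?M = "weyl_function (minimal_operator n) n (Gamma0 n) (Gamma1 n)"
  show "R_function n ?M" by (rule R_function_weyl[OF n])
  show "spectral_matrix n t \<in> carrier_mat n n" for t by (rule spectral_matrix_carrier)
  have real: "mat_adjoint A = A" if A: "A \<in> carrier_mat n n" "\<And>j k. j < n \<Longrightarrow> k < n \<Longrightarrow> cnj (A $$ (k, j)) = A $$ (j, k)" for A
    using A mat_adjoint_carrier[OF A(1)] by (intro eq_matI) (auto simp: mat_adjoint_index)
  have sym: "weight k j = weight j k" "expo k j = expo j k" for j k
    by (simp_all add: weight_def expo_def add_ac mult.commute)
  show "mat_adjoint (spectral_matrix n t) = spectral_matrix n t" for t
    by (rule real[OF spectral_matrix_carrier]) (simp add: spectral_matrix_index sym)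
  show "nonneg_mat n (spectral_matrix n t - spectral_matrix n s)" if "s \<le> t" for s t
    by (rule nonneg_spectral_matrix_diff[OF that])
  show "continuous (at_left t) (\<lambda>s. spectral_matrix n s $$ (j, k))" if jk: "j < n" "k < n" for t j k
  proof (rule continuous_at_imp_continuous_within)
    have "continuous_on UNIV (\<lambda>s. spectral_matrix n s $$ (j, k))"
      unfolding spectral_matrix_index[OF jk] using expo_bounds(1)[of j k]
      by (intro continuous_on_of_real continuous_on_mult continuous_on_const continuous_on_max_powr) simp
    then show "isCont (\<lambda>s. spectral_matrix n s $$ (j, k)) t" by (simp add: continuous_on_eq_continuous_at)
  qed
  show "spectral_matrix n 0 = 0\<^sub>m n n" by (rule eq_matI) (auto simp: spectral_matrix_def)
  show "\<exists>S. has_mat_RS_integral n (\<lambda>t. 1 / (1 + complex_of_real t ^ 2)) (spectral_matrix n) S"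
  proof -
    have "\<forall>j k. \<exists>I. j < n \<longrightarrow> k < n \<longrightarrow> has_RS_integral_real_line (\<lambda>t. 1 / (1 + complex_of_real t ^ 2)) (\<lambda>t. spectral_matrix n t $$ (j, k)) I"
      using has_RS_integral_Cauchy_weight[OF expo_bounds(1,2)] by (auto simp: spectral_matrix_index)
    then obtain I where I: "\<And>j k. j < n \<Longrightarrow> k < n \<Longrightarrow>
        has_RS_integral_real_line (\<lambda>t. 1 / (1 + complex_of_real t ^ 2)) (\<lambda>t. spectral_matrix n t $$ (j, k)) (I j k)"
      by metis
    show ?thesis
      unfolding has_mat_RS_integral_def by (intro exI[of _ "mat n n (\<lambda>(j, k). I j k)"]) (simp add: I)
  qed
  let ?P = "mat n n (\<lambda>(j, k). complex_of_real (- (cot_prod n j * cot_prod n k / pi * cauchy_power_moment (expo j k))))"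
  let ?S = "\<lambda>z. mat n n (\<lambda>(j, k). complex_of_real (cot_prod n j * cot_prod n k / pi) *
      (of_real (cauchy_power_moment (expo j k)) - of_real (pi / sin (pi * expo j k)) * (- z) powr of_real (expo j k)))"
  show "\<exists>P Q. P \<in> carrier_mat n n \<and> mat_adjoint P = P \<and> Q \<in> carrier_mat n n \<and> mat_adjoint Q = Q \<and> nonneg_mat n Q \<and>
      (\<forall>z. Im z > 0 \<longrightarrow> (\<exists>S. has_mat_RS_integral n
          (\<lambda>t. 1 / (complex_of_real t - z) - complex_of_real t / (1 + complex_of_real t ^ 2)) (spectral_matrix n) S \<and>
        ?M z = P + z \<cdot>\<^sub>m Q + S))"
  proof (rule exI[of _ ?P], rule exI[of _ "0\<^sub>m n n"], intro conjI allI impI)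
    show "mat_adjoint ?P = ?P" by (rule real) (simp_all add: sym mult.commute)
    show "mat_adjoint (0\<^sub>m n n) = (0\<^sub>m n n :: complex mat)" by (rule real) simp_all
    show "nonneg_mat n (0\<^sub>m n n)"
      unfolding nonneg_mat_def by (auto simp: cscalar_prod_mult_mat_vec[of _ n])
    fix z assume z: "Im z > 0"
    show "\<exists>S. has_mat_RS_integral n
          (\<lambda>t. 1 / (complex_of_real t - z) - complex_of_real t / (1 + complex_of_real t ^ 2)) (spectral_matrix n) S \<and>
        ?M z = ?P + z \<cdot>\<^sub>m 0\<^sub>m n n + S"
    proof (intro exI[of _ "?S z"] conjI)
      have "has_RS_integral_real_line (\<lambda>t. 1 / (complex_of_real t - z) - of_real t / (1 + (of_real t)\<^sup>2))
          (\<lambda>t. spectral_matrix n t $$ (j, k)) (?S z $$ (j, k))" if jk: "j < n" "k < n" for j k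
        using has_RS_integral_Nevanlinna_kernel[OF expo_bounds(1) expo_bounds(2)[OF jk] z, of "weight j k"] jk
        unfolding spectral_matrix_index[OF jk] weight_mult by simp
      then show "has_mat_RS_integral n
          (\<lambda>t. 1 / (complex_of_real t - z) - complex_of_real t / (1 + complex_of_real t ^ 2)) (spectral_matrix n) (?S z)"
        unfolding has_mat_RS_integral_def by simp
      show "?M z = ?P + z \<cdot>\<^sub>m 0\<^sub>m n n + ?S z"
        unfolding weyl_function_powr[OF n z]
      proof (rule eq_matI)
        fix j k assume "j < dim_row (?P + z \<cdot>\<^sub>m 0\<^sub>m n n + ?S z)" "k < dim_col (?P + z \<cdot>\<^sub>m 0\<^sub>m n n + ?S z)"
        then have jk: "j < n" "k < n" by simp_all
        have "real (j + k + 1) * alpha n = pi * expo j k" by (rule expo_bounds(3))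
        moreover have "real (j + k + 1) / (2 * real n) = expo j k" by (simp only: expo_def)
        \<comment> \<open>The entry identity in abstract form: the moment c cancels between P and
          the integral.\<close>
        moreover have "complex_of_real (- a / s) * w = of_real (- (a / pi * c)) + of_real (a / pi) * (of_real c - of_real (pi / s) * w)" for a s c w
          by (simp add: right_diff_distrib)
        ultimately show "mat n n (\<lambda>(j, k). complex_of_real (- cot_prod n j * cot_prod n k / sin (real (j + k + 1) * alpha n)) *
            (- z) powr of_real (real (j + k + 1) / (2 * real n))) $$ (j, k) = (?P + z \<cdot>\<^sub>m 0\<^sub>m n n + ?S z) $$ (j, k)"
          using jk by (simp only: index_mat index_add_mat index_smult_mat index_zero_mat dim_row_mat dim_col_mat case_prod_conv
            mult_zero_right add_0_right mult_minus_left)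
      qed simp_all
    qed
  qed simp_all
qed

end

theorem theorem1:
  fixes n :: nat
  assumes "n \<ge> 1"
  shows
    "boundary_triplet (minimal_operator n) n (Gamma0 n) (Gamma1 n) \<and>
     corresponds_to (minimal_operator n) n (Gamma0 n) (friedrichs_extension (minimal_operator n)) \<and>
     (\<forall>r \<phi> :: real. r > 0 \<and> 0 < \<phi> \<and> \<phi> < pi \<longrightarrow>
        weyl_function (minimal_operator n) n (Gamma0 n) (Gamma1 n) (rcis r \<phi>) =
          mat n n (\<lambda>(j, k).
            complex_of_real (- cot_prod n j * cot_prod n k / sin (real (j + k + 1) * alpha n)) *
            rcis (root (2 * n) r) ((\<phi> - pi) / (2 * real n)) ^ (j + k + 1))) \<and>
     spectral_function n (weyl_function (minimal_operator n) n (Gamma0 n) (Gamma1 n))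
       (\<lambda>t. if t < 0 then 0\<^sub>m n n
            else mat n n (\<lambda>(j, k).
              complex_of_real (2 * real n / pi *
                (cot_prod n j * cot_prod n k / real (2 * n + 1 + j + k) *
                 t powr (real (2 * n + 1 + j + k) / real (2 * n))))))"
  using boundary_triplet_Gamma[of n] corresponds_to_friedrichs[OF assms]
    weyl_function_rcis(1)[OF assms, unfolded char_matrix_def] spectral_function_weyl[OF assms, unfolded spectral_matrix_def]
  by blast

end
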